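(* Let $\alpha>0$, let $k\ge1$ be an integer and $s>n/2$. Then the initial value problem $$i\partial_tu+t^\alpha\Delta_xu=\pm u|u|^{2k},\qquad u(0,x)=u_0(x),\quad x\in\mathbb{R}^n,$$ is locally well-posed in $H^s(\mathbb{R}^n)$, and its solution satisfies the smoothing estimates: for $n=1$, $\sup_{x\in\mathbb{R}}\|t^{\alpha/2}D_x^{s+1/2}u\|_{L^2_t([0,T])}<\infty$; for $n\ge2$, $\sup_{\beta\in\mathbb{Z}^n}\|t^{\alpha/2}D_x^{s+1/2}u\|_{L^2_x(Q_\beta)L^2_t([0,T])}<\infty$, where $[0,T]$ is the existence interval.
   Context: Local well-posedness in $H^s(\mathbb{R}^n)$ means: for every ball $B$ in $H^s(\mathbb{R}^n)$ there exist a time $T>0$ and a Banach space $X\subset L^\infty([0,T];H^s(\mathbb{R}^n))$ such that for each $u_0\in B$ there is a unique solution $u\in X\cap C([0,T];H^s(\mathbb{R}^n))$ of the integral equation $u(t)=W_\alpha(t,0)u_0+\int_0^tW_\alpha(t,\tau)(\text{nonlinearity})(\tau)\,d\tau$, and the map $u_0\mapsto u$ is continuous from $H^s$ into $C([0,T];H^s)$. Here $W_\alpha(t,s)$ is the Fourier multiplier with symbol $e^{-i\frac{t^{\alpha+1}-s^{\alpha+1}}{\alpha+1}|\xi|^2}$. $D_x^\gamma$ is the Fourier multiplier with symbol $|\xi|^\gamma$; $\{Q_\beta\}_{\beta\in\mathbb{Z}^n}$ are the non-overlapping unit cubes covering $\mathbb{R}^n$. *)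

theory Defs
  imports "HOL-Analysis.Analysis"
begin

text \<open>Functions on R^n are modelled as complex-valued functions on real^'n.
  Fourier transform convention: hat f(xi) = integral of f(x) exp(-i x.xi) dx,
  so that Laplacian corresponds to -|xi|^2 and D^gamma to |xi|^gamma.\<close>

definition L2 :: "(real^'n \<Rightarrow> complex) \<Rightarrow> bool" where
  "L2 f \<longleftrightarrow> f \<in> borel_measurable lborel \<and> integrable lborel (\<lambda>x. (cmod (f x))^2)"

definition fourier1 :: "(real^'n \<Rightarrow> complex) \<Rightarrow> real^'n \<Rightarrow> complex" where
  "fourier1 f \<xi> = (LINT x|lborel. f x * cis (- (x \<bullet> \<xi>)))"

text \<open>g is the (Plancherel) Fourier transform of the L2 function f: characterised by
  the duality identity integral(hat f * phi) = integral(f * hat phi) for box indicators phi.\<close>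
definition is_fourier_L2 :: "(real^'n \<Rightarrow> complex) \<Rightarrow> (real^'n \<Rightarrow> complex) \<Rightarrow> bool" where
  "is_fourier_L2 f g \<longleftrightarrow> L2 f \<and> L2 g \<and>
     (\<forall>a b. (LINT \<xi>|lborel. g \<xi> * indicator (cbox a b) \<xi>)
            = (LINT x|lborel. f x * fourier1 (indicator (cbox a b)) x))"

definition FT :: "(real^'n \<Rightarrow> complex) \<Rightarrow> real^'n \<Rightarrow> complex" where
  "FT f = (SOME g. is_fourier_L2 f g)"

definition sobolev :: "real \<Rightarrow> (real^'n \<Rightarrow> complex) set" where
  "sobolev s = {f. L2 f \<and> integrable lborel (\<lambda>\<xi>. (1 + (norm \<xi>)^2) powr s * (cmod (FT f \<xi>))^2)}"

definition hs_norm :: "real \<Rightarrow> (real^'n \<Rightarrow> complex) \<Rightarrow> real" where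
  "hs_norm s f = sqrt (LINT \<xi>|lborel. (1 + (norm \<xi>)^2) powr s * (cmod (FT f \<xi>))^2)"

definition hs_inner :: "real \<Rightarrow> (real^'n \<Rightarrow> complex) \<Rightarrow> (real^'n \<Rightarrow> complex) \<Rightarrow> complex" where
  "hs_inner s f g = (LINT \<xi>|lborel. of_real ((1 + (norm \<xi>)^2) powr s) * FT f \<xi> * cnj (FT g \<xi>))"

definition hs_dist :: "real \<Rightarrow> (real^'n \<Rightarrow> complex) \<Rightarrow> (real^'n \<Rightarrow> complex) \<Rightarrow> real" where
  "hs_dist s f g = hs_norm s (\<lambda>x. f x - g x)"

definition Hball :: "real \<Rightarrow> real \<Rightarrow> (real^'n \<Rightarrow> complex) set" where
  "Hball s R = {f \<in> sobolev s. hs_norm s f \<le> R}"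

definition W :: "real \<Rightarrow> real \<Rightarrow> real \<Rightarrow> (real^'n \<Rightarrow> complex) \<Rightarrow> (real^'n \<Rightarrow> complex)" where
  "W \<alpha> t \<tau> F = (SOME h. is_fourier_L2 h
      (\<lambda>\<xi>. cis (- ((t powr (\<alpha>+1) - \<tau> powr (\<alpha>+1)) / (\<alpha>+1)) * (norm \<xi>)^2) * FT F \<xi>))"

definition nonlin :: "nat \<Rightarrow> (real^'n \<Rightarrow> complex) \<Rightarrow> (real^'n \<Rightarrow> complex)" where
  "nonlin k f = (\<lambda>x. f x * of_real ((cmod (f x)) ^ (2*k)))"

definition boxpair :: "(real^'n \<Rightarrow> complex) \<Rightarrow> real^'n \<Rightarrow> real^'n \<Rightarrow> complex" where
  "boxpair f a b = (LINT x|lborel. f x * indicator (cbox a b) x)"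

text \<open>Duhamel integral equation for  i u_t + t^alpha Lap u = sigma u |u|^(2k), u(0)=u0,
  i.e. u(t) = W(t,0)u0 + integral_0^t W(t,tau)(-i sigma u|u|^(2k))(tau) dtau,
  stated weakly (tested against box indicators, which determine an L2 function).\<close>
definition solves :: "real \<Rightarrow> real \<Rightarrow> nat \<Rightarrow> real \<Rightarrow> (real^'n \<Rightarrow> complex)
      \<Rightarrow> (real \<Rightarrow> real^'n \<Rightarrow> complex) \<Rightarrow> bool" where
  "solves \<alpha> \<sigma> k T u0 u \<longleftrightarrow> (\<forall>t\<in>{0..T}. \<forall>a b.
     boxpair (u t) a b = boxpair (W \<alpha> t 0 u0) a b
       + (LINT \<tau>:{0..t}|lborel. boxpair (W \<alpha> t \<tau> (\<lambda>x. - \<i> * of_real \<sigma> * nonlin k (u \<tau>) x)) a b))"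

definition cont_Hs :: "real \<Rightarrow> real \<Rightarrow> (real \<Rightarrow> real^'n \<Rightarrow> complex) \<Rightarrow> bool" where
  "cont_Hs s T u \<longleftrightarrow> (\<forall>t\<in>{0..T}. u t \<in> sobolev s) \<and>
     (\<forall>t\<in>{0..T}. \<forall>\<epsilon>>0. \<exists>\<delta>>0. \<forall>t'\<in>{0..T}. \<bar>t' - t\<bar> < \<delta> \<longrightarrow> hs_dist s (u t') (u t) < \<epsilon>)"

text \<open>(X, N) is a Banach space contained in L^infty([0,T]; H^s):
  a complex vector space of functions with a complete seminorm whose kernel consists of
  functions vanishing a.e. on [0,T] (so the quotient is a Banach space), and whose elements
  are (weakly, hence by Pettis strongly) measurable, essentially bounded H^s-valued maps.\<close>
definition banach_Linf :: "real \<Rightarrow> real \<Rightarrow> (real \<Rightarrow> real^'n \<Rightarrow> complex) set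
      \<Rightarrow> ((real \<Rightarrow> real^'n \<Rightarrow> complex) \<Rightarrow> real) \<Rightarrow> bool" where
  "banach_Linf s T X N \<longleftrightarrow>
     (\<lambda>_ _. 0) \<in> X \<and>
     (\<forall>u\<in>X. \<forall>v\<in>X. (\<lambda>t x. u t x + v t x) \<in> X) \<and>
     (\<forall>c::complex. \<forall>u\<in>X. (\<lambda>t x. c * u t x) \<in> X) \<and>
     (\<forall>u\<in>X. N u \<ge> 0) \<and>
     (\<forall>u\<in>X. \<forall>v\<in>X. N (\<lambda>t x. u t x + v t x) \<le> N u + N v) \<and>
     (\<forall>c::complex. \<forall>u\<in>X. N (\<lambda>t x. c * u t x) = cmod c * N u) \<and>
     (\<forall>u\<in>X. N u = 0 \<longrightarrow> (AE t in lborel. t \<in> {0..T} \<longrightarrow> hs_norm s (u t) = 0)) \<and>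
     (\<forall>f. (\<forall>n. f n \<in> X) \<longrightarrow>
        (\<forall>\<epsilon>>0. \<exists>M. \<forall>m\<ge>M. \<forall>n\<ge>M. N (\<lambda>t x. f m t x - f n t x) < \<epsilon>) \<longrightarrow>
        (\<exists>v\<in>X. (\<lambda>n. N (\<lambda>t x. f n t x - v t x)) \<longlonglongrightarrow> 0)) \<and>
     (\<forall>u\<in>X. (AE t in lborel. t \<in> {0..T} \<longrightarrow> u t \<in> sobolev s) \<and>
        (\<forall>v\<in>sobolev s. (\<lambda>t. hs_inner s (u t) v) \<in> borel_measurable (restrict_space lborel {0..T})) \<and>
        (\<exists>C. AE t in lborel. t \<in> {0..T} \<longrightarrow> hs_norm s (u t) \<le> C))"

text \<open>Test functions: bounded, measurable, compactly supported, with rapidly decaying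
  Fourier transform (equivalently, C_c^infty up to a.e. modification).\<close>
definition test_fn :: "(real^'n \<Rightarrow> complex) \<Rightarrow> bool" where
  "test_fn \<phi> \<longleftrightarrow> \<phi> \<in> borel_measurable lborel \<and> bounded (range \<phi>) \<and>
     (\<exists>R. \<forall>x. norm x > R \<longrightarrow> \<phi> x = 0) \<and>
     (\<forall>m::nat. \<exists>C. \<forall>\<xi>. (1 + norm \<xi>)^m * cmod (fourier1 \<phi> \<xi>) \<le> C)"

text \<open>w(t,x) is (a measurable space-time representative of) D_x^gamma u(t,x) on [0,T]:
  for a.e. t, w(t,.) agrees with D^gamma u(t) as a distribution, via
  integral(w phi) = (2 pi)^(-n) integral(|xi|^gamma hat u(xi) hat phi(-xi)).\<close>
definition is_Dx :: "real \<Rightarrow> real \<Rightarrow> (real \<Rightarrow> real^'n \<Rightarrow> complex) \<Rightarrow> (real \<times> (real^'n) \<Rightarrow> complex) \<Rightarrow> bool" where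
  "is_Dx \<gamma> T u w \<longleftrightarrow> w \<in> borel_measurable (lborel \<Otimes>\<^sub>M lborel) \<and>
     (AE t in lborel. t \<in> {0..T} \<longrightarrow> (\<forall>\<phi>. test_fn \<phi> \<longrightarrow>
        integrable lborel (\<lambda>x. w (t, x) * \<phi> x) \<and>
        (LINT x|lborel. w (t, x) * \<phi> x) =
          of_real (1 / (2 * pi) ^ CARD('n)) *
          (LINT \<xi>|lborel. of_real (norm \<xi> powr \<gamma>) * FT (u t) \<xi> * fourier1 \<phi> (- \<xi>))))"

definition cube :: "('n \<Rightarrow> int) \<Rightarrow> (real^'n) set" where
  "cube \<beta> = {x. \<forall>i. of_int (\<beta> i) \<le> x $ i \<and> x $ i < of_int (\<beta> i) + 1}"

end

theory Submission
  imports Defs "HOL-Probability.Probability"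
begin

text \<open>Write \<open>r(t) = t powr (\<alpha> + 1) / (\<alpha> + 1)\<close>. In the interaction picture
  \<open>V(t) = (1 + |\<xi>|\<^sup>2) powr (s/2) * exp(i r(t) |\<xi>|\<^sup>2) * FT (u(t))\<close> the integral equation becomes
  \<open>V(t) = V(0) + \<integral>\<^sub>0\<^sup>t N(\<tau>, V(\<tau>)) d\<tau>\<close> in \<open>L\<^sup>2\<close>. For \<open>s > n/2\<close> the Sobolev space is an algebra, so \<open>N\<close> is
  Lipschitz on balls, uniformly in \<open>\<tau>\<close>; Picard iteration and Gronwall's inequality give well-posedness.

  For the smoothing, \<open>dr = t powr \<alpha> dt\<close> turns the weighted time integral into one for the free
  Schroedinger group. Inserting a Gaussian in \<open>r\<close> and a spatial weight \<open>\<rho>\<close> and expanding the square produces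
  a quadratic form in frequency with kernel
  \<open>(|\<xi>| |\<eta>|) powr (1/2) * exp (- (|\<xi>|\<^sup>2 - |\<eta>|\<^sup>2)\<^sup>2 / 2) * FT \<rho> (\<xi> - \<eta>)\<close>,
  which Schur's test bounds: for a Gaussian \<open>\<rho>\<close> with a constant independent of its centre, and for \<open>n = 1\<close>
  and \<open>\<rho>\<close> the indicator of \<open>A\<close> with a constant proportional to \<open>|A|\<close>. The former covers the cubes, the latter
  gives the bound for almost every \<open>x\<close>. The integral term is handled by Cauchy-Schwarz in \<open>\<tau>\<close>, and truncation
  of the frequencies is removed by completeness of a weighted \<open>L\<^sup>2\<close> space.\<close>

section \<open>The Hilbert space of square-integrable functions\<close>

lemma borel_measurable_cnj [measurable (raw)]:
  "f \<in> borel_measurable M \<Longrightarrow> (\<lambda>x. cnj (f x)) \<in> borel_measurable M"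
  by (rule borel_measurable_continuous_on[where f=cnj]) (auto intro!: continuous_intros)

definition square_integrable :: "('a::euclidean_space \<Rightarrow> complex) \<Rightarrow> bool" where
  "square_integrable f \<longleftrightarrow> f \<in> borel_measurable lborel \<and> integrable lborel (\<lambda>x. (cmod (f x))\<^sup>2)"

lemma L2_eq_square_integrable: "L2 f = square_integrable f"
  by (simp add: L2_def square_integrable_def)

lemma square_integrable_measurable [measurable_dest]:
  "square_integrable f \<Longrightarrow> f \<in> borel_measurable lborel"
  by (simp add: square_integrable_def)

lemma square_integrable_measurable_borel: "square_integrable f \<Longrightarrow> f \<in> borel_measurable borel"
  by (simp add: square_integrable_def)

lemma integrable_norm_sq: "square_integrable f \<Longrightarrow> integrable lborel (\<lambda>x. (cmod (f x))\<^sup>2)"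
  by (simp add: square_integrable_def)

lemma square_integrable_if_nn_integral_finite:
  assumes "f \<in> borel_measurable lborel" "(\<integral>\<^sup>+x. ennreal ((cmod (f x))\<^sup>2) \<partial>lborel) < \<infinity>"
  shows "square_integrable f"
  unfolding square_integrable_def using assms by (auto intro!: integrableI_bounded)

lemma square_integrable_bound:
  assumes "square_integrable f" "g \<in> borel_measurable lborel"
    and dominated: "AE x in lborel. cmod (g x) \<le> C * cmod (f x)"
  shows "square_integrable g"
  unfolding square_integrable_def
proof
  show "integrable lborel (\<lambda>x. (cmod (g x))\<^sup>2)"
  proof (rule Bochner_Integration.integrable_bound)
    show "integrable lborel (\<lambda>x. C\<^sup>2 * (cmod (f x))\<^sup>2)"
      using integrable_norm_sq[OF assms(1)] by simp
    show "AE x in lborel. norm ((cmod (g x))\<^sup>2) \<le> norm (C\<^sup>2 * (cmod (f x))\<^sup>2)"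
      using dominated
    proof eventually_elim
      case (elim x)
      then have "(cmod (g x))\<^sup>2 \<le> (C * cmod (f x))\<^sup>2" by (intro power_mono) auto
      then show ?case by (simp add: power_mult_distrib)
    qed
  qed (use assms in measurable)
qed fact

lemma square_integrable_cong_AE:
  assumes "square_integrable f" "g \<in> borel_measurable lborel" "AE x in lborel. f x = g x"
  shows "square_integrable g"
  by (rule square_integrable_bound[OF assms(1,2), of 1]) (use assms(3) in auto)

lemma square_integrable_mult_bounded:
  assumes "square_integrable f" "m \<in> borel_measurable borel" "\<And>x. cmod (m x) \<le> C"
  shows "square_integrable (\<lambda>x. m x * f x)"
proof (rule square_integrable_bound[OF assms(1)])
  show "(\<lambda>x. m x * f x) \<in> borel_measurable lborel"
    using assms(1,2) by (auto simp: square_integrable_def)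
  show "AE x in lborel. cmod (m x * f x) \<le> C * cmod (f x)"
    by (intro AE_I2) (simp add: norm_mult mult_right_mono assms(3))
qed

lemma square_integrable_cmult: "square_integrable f \<Longrightarrow> square_integrable (\<lambda>x. c * f x)"
  by (rule square_integrable_mult_bounded[where C="cmod c"]) auto

lemma square_integrable_cnj: "square_integrable f \<Longrightarrow> square_integrable (\<lambda>x. cnj (f x))"
  by (rule square_integrable_bound[where C=1]) (auto simp: square_integrable_def borel_measurable_cnj)

lemma square_integrable_zero: "square_integrable (\<lambda>_. 0)"
  by (simp add: square_integrable_def)

lemma norm_add_sq_le: "(norm (x + y))\<^sup>2 \<le> 2 * (norm x)\<^sup>2 + 2 * (norm y)\<^sup>2"
  for x y :: "'b::real_normed_vector"
proof -
  have "(norm (x + y))\<^sup>2 \<le> (norm x + norm y)\<^sup>2" by (intro power_mono norm_triangle_ineq) simp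
  also have "\<dots> \<le> 2 * (norm x)\<^sup>2 + 2 * (norm y)\<^sup>2"
    using sum_squares_bound[of "norm x" "norm y"] by (simp add: power2_sum)
  finally show ?thesis .
qed

lemma square_integrable_add:
  assumes [measurable]: "square_integrable f" "square_integrable g"
  shows "square_integrable (\<lambda>x. f x + g x)"
  unfolding square_integrable_def
proof
  show "integrable lborel (\<lambda>x. (cmod (f x + g x))\<^sup>2)"
  proof (rule Bochner_Integration.integrable_bound)
    show "integrable lborel (\<lambda>x. 2 * (cmod (f x))\<^sup>2 + 2 * (cmod (g x))\<^sup>2)"
      using assms by (auto simp: square_integrable_def)
    show "AE x in lborel. norm ((cmod (f x + g x))\<^sup>2) \<le> norm (2 * (cmod (f x))\<^sup>2 + 2 * (cmod (g x))\<^sup>2)"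
      by (intro AE_I2) (simp add: norm_add_sq_le)
  qed measurable
qed measurable

lemma square_integrable_uminus: "square_integrable f \<Longrightarrow> square_integrable (\<lambda>x. - f x)"
  using square_integrable_cmult[of f "-1"] by simp

lemma square_integrable_diff:
  "square_integrable f \<Longrightarrow> square_integrable g \<Longrightarrow> square_integrable (\<lambda>x. f x - g x)"
  using square_integrable_add[OF _ square_integrable_uminus, of f g] by simp

lemma integrable_mult_square_integrable:
  assumes [measurable]: "square_integrable f" "square_integrable g"
  shows "integrable lborel (\<lambda>x. f x * g x)"
proof (rule Bochner_Integration.integrable_bound)
  show "integrable lborel (\<lambda>x. (cmod (f x))\<^sup>2 + (cmod (g x))\<^sup>2)"
    using assms by (auto simp: square_integrable_def)
  have "cmod (f x) * cmod (g x) \<le> (cmod (f x))\<^sup>2 + (cmod (g x))\<^sup>2" for x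
  proof -
    have "0 \<le> cmod (f x) * cmod (g x)" by simp
    then show ?thesis using sum_squares_bound[of "cmod (f x)" "cmod (g x)"] by linarith
  qed
  then show "AE x in lborel. norm (f x * g x) \<le> norm ((cmod (f x))\<^sup>2 + (cmod (g x))\<^sup>2)"
    by (simp add: norm_mult)
qed measurable

quotient_type (overloaded) 'a lsq = "'a::euclidean_space \<Rightarrow> complex" / partial:
  "\<lambda>f g. square_integrable f \<and> square_integrable g \<and> (AE x in lborel. f x = g x)"
proof (intro part_equivpI)
  show "\<exists>f. square_integrable f \<and> square_integrable f \<and> (AE x in lborel. f x = f x)"
    by (auto intro!: exI[of _ "\<lambda>_. 0"] square_integrable_zero)
  show "symp (\<lambda>f g. square_integrable f \<and> square_integrable g \<and> (AE x in lborel. f x = g x))"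
    by (auto simp: symp_def)
  show "transp (\<lambda>f g. square_integrable f \<and> square_integrable g \<and> (AE x in lborel. f x = g x))"
    by (rule transpI) auto
qed

lemma square_integrable_rep: "square_integrable (rep_lsq U)"
  using Quotient3_rel_rep[OF Quotient3_lsq, of U U] by auto

lemma rep_measurable [measurable]: "rep_lsq U \<in> borel_measurable borel"
  using square_integrable_rep[of U] by (simp add: square_integrable_def)

lemma abs_rep_lsq: "abs_lsq (rep_lsq U) = U"
  by (rule Quotient3_abs_rep[OF Quotient3_lsq])

lemma rep_abs_lsq:
  assumes "square_integrable f" shows "AE x in lborel. rep_lsq (abs_lsq f) x = f x"
  using rep_abs_rsp_left[OF Quotient3_lsq, of f f] assms by auto

lemma abs_lsq_eqI:
  assumes "square_integrable f" "square_integrable g" "AE x in lborel. f x = g x"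
  shows "abs_lsq f = abs_lsq g"
  using Quotient3_rel_abs[OF Quotient3_lsq, of f g] assms by auto

lemma lsq_eqI:
  assumes "AE x in lborel. rep_lsq U x = rep_lsq V x" shows "U = V"
  using abs_lsq_eqI[OF square_integrable_rep square_integrable_rep assms] by (simp add: abs_rep_lsq)

lemma lsq_eqI_abs:
  assumes "square_integrable f" "AE x in lborel. rep_lsq U x = f x" shows "U = abs_lsq f"
  using abs_lsq_eqI[OF square_integrable_rep assms] by (simp add: abs_rep_lsq)

instantiation lsq :: (euclidean_space) real_inner
begin

lift_definition zero_lsq :: "'a lsq" is "\<lambda>_. 0"
  by (simp add: square_integrable_zero)

lift_definition plus_lsq :: "'a lsq \<Rightarrow> 'a lsq \<Rightarrow> 'a lsq" is "\<lambda>f g x. f x + g x"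
  by (auto intro: square_integrable_add)

lift_definition minus_lsq :: "'a lsq \<Rightarrow> 'a lsq \<Rightarrow> 'a lsq" is "\<lambda>f g x. f x - g x"
  by (auto intro: square_integrable_diff)

lift_definition uminus_lsq :: "'a lsq \<Rightarrow> 'a lsq" is "\<lambda>f x. - f x"
  by (auto intro: square_integrable_uminus)

lift_definition scaleR_lsq :: "real \<Rightarrow> 'a lsq \<Rightarrow> 'a lsq" is "\<lambda>c f x. of_real c * f x"
  by (auto intro: square_integrable_cmult)

lift_definition inner_lsq :: "'a lsq \<Rightarrow> 'a lsq \<Rightarrow> real" is "\<lambda>f g. Re (LINT x|lborel. f x * cnj (g x))"
proof (elim conjE, intro arg_cong[of _ _ Re] integral_cong_AE)
  fix f f' g g' :: "'a \<Rightarrow> complex"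
  assume [measurable]: "square_integrable f" "square_integrable f'" "square_integrable g" "square_integrable g'"
  show "(\<lambda>x. f x * cnj (g x)) \<in> borel_measurable lborel" "(\<lambda>x. f' x * cnj (g' x)) \<in> borel_measurable lborel"
    by measurable
qed auto

definition norm_lsq :: "'a lsq \<Rightarrow> real" where "norm_lsq U = sqrt (U \<bullet> U)"

definition dist_lsq :: "'a lsq \<Rightarrow> 'a lsq \<Rightarrow> real" where "dist_lsq U V = norm (U - V)"

definition sgn_lsq :: "'a lsq \<Rightarrow> 'a lsq" where "sgn_lsq U = inverse (norm U) *\<^sub>R U"

definition uniformity_lsq :: "('a lsq \<times> 'a lsq) filter" where
  "uniformity_lsq = (INF e\<in>{0 <..}. principal {(x, y). dist x y < e})"

definition open_lsq :: "'a lsq set \<Rightarrow> bool" where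
  "open_lsq U \<longleftrightarrow> (\<forall>x\<in>U. eventually (\<lambda>(x', y). x' = x \<longrightarrow> y \<in> U) uniformity)"

lemma integral_mult_cnj_self: "(LINT x|lborel. f x * cnj (f x)) = of_real (LINT x|lborel. (cmod (f x))\<^sup>2)"
  by (simp flip: complex_norm_square of_real_power)

instance
proof
  fix U V Z :: "'a lsq" and a b :: real
  show "U + V + Z = U + (V + Z)" by transfer (simp add: square_integrable_add add.assoc)
  show "U + V = V + U" by transfer (simp add: square_integrable_add add.commute)
  show "0 + U = U" by transfer simp
  show "- U + U = 0" by transfer (simp add: square_integrable_zero)
  show "U - V = U + - V" by transfer (simp add: square_integrable_diff)
  show "a *\<^sub>R (U + V) = a *\<^sub>R U + a *\<^sub>R V"
    by transfer (simp add: square_integrable_add square_integrable_cmult distrib_left)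
  show "(a + b) *\<^sub>R U = a *\<^sub>R U + b *\<^sub>R U"
    by transfer (simp add: square_integrable_add square_integrable_cmult distrib_right)
  show "a *\<^sub>R b *\<^sub>R U = (a * b) *\<^sub>R U" by transfer (simp add: square_integrable_cmult mult.assoc)
  show "1 *\<^sub>R U = U" by transfer simp
  show "dist U V = norm (U - V)" by (rule dist_lsq_def)
  show "sgn U = inverse (norm U) *\<^sub>R U" by (rule sgn_lsq_def)
  show "norm U = sqrt (U \<bullet> U)" by (rule norm_lsq_def)
  have integrable_inner: "integrable lborel (\<lambda>x. f x * cnj (g x))"
    if "square_integrable f" "square_integrable g" for f g :: "'a \<Rightarrow> complex"
    using that by (intro integrable_mult_square_integrable square_integrable_cnj)
  have "Re (LINT x|lborel. f x * cnj (g x)) = Re (LINT x|lborel. g x * cnj (f x))" for f g :: "'a \<Rightarrow> complex"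
    using Bochner_Integration.integral_cnj[of lborel "\<lambda>x. g x * cnj (f x)"] by (simp add: mult.commute)
  then show "U \<bullet> V = V \<bullet> U" by transfer
  show "(U + V) \<bullet> Z = U \<bullet> Z + V \<bullet> Z" by transfer (simp add: distrib_right integrable_inner)
  show "a *\<^sub>R U \<bullet> V = a * (U \<bullet> V)" by transfer (simp add: mult.assoc)
  show "0 \<le> U \<bullet> U" by transfer (simp add: integral_mult_cnj_self)
  have "(LINT x|lborel. (cmod (f x))\<^sup>2) = 0 \<longleftrightarrow> (AE x in lborel. f x = 0)"
    if "square_integrable f" for f :: "'a \<Rightarrow> complex"
    using integral_nonneg_eq_0_iff_AE[OF integrable_norm_sq[OF that]] by simp
  then show "U \<bullet> U = 0 \<longleftrightarrow> U = 0"
    by transfer (auto simp: integral_mult_cnj_self square_integrable_zero)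
qed (rule uniformity_lsq_def open_lsq_def)+

end

lemma abs_lsq_zero: "abs_lsq (\<lambda>_. 0) = 0"
  by (simp add: zero_lsq.abs_eq)

lemma abs_lsq_add:
  "square_integrable f \<Longrightarrow> square_integrable g \<Longrightarrow> abs_lsq (\<lambda>x. f x + g x) = abs_lsq f + abs_lsq g"
  by (simp add: plus_lsq.abs_eq)

lemma abs_lsq_diff:
  "square_integrable f \<Longrightarrow> square_integrable g \<Longrightarrow> abs_lsq (\<lambda>x. f x - g x) = abs_lsq f - abs_lsq g"
  by (simp add: minus_lsq.abs_eq)

lemma abs_lsq_scaleR: "square_integrable f \<Longrightarrow> abs_lsq (\<lambda>x. of_real c * f x) = c *\<^sub>R abs_lsq f"
  by (simp add: scaleR_lsq.abs_eq)

lemma inner_abs_lsq: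
  "square_integrable f \<Longrightarrow> square_integrable g \<Longrightarrow> abs_lsq f \<bullet> abs_lsq g = Re (LINT x|lborel. f x * cnj (g x))"
  by (simp add: inner_lsq.abs_eq)

lemma rep_add: "AE x in lborel. rep_lsq (U + V) x = rep_lsq U x + rep_lsq V x"
  using rep_abs_lsq[OF square_integrable_add[OF square_integrable_rep[of U] square_integrable_rep[of V]]]
  by (simp add: abs_lsq_add square_integrable_rep abs_rep_lsq)

lemma rep_scaleR: "AE x in lborel. rep_lsq (c *\<^sub>R U) x = of_real c * rep_lsq U x"
  using rep_abs_lsq[OF square_integrable_cmult[OF square_integrable_rep[of U], of "of_real c"]]
  by (simp add: abs_lsq_scaleR square_integrable_rep abs_rep_lsq)

lemma norm_abs_lsq_sq:
  assumes "square_integrable f" shows "(norm (abs_lsq f))\<^sup>2 = (LINT x|lborel. (cmod (f x))\<^sup>2)"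
  by (simp add: power2_norm_eq_inner inner_abs_lsq assms integral_mult_cnj_self)

lemma norm_lsq_sq: "(norm U)\<^sup>2 = (LINT x|lborel. (cmod (rep_lsq U x))\<^sup>2)"
  using norm_abs_lsq_sq[OF square_integrable_rep[of U]] by (simp add: abs_rep_lsq)

lemma nn_integral_abs_lsq:
  assumes "square_integrable f"
  shows "(\<integral>\<^sup>+x. ennreal ((cmod (f x))\<^sup>2) \<partial>lborel) = ennreal ((norm (abs_lsq f))\<^sup>2)"
  unfolding norm_abs_lsq_sq[OF assms]
  by (rule nn_integral_eq_integral) (use assms in \<open>auto simp: square_integrable_def\<close>)

lemma nn_integral_rep_lsq: "(\<integral>\<^sup>+x. ennreal ((cmod (rep_lsq U x))\<^sup>2) \<partial>lborel) = ennreal ((norm U)\<^sup>2)"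
  using nn_integral_abs_lsq[OF square_integrable_rep[of U]] by (simp add: abs_rep_lsq)

lemma norm_abs_lsq_le:
  assumes "f \<in> borel_measurable lborel" "0 \<le> C" "(\<integral>\<^sup>+x. ennreal ((cmod (f x))\<^sup>2) \<partial>lborel) \<le> ennreal (C\<^sup>2)"
  shows "square_integrable f" "norm (abs_lsq f) \<le> C"
proof -
  show f: "square_integrable f"
    using assms by (intro square_integrable_if_nn_integral_finite) (auto intro: le_less_trans)
  then have "(norm (abs_lsq f))\<^sup>2 \<le> C\<^sup>2" using assms(3) by (simp add: nn_integral_abs_lsq)
  then show "norm (abs_lsq f) \<le> C" using assms(2) by (rule power2_le_imp_le)
qed

lemma summable_norm_if_summable_weighted_sq:
  fixes d :: "nat \<Rightarrow> 'b::real_normed_vector"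
  assumes "summable (\<lambda>n. 4 ^ n * (norm (d n))\<^sup>2)"
  shows "summable (\<lambda>n. norm (d n))"
proof (rule summable_comparison_test')
  show "summable (\<lambda>n. 4 ^ n * (norm (d n))\<^sup>2 + (1/4::real) ^ n)"
    using assms by (intro summable_add) (auto intro!: summable_geometric)
  fix n
  have "norm (d n) \<le> 2 * (2 ^ n * norm (d n)) * (1/2) ^ n" by (simp add: power_divide)
  also have "\<dots> \<le> (2 ^ n * norm (d n))\<^sup>2 + ((1/2) ^ n)\<^sup>2" by (rule sum_squares_bound)
  also have "\<dots> = (2 ^ n)\<^sup>2 * (norm (d n))\<^sup>2 + ((1/2) ^ n)\<^sup>2" by (simp only: power_mult_distrib)
  also have "(2 ^ n)\<^sup>2 = (4::real) ^ n" by (simp add: power2_eq_square flip: power_mult_distrib)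
  also have "((1/2) ^ n)\<^sup>2 = (1/4::real) ^ n" by (simp add: power2_eq_square flip: power_mult_distrib)
  finally show "norm (norm (d n)) \<le> 4 ^ n * (norm (d n))\<^sup>2 + (1/4) ^ n" by simp
qed

lemma AE_convergent_if_summable_diff_sq:
  fixes f :: "nat \<Rightarrow> 'a \<Rightarrow> 'b::{banach, second_countable_topology}"
  assumes [measurable]: "\<And>n. f n \<in> borel_measurable M"
    and fast: "\<And>n. (\<integral>\<^sup>+x. ennreal ((norm (f (Suc n) x - f n x))\<^sup>2) \<partial>M) \<le> ennreal ((1/16) ^ n)"
  shows "AE x in M. convergent (\<lambda>n. f n x)"
proof -
  have weighted: "(\<integral>\<^sup>+x. ennreal (4 ^ n * (norm (f (Suc n) x - f n x))\<^sup>2) \<partial>M) \<le> ennreal ((1/4) ^ n)" for n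
  proof -
    have "(\<integral>\<^sup>+x. ennreal (4 ^ n * (norm (f (Suc n) x - f n x))\<^sup>2) \<partial>M)
        = ennreal (4 ^ n) * (\<integral>\<^sup>+x. ennreal ((norm (f (Suc n) x - f n x))\<^sup>2) \<partial>M)"
      by (subst nn_integral_cmult[symmetric]) (auto simp: ennreal_mult)
    also have "\<dots> \<le> ennreal (4 ^ n) * ennreal ((1/16) ^ n)" by (intro mult_left_mono fast) simp
    also have "\<dots> = ennreal (4 ^ n * (1/16) ^ n)" by (rule ennreal_mult[symmetric]) auto
    also have "4 ^ n * (1/16) ^ n = (1/4::real) ^ n" by (simp only: power_mult_distrib[symmetric]) simp
    finally show ?thesis .
  qed
  have "(\<integral>\<^sup>+x. (\<Sum>n. ennreal (4 ^ n * (norm (f (Suc n) x - f n x))\<^sup>2)) \<partial>M)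
      = (\<Sum>n. \<integral>\<^sup>+x. ennreal (4 ^ n * (norm (f (Suc n) x - f n x))\<^sup>2) \<partial>M)"
    by (rule nn_integral_suminf) measurable
  also have "\<dots> \<le> (\<Sum>n. ennreal ((1/4) ^ n))" by (intro suminf_le summableI weighted)
  also have "\<dots> = ennreal (\<Sum>n. (1/4) ^ n)" by (rule suminf_ennreal2) (auto intro!: summable_geometric)
  also have "\<dots> < \<infinity>" by simp
  finally have "AE x in M. (\<Sum>n. ennreal (4 ^ n * (norm (f (Suc n) x - f n x))\<^sup>2)) \<noteq> \<infinity>"
    by (intro nn_integral_noteq_infinite) (auto simp: less_top)
  then show ?thesis
  proof eventually_elim
    case (elim x)
    have "summable (\<lambda>n. 4 ^ n * (norm (f (Suc n) x - f n x))\<^sup>2)"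
      using elim by (intro summable_suminf_not_top) auto
    then have "summable (\<lambda>n. f (Suc n) x - f n x)"
      by (rule summable_norm_cancel[OF summable_norm_if_summable_weighted_sq])
    then have "convergent (\<lambda>n. f n x - f 0 x)"
      unfolding summable_iff_convergent sum_lessThan_telescope[of "\<lambda>n. f n x"] .
    then have "convergent (\<lambda>n. (f n x - f 0 x) + f 0 x)" by (intro convergent_add convergent_const)
    then show ?case by simp
  qed
qed

lemma nn_integral_norm_sq_limit_le:
  fixes f :: "nat \<Rightarrow> 'a \<Rightarrow> 'b::{real_normed_vector, second_countable_topology}"
  assumes [measurable]: "\<And>n. f n \<in> borel_measurable M"
    and lim: "AE x in M. (\<lambda>n. f n x) \<longlonglongrightarrow> F x"
    and bound: "\<forall>\<^sub>F n in sequentially. (\<integral>\<^sup>+x. ennreal ((norm (f n x))\<^sup>2) \<partial>M) \<le> K"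
  shows "(\<integral>\<^sup>+x. ennreal ((norm (F x))\<^sup>2) \<partial>M) \<le> K"
proof -
  have "(\<integral>\<^sup>+x. ennreal ((norm (F x))\<^sup>2) \<partial>M) = (\<integral>\<^sup>+x. liminf (\<lambda>n. ennreal ((norm (f n x))\<^sup>2)) \<partial>M)"
  proof (rule nn_integral_cong_AE)
    show "AE x in M. ennreal ((norm (F x))\<^sup>2) = liminf (\<lambda>n. ennreal ((norm (f n x))\<^sup>2))"
      using lim
    proof eventually_elim
      case (elim x)
      then have "(\<lambda>n. ennreal ((norm (f n x))\<^sup>2)) \<longlonglongrightarrow> ennreal ((norm (F x))\<^sup>2)"
        by (intro tendsto_ennrealI tendsto_power tendsto_norm)
      then show ?case by (rule lim_imp_Liminf[symmetric, OF sequentially_bot])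
    qed
  qed
  also have "\<dots> \<le> liminf (\<lambda>n. \<integral>\<^sup>+x. ennreal ((norm (f n x))\<^sup>2) \<partial>M)" by (rule nn_integral_liminf) measurable
  also have "\<dots> \<le> liminf (\<lambda>n::nat. K)" using bound by (rule Liminf_mono)
  finally show ?thesis by (simp add: Liminf_const)
qed

lemma nn_integral_rep_diff:
  "(\<integral>\<^sup>+x. ennreal ((cmod (rep_lsq U x - rep_lsq V x))\<^sup>2) \<partial>lborel) = ennreal ((norm (U - V))\<^sup>2)"
  by (simp add: nn_integral_abs_lsq square_integrable_diff square_integrable_rep abs_lsq_diff abs_rep_lsq)

lemma norm_diff_AE_limit_le:
  fixes F :: "'a::euclidean_space \<Rightarrow> complex"
  assumes [measurable]: "F \<in> borel_measurable borel"
    and lim: "AE x in lborel. (\<lambda>k. rep_lsq (X k) x) \<longlonglongrightarrow> F x"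
    and bound: "\<forall>\<^sub>F k in sequentially. norm (U - X k) \<le> e"
  shows "norm (U - abs_lsq F) \<le> e"
proof -
  have e: "e \<ge> 0" using bound by (auto simp: eventually_sequentially intro: order_trans[OF norm_ge_zero])
  have "(\<integral>\<^sup>+x. ennreal ((cmod (rep_lsq U x - F x))\<^sup>2) \<partial>lborel) \<le> ennreal (e\<^sup>2)"
  proof (rule nn_integral_norm_sq_limit_le[where f="\<lambda>k x. rep_lsq U x - rep_lsq (X k) x"])
    show "AE x in lborel. (\<lambda>k. rep_lsq U x - rep_lsq (X k) x) \<longlonglongrightarrow> rep_lsq U x - F x"
      using lim by eventually_elim (intro tendsto_intros)
    show "\<forall>\<^sub>F k in sequentially. (\<integral>\<^sup>+x. ennreal ((cmod (rep_lsq U x - rep_lsq (X k) x))\<^sup>2) \<partial>lborel) \<le> ennreal (e\<^sup>2)"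
      unfolding nn_integral_rep_diff using bound
      by eventually_elim (intro ennreal_leI power_mono norm_ge_zero)
  qed measurable
  note diff = norm_abs_lsq_le[OF _ e this]
  have diff_sq: "square_integrable (\<lambda>x. rep_lsq U x - F x)" by (rule diff(1)) measurable
  have F: "square_integrable F"
    using square_integrable_diff[OF square_integrable_rep[of U] diff_sq] by simp
  have "norm (abs_lsq (\<lambda>x. rep_lsq U x - F x)) \<le> e" by (rule diff(2)) measurable
  then show "norm (U - abs_lsq F) \<le> e"
    by (simp add: abs_lsq_diff square_integrable_rep F abs_rep_lsq)
qed

instance lsq :: (euclidean_space) complete_space
proof
  fix X :: "nat \<Rightarrow> 'a lsq" assume "Cauchy X"
  then have "\<forall>n::nat. \<exists>M. \<forall>m\<ge>M. \<forall>k\<ge>M. norm (X m - X k) < (1/4) ^ n"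
    by (auto simp: Cauchy_def dist_norm)
  then obtain N where N: "\<And>n m k. m \<ge> N n \<Longrightarrow> k \<ge> N n \<Longrightarrow> norm (X m - X k) < (1/4) ^ n"
    by metis
  define r where "r n = Max (N ` {..n})" for n
  have r_ge: "r k \<ge> N n" if "k \<ge> n" for k n
    unfolding r_def using that by (intro Max_ge) auto
  have quarter_sq: "((1/4) ^ n)\<^sup>2 = (1/16::real) ^ n" for n
    by (simp add: power2_eq_square flip: power_mult_distrib)
  have nn_integral_diff: "(\<integral>\<^sup>+x. ennreal ((cmod (rep_lsq (X m) x - rep_lsq (X k) x))\<^sup>2) \<partial>lborel) \<le> ennreal ((1/16) ^ n)"
    if "m \<ge> N n" "k \<ge> N n" for m k n
    unfolding nn_integral_rep_diff quarter_sq[symmetric]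
    using N[OF that] by (intro ennreal_leI power_mono) auto
  define F where "F x = lim (\<lambda>n. rep_lsq (X (r n)) x)" for x
  have F: "F \<in> borel_measurable borel"
    unfolding F_def by (rule borel_measurable_lim_metric) measurable
  have "AE x in lborel. convergent (\<lambda>n. rep_lsq (X (r n)) x)"
    by (rule AE_convergent_if_summable_diff_sq) (auto intro!: nn_integral_diff r_ge)
  then have lim: "AE x in lborel. (\<lambda>n. rep_lsq (X (r n)) x) \<longlonglongrightarrow> F x"
    by eventually_elim (simp add: F_def convergent_LIMSEQ_iff)
  have norm_diff: "norm (X m - abs_lsq F) \<le> (1/4) ^ n" if "m \<ge> N n" for m n
    using F lim eventually_mono[OF eventually_ge_at_top[of n] less_imp_le[OF N[OF that r_ge]]]
    by (rule norm_diff_AE_limit_le)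
  have "X \<longlonglongrightarrow> abs_lsq F"
  proof (rule LIMSEQ_I)
    fix e :: real assume "e > 0"
    then obtain n where "(1/4::real) ^ n < e" using real_arch_pow_inv[of e "1/4"] by auto
    then show "\<exists>no. \<forall>m\<ge>no. norm (X m - abs_lsq F) < e"
      using norm_diff[of n] by (intro exI[of _ "N n"]) (auto intro: le_less_trans)
  qed
  then show "convergent X" by (rule convergentI)
qed

instance lsq :: (euclidean_space) banach ..

definition pairing :: "('a::euclidean_space \<Rightarrow> complex) \<Rightarrow> 'a lsq \<Rightarrow> complex" where
  "pairing g U = (LINT x|lborel. g x * rep_lsq U x)"

lemma pairing_abs_lsq:
  assumes [measurable]: "square_integrable g" and f: "square_integrable f"
  shows "pairing g (abs_lsq f) = (LINT x|lborel. g x * f x)"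
  unfolding pairing_def
proof (rule integral_cong_AE)
  show "(\<lambda>x. g x * f x) \<in> borel_measurable lborel"
    using assms[THEN square_integrable_measurable] by measurable
  show "AE x in lborel. g x * rep_lsq (abs_lsq f) x = g x * f x"
    using rep_abs_lsq[OF f] by eventually_elim simp
qed measurable

lemma lsq_cases:
  obtains f where "square_integrable f" "U = abs_lsq f"
  using square_integrable_rep[of U] abs_rep_lsq[of U] by metis

lemma pairing_add: "square_integrable g \<Longrightarrow> pairing g (U + V) = pairing g U + pairing g V"
  by (cases U rule: lsq_cases, cases V rule: lsq_cases)
     (simp add: pairing_abs_lsq square_integrable_add distrib_left integrable_mult_square_integrable flip: abs_lsq_add)

lemma pairing_scaleR: "square_integrable g \<Longrightarrow> pairing g (c *\<^sub>R U) = c *\<^sub>R pairing g U"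
  by (cases U rule: lsq_cases)
     (simp add: pairing_abs_lsq square_integrable_cmult scaleR_conv_of_real mult.left_commute[of _ "of_real c"] flip: abs_lsq_scaleR)

lemma square_integrable_Cauchy_Schwarz:
  assumes "square_integrable f" "square_integrable g"
  shows "(LINT x|lborel. cmod (f x) * cmod (g x)) \<le> norm (abs_lsq f) * norm (abs_lsq g)"
proof -
  let ?abs = "\<lambda>f x. complex_of_real (cmod (f x))"
  have square_integrable_abs: "square_integrable (?abs f)" "square_integrable (?abs g)"
    using assms by (auto simp: square_integrable_def)
  have norm_abs: "norm (abs_lsq (?abs f)) = norm (abs_lsq f)" "norm (abs_lsq (?abs g)) = norm (abs_lsq g)"
    by (rule power2_eq_imp_eq; simp add: norm_abs_lsq_sq square_integrable_abs assms)+
  have "abs_lsq (?abs f) \<bullet> abs_lsq (?abs g) = Re (LINT x|lborel. of_real (cmod (f x) * cmod (g x)))"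
    by (simp add: inner_abs_lsq square_integrable_abs)
  also have "\<dots> = (LINT x|lborel. cmod (f x) * cmod (g x))"
    by (simp only: integral_complex_of_real Re_complex_of_real)
  finally show ?thesis
    using norm_cauchy_schwarz[of "abs_lsq (?abs f)" "abs_lsq (?abs g)"] norm_abs by simp
qed

lemma norm_pairing_le:
  assumes "square_integrable g" shows "cmod (pairing g U) \<le> norm (abs_lsq g) * norm U"
proof -
  have "cmod (pairing g U) \<le> (LINT x|lborel. cmod (g x * rep_lsq U x))"
    unfolding pairing_def by (rule integral_norm_bound)
  also have "\<dots> \<le> norm (abs_lsq g) * norm (abs_lsq (rep_lsq U))"
    unfolding norm_mult by (rule square_integrable_Cauchy_Schwarz[OF assms square_integrable_rep])
  finally show ?thesis by (simp add: abs_rep_lsq)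
qed

lemma bounded_linear_pairing: "square_integrable g \<Longrightarrow> bounded_linear (pairing g)"
  by (rule bounded_linear_intro[where K="norm (abs_lsq g)"])
     (simp_all add: pairing_add pairing_scaleR norm_pairing_le mult.commute[of "norm _" "norm (abs_lsq g)"])

definition mult_op :: "('a::euclidean_space \<Rightarrow> complex) \<Rightarrow> 'a lsq \<Rightarrow> 'a lsq" where
  "mult_op m U = abs_lsq (\<lambda>x. m x * rep_lsq U x)"

lemma mult_op_one: "mult_op (\<lambda>_. 1) U = U"
  by (simp add: mult_op_def abs_rep_lsq)

lemma mult_op_zero: "mult_op (\<lambda>_. 0) U = 0"
  by (simp add: mult_op_def abs_lsq_zero)

lemma mult_op_of_real: "mult_op (\<lambda>_. of_real c) U = c *\<^sub>R U"
  by (simp add: mult_op_def abs_lsq_scaleR square_integrable_rep abs_rep_lsq)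

context
  fixes m :: "'a::euclidean_space \<Rightarrow> complex" and C
  assumes m: "m \<in> borel_measurable borel" "\<And>x. cmod (m x) \<le> C"
begin

lemma square_integrable_mult_rep: "square_integrable (\<lambda>x. m x * rep_lsq U x)"
  by (rule square_integrable_mult_bounded[OF square_integrable_rep m])

lemma rep_mult_op: "AE x in lborel. rep_lsq (mult_op m U) x = m x * rep_lsq U x"
  unfolding mult_op_def by (rule rep_abs_lsq[OF square_integrable_mult_rep])

lemma mult_op_abs_lsq:
  assumes "square_integrable f" shows "mult_op m (abs_lsq f) = abs_lsq (\<lambda>x. m x * f x)"
  unfolding mult_op_def
  by (rule abs_lsq_eqI[OF square_integrable_mult_rep square_integrable_mult_bounded[OF assms m]])
     (use rep_abs_lsq[OF assms] in auto)

lemma norm_mult_op_le: "norm (mult_op m U) \<le> C * norm U"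
proof -
  have C: "0 \<le> C" using m(2)[of 0] norm_ge_zero order_trans by blast
  have "(norm (mult_op m U))\<^sup>2 = (LINT x|lborel. (cmod (m x * rep_lsq U x))\<^sup>2)"
    unfolding mult_op_def by (rule norm_abs_lsq_sq[OF square_integrable_mult_rep])
  also have "\<dots> \<le> (LINT x|lborel. C\<^sup>2 * (cmod (rep_lsq U x))\<^sup>2)"
  proof (rule integral_mono)
    show "(cmod (m x * rep_lsq U x))\<^sup>2 \<le> C\<^sup>2 * (cmod (rep_lsq U x))\<^sup>2" for x
      unfolding norm_mult power_mult_distrib by (intro mult_right_mono power_mono m) auto
  qed (auto intro: integrable_norm_sq square_integrable_mult_rep square_integrable_rep)
  also have "\<dots> = (C * norm U)\<^sup>2" by (simp add: norm_lsq_sq power_mult_distrib)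
  finally show ?thesis by (rule power2_le_imp_le) (simp add: C)
qed

lemma bounded_linear_mult_op: "bounded_linear (mult_op m)"
proof (rule bounded_linear_intro[where K=C])
  note mult_bounded = square_integrable_mult_bounded[OF _ m]
  show "mult_op m (U + V) = mult_op m U + mult_op m V" for U V
    by (cases U rule: lsq_cases, cases V rule: lsq_cases)
       (simp add: mult_op_abs_lsq square_integrable_add mult_bounded distrib_left flip: abs_lsq_add)
  show "mult_op m (c *\<^sub>R U) = c *\<^sub>R mult_op m U" for c U
    by (cases U rule: lsq_cases)
       (simp add: mult_op_abs_lsq square_integrable_cmult mult_bounded mult.left_commute flip: abs_lsq_scaleR)
  show "norm (mult_op m U) \<le> norm U * C" for U
    using norm_mult_op_le[of U] by (simp add: mult.commute)
qed

end

lemma bounded_linear_mult_op_const: "bounded_linear (mult_op (\<lambda>_. c))"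
  by (rule bounded_linear_mult_op[where C="cmod c"]) auto

lemma mult_op_mult_op:
  assumes m: "m \<in> borel_measurable borel" "\<And>x. cmod (m x) \<le> C"
    and l: "l \<in> borel_measurable borel" "\<And>x. cmod (l x) \<le> D"
  shows "mult_op m (mult_op l U) = mult_op (\<lambda>x. m x * l x) U"
  unfolding mult_op_def[of l] mult_op_def[of "\<lambda>x. m x * l x"]
  by (simp add: mult_op_abs_lsq[OF m square_integrable_mult_rep[OF l]] mult.assoc)

lemma tendsto_mult_op:
  assumes m: "\<And>n. m n \<in> borel_measurable borel" "\<And>n x. cmod (m n x) \<le> C"
    and l: "l \<in> borel_measurable borel" "\<And>x. cmod (l x) \<le> C" and lim: "\<And>x. (\<lambda>n. m n x) \<longlonglongrightarrow> l x"
  shows "(\<lambda>n. mult_op (m n) U) \<longlonglongrightarrow> mult_op l U"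
proof -
  have diff_bound: "cmod (m n x - l x) \<le> 2 * C" for n x
    using norm_triangle_ineq4[of "m n x" "l x"] m(2)[of n x] l(2)[of x] by simp
  have diff: "square_integrable (\<lambda>x. (m n x - l x) * rep_lsq U x)" for n
    by (rule square_integrable_mult_bounded[OF square_integrable_rep _ diff_bound]) (use m l in simp)
  have "(\<lambda>n. LINT x|lborel. (cmod ((m n x - l x) * rep_lsq U x))\<^sup>2) \<longlonglongrightarrow> (LINT x::'a|lborel. 0)"
  proof (rule integral_dominated_convergence[where w="\<lambda>x. (2 * C)\<^sup>2 * (cmod (rep_lsq U x))\<^sup>2"])
    show "integrable lborel (\<lambda>x. (2 * C)\<^sup>2 * (cmod (rep_lsq U x))\<^sup>2)"
      using integrable_norm_sq[OF square_integrable_rep[of U]] by simp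
    have "(\<lambda>n. (cmod ((m n x - l x) * rep_lsq U x))\<^sup>2) \<longlonglongrightarrow> (cmod ((l x - l x) * rep_lsq U x))\<^sup>2" for x
      by (intro tendsto_power tendsto_norm tendsto_mult tendsto_diff lim tendsto_const)
    then show "AE x in lborel. (\<lambda>n. (cmod ((m n x - l x) * rep_lsq U x))\<^sup>2) \<longlonglongrightarrow> 0" by simp
    have "(cmod (m n x - l x))\<^sup>2 * (cmod (rep_lsq U x))\<^sup>2 \<le> (2 * C)\<^sup>2 * (cmod (rep_lsq U x))\<^sup>2" for n x
      by (intro mult_right_mono power_mono diff_bound) auto
    then show "AE x in lborel. norm ((cmod ((m n x - l x) * rep_lsq U x))\<^sup>2) \<le> (2 * C)\<^sup>2 * (cmod (rep_lsq U x))\<^sup>2" for n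
      by (simp add: norm_mult power_mult_distrib)
    show "(\<lambda>x. (cmod ((m n x - l x) * rep_lsq U x))\<^sup>2) \<in> borel_measurable lborel" for n
      by (rule borel_measurable_integrable[OF integrable_norm_sq[OF diff]])
  qed simp
  moreover have "mult_op (m n) U - mult_op l U = abs_lsq (\<lambda>x. (m n x - l x) * rep_lsq U x)" for n
    unfolding mult_op_def left_diff_distrib
    by (simp add: abs_lsq_diff square_integrable_mult_rep[OF m] square_integrable_mult_rep[OF l])
  ultimately have "(\<lambda>n. (norm (mult_op (m n) U - mult_op l U))\<^sup>2) \<longlonglongrightarrow> 0"
    by (simp add: norm_abs_lsq_sq diff)
  then have "(\<lambda>n. norm (mult_op (m n) U - mult_op l U)) \<longlonglongrightarrow> 0" using tendsto_real_sqrt by fastforce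
  then show ?thesis by (simp add: tendsto_norm_zero_iff LIM_zero_iff)
qed

section \<open>Plancherel's theorem\<close>

definition interval_FT :: "real \<Rightarrow> real \<Rightarrow> real \<Rightarrow> complex" where
  "interval_FT a b t = (LINT x|lborel. indicator {a..b} x * cis (- (x * t)))"

lemma borel_measurable_cis [measurable (raw)]:
  "f \<in> borel_measurable M \<Longrightarrow> (\<lambda>x. cis (f x)) \<in> borel_measurable M"
  by (rule borel_measurable_continuous_on[where f=cis]) (auto simp: cis_conv_exp intro!: continuous_intros)

lemma integrable_indicator_cis:
  "integrable lborel (\<lambda>x. indicator {a..b} x * cis (g x) :: complex)" if [measurable]: "g \<in> borel_measurable borel" for g :: "real \<Rightarrow> real"
proof (rule Bochner_Integration.integrable_bound)
  show "integrable lborel (indicator {a..b} :: real \<Rightarrow> real)"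
    by (simp add: integrable_indicator_iff emeasure_lborel_Icc_eq)
qed (auto simp: norm_mult indicator_def)

lemma interval_FT_measurable [measurable]: "interval_FT a b \<in> borel_measurable borel"
  unfolding interval_FT_def[abs_def] by measurable

lemma interval_FT_empty: "b \<le> a \<Longrightarrow> interval_FT a b t = 0"
  unfolding interval_FT_def
proof (rule integral_eq_zero_AE)
  assume "b \<le> a"
  then show "AE x in lborel. indicator {a..b} x * cis (- (x * t)) = 0"
    by (intro eventually_mono[OF AE_lborel_singleton[of a]]) (auto simp: indicator_def)
qed

lemma interval_FT_eq:
  assumes "a \<le> b" "t \<noteq> 0"
  shows "interval_FT a b t = (iexp (- (t * a)) - iexp (- (t * b))) / (\<i> * t)"
proof -
  have "(\<integral>x. indicator {a .. b} x *\<^sub>R cis (- (x * t)) \<partial>lborel) = - iexp (- (t * b)) / (\<i> * t) - (- iexp (- (t * a)) / (\<i> * t))"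
  proof (rule integral_FTC_Icc[OF assms(1)])
    fix x
    show "((\<lambda>x. - iexp (- (t * x)) / (\<i> * t)) has_vector_derivative cis (- (x * t))) (at x within {a..b})"
    proof -
      have "((\<lambda>z. - exp (- (\<i> * t * z)) / (\<i> * t)) has_field_derivative exp (- (\<i> * t * of_real x))) (at (of_real x))"
        using assms(2) by (auto intro!: derivative_eq_intros simp: field_simps)
      from has_vector_derivative_real_field[OF this, of "{a..b}"]
      show ?thesis by (simp add: cis_conv_exp mult_ac)
    qed
  qed (auto simp: cis_conv_exp intro!: continuous_intros)
  moreover have "indicator {a .. b} x *\<^sub>R cis (- (x * t)) = indicator {a .. b} x * cis (- (x * t))" for x
    by (simp add: indicator_def)
  ultimately show ?thesis by (simp add: interval_FT_def diff_divide_distrib)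
qed

lemma interval_FT_bound: "(1 + t\<^sup>2) * (cmod (interval_FT a b t))\<^sup>2 \<le> (b - a)\<^sup>2 + 4"
proof (cases "a \<le> b")
  case True
  have le_length: "cmod (interval_FT a b t) \<le> b - a"
  proof -
    have "cmod (interval_FT a b t) \<le> (LINT x|lborel. cmod (indicator {a..b} x * cis (- (x * t))))"
      unfolding interval_FT_def by (rule integral_norm_bound)
    also have "\<dots> = (LINT x|lborel. indicator {a..b} x)"
      by (intro Bochner_Integration.integral_cong) (auto simp: norm_mult indicator_def)
    finally show ?thesis using True by simp
  qed
  have decay: "t\<^sup>2 * (cmod (interval_FT a b t))\<^sup>2 \<le> 2\<^sup>2"
  proof (cases "t = 0")
    case False
    then have "\<bar>t\<bar> * cmod (interval_FT a b t) = cmod (iexp (- (t * a)) - iexp (- (t * b)))"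
      unfolding interval_FT_eq[OF True False] by (simp add: norm_divide norm_mult)
    also have "\<dots> \<le> cmod (iexp (- (t * a))) + cmod (iexp (- (t * b)))"
      by (rule norm_triangle_ineq4)
    also have "\<dots> = 2" by (simp only: norm_exp_i_times)
    finally have "(\<bar>t\<bar> * cmod (interval_FT a b t))\<^sup>2 \<le> 2\<^sup>2" by (intro power_mono) auto
    then show ?thesis by (simp add: power_mult_distrib)
  qed simp
  have "(cmod (interval_FT a b t))\<^sup>2 \<le> (b - a)\<^sup>2" using le_length by (intro power_mono) auto
  with decay show ?thesis by (simp add: algebra_simps)
qed (simp add: interval_FT_empty)

lemma integrable_inverse_1_plus_square_real: "integrable lborel (\<lambda>t::real. inverse (1 + t\<^sup>2))"
  using integrable_inverse_1_plus_square
  by (simp add: set_integrable_def einterval_eq_UNIV)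

lemma square_integrable_interval_FT: "square_integrable (interval_FT a b)"
  unfolding square_integrable_def
proof
  show "integrable lborel (\<lambda>x. (cmod (interval_FT a b x))\<^sup>2)"
  proof (rule Bochner_Integration.integrable_bound)
    show "integrable lborel (\<lambda>t. ((b - a)\<^sup>2 + 4) * inverse (1 + t\<^sup>2))"
      using integrable_inverse_1_plus_square_real by simp
    show "AE t in lborel. norm ((cmod (interval_FT a b t))\<^sup>2) \<le> norm (((b - a)\<^sup>2 + 4) * inverse (1 + t\<^sup>2))"
    proof (intro AE_I2)
      fix t :: real
      have "0 < 1 + t\<^sup>2" by (simp add: add_pos_nonneg)
      then show "norm ((cmod (interval_FT a b t))\<^sup>2) \<le> norm (((b - a)\<^sup>2 + 4) * inverse (1 + t\<^sup>2))"
        using interval_FT_bound[of t a b] by (simp add: field_simps)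
    qed
  qed measurable
qed measurable

lemma char_uniform_measure_interval:
  assumes "c < d"
  shows "char (uniform_measure lborel {c..d}) t = cnj (interval_FT c d t) / of_real (d - c)"
proof -
  have "uniform_measure lborel {c..d} = density lborel (\<lambda>x. ennreal (indicator {c..d} x / (d - c)))"
    unfolding uniform_measure_def using assms
    by (intro density_cong) (auto simp: indicator_def divide_ennreal simp flip: ennreal_1)
  then have "char (uniform_measure lborel {c..d}) t = (LINT x|lborel. (indicator {c..d} x / (d - c)) *\<^sub>R iexp (t * x))"
    unfolding char_def using assms by (simp add: integral_density)
  also have "\<dots> = (LINT x|lborel. cnj (indicator {c..d} x * cis (- (x * t))) / of_real (d - c))"
    by (intro Bochner_Integration.integral_cong)
       (auto simp: indicator_def scaleR_conv_of_real cis_conv_exp exp_cnj mult.commute)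
  also have "\<dots> = cnj (interval_FT c d t) / of_real (d - c)"
    unfolding interval_FT_def Bochner_Integration.integral_cnj[symmetric]
    by (simp del: Bochner_Integration.integral_cnj)
  finally show ?thesis .
qed

lemma tendsto_integral_symmetric_interval:
  fixes f :: "real \<Rightarrow> 'b::{banach, second_countable_topology}"
  assumes "integrable lborel f"
  shows "(\<lambda>n. LINT t:{- real n<..<real n}|lborel. f t) \<longlonglongrightarrow> (LINT t|lborel. f t)"
proof -
  have "(\<Union>n. {- real n<..<real n}) = UNIV"
  proof (rule equalityI[OF subset_UNIV subsetI])
    fix t :: real
    obtain n where "\<bar>t\<bar> < real n" using reals_Archimedean2 by blast
    then show "t \<in> (\<Union>n. {- real n<..<real n})" by (auto simp: abs_less_iff intro: exI[of _ n])
  qed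
  moreover have "incseq (\<lambda>n. {- real n<..<real n})" by (auto simp: incseq_def)
  ultimately show ?thesis
    using set_integral_cont_up[of "\<lambda>n. {- real n<..<real n}" lborel f] assms
    by (simp add: set_integrable_def set_lebesgue_integral_def)
qed

lemma CLBINT_Levy_uniform_measure:
  fixes n :: nat
  assumes "a \<le> b" "c < d"
  shows "(CLBINT t=-real n..real n. (iexp (-(t * a)) - iexp (-(t * b))) / (\<i> * t) * char (uniform_measure lborel {c..d}) t)
    = (LINT t:{- real n<..<real n}|lborel. interval_FT a b t * cnj (interval_FT c d t)) / of_real (d - c)"
proof -
  let ?f = "\<lambda>t. interval_FT a b t * cnj (interval_FT c d t)" and ?M = "uniform_measure lborel {c..d}"
  have "(CLBINT t=-real n..real n. (iexp (-(t * a)) - iexp (-(t * b))) / (\<i> * t) * char ?M t)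
      = (LINT t|lborel. indicator {- real n<..<real n} t *\<^sub>R ((iexp (-(t * a)) - iexp (-(t * b))) / (\<i> * t) * char ?M t))"
    by (simp add: interval_lebesgue_integral_def set_lebesgue_integral_def)
  also have "\<dots> = (LINT t|lborel. indicator {- real n<..<real n} t *\<^sub>R ?f t / of_real (d - c))"
  proof (rule integral_cong_AE)
    show "AE t in lborel. indicator {- real n<..<real n} t *\<^sub>R ((iexp (-(t * a)) - iexp (-(t * b))) / (\<i> * t) * char ?M t)
        = indicator {- real n<..<real n} t *\<^sub>R ?f t / of_real (d - c)"
      using AE_lborel_singleton[of 0]
      by eventually_elim (simp add: char_uniform_measure_interval assms interval_FT_eq scaleR_conv_of_real)
  qed (simp_all add: char_uniform_measure_interval assms)
  finally show ?thesis by (simp add: set_lebesgue_integral_def)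
qed

text \<open>Levy's inversion theorem for the uniform distribution on \<open>{c..d}\<close>.\<close>

lemma Parseval_interval_nondegenerate:
  assumes "a \<le> b" "c < d"
  shows "(LINT t|lborel. interval_FT a b t * cnj (interval_FT c d t)) = of_real (2 * pi * measure lborel ({a..b} \<inter> {c..d}))"
proof -
  let ?f = "\<lambda>t. interval_FT a b t * cnj (interval_FT c d t)"
  define M where "M = uniform_measure lborel {c..d}"
  interpret M: prob_space M unfolding M_def using assms by (intro prob_space_uniform_measure) auto
  interpret real_distribution M by standard (auto simp: M_def)
  define w where "w = complex_of_real (d - c)"
  have w: "w \<noteq> 0" using assms by (simp add: w_def del: of_real_diff)
  have measure_M: "measure M A = measure lborel ({c..d} \<inter> A) / (d - c)" if "A \<in> sets borel" for A
    unfolding M_def using assms that by (subst measure_uniform_measure) auto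
  have "measure M {x} = 0" for x
    using measure_M[of "{x}"] by (simp add: Int_insert_right)
  from Levy_Inversion[OF assms(1) this this]
  have "(\<lambda>n::nat. 1 / (2 * pi) * ((LINT t:{- real n<..<real n}|lborel. ?f t) / w)) \<longlonglongrightarrow> measure M {a<..b}"
    unfolding w_def CLBINT_Levy_uniform_measure[OF assms, symmetric] M_def by simp
  moreover have "(\<lambda>n::nat. 1 / (2 * pi) * ((LINT t:{- real n<..<real n}|lborel. ?f t) / w))
      \<longlonglongrightarrow> 1 / (2 * pi) * ((LINT t|lborel. ?f t) / w)"
    by (intro tendsto_intros tendsto_integral_symmetric_interval w integrable_mult_square_integrable
        square_integrable_cnj square_integrable_interval_FT)
  ultimately have "1 / (2 * pi) * ((LINT t|lborel. ?f t) / w) = of_real (measure M {a<..b})"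
    by (rule LIMSEQ_unique[rotated])
  also have "measure M {a<..b} = measure lborel ({a..b} \<inter> {c..d}) / (d - c)"
  proof -
    have "AE x in lborel. x \<in> {c..d} \<inter> {a<..b} \<longleftrightarrow> x \<in> {a..b} \<inter> {c..d}"
      using AE_lborel_singleton[of a] by eventually_elim auto
    then have "measure lborel ({c..d} \<inter> {a<..b}) = measure lborel ({a..b} \<inter> {c..d})"
      by (rule measure_eq_AE) auto
    then show ?thesis using measure_M[of "{a<..b}"] by simp
  qed
  also have "complex_of_real \<dots> = of_real (measure lborel ({a..b} \<inter> {c..d})) / w"
    unfolding w_def by (rule of_real_divide)
  finally show ?thesis using w by (simp add: field_simps)
qed

lemma Parseval_interval:
  "(LINT t|lborel. interval_FT a b t * cnj (interval_FT c d t))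
    = of_real (2 * pi) * (LINT x|lborel. indicator {a..b} x * indicator {c..d} x)"
proof (cases "a \<le> b \<and> c < d")
  case True
  have "(LINT x|lborel. indicator {a..b} x * indicator {c..d} x :: complex)
      = (LINT x|lborel. complex_of_real (indicator ({a..b} \<inter> {c..d}) x))"
    by (intro Bochner_Integration.integral_cong) (auto simp: indicator_def)
  also have "\<dots> = of_real (measure lborel ({a..b} \<inter> {c..d}))" by simp
  finally show ?thesis using Parseval_interval_nondegenerate[of a b c d] True by simp
next
  case False
  have "(LINT x|lborel. indicator {a..b} x * indicator {c..d} x :: complex) = 0"
    by (rule integral_eq_zero_AE, use AE_lborel_singleton[of c] in eventually_elim)
       (use False in \<open>auto simp: indicator_def\<close>)
  moreover have "interval_FT a b t * cnj (interval_FT c d t) = 0" for t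
    using False by (auto simp: interval_FT_empty not_le not_less)
  ultimately show ?thesis by (simp only: mult_zero_right Bochner_Integration.integral_zero)
qed

lemma
  fixes f :: "'a::euclidean_space \<Rightarrow> real \<Rightarrow> complex"
  assumes "\<And>b. b \<in> Basis \<Longrightarrow> integrable lborel (f b)"
  shows integrable_lborel_prod: "integrable lborel (\<lambda>x::'a. \<Prod>b\<in>Basis. f b (x \<bullet> b))"
    and integral_lborel_prod: "(LINT x::'a|lborel. (\<Prod>b\<in>Basis. f b (x \<bullet> b))) = (\<Prod>b\<in>Basis. LINT t|lborel. f b t)"
proof -
  interpret product_sigma_finite "\<lambda>_::'a. lborel :: real measure"
    by standard
  have meas [measurable]: "(\<lambda>g. \<Sum>b\<in>Basis. g b *\<^sub>R b :: 'a) \<in> measurable (Pi\<^sub>M Basis (\<lambda>_. lborel)) borel"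
    by measurable
  have [measurable]: "f b \<in> borel_measurable borel" if "b \<in> Basis" for b
    using borel_measurable_integrable[OF assms[OF that]] by simp
  have coordinates: "(\<Prod>b\<in>Basis. f b ((\<Sum>b\<in>Basis. g b *\<^sub>R b) \<bullet> b)) = (\<Prod>b\<in>Basis. f b (g b))" for g :: "'a \<Rightarrow> real"
    by (intro prod.cong refl) simp
  show "integrable lborel (\<lambda>x::'a. \<Prod>b\<in>Basis. f b (x \<bullet> b))"
    by (subst lborel_eq, subst integrable_distr_eq)
       (auto simp: coordinates intro!: product_integrable_prod assms)
  show "(LINT x::'a|lborel. (\<Prod>b\<in>Basis. f b (x \<bullet> b))) = (\<Prod>b\<in>Basis. LINT t|lborel. f b t)"
    by (subst lborel_eq, subst integral_distr)
       (auto simp: coordinates intro!: product_integral_prod assms)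
qed

lemma subspace_closure:
  fixes S :: "'b::real_normed_vector set"
  assumes "subspace S" shows "subspace (closure S)"
proof (rule subspaceI)
  show "0 \<in> closure S" using subspace_0[OF assms] closure_subset by blast
next
  fix x y assume "x \<in> closure S" "y \<in> closure S"
  then obtain f g where "\<And>n. f n \<in> S" "f \<longlonglongrightarrow> x" "\<And>n. g n \<in> S" "g \<longlonglongrightarrow> y"
    unfolding closure_sequential by metis
  then show "x + y \<in> closure S"
    unfolding closure_sequential
    by (intro exI[of _ "\<lambda>n::nat. f n + g n"]) (auto intro!: tendsto_add subspace_add[OF assms])
next
  fix c x assume "x \<in> closure S"
  then obtain f where "\<And>n. f n \<in> S" "f \<longlonglongrightarrow> x"
    unfolding closure_sequential by metis
  then show "c *\<^sub>R x \<in> closure S"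
    unfolding closure_sequential
    by (intro exI[of _ "\<lambda>n::nat. c *\<^sub>R f n"]) (auto intro!: tendsto_scaleR subspace_scale[OF assms])
qed

lemma cis_sum: "finite I \<Longrightarrow> cis (\<Sum>i\<in>I. f i) = (\<Prod>i\<in>I. cis (f i))"
  by (induction I rule: finite_induct) (simp_all flip: cis_mult)

lemma indicator_cbox_prod:
  "(indicator (cbox a b) x :: complex) = (\<Prod>i\<in>Basis. indicator {a \<bullet> i..b \<bullet> i} (x \<bullet> i))"
proof (cases "x \<in> cbox a b")
  case True
  then have "(\<Prod>i\<in>Basis. indicator {a \<bullet> i..b \<bullet> i} (x \<bullet> i) :: complex) = (\<Prod>i\<in>(Basis::'a set). 1)"
    by (intro prod.cong) (auto simp: mem_box)
  with True show ?thesis by simp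
next
  case False
  then obtain i where "i \<in> Basis" "indicator {a \<bullet> i..b \<bullet> i} (x \<bullet> i) = (0::complex)"
    by (auto simp: mem_box indicator_def)
  then have "(\<Prod>i\<in>Basis. indicator {a \<bullet> i..b \<bullet> i} (x \<bullet> i) :: complex) = 0"
    by (intro prod_zero) auto
  with False show ?thesis by simp
qed

lemma square_integrable_indicator:
  assumes "A \<in> sets borel" "emeasure lborel A < \<infinity>"
  shows "square_integrable (indicator A :: 'a::euclidean_space \<Rightarrow> complex)"
proof (rule square_integrable_if_nn_integral_finite)
  have "(\<integral>\<^sup>+x. ennreal ((cmod (indicator A x))\<^sup>2) \<partial>lborel) = (\<integral>\<^sup>+x. indicator A x \<partial>lborel)"
    by (intro nn_integral_cong) (auto simp: indicator_def)
  also have "\<dots> < \<infinity>" using assms by simp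
  finally show "(\<integral>\<^sup>+x. ennreal ((cmod (indicator A x))\<^sup>2) \<partial>lborel) < \<infinity>" .
qed (use assms in simp)

lemma integrable_indicator_complex:
  assumes "A \<in> sets borel" "emeasure lborel A < \<infinity>"
  shows "integrable lborel (indicator A :: 'a::euclidean_space \<Rightarrow> complex)"
proof (rule Bochner_Integration.integrable_bound)
  show "integrable lborel (indicator A :: 'a \<Rightarrow> real)" using assms by (simp add: integrable_indicator_iff)
qed (use assms in \<open>auto simp: indicator_def\<close>)

lemma emeasure_cbox_finite: "emeasure lborel (cbox a b :: 'a::euclidean_space set) < \<infinity>"
  using emeasure_lborel_cbox_finite[of a b] by simp

lemmas square_integrable_cbox = square_integrable_indicator[OF borel_closed[OF closed_cbox] emeasure_cbox_finite]
lemmas integrable_cbox = integrable_indicator_complex[OF borel_closed[OF closed_cbox] emeasure_cbox_finite]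

lemma fourier1_cbox:
  fixes a b :: "real^'n"
  shows "fourier1 (indicator (cbox a b)) \<xi> = (\<Prod>i\<in>Basis. interval_FT (a \<bullet> i) (b \<bullet> i) (\<xi> \<bullet> i))"
proof -
  have "fourier1 (indicator (cbox a b)) \<xi> =
      (LINT x|lborel. (\<Prod>i\<in>Basis. indicator {a \<bullet> i..b \<bullet> i} (x \<bullet> i) * cis (- ((x \<bullet> i) * (\<xi> \<bullet> i)))))"
    unfolding fourier1_def
  proof (intro Bochner_Integration.integral_cong refl)
    fix x :: "real^'n"
    have "- (x \<bullet> \<xi>) = (\<Sum>i\<in>Basis. - ((x \<bullet> i) * (\<xi> \<bullet> i)))"
      by (simp add: euclidean_inner[of x \<xi>] sum_negf)
    then have "cis (- (x \<bullet> \<xi>)) = (\<Prod>i\<in>Basis. cis (- ((x \<bullet> i) * (\<xi> \<bullet> i))))"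
      by (simp only: cis_sum[OF finite_Basis])
    then show "indicator (cbox a b) x * cis (- (x \<bullet> \<xi>)) = (\<Prod>i\<in>Basis. indicator {a \<bullet> i..b \<bullet> i} (x \<bullet> i) * cis (- ((x \<bullet> i) * (\<xi> \<bullet> i))))"
      by (simp only: indicator_cbox_prod prod.distrib)
  qed
  also have "\<dots> = (\<Prod>i\<in>Basis. LINT t|lborel. indicator {a \<bullet> i..b \<bullet> i} t * cis (- (t * (\<xi> \<bullet> i))))"
    by (rule integral_lborel_prod[where f="\<lambda>i t. indicator {a \<bullet> i..b \<bullet> i} t * cis (- (t * (\<xi> \<bullet> i)))"]) (intro integrable_indicator_cis, measurable)
  finally show ?thesis by (simp add: interval_FT_def)
qed

lemma fourier1_measurable [measurable]:
  assumes [measurable]: "f \<in> borel_measurable borel"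
  shows "fourier1 f \<in> borel_measurable borel"
  unfolding fourier1_def[abs_def] by measurable

lemma
  fixes a b c d :: "real^'n"
  defines "A \<equiv> fourier1 (indicator (cbox a b))" and "B \<equiv> fourier1 (indicator (cbox c d))"
  shows integrable_Parseval_cbox: "integrable lborel (\<lambda>\<xi>. A \<xi> * cnj (B \<xi>))"
    and Parseval_cbox: "(LINT \<xi>|lborel. A \<xi> * cnj (B \<xi>)) = of_real ((2 * pi) ^ CARD('n)) * (LINT x|lborel. indicator (cbox a b) x * indicator (cbox c d) x)"
proof -
  let ?f = "\<lambda>(i::real^'n) t. interval_FT (a \<bullet> i) (b \<bullet> i) t * cnj (interval_FT (c \<bullet> i) (d \<bullet> i) t)"
  let ?g = "\<lambda>(i::real^'n) t. indicator {a \<bullet> i..b \<bullet> i} t * indicator {c \<bullet> i..d \<bullet> i} t :: complex"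
  have AB_prod: "A \<xi> * cnj (B \<xi>) = (\<Prod>i\<in>Basis. ?f i (\<xi> \<bullet> i))" for \<xi>
    by (simp add: A_def B_def fourier1_cbox prod.distrib)
  have integrable_FT: "integrable lborel (?f i)" for i
    by (intro integrable_mult_square_integrable square_integrable_cnj square_integrable_interval_FT)
  have integrable_indicator: "integrable lborel (?g i)" for i
    using integrable_mult_square_integrable[OF square_integrable_cbox[of "a \<bullet> i" "b \<bullet> i"] square_integrable_cbox[of "c \<bullet> i" "d \<bullet> i"]] by (simp add: cbox_interval)
  show "integrable lborel (\<lambda>\<xi>. A \<xi> * cnj (B \<xi>))"
    unfolding AB_prod using integrable_lborel_prod[where f="?f"] integrable_FT by blast
  have "(LINT \<xi>|lborel. A \<xi> * cnj (B \<xi>)) = (\<Prod>i\<in>Basis. LINT t|lborel. ?f i t)"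
    unfolding AB_prod using integral_lborel_prod[where f="?f"] integrable_FT by blast
  also have "\<dots> = (\<Prod>i\<in>(Basis::(real^'n) set). of_real (2 * pi) * (LINT t|lborel. ?g i t))"
    by (simp only: Parseval_interval)
  also have "\<dots> = of_real ((2 * pi) ^ CARD('n)) * (\<Prod>i\<in>(Basis::(real^'n) set). LINT t|lborel. ?g i t)"
    by (simp add: prod.distrib)
  also have "(\<Prod>i\<in>(Basis::(real^'n) set). LINT t|lborel. ?g i t) = (LINT x::real^'n|lborel. (\<Prod>i\<in>Basis. ?g i (x \<bullet> i)))"
    using integral_lborel_prod[where f="?g"] integrable_indicator by (metis (no_types, lifting))
  also have "\<dots> = (LINT x|lborel. indicator (cbox a b) x * indicator (cbox c d) x)"
    by (simp only: indicator_cbox_prod prod.distrib)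
  finally show "(LINT \<xi>|lborel. A \<xi> * cnj (B \<xi>)) = of_real ((2 * pi) ^ CARD('n)) * (LINT x|lborel. indicator (cbox a b) x * indicator (cbox c d) x)" .
qed

lemma square_integrable_fourier1_cbox: "square_integrable (fourier1 (indicator (cbox a b)))"
  unfolding square_integrable_def
proof
  show "fourier1 (indicator (cbox a b)) \<in> borel_measurable lborel" by measurable
  have "integrable lborel (\<lambda>\<xi>. Re (fourier1 (indicator (cbox a b)) \<xi> * cnj (fourier1 (indicator (cbox a b)) \<xi>)))"
    by (rule integrable_Re[OF integrable_Parseval_cbox])
  then show "integrable lborel (\<lambda>x. (cmod (fourier1 (indicator (cbox a b)) x))\<^sup>2)"
    by (simp only: complex_norm_square[symmetric] of_real_power[symmetric] Re_complex_of_real)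
qed

definition cbox_lsq :: "complex \<Rightarrow> 'a::euclidean_space \<Rightarrow> 'a \<Rightarrow> 'a lsq" where
  "cbox_lsq c a b = abs_lsq (\<lambda>x. c * indicator (cbox a b) x)"

lemma mult_op_cbox_lsq:
  assumes "m \<in> borel_measurable borel" "\<And>x. cmod (m x) \<le> C"
  shows "mult_op m (cbox_lsq 1 a b) = abs_lsq (\<lambda>x. m x * indicator (cbox a b) x)"
  unfolding cbox_lsq_def by (subst mult_op_abs_lsq[OF assms]) (auto intro: square_integrable_cbox)

lemma Int_stable_cbox: "Int_stable (range (\<lambda>(a,b). cbox a b :: 'a::euclidean_space set))"
  by (auto simp: Int_stable_def) (metis (mono_tags, lifting) Int_interval case_prod_conv rangeI)

lemma borel_eq_sigma_cbox: "(borel :: 'a::euclidean_space measure) = sigma UNIV (range (\<lambda>(a,b). cbox a b))"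
proof (rule borel_eq_sigmaI1[OF borel_def])
  fix S :: "'a set" assume "S \<in> {S. open S}"
  then obtain \<D> where "countable \<D>" "\<And>X. X \<in> \<D> \<Longrightarrow> \<exists>a b. X = cbox a b" "\<Union>\<D> = S"
    using open_countable_Union_open_cbox[of S] by (metis mem_Collect_eq)
  then show "S \<in> sets (sigma UNIV (range (\<lambda>(a,b). cbox a b)))"
    by (intro sets.countable_Union[of \<D>, unfolded \<open>\<Union>\<D> = S\<close>]) (auto intro!: sigma_sets.Basic)
qed auto

lemma mem_cbox_if_norm_le: "norm x \<le> r \<Longrightarrow> x \<in> cbox (- (r *\<^sub>R One)) (r *\<^sub>R One)"
  for x :: "'a::euclidean_space"
proof -
  assume "norm x \<le> r"
  then have "\<bar>x \<bullet> i\<bar> \<le> r" if "i \<in> Basis" for i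
    using Basis_le_norm[OF that, of x] by simp
  then show ?thesis by (auto simp: mem_box abs_le_iff) (metis minus_le_iff)
qed

lemma mult_op_add:
  assumes m: "m \<in> borel_measurable borel" "\<And>x. cmod (m x) \<le> C"
    and l: "l \<in> borel_measurable borel" "\<And>x. cmod (l x) \<le> D"
  shows "mult_op (\<lambda>x. m x + l x) U = mult_op m U + mult_op l U"
  unfolding mult_op_def distrib_right
  by (rule abs_lsq_add[OF square_integrable_mult_rep[OF m] square_integrable_mult_rep[OF l]])

lemma mult_op_sum:
  assumes "finite I" and m: "\<And>i. i \<in> I \<Longrightarrow> m i \<in> borel_measurable borel" "\<And>i x. i \<in> I \<Longrightarrow> cmod (m i x) \<le> C i"
  shows "mult_op (\<lambda>x. \<Sum>i\<in>I. m i x) U = (\<Sum>i\<in>I. mult_op (m i) U)"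
  using assms
proof (induction I rule: finite_induct)
  case empty
  then show ?case by (simp add: mult_op_zero)
next
  case (insert i I)
  have "mult_op (\<lambda>x. m i x + (\<Sum>j\<in>I. m j x)) U = mult_op (m i) U + mult_op (\<lambda>x. \<Sum>j\<in>I. m j x) U"
  proof (rule mult_op_add[where C="C i" and D="\<Sum>j\<in>I. C j"])
    show "cmod (\<Sum>j\<in>I. m j x) \<le> (\<Sum>j\<in>I. C j)" for x
      using insert.prems by (intro order_trans[OF norm_sum sum_mono]) auto
  qed (use insert.prems in auto)
  then show ?case using insert by simp
qed

definition box_closure :: "'a::euclidean_space lsq set" where
  "box_closure = closure (span (range (\<lambda>(c, a, b). cbox_lsq c a b)))"

lemma subspace_box_closure: "subspace box_closure"
  unfolding box_closure_def by (intro subspace_closure subspace_span)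

lemma box_closure_limit: "(\<And>n. F n \<in> box_closure) \<Longrightarrow> F \<longlonglongrightarrow> U \<Longrightarrow> U \<in> box_closure"
  unfolding box_closure_def using closed_closure closed_sequentially by blast

lemma cbox_lsq_in_box_closure: "cbox_lsq c a b \<in> box_closure"
  unfolding box_closure_def using closure_subset
  by (rule subsetD) (intro span_base image_eqI[where x="(c, a, b)"], auto)

lemma cmod_indicator_le: "cmod (c * indicator A x) \<le> cmod c"
  by (simp add: indicator_def)

lemma mult_op_indicator_Compl_cbox_lsq:
  assumes [measurable]: "A \<in> sets borel"
  shows "mult_op (\<lambda>x. c * indicator (UNIV - A) x) (cbox_lsq 1 a b)
    = cbox_lsq c a b - mult_op (\<lambda>x. c * indicator A x) (cbox_lsq 1 a b)"
proof -
  have "mult_op (\<lambda>x. c * indicator (UNIV - A) x + c * indicator A x) (cbox_lsq 1 a b)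
      = mult_op (\<lambda>x. c * indicator (UNIV - A) x) (cbox_lsq 1 a b) + mult_op (\<lambda>x. c * indicator A x) (cbox_lsq 1 a b)"
    by (rule mult_op_add[OF _ cmod_indicator_le _ cmod_indicator_le]) measurable
  moreover have "c * indicator (UNIV - A) x + c * indicator A x = c" for x by (simp add: indicator_def)
  moreover have "mult_op (\<lambda>_. c) (cbox_lsq 1 a b) = cbox_lsq c a b"
    by (subst mult_op_cbox_lsq[where C="cmod c"]) (auto simp: cbox_lsq_def)
  ultimately show ?thesis by (simp add: eq_diff_eq)
qed

lemma mult_op_indicator_in_box_closure:
  assumes "A \<in> sets borel"
  shows "mult_op (\<lambda>x. c * indicator A x) (cbox_lsq 1 a b) \<in> box_closure"
proof -
  let ?G = "range (\<lambda>(a,b). cbox a b :: 'a set)"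
  have "Int_stable ?G" "?G \<subseteq> Pow UNIV" "A \<in> sigma_sets UNIV ?G"
    using assms Int_stable_cbox by (auto simp: borel_eq_sigma_cbox)
  then show ?thesis
  proof (induction rule: sigma_sets_induct_disjoint)
    case (basic A)
    then obtain a' b' where A: "A = cbox a' b'" by auto
    obtain a'' b'' where inter: "cbox a' b' \<inter> cbox a b = cbox a'' b''" by (rule that) (rule Int_interval)
    have "mult_op (\<lambda>x. c * indicator A x) (cbox_lsq 1 a b) = cbox_lsq c a'' b''"
      unfolding cbox_lsq_def[of c] inter[symmetric] indicator_inter_arith mult.assoc[symmetric] A
      by (rule mult_op_cbox_lsq[OF _ cmod_indicator_le]) simp
    then show ?case by (simp add: cbox_lsq_in_box_closure)
  next
    case empty
    show ?case using subspace_0[OF subspace_box_closure] by (simp add: mult_op_zero)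
  next
    case (compl A)
    then have "A \<in> sets borel" by (simp add: borel_eq_sigma_cbox)
    then show ?case
      using subspace_diff[OF subspace_box_closure cbox_lsq_in_box_closure compl(2)]
      by (simp add: mult_op_indicator_Compl_cbox_lsq)
  next
    case (union A)
    then have [measurable]: "A i \<in> sets borel" for i by (auto simp: borel_eq_sigma_cbox)
    have partial: "c * indicator (\<Union>i<n. A i) x = (\<Sum>i<n. c * indicator (A i) x)" for n x
      using union(1) by (subst indicator_UN_disjoint) (auto simp: sum_distrib_left intro: disjoint_family_on_mono)
    have "mult_op (\<lambda>x. c * indicator (\<Union>i<n. A i) x) (cbox_lsq 1 a b) \<in> box_closure" for n
      unfolding partial
      by (subst mult_op_sum[where C="\<lambda>_. cmod c"]) (auto intro!: subspace_sum[OF subspace_box_closure] union cmod_indicator_le)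
    moreover have "(\<lambda>n. mult_op (\<lambda>x. c * indicator (\<Union>i<n. A i) x) (cbox_lsq 1 a b))
        \<longlonglongrightarrow> mult_op (\<lambda>x. c * indicator (\<Union>i. A i) x) (cbox_lsq 1 a b)"
      by (rule tendsto_mult_op[where C="cmod c"]) (auto intro!: cmod_indicator_le tendsto_mult LIMSEQ_indicator_UN)
    ultimately show ?case by (rule box_closure_limit)
  qed
qed

lemma mult_op_simple_in_box_closure:
  assumes s: "simple_function borel s"
  shows "mult_op s (cbox_lsq 1 a b) \<in> box_closure"
proof -
  have finite_range: "finite (range s)" using s by (simp add: simple_function_def)
  have level [measurable]: "s -` {y} \<in> sets borel" for y
    using measurable_sets[OF borel_measurable_simple_function[OF s], of "{y}"] by simp
  have "s x = (\<Sum>y\<in>range s. y * indicator (s -` {y}) x)" for x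
  proof -
    have "(\<Sum>y\<in>range s. y * indicator (s -` {y}) x) = (\<Sum>y\<in>range s. if y = s x then y else 0)"
      by (intro sum.cong) (auto simp: indicator_def)
    then show ?thesis using finite_range by simp
  qed
  then have "mult_op s (cbox_lsq 1 a b) = mult_op (\<lambda>x. \<Sum>y\<in>range s. y * indicator (s -` {y}) x) (cbox_lsq 1 a b)"
    by (rule arg_cong2[of _ _ _ _ mult_op, OF ext refl])
  also have "\<dots> = (\<Sum>y\<in>range s. mult_op (\<lambda>x. y * indicator (s -` {y}) x) (cbox_lsq 1 a b))"
    by (rule mult_op_sum[OF finite_range _ cmod_indicator_le]) measurable
  also have "\<dots> \<in> box_closure"
    by (intro subspace_sum[OF subspace_box_closure] mult_op_indicator_in_box_closure level)
  finally show ?thesis .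
qed

lemma mult_op_bounded_in_box_closure:
  assumes m: "m \<in> borel_measurable borel" "\<And>x. cmod (m x) \<le> C"
  shows "mult_op m (cbox_lsq 1 a b) \<in> box_closure"
proof -
  obtain F where F: "\<And>i. simple_function borel (F i)" "\<And>x. (\<lambda>i. F i x) \<longlonglongrightarrow> m x" "\<And>i x. cmod (F i x) \<le> 2 * cmod (m x)"
    using borel_measurable_implies_sequence_metric[OF m(1), of 0] by auto
  have "0 \<le> C" using order_trans[OF norm_ge_zero m(2)] .
  have "(\<lambda>i. mult_op (F i) (cbox_lsq 1 a b)) \<longlonglongrightarrow> mult_op m (cbox_lsq 1 a b)"
  proof (rule tendsto_mult_op[where C="2 * C"])
    show "F i \<in> borel_measurable borel" for i using F(1) by (rule borel_measurable_simple_function)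
    show "cmod (F i x) \<le> 2 * C" for i x using F(3)[of i x] m(2)[of x] by linarith
    show "cmod (m x) \<le> 2 * C" for x using m(2)[of x] \<open>0 \<le> C\<close> by linarith
  qed (use m F in auto)
  with mult_op_simple_in_box_closure[OF F(1)] show ?thesis by (rule box_closure_limit)
qed

lemma box_closure_eq_UNIV: "box_closure = UNIV"
proof (intro equalityI subset_UNIV subsetI)
  fix U :: "'a lsq"
  define K where "K n = cbox (- (real n *\<^sub>R One)) (real n *\<^sub>R One :: 'a)" for n
  define S where "S n = {x. cmod (rep_lsq U x) \<le> real n}" for n
  have [measurable]: "S n \<in> sets borel" "K n \<in> sets borel" for n
    unfolding S_def K_def by measurable
  let ?m = "\<lambda>n x. indicator (S n) x * rep_lsq U x"
  have m: "?m n \<in> borel_measurable borel" "cmod (?m n x) \<le> real n" for n x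
    by measurable (auto simp: S_def indicator_def)
  have "mult_op (indicator (S n \<inter> K n)) U = mult_op (?m n) (cbox_lsq 1 (- (real n *\<^sub>R One)) (real n *\<^sub>R One))" for n
    unfolding mult_op_cbox_lsq[OF m] unfolding mult_op_def indicator_inter_arith K_def by (simp only: mult_ac)
  then have "mult_op (indicator (S n \<inter> K n)) U \<in> box_closure" for n
    by (simp add: mult_op_bounded_in_box_closure[OF m])
  moreover have "(\<lambda>n. mult_op (indicator (S n \<inter> K n)) U) \<longlonglongrightarrow> mult_op (\<lambda>_. 1) U"
  proof (rule tendsto_mult_op[where C=1])
    fix x :: 'a
    obtain j :: nat where j: "max (norm x) (cmod (rep_lsq U x)) \<le> real j" using real_arch_simple by blast
    have "\<forall>\<^sub>F n in sequentially. indicator (S n \<inter> K n) x = (1::complex)"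
      using eventually_ge_at_top[of j]
      by eventually_elim (use j in \<open>auto simp: indicator_def S_def K_def intro!: mem_cbox_if_norm_le\<close>)
    then show "(\<lambda>n. indicator (S n \<inter> K n) x) \<longlonglongrightarrow> (1::complex)" by (rule tendsto_eventually)
  qed (auto simp: indicator_def)
  ultimately have "mult_op (\<lambda>_. 1) U \<in> box_closure" by (rule box_closure_limit)
  then show "U \<in> box_closure" by (simp only: mult_op_one)
qed

lemma pairing_cnj: "square_integrable f \<Longrightarrow> U \<bullet> abs_lsq f = Re (pairing (\<lambda>x. cnj (f x)) U)"
  by (cases U rule: lsq_cases) (simp add: inner_abs_lsq pairing_abs_lsq square_integrable_cnj mult.commute)

lemma inner_cbox_lsq: "U \<bullet> cbox_lsq c a b = Re (cnj c * pairing (indicator (cbox a b)) U)"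
proof -
  have "U \<bullet> cbox_lsq c a b = Re (LINT x|lborel. cnj c * (cnj (indicator (cbox a b) x) * rep_lsq U x))"
    unfolding cbox_lsq_def by (simp add: pairing_cnj square_integrable_cmult square_integrable_cbox pairing_def mult.assoc)
  moreover have "cnj (indicator (cbox a b) x) = indicator (cbox a b) x" for x :: 'a by (simp add: indicator_def)
  ultimately show ?thesis by (simp add: pairing_def)
qed

lemma lsq_eq_boxI:
  assumes pairing_cbox_eq: "\<And>a b. pairing (indicator (cbox a b)) U = pairing (indicator (cbox a b)) V" shows "U = V"
proof -
  have "box_closure \<subseteq> {Z. U \<bullet> Z = V \<bullet> Z}"
    unfolding box_closure_def
  proof (rule closure_minimal)
    show "span (range (\<lambda>(c, a, b). cbox_lsq c a b)) \<subseteq> {Z. U \<bullet> Z = V \<bullet> Z}"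
      by (rule span_minimal) (auto simp: inner_cbox_lsq pairing_cbox_eq subspace_def inner_add_right)
    show "closed {Z. U \<bullet> Z = V \<bullet> Z}" by (intro closed_Collect_eq continuous_intros)
  qed
  then show ?thesis unfolding box_closure_eq_UNIV by (intro vector_eq_ldot[THEN iffD1]) (auto simp: inner_commute)
qed

definition cbox_FT :: "complex \<Rightarrow> real^'n \<Rightarrow> real^'n \<Rightarrow> (real^'n) lsq" where
  "cbox_FT c a b = abs_lsq (\<lambda>x. c * fourier1 (indicator (cbox a b)) x)"

lemma inner_cbox_FT:
  fixes a b a' b' :: "real^'n"
  shows "cbox_FT c a b \<bullet> cbox_FT d a' b' = (2 * pi) ^ CARD('n) * (cbox_lsq c a b \<bullet> cbox_lsq d a' b')"
proof -
  have "cbox_FT c a b \<bullet> cbox_FT d a' b' =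
    Re (LINT x|lborel. c * cnj d * (fourier1 (indicator (cbox a b)) x * cnj (fourier1 (indicator (cbox a' b')) x)))"
    unfolding cbox_FT_def
    by (subst inner_abs_lsq) (auto intro!: square_integrable_cmult square_integrable_fourier1_cbox simp: mult_ac)
  also have "\<dots> = Re (of_real ((2 * pi) ^ CARD('n)) * (c * cnj d * (LINT x|lborel. indicator (cbox a b) x * indicator (cbox a' b') x)))"
    by (simp only: integral_mult_right_zero Parseval_cbox mult.left_commute)
  also have "\<dots> = (2 * pi) ^ CARD('n) * Re (c * cnj d * (LINT x|lborel. indicator (cbox a b) x * indicator (cbox a' b') x))"
    by (simp only: scaleR_conv_of_real[symmetric] scaleR_complex.simps)
  also have "c * cnj d * (LINT x|lborel. indicator (cbox a b) x * indicator (cbox a' b') x) =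
     (LINT x|lborel. (c * indicator (cbox a b) x) * cnj (d * indicator (cbox a' b') x))"
    unfolding integral_mult_right_zero[symmetric]
    by (intro Bochner_Integration.integral_cong) (auto simp: indicator_def)
  also have "Re \<dots> = cbox_lsq c a b \<bullet> cbox_lsq d a' b'"
    unfolding cbox_lsq_def by (subst inner_abs_lsq) (auto intro!: square_integrable_cmult square_integrable_cbox)
  finally show ?thesis .
qed

lemma integrable_mult_pair:
  fixes f :: "'a::euclidean_space \<Rightarrow> complex" and g :: "'b::euclidean_space \<Rightarrow> complex"
  assumes f: "integrable lborel f" and g: "integrable lborel g"
    and h [measurable]: "h \<in> borel_measurable (lborel \<Otimes>\<^sub>M lborel)" and "\<And>p. cmod (h p) \<le> C"
  shows "integrable (lborel \<Otimes>\<^sub>M lborel) (\<lambda>p. f (fst p) * g (snd p) * h p)"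
proof -
  have [measurable]: "f \<in> borel_measurable lborel" "g \<in> borel_measurable lborel"
    using f g by auto
  have "integrable (lborel \<Otimes>\<^sub>M lborel) (\<lambda>p. f (fst p) * g (snd p))"
  proof (rule lborel_pair.Fubini_integrable)
    show "integrable lborel (\<lambda>x. LINT y|lborel. norm (f (fst (x, y)) * g (snd (x, y))))"
      using f by (simp add: norm_mult)
  qed (use g in auto)
  then have "integrable (lborel \<Otimes>\<^sub>M lborel) (\<lambda>p. C * cmod (f (fst p) * g (snd p)))"
    by (intro integrable_mult_right integrable_norm)
  then show ?thesis
  proof (rule Bochner_Integration.integrable_bound)
    have C: "0 \<le> C" using order_trans[OF norm_ge_zero assms(4)] .
    show "AE p in lborel \<Otimes>\<^sub>M lborel. norm (f (fst p) * g (snd p) * h p) \<le> norm (C * cmod (f (fst p) * g (snd p)))"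
    proof (intro AE_I2)
      fix p :: "'a \<times> 'b"
      have "cmod (f (fst p) * g (snd p)) * cmod (h p) \<le> cmod (f (fst p) * g (snd p)) * C"
        by (intro mult_left_mono assms) simp
      then show "norm (f (fst p) * g (snd p) * h p) \<le> norm (C * cmod (f (fst p) * g (snd p)))"
        using C by (simp add: norm_mult mult_ac)
    qed
  qed measurable
qed

lemma fourier1_duality:
  fixes f g :: "real^'n \<Rightarrow> complex"
  assumes "integrable lborel f" "integrable lborel g"
  shows "(LINT \<xi>|lborel. fourier1 f \<xi> * g \<xi>) = (LINT x|lborel. f x * fourier1 g x)"
proof -
  have int: "integrable (lborel \<Otimes>\<^sub>M lborel) (\<lambda>(x, \<xi>). f x * g \<xi> * cis (- (x \<bullet> \<xi>)))"
    using integrable_mult_pair[OF assms, of "\<lambda>(x, \<xi>). cis (- (x \<bullet> \<xi>))" 1]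
    by (simp add: split_def)
  have "(LINT \<xi>|lborel. fourier1 f \<xi> * g \<xi>) = (LINT \<xi>|lborel. LINT x|lborel. f x * g \<xi> * cis (- (x \<bullet> \<xi>)))"
    unfolding fourier1_def integral_mult_left_zero[symmetric] by (simp add: mult_ac)
  also have "\<dots> = (LINT x|lborel. LINT \<xi>|lborel. f x * g \<xi> * cis (- (x \<bullet> \<xi>)))"
    by (rule lborel_pair.Fubini_integral[OF int])
  also have "\<dots> = (LINT x|lborel. f x * fourier1 g x)"
    unfolding fourier1_def integral_mult_right_zero[symmetric]
    by (simp add: mult_ac inner_commute)
  finally show ?thesis .
qed

definition fourier_graph :: "((real^'n) lsq \<times> (real^'n) lsq) set" where
  "fourier_graph = closure (span (range (\<lambda>(c, a, b). (cbox_lsq c a b, cbox_FT c a b))))"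

lemma subspace_fourier_graph: "subspace fourier_graph"
  unfolding fourier_graph_def by (intro subspace_closure subspace_span)

lemma closed_fourier_graph: "closed fourier_graph"
  unfolding fourier_graph_def by simp

lemma cbox_in_fourier_graph: "(cbox_lsq c a b, cbox_FT c a b) \<in> fourier_graph"
  unfolding fourier_graph_def using closure_subset
  by (rule subsetD) (intro span_base image_eqI[where x="(c, a, b)"], auto)

lemma fourier_graph_induct:
  assumes "p \<in> fourier_graph" "closed {p. P p}" "subspace {p. P p}"
    "\<And>c a b. P (cbox_lsq c a b, cbox_FT c a b)"
  shows "P p"
proof -
  have "span (range (\<lambda>(c, a, b). (cbox_lsq c a b, cbox_FT c a b))) \<subseteq> {p. P p}"
    using assms(3,4) by (intro span_minimal) auto
  then have "fourier_graph \<subseteq> {p. P p}"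
    unfolding fourier_graph_def using assms(2) by (rule closure_minimal)
  then show ?thesis using assms(1) by auto
qed

lemma fourier_graph_inner:
  fixes p q :: "(real^'n) lsq \<times> (real^'n) lsq"
  assumes "p \<in> fourier_graph" "q \<in> fourier_graph"
  shows "snd p \<bullet> snd q = (2 * pi) ^ CARD('n) * (fst p \<bullet> fst q)"
proof -
  have inner_cbox: "snd p \<bullet> cbox_FT c a b = (2 * pi) ^ CARD('n) * (fst p \<bullet> cbox_lsq c a b)" for c and a b :: "real^'n"
    using assms(1)
  proof (rule fourier_graph_induct)
    show "closed {p. snd p \<bullet> cbox_FT c a b = (2 * pi) ^ CARD('n) * (fst p \<bullet> cbox_lsq c a b)}"
      by (intro closed_Collect_eq continuous_intros)
  qed (auto simp: subspace_def inner_add_left inner_cbox_FT algebra_simps)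
  show ?thesis using assms(2)
  proof (rule fourier_graph_induct)
    show "closed {q. snd p \<bullet> snd q = (2 * pi) ^ CARD('n) * (fst p \<bullet> fst q)}"
      by (intro closed_Collect_eq continuous_intros)
  qed (auto simp: subspace_def inner_add_right inner_cbox algebra_simps)
qed

lemma fourier_graph_norm:
  fixes p :: "(real^'n) lsq \<times> (real^'n) lsq"
  assumes "p \<in> fourier_graph"
  shows "norm (snd p) = sqrt ((2 * pi) ^ CARD('n)) * norm (fst p)"
  using fourier_graph_inner[OF assms assms] by (simp add: norm_eq_sqrt_inner real_sqrt_mult)

lemma fourier_graph_total: "\<exists>V. (U, V) \<in> fourier_graph" for U :: "(real^'n) lsq"
proof -
  let ?c = "sqrt ((2 * pi) ^ CARD('n))"
  have "closed (fst ` (fourier_graph :: ((real^'n) lsq \<times> (real^'n) lsq) set))"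
  proof (rule complete_imp_closed, rule complete_isometric_image[where e="1 / (1 + ?c)"])
    show "\<forall>p\<in>fourier_graph. norm (fst p) \<ge> 1 / (1 + ?c) * norm (p :: (real^'n) lsq \<times> (real^'n) lsq)"
    proof
      fix p :: "(real^'n) lsq \<times> (real^'n) lsq" assume "p \<in> fourier_graph"
      then have "norm p \<le> (1 + ?c) * norm (fst p)"
        using norm_Pair_le[of "fst p" "snd p"] by (simp add: fourier_graph_norm distrib_right)
      moreover have "1 + ?c > 0" by (simp add: add_pos_nonneg)
      ultimately show "norm (fst p) \<ge> 1 / (1 + ?c) * norm p" by (simp add: divide_le_eq mult.commute)
    qed
  qed (auto simp: subspace_fourier_graph closed_fourier_graph complete_eq_closed bounded_linear_fst add_pos_nonneg)
  moreover have "span (range (\<lambda>(c, a, b). cbox_lsq c a b)) \<subseteq> fst ` (fourier_graph :: ((real^'n) lsq \<times> (real^'n) lsq) set)"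
  proof (rule span_minimal)
    show "range (\<lambda>(c, a, b). cbox_lsq c a b) \<subseteq> fst ` (fourier_graph :: ((real^'n) lsq \<times> (real^'n) lsq) set)"
      using imageI[OF cbox_in_fourier_graph, of fst] by auto
  qed (rule linear_subspace_image[OF linear_fst subspace_fourier_graph])
  ultimately have "box_closure \<subseteq> fst ` (fourier_graph :: ((real^'n) lsq \<times> (real^'n) lsq) set)"
    unfolding box_closure_def by (rule closure_minimal[rotated])
  then show ?thesis unfolding box_closure_eq_UNIV by force
qed

lemma fourier_graph_unique:
  assumes "(U, V) \<in> fourier_graph" "(U, V') \<in> fourier_graph" shows "V = V'"
  using fourier_graph_norm[OF subspace_diff[OF subspace_fourier_graph assms]] by simp

definition fourier_lsq :: "(real^'n) lsq \<Rightarrow> (real^'n) lsq" where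
  "fourier_lsq U = (THE V. (U, V) \<in> fourier_graph)"

lemma fourier_lsq_graph: "(U, fourier_lsq U) \<in> fourier_graph"
proof -
  obtain V where V: "(U, V) \<in> fourier_graph" using fourier_graph_total[of U] ..
  then show ?thesis unfolding fourier_lsq_def by (rule theI) (rule fourier_graph_unique[OF _ V])
qed

lemma fourier_lsq_eqI: "(U, V) \<in> fourier_graph \<Longrightarrow> fourier_lsq U = V"
  using fourier_graph_unique fourier_lsq_graph by blast

lemma fourier_lsq_add: "fourier_lsq (U + V) = fourier_lsq U + fourier_lsq V"
  using subspace_add[OF subspace_fourier_graph fourier_lsq_graph[of U] fourier_lsq_graph[of V]] by (intro fourier_lsq_eqI) simp

lemma fourier_lsq_scaleR: "fourier_lsq (c *\<^sub>R U) = c *\<^sub>R fourier_lsq U"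
  using subspace_scale[OF subspace_fourier_graph fourier_lsq_graph[of U], of c] by (intro fourier_lsq_eqI) simp

lemma fourier_lsq_inner: "fourier_lsq U \<bullet> fourier_lsq V = (2 * pi) ^ CARD('n) * (U \<bullet> V)" for U V :: "(real^'n) lsq"
  using fourier_graph_inner[OF fourier_lsq_graph[of U] fourier_lsq_graph[of V]] by simp

lemma norm_fourier_lsq: "norm (fourier_lsq U) = sqrt ((2 * pi) ^ CARD('n)) * norm U" for U :: "(real^'n) lsq"
  using fourier_graph_norm[OF fourier_lsq_graph[of U]] by simp

lemma bounded_linear_fourier_lsq: "bounded_linear (fourier_lsq :: (real^'n) lsq \<Rightarrow> _)"
  by (rule bounded_linear_intro[where K="sqrt ((2 * pi) ^ CARD('n))"])
     (simp_all add: fourier_lsq_add fourier_lsq_scaleR norm_fourier_lsq mult.commute)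

lemma fourier_lsq_box_duality:
  "pairing (indicator (cbox a b)) (fourier_lsq U) = pairing (fourier1 (indicator (cbox a b))) U"
proof -
  interpret l1: bounded_linear "pairing (indicator (cbox a b))" by (rule bounded_linear_pairing[OF square_integrable_cbox])
  interpret l2: bounded_linear "pairing (fourier1 (indicator (cbox a b)))" by (rule bounded_linear_pairing[OF square_integrable_fourier1_cbox])
  have "pairing (indicator (cbox a b)) (snd (U, fourier_lsq U)) = pairing (fourier1 (indicator (cbox a b))) (fst (U, fourier_lsq U))"
    using fourier_lsq_graph
  proof (rule fourier_graph_induct)
    show "closed {p. pairing (indicator (cbox a b)) (snd p) = pairing (fourier1 (indicator (cbox a b))) (fst p)}"
      by (intro closed_Collect_eq l1.continuous_on l2.continuous_on continuous_intros)
    show "pairing (indicator (cbox a b)) (snd (cbox_lsq c a' b', cbox_FT c a' b')) =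
       pairing (fourier1 (indicator (cbox a b))) (fst (cbox_lsq c a' b', cbox_FT c a' b'))" for c a' b'
    proof -
      have "(LINT x|lborel. indicator (cbox a b) x * (c * fourier1 (indicator (cbox a' b')) x)) =
            c * (LINT x|lborel. fourier1 (indicator (cbox a' b')) x * indicator (cbox a b) x)"
        unfolding integral_mult_right_zero[symmetric] by (simp add: mult_ac)
      also have "\<dots> = c * (LINT x|lborel. indicator (cbox a' b') x * fourier1 (indicator (cbox a b)) x)"
        by (simp only: fourier1_duality[OF integrable_cbox integrable_cbox])
      also have "\<dots> = (LINT x|lborel. fourier1 (indicator (cbox a b)) x * (c * indicator (cbox a' b') x))"
        unfolding integral_mult_right_zero[symmetric] by (simp add: mult_ac)
      finally show ?thesis
        unfolding cbox_lsq_def cbox_FT_def fst_conv snd_conv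
        by (subst (1 2) pairing_abs_lsq) (auto intro!: square_integrable_cmult square_integrable_cbox square_integrable_fourier1_cbox)
    qed
  qed (auto simp: subspace_def l1.add l2.add l1.scaleR l2.scaleR l1.zero l2.zero)
  then show ?thesis by simp
qed

lemma is_fourier_L2_iff:
  "is_fourier_L2 f g \<longleftrightarrow> square_integrable f \<and> square_integrable g \<and> abs_lsq g = fourier_lsq (abs_lsq f)"
proof (cases "square_integrable f \<and> square_integrable g")
  case True
  have "(LINT \<xi>|lborel. g \<xi> * indicator (cbox a b) \<xi>) = pairing (indicator (cbox a b)) (abs_lsq g)" for a b
    using True by (subst pairing_abs_lsq[OF square_integrable_cbox]) (simp_all only: mult.commute)
  moreover have "(LINT x|lborel. f x * fourier1 (indicator (cbox a b)) x) = pairing (indicator (cbox a b)) (fourier_lsq (abs_lsq f))" for a b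
    unfolding fourier_lsq_box_duality using True
    by (subst pairing_abs_lsq[OF square_integrable_fourier1_cbox]) (simp_all only: mult.commute)
  ultimately show ?thesis
    unfolding is_fourier_L2_def L2_eq_square_integrable using True by (metis lsq_eq_boxI)
qed (auto simp: is_fourier_L2_def L2_eq_square_integrable)

lift_definition cnj_lsq :: "'a::euclidean_space lsq \<Rightarrow> 'a lsq" is "\<lambda>f x. cnj (f x)"
  by (auto intro: square_integrable_cnj)

lemma cnj_abs_lsq: "square_integrable f \<Longrightarrow> cnj_lsq (abs_lsq f) = abs_lsq (\<lambda>x. cnj (f x))"
  by (simp add: cnj_lsq.abs_eq)

lemma rep_cnj_lsq: "AE x in lborel. rep_lsq (cnj_lsq U) x = cnj (rep_lsq U x)"
  using rep_abs_lsq[OF square_integrable_cnj[OF square_integrable_rep[of U]]]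
  by (simp add: abs_rep_lsq square_integrable_rep flip: cnj_abs_lsq)

lemma cnj_lsq_cnj_lsq [simp]: "cnj_lsq (cnj_lsq U) = U"
  by transfer (simp add: square_integrable_cnj)

lemma inner_cnj_lsq: "cnj_lsq U \<bullet> V = U \<bullet> cnj_lsq V"
proof transfer
  fix f g :: "'a \<Rightarrow> complex"
  show "Re (LINT x|lborel. cnj (f x) * cnj (g x)) = Re (LINT x|lborel. f x * cnj (cnj (g x)))"
    unfolding complex_cnj_mult[symmetric] Bochner_Integration.integral_cnj by simp
qed

lemma norm_cnj_lsq [simp]: "norm (cnj_lsq U) = norm U"
  unfolding norm_eq_sqrt_inner inner_cnj_lsq cnj_lsq_cnj_lsq ..

lemma cnj_lsq_add: "cnj_lsq (U + V) = cnj_lsq U + cnj_lsq V"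
  by transfer (simp add: square_integrable_add square_integrable_cnj)

lemma cnj_lsq_scaleR: "cnj_lsq (c *\<^sub>R U) = c *\<^sub>R cnj_lsq U"
  by transfer (simp add: square_integrable_cmult square_integrable_cnj)

lemma bounded_linear_cnj_lsq: "bounded_linear cnj_lsq"
  by (rule bounded_linear_intro[where K=1]) (simp_all add: cnj_lsq_add cnj_lsq_scaleR)

lemma cnj_cbox_lsq: "cnj_lsq (cbox_lsq c a b) = cbox_lsq (cnj c) a b"
proof -
  have "cnj (indicator (cbox a b) x) = indicator (cbox a b) x" for x by (simp add: indicator_def)
  then show ?thesis
    unfolding cbox_lsq_def by (simp add: cnj_abs_lsq square_integrable_cmult square_integrable_cbox)
qed

lemma inner_cnj_cbox_FT: "U \<bullet> cnj_lsq (cbox_FT c a b) = Re (c * pairing (fourier1 (indicator (cbox a b))) U)"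
proof -
  have FT: "square_integrable (\<lambda>x. c * fourier1 (indicator (cbox a b)) x)"
    by (intro square_integrable_cmult square_integrable_fourier1_cbox)
  show ?thesis
    unfolding cbox_FT_def cnj_abs_lsq[OF FT] pairing_cnj[OF square_integrable_cnj[OF FT]]
    by (simp only: pairing_def complex_cnj_cnj mult.assoc integral_mult_right_zero)
qed

lemma fourier_lsq_selfadjoint: "fourier_lsq U \<bullet> cnj_lsq V = U \<bullet> cnj_lsq (fourier_lsq V)"
proof -
  interpret cnj: bounded_linear cnj_lsq by (rule bounded_linear_cnj_lsq)
  have "fourier_lsq U \<bullet> cnj_lsq (fst (V, fourier_lsq V)) = U \<bullet> cnj_lsq (snd (V, fourier_lsq V))"
    using fourier_lsq_graph
  proof (rule fourier_graph_induct)
    show "closed {p. fourier_lsq U \<bullet> cnj_lsq (fst p) = U \<bullet> cnj_lsq (snd p)}"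
      by (intro closed_Collect_eq continuous_intros cnj.continuous_on)
    show "fourier_lsq U \<bullet> cnj_lsq (fst (cbox_lsq c a b, cbox_FT c a b)) = U \<bullet> cnj_lsq (snd (cbox_lsq c a b, cbox_FT c a b))" for c a b
      by (simp add: cnj_cbox_lsq inner_cbox_lsq fourier_lsq_box_duality inner_cnj_cbox_FT)
  qed (auto simp: subspace_def cnj.add cnj.scaleR cnj.zero inner_add_right)
  then show ?thesis by simp
qed

definition inv_fourier_lsq :: "(real^'n) lsq \<Rightarrow> (real^'n) lsq" where
  "inv_fourier_lsq V = (1 / (2 * pi) ^ CARD('n)) *\<^sub>R cnj_lsq (fourier_lsq (cnj_lsq V))"

lemma inv_fourier_lsq_fourier_lsq: "inv_fourier_lsq (fourier_lsq U) = U" for U :: "(real^'n) lsq"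
proof -
  have "V \<bullet> cnj_lsq (fourier_lsq (cnj_lsq (fourier_lsq U))) = V \<bullet> ((2 * pi) ^ CARD('n) *\<^sub>R U)" for V
    using fourier_lsq_selfadjoint[of V "cnj_lsq (fourier_lsq U)"] fourier_lsq_inner[of V U] by simp
  then have "cnj_lsq (fourier_lsq (cnj_lsq (fourier_lsq U))) = (2 * pi) ^ CARD('n) *\<^sub>R U"
    using vector_eq_ldot by blast
  then show ?thesis by (simp add: inv_fourier_lsq_def)
qed

lemma fourier_lsq_inv_fourier_lsq: "fourier_lsq (inv_fourier_lsq V) = V" for V :: "(real^'n) lsq"
proof -
  have "fourier_lsq (cnj_lsq (fourier_lsq (cnj_lsq V))) = cnj_lsq (cnj_lsq (fourier_lsq (cnj_lsq (fourier_lsq (cnj_lsq V)))))" by simp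
  also have "cnj_lsq (fourier_lsq (cnj_lsq (fourier_lsq (cnj_lsq V)))) = (2 * pi) ^ CARD('n) *\<^sub>R inv_fourier_lsq (fourier_lsq (cnj_lsq V))"
    unfolding inv_fourier_lsq_def by simp
  also have "cnj_lsq \<dots> = (2 * pi) ^ CARD('n) *\<^sub>R V"
    by (simp add: inv_fourier_lsq_fourier_lsq cnj_lsq_scaleR)
  finally show ?thesis by (simp add: inv_fourier_lsq_def fourier_lsq_scaleR)
qed

lemma bounded_linear_inv_fourier_lsq: "bounded_linear (inv_fourier_lsq :: (real^'n) lsq \<Rightarrow> _)"
  unfolding inv_fourier_lsq_def
  by (intro bounded_linear_scaleR_right bounded_linear_compose[OF bounded_linear_scaleR_right]
      bounded_linear_compose[OF bounded_linear_cnj_lsq] bounded_linear_compose[OF bounded_linear_fourier_lsq] bounded_linear_ident)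

lemma square_integrable_FT_abs:
  assumes "square_integrable f" shows "square_integrable (FT f)" "abs_lsq (FT f) = fourier_lsq (abs_lsq f)"
proof -
  have "is_fourier_L2 f (rep_lsq (fourier_lsq (abs_lsq f)))"
    by (simp add: is_fourier_L2_iff assms square_integrable_rep abs_rep_lsq)
  then have "is_fourier_L2 f (FT f)" unfolding FT_def by (rule someI[of "is_fourier_L2 f"])
  then show "square_integrable (FT f)" "abs_lsq (FT f) = fourier_lsq (abs_lsq f)" by (simp_all add: is_fourier_L2_iff)
qed

lemma FT_AE: "square_integrable f \<Longrightarrow> AE x in lborel. FT f x = rep_lsq (fourier_lsq (abs_lsq f)) x"
  using rep_abs_lsq[OF square_integrable_FT_abs(1), of f] square_integrable_FT_abs(2)[of f] by auto

lemma SOME_is_fourier_L2: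
  assumes "square_integrable g"
  shows "square_integrable (SOME h. is_fourier_L2 h g)" "abs_lsq (SOME h. is_fourier_L2 h g) = inv_fourier_lsq (abs_lsq g)"
proof -
  let ?h = "SOME h. is_fourier_L2 h g"
  have "is_fourier_L2 (rep_lsq (inv_fourier_lsq (abs_lsq g))) g"
    by (simp add: is_fourier_L2_iff assms square_integrable_rep abs_rep_lsq fourier_lsq_inv_fourier_lsq)
  then have "is_fourier_L2 ?h g" by (rule someI[of "\<lambda>h. is_fourier_L2 h g"])
  from is_fourier_L2_iff[THEN iffD1, OF this]
  have h: "square_integrable ?h" "abs_lsq g = fourier_lsq (abs_lsq ?h)" by blast+
  show "square_integrable ?h" by (rule h)
  show "abs_lsq ?h = inv_fourier_lsq (abs_lsq g)" unfolding h(2) by (rule inv_fourier_lsq_fourier_lsq[symmetric])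
qed

lemma norm_fourier1_le: "cmod (fourier1 f \<xi>) \<le> (LINT x|lborel. cmod (f x))"
proof -
  have "cmod (fourier1 f \<xi>) \<le> (LINT x|lborel. cmod (f x * cis (- (x \<bullet> \<xi>))))"
    unfolding fourier1_def by (rule integral_norm_bound)
  then show ?thesis by (simp add: norm_mult)
qed

lemma fourier_lsq_eq_fourier1_on_cbox:
  fixes f :: "real^'n \<Rightarrow> complex"
  assumes int: "integrable lborel f" and f: "square_integrable f"
  shows "AE x in lborel. x \<in> cbox u v \<longrightarrow> rep_lsq (fourier_lsq (abs_lsq f)) x = fourier1 f x"
proof -
  let ?F = "fourier_lsq (abs_lsq f)"
  let ?L2 = "\<lambda>x. indicator (cbox u v) x * rep_lsq ?F x" and ?L1 = "\<lambda>x. fourier1 f x * indicator (cbox u v) x"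
  have [measurable]: "f \<in> borel_measurable borel" using f by (rule square_integrable_measurable_borel)
  have L2: "square_integrable ?L2"
    by (rule square_integrable_mult_bounded[OF square_integrable_rep, where C=1]) (auto simp: indicator_def)
  have L1: "square_integrable ?L1"
    by (rule square_integrable_mult_bounded[OF square_integrable_cbox _ norm_fourier1_le]) measurable
  have "abs_lsq ?L2 = abs_lsq ?L1"
  proof (rule lsq_eq_boxI)
    fix a b :: "real^'n"
    obtain c d where "cbox a b \<inter> cbox u v = cbox c d" by (rule that) (rule Int_interval)
    then have inter: "indicator (cbox a b) x * indicator (cbox u v) x = (indicator (cbox c d) x :: complex)" for x
      by (simp flip: indicator_inter_arith)
    have "pairing (indicator (cbox a b)) (abs_lsq ?L2) = (LINT x|lborel. indicator (cbox c d) x * rep_lsq ?F x)"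
      unfolding pairing_abs_lsq[OF square_integrable_cbox L2] by (simp add: inter flip: mult.assoc)
    also have "\<dots> = pairing (indicator (cbox c d)) ?F" by (simp add: pairing_def)
    also have "\<dots> = (LINT x|lborel. fourier1 (indicator (cbox c d)) x * f x)"
      unfolding fourier_lsq_box_duality by (rule pairing_abs_lsq[OF square_integrable_fourier1_cbox f])
    also have "\<dots> = (LINT x|lborel. indicator (cbox c d) x * fourier1 f x)"
      by (rule fourier1_duality[OF integrable_cbox int])
    also have "\<dots> = (LINT x|lborel. indicator (cbox a b) x * ?L1 x)"
      by (intro Bochner_Integration.integral_cong refl) (simp add: mult_ac flip: inter)
    also have "\<dots> = pairing (indicator (cbox a b)) (abs_lsq ?L1)"
      by (rule pairing_abs_lsq[OF square_integrable_cbox L1, symmetric])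
    finally show "pairing (indicator (cbox a b)) (abs_lsq ?L2) = pairing (indicator (cbox a b)) (abs_lsq ?L1)" .
  qed
  then have "AE x in lborel. ?L2 x = ?L1 x"
    using rep_abs_lsq[OF L2] rep_abs_lsq[OF L1] by auto
  then show ?thesis by eventually_elim (simp add: indicator_def split: if_splits)
qed

lemma fourier_lsq_eq_fourier1:
  fixes f :: "real^'n \<Rightarrow> complex"
  assumes "integrable lborel f" "square_integrable f"
  shows "AE x in lborel. rep_lsq (fourier_lsq (abs_lsq f)) x = fourier1 f x"
proof -
  have "AE x in lborel. \<forall>n::nat. x \<in> cbox (- (real n *\<^sub>R One)) (real n *\<^sub>R One) \<longrightarrow> rep_lsq (fourier_lsq (abs_lsq f)) x = fourier1 f x"
    unfolding AE_all_countable using fourier_lsq_eq_fourier1_on_cbox[OF assms] by (intro allI)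
  then show ?thesis
  proof eventually_elim
    case (elim x)
    obtain n :: nat where "norm x \<le> real n" using real_arch_simple by blast
    from elim mem_cbox_if_norm_le[OF this] show ?case by blast
  qed
qed

lemma cnj_fourier1: "cnj (fourier1 (\<lambda>x. cnj (g x)) x) = fourier1 g (- x)"
  unfolding fourier1_def Bochner_Integration.integral_cnj[symmetric]
  by (simp add: cis_cnj)

lemma inv_fourier_lsq_eq_fourier1:
  fixes g :: "real^'n \<Rightarrow> complex"
  assumes "integrable lborel g" "square_integrable g"
  shows "AE x in lborel. rep_lsq (inv_fourier_lsq (abs_lsq g)) x = of_real (1 / (2 * pi) ^ CARD('n)) * fourier1 g (- x)"
proof -
  have "integrable lborel (\<lambda>x. cnj (g x))" "square_integrable (\<lambda>x. cnj (g x))"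
    using assms by (auto intro: square_integrable_cnj)
  from fourier_lsq_eq_fourier1[OF this] show ?thesis
    unfolding inv_fourier_lsq_def cnj_abs_lsq[OF assms(2)]
    using rep_cnj_lsq[of "fourier_lsq (abs_lsq (\<lambda>x. cnj (g x)))"]
      rep_scaleR[of "1 / (2 * pi) ^ CARD('n)" "cnj_lsq (fourier_lsq (abs_lsq (\<lambda>x. cnj (g x))))"]
    by eventually_elim (simp only: cnj_fourier1)
qed

lemma fourier1_cong_AE:
  assumes [measurable]: "f \<in> borel_measurable borel" "g \<in> borel_measurable borel"
    and AE_eq: "AE x in lborel. f x = g x"
  shows "fourier1 f \<xi> = fourier1 g \<xi>"
  unfolding fourier1_def
proof (rule integral_cong_AE)
  show "AE x in lborel. f x * cis (- (x \<bullet> \<xi>)) = g x * cis (- (x \<bullet> \<xi>))"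
    using AE_eq by eventually_elim simp
qed measurable

lemma integrable_mult_cis:
  fixes f :: "'a::euclidean_space \<Rightarrow> complex"
  assumes int: "integrable lborel f" and [measurable]: "g \<in> borel_measurable borel"
  shows "integrable lborel (\<lambda>x. f x * cis (g x))"
proof (rule Bochner_Integration.integrable_bound[OF int])
  have [measurable]: "f \<in> borel_measurable borel" using borel_measurable_integrable[OF int] by simp
  show "(\<lambda>x. f x * cis (g x)) \<in> borel_measurable lborel" by measurable
qed (auto simp: norm_mult)

lemma fourier1_add:
  assumes "integrable lborel f" "integrable lborel g"
  shows "fourier1 (\<lambda>x. f x + g x) \<xi> = fourier1 f \<xi> + fourier1 g \<xi>"
  unfolding fourier1_def distrib_right
  by (rule Bochner_Integration.integral_add) (intro integrable_mult_cis assms, measurable)+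

lemma fourier1_cmult: "fourier1 (\<lambda>x. c * f x) \<xi> = c * fourier1 f \<xi>"
  unfolding fourier1_def mult.assoc by (rule integral_mult_right_zero)

section \<open>Convolutions and weights\<close>

lemma distr_lborel_reflect: "distr lborel borel (\<lambda>x::'a::euclidean_space. t - x) = lborel"
  using lborel_affine[of "-1" t] by (simp add: density_1)

lemma distr_lborel_translate: "distr lborel borel (\<lambda>x::'a::euclidean_space. x - t) = lborel"
  using lborel_affine[of "1" "- t"] by (simp add: density_1 add.commute)

lemma nn_integral_reflect:
  assumes "f \<in> borel_measurable borel"
  shows "(\<integral>\<^sup>+x. f (t - x) \<partial>lborel) = (\<integral>\<^sup>+(x::'a::euclidean_space). f x \<partial>lborel)"
  by (subst (2) distr_lborel_reflect[of t, symmetric]) (simp add: nn_integral_distr assms)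

lemma nn_integral_translate:
  assumes "f \<in> borel_measurable borel"
  shows "(\<integral>\<^sup>+x. f (x - t) \<partial>lborel) = (\<integral>\<^sup>+(x::'a::euclidean_space). f x \<partial>lborel)"
  by (subst (2) distr_lborel_translate[of t, symmetric]) (simp add: nn_integral_distr assms)

lemma integral_translate:
  fixes f :: "'a::euclidean_space \<Rightarrow> 'b::{banach, second_countable_topology}"
  assumes "f \<in> borel_measurable borel"
  shows "(LINT x|lborel. f (x - t)) = (LINT x|lborel. f x)"
  by (subst (2) distr_lborel_translate[of t, symmetric]) (simp add: integral_distr assms)

lemma integral_reflect:
  fixes f :: "'a::euclidean_space \<Rightarrow> 'b::{banach, second_countable_topology}"
  assumes "f \<in> borel_measurable borel"
  shows "(LINT x|lborel. f (t - x)) = (LINT x|lborel. f x)"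
  by (subst (2) distr_lborel_reflect[of t, symmetric]) (simp add: integral_distr assms)

definition bessel_weight :: "real \<Rightarrow> 'a::euclidean_space \<Rightarrow> real" where
  "bessel_weight s \<xi> = (1 + (norm \<xi>)\<^sup>2) powr (s / 2)"

lemma bessel_weight_pos: "bessel_weight s \<xi> > 0"
proof -
  have "1 + (norm \<xi>)\<^sup>2 > 0" by (simp add: add_pos_nonneg)
  then show ?thesis by (simp add: bessel_weight_def)
qed

lemma bessel_weight_nonneg [simp]: "bessel_weight s \<xi> \<ge> 0" using bessel_weight_pos[of s \<xi>] by simp

lemma bessel_weight_measurable [measurable]: "bessel_weight s \<in> borel_measurable borel"
  unfolding bessel_weight_def[abs_def] by measurable

lemma bessel_weight_mult_inverse [simp]: "bessel_weight s \<xi> * bessel_weight (- s) \<xi> = 1"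
proof -
  have "1 + (norm \<xi>)\<^sup>2 \<noteq> 0" by (metis add_pos_nonneg less_irrefl zero_le_power2 zero_less_one)
  then show ?thesis by (simp add: bessel_weight_def flip: powr_add)
qed

lemma bessel_weight_cancel [simp]:
  "of_real (bessel_weight s \<xi>) * (of_real (bessel_weight (- s) \<xi>) * z) = (z::complex)"
  "of_real (bessel_weight (- s) \<xi>) * (of_real (bessel_weight s \<xi>) * z) = (z::complex)"
  using bessel_weight_mult_inverse[of s \<xi>]
  by (simp_all only: mult.assoc[symmetric] of_real_mult[symmetric] mult.commute[of "bessel_weight (- s) \<xi>"]) simp_all

lemma bessel_weight_sq: "(bessel_weight s \<xi>)\<^sup>2 = (1 + (norm \<xi>)\<^sup>2) powr s"
  by (simp add: bessel_weight_def power2_eq_square flip: powr_add)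

lemma bessel_weight_neg_le_1: "0 \<le> s \<Longrightarrow> bessel_weight (- s) \<xi> \<le> 1"
  unfolding bessel_weight_def using powr_mono[of "- s / 2" 0 "1 + (norm \<xi>)\<^sup>2"] by (auto split: if_splits)

lemma bessel_weight_minus [simp]: "bessel_weight s (- \<xi>) = bessel_weight s \<xi>" by (simp add: bessel_weight_def)

lemma bessel_weight_subadditive:
  assumes "0 \<le> s" shows "bessel_weight s \<xi> \<le> 2 powr s * (bessel_weight s (\<xi> - \<eta>) + bessel_weight s \<eta>)"
proof -
  let ?m = "max (1 + (norm (\<xi> - \<eta>))\<^sup>2) (1 + (norm \<eta>)\<^sup>2)"
  have "(norm \<xi>)\<^sup>2 \<le> 2 * (norm (\<xi> - \<eta>))\<^sup>2 + 2 * (norm \<eta>)\<^sup>2" using norm_add_sq_le[of "\<xi> - \<eta>" \<eta>] by simp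
  moreover have "1 + (norm (\<xi> - \<eta>))\<^sup>2 \<le> ?m" "1 + (norm \<eta>)\<^sup>2 \<le> ?m" by (rule max.cobounded1, rule max.cobounded2)
  ultimately have "1 + (norm \<xi>)\<^sup>2 \<le> 4 * ?m" by argo
  then have "bessel_weight s \<xi> \<le> (4 * ?m) powr (s / 2)"
    unfolding bessel_weight_def using assms by (intro powr_mono2) auto
  also have "\<dots> = 4 powr (s / 2) * ?m powr (s / 2)" by (rule powr_mult)
  also have "(4::real) powr (s / 2) = (2 powr 2) powr (s / 2)" by simp
  also have "\<dots> = 2 powr s" by (simp only: powr_powr) simp
  also have "?m powr (s / 2) \<le> bessel_weight s (\<xi> - \<eta>) + bessel_weight s \<eta>"
    using bessel_weight_nonneg[of s "\<xi> - \<eta>"] bessel_weight_nonneg[of s \<eta>] by (auto simp: max_def bessel_weight_def)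
  finally show ?thesis by simp
qed

lemma nn_integral_powr_finite:
  assumes "p > 1" shows "(\<integral>\<^sup>+t. ennreal ((1 + t) powr (- p)) * indicator {0..} t \<partial>lborel) < \<infinity>"
proof -
  have "(\<integral>\<^sup>+t. ennreal ((1 + t) powr (- p)) * indicator {0..} t \<partial>lborel) = ennreal (0 - (1 + 0) powr (1 - p) / (1 - p))"
  proof (rule nn_integral_FTC_atLeast)
    show "DERIV (\<lambda>t. (1 + t) powr (1 - p) / (1 - p)) t :> (1 + t) powr (- p)" if "0 \<le> t" for t
      using that assms by (auto intro!: derivative_eq_intros)
    show "((\<lambda>t::real. (1 + t) powr (1 - p) / (1 - p)) \<longlongrightarrow> 0) at_top"
    proof -
      have "((\<lambda>t::real. (1 + t) powr (1 - p)) \<longlongrightarrow> 0) at_top"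
        using assms by (intro tendsto_neg_powr) (auto intro!: filterlim_tendsto_add_at_top[OF tendsto_const filterlim_ident])
      from tendsto_divide[OF this tendsto_const[of "1 - p"]] show ?thesis using assms by simp
    qed
  qed auto
  then show ?thesis by simp
qed

lemma nn_integral_japanese_real:
  assumes "p > 1/2" shows "(\<integral>\<^sup>+(t::real). ennreal ((1 + t\<^sup>2) powr (- p)) \<partial>lborel) < \<infinity>"
proof -
  let ?g = "\<lambda>t. ennreal ((1 + t) powr (- (2 * p))) * indicator {0..} t"
  have tail_finite: "(\<integral>\<^sup>+t. ?g t \<partial>lborel) < \<infinity>" using assms by (intro nn_integral_powr_finite) simp
  have tail_finite_reflected: "(\<integral>\<^sup>+t. ?g (0 - t) \<partial>lborel) < \<infinity>"
    by (subst nn_integral_reflect[of ?g 0]) (use tail_finite in auto)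
  have "(\<integral>\<^sup>+(t::real). ennreal ((1 + t\<^sup>2) powr (- p)) \<partial>lborel) \<le> (\<integral>\<^sup>+t. ennreal (2 powr p) * (?g t + ?g (0 - t)) \<partial>lborel)"
  proof (rule nn_integral_mono)
    fix t :: real
    have "0 \<le> (1 - \<bar>t\<bar>)\<^sup>2" by simp
    then have "(1 + \<bar>t\<bar>)\<^sup>2 / 2 \<le> 1 + t\<^sup>2" by (simp add: power2_eq_square algebra_simps abs_mult_self_eq)
    then have "(1 + t\<^sup>2) powr (- p) \<le> ((1 + \<bar>t\<bar>)\<^sup>2 / 2) powr (- p)"
      using assms by (intro powr_mono2') (auto simp: add_pos_nonneg)
    also have "\<dots> = 2 powr p * (1 + \<bar>t\<bar>) powr (- (2 * p))"
    proof -
      have "((1 + \<bar>t\<bar>)\<^sup>2 / 2) powr (- p) = ((1 + \<bar>t\<bar>)\<^sup>2) powr (- p) / 2 powr (- p)"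
        by (subst powr_divide) auto
      also have "(1 + \<bar>t\<bar>)\<^sup>2 = (1 + \<bar>t\<bar>) powr 2"
        using powr_numeral[of "1 + \<bar>t\<bar>"] by simp
      also have "((1 + \<bar>t\<bar>) powr 2) powr (- p) = (1 + \<bar>t\<bar>) powr (- (2 * p))"
        by (simp only: powr_powr) simp
      also have "(1 + \<bar>t\<bar>) powr (- (2 * p)) / 2 powr (- p) = 2 powr p * (1 + \<bar>t\<bar>) powr (- (2 * p))"
        by (simp add: powr_minus_divide)
      finally show ?thesis by simp
    qed
    finally have "ennreal ((1 + t\<^sup>2) powr (- p)) \<le> ennreal (2 powr p) * ennreal ((1 + \<bar>t\<bar>) powr (- (2 * p)))"
      by (simp add: ennreal_leI flip: ennreal_mult)
    also have "\<dots> \<le> ennreal (2 powr p) * (?g t + ?g (0 - t))"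
      by (intro mult_left_mono) (auto simp: indicator_def)
    finally show "ennreal ((1 + t\<^sup>2) powr (- p)) \<le> ennreal (2 powr p) * (?g t + ?g (0 - t))" .
  qed
  also have "\<dots> = ennreal (2 powr p) * ((\<integral>\<^sup>+t. ?g t \<partial>lborel) + (\<integral>\<^sup>+t. ?g (0 - t) \<partial>lborel))"
    by (subst nn_integral_cmult) (auto simp: nn_integral_add)
  also have "\<dots> < \<infinity>" using tail_finite tail_finite_reflected by (simp add: ennreal_mult_less_top)
  finally show ?thesis .
qed

lemma square_integrable_bessel_weight_neg:
  assumes "s > real DIM('a::euclidean_space) / 2"
  shows "square_integrable (\<lambda>\<xi>::'a. complex_of_real (bessel_weight (- s) \<xi>))"
proof (rule square_integrable_if_nn_integral_finite)
  let ?n = "real DIM('a)"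
  let ?f = "\<lambda>(b::'a) t. ennreal ((1 + t\<^sup>2) powr (- (s / ?n)))"
  have dim_pos: "?n > 0" by simp
  then have s_pos: "s > 0" using assms by (meson divide_pos_pos less_trans zero_less_numeral)
  have "(\<integral>\<^sup>+(\<xi>::'a). ennreal ((cmod (complex_of_real (bessel_weight (- s) \<xi>)))\<^sup>2) \<partial>lborel)
      \<le> (\<integral>\<^sup>+(\<xi>::'a). (\<Prod>b\<in>Basis. ?f b (\<xi> \<bullet> b)) \<partial>lborel)"
  proof (rule nn_integral_mono)
    fix \<xi> :: 'a
    have "1 + (norm \<xi>)\<^sup>2 > 0" by (simp add: add_pos_nonneg)
    then have "(cmod (complex_of_real (bessel_weight (- s) \<xi>)))\<^sup>2 = (\<Prod>b\<in>(Basis::'a set). (1 + (norm \<xi>)\<^sup>2) powr (- (s / ?n)))"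
      by (simp add: bessel_weight_sq powr_powr flip: powr_realpow)
    also have "\<dots> \<le> (\<Prod>b\<in>Basis. (1 + (\<xi> \<bullet> b)\<^sup>2) powr (- (s / ?n)))"
    proof (rule prod_mono)
      fix b :: 'a assume "b \<in> Basis"
      then have "(\<xi> \<bullet> b)\<^sup>2 \<le> (norm \<xi>)\<^sup>2" using Basis_le_norm[of b \<xi>] abs_le_square_iff[of "\<xi> \<bullet> b" "norm \<xi>"] by simp
      then show "0 \<le> (1 + (norm \<xi>)\<^sup>2) powr (- (s / ?n)) \<and> (1 + (norm \<xi>)\<^sup>2) powr (- (s / ?n)) \<le> (1 + (\<xi> \<bullet> b)\<^sup>2) powr (- (s / ?n))"
        using s_pos dim_pos by (intro conjI powr_mono2') (auto simp: add_pos_nonneg)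
    qed
    finally show "ennreal ((cmod (complex_of_real (bessel_weight (- s) \<xi>)))\<^sup>2) \<le> (\<Prod>b\<in>Basis. ?f b (\<xi> \<bullet> b))"
      by (simp add: prod_ennreal ennreal_leI)
  qed
  also have "\<dots> = (\<Prod>b\<in>(Basis::'a set). \<integral>\<^sup>+t. ?f b t \<partial>lborel)"
    by (rule nn_integral_lborel_prod) auto
  also have "\<dots> < \<infinity>"
    using nn_integral_japanese_real[of "s / ?n"] assms dim_pos
    by (simp add: less_top[symmetric] power_eq_top_ennreal less_divide_eq)
  finally show "(\<integral>\<^sup>+(\<xi>::'a). ennreal ((cmod (complex_of_real (bessel_weight (- s) \<xi>)))\<^sup>2) \<partial>lborel) < \<infinity>" .
qed measurable

lemma ennreal_norm_integral_le:
  fixes f :: "'a \<Rightarrow> complex"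
  shows "ennreal (cmod (integral\<^sup>L M f)) \<le> (\<integral>\<^sup>+x. ennreal (cmod (f x)) \<partial>M)"
proof (cases "integrable M f")
  case True
  then show ?thesis by (rule integral_norm_bound_ennreal)
qed (simp add: not_integrable_integral_eq)

lemma nn_integral_Young:
  fixes a q :: "'a::euclidean_space \<Rightarrow> ennreal"
  assumes [measurable]: "a \<in> borel_measurable borel" "q \<in> borel_measurable borel"
  shows "(\<integral>\<^sup>+\<xi>. (\<integral>\<^sup>+\<eta>. a (\<xi> - \<eta>) * q \<eta> \<partial>lborel)\<^sup>2 \<partial>lborel) \<le> (\<integral>\<^sup>+\<eta>. q \<eta> \<partial>lborel)\<^sup>2 * (\<integral>\<^sup>+\<xi>. (a \<xi>)\<^sup>2 \<partial>lborel)"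
proof -
  let ?Q = "\<integral>\<^sup>+\<eta>. q \<eta> \<partial>lborel"
  have Cauchy_Schwarz: "(\<integral>\<^sup>+\<eta>. a (\<xi> - \<eta>) * q \<eta> \<partial>lborel)\<^sup>2 \<le> (\<integral>\<^sup>+\<eta>. (a (\<xi> - \<eta>))\<^sup>2 * q \<eta> \<partial>lborel) * ?Q" for \<xi>
  proof -
    have "(\<integral>\<^sup>+\<eta>. a (\<xi> - \<eta>) * 1 \<partial>density lborel q)\<^sup>2 \<le> (\<integral>\<^sup>+\<eta>. (a (\<xi> - \<eta>))\<^sup>2 \<partial>density lborel q) * (\<integral>\<^sup>+\<eta>. 1\<^sup>2 \<partial>density lborel q)"
      by (rule Cauchy_Schwarz_nn_integral) measurable
    moreover have "(\<integral>\<^sup>+\<eta>. g \<eta> \<partial>density lborel q) = (\<integral>\<^sup>+\<eta>. g \<eta> * q \<eta> \<partial>lborel)" if [measurable]: "g \<in> borel_measurable borel" for g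
      by (subst nn_integral_density) (auto simp: mult.commute)
    ultimately show ?thesis by (simp add: emeasure_density)
  qed
  have "(\<integral>\<^sup>+\<xi>. (\<integral>\<^sup>+\<eta>. a (\<xi> - \<eta>) * q \<eta> \<partial>lborel)\<^sup>2 \<partial>lborel) \<le> (\<integral>\<^sup>+\<xi>. (\<integral>\<^sup>+\<eta>. (a (\<xi> - \<eta>))\<^sup>2 * q \<eta> \<partial>lborel) * ?Q \<partial>lborel)"
    by (rule nn_integral_mono) (rule Cauchy_Schwarz)
  also have "\<dots> = (\<integral>\<^sup>+\<xi>. (\<integral>\<^sup>+\<eta>. (a (\<xi> - \<eta>))\<^sup>2 * q \<eta> \<partial>lborel) \<partial>lborel) * ?Q"
    by (rule nn_integral_multc) measurable
  also have "(\<integral>\<^sup>+\<xi>. (\<integral>\<^sup>+\<eta>. (a (\<xi> - \<eta>))\<^sup>2 * q \<eta> \<partial>lborel) \<partial>lborel) = (\<integral>\<^sup>+\<eta>. (\<integral>\<^sup>+\<xi>. (a (\<xi> - \<eta>))\<^sup>2 * q \<eta> \<partial>lborel) \<partial>lborel)"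
    by (rule lborel_pair.Fubini') measurable
  also have "\<dots> = (\<integral>\<^sup>+\<eta>. (\<integral>\<^sup>+\<xi>. (a \<xi>)\<^sup>2 \<partial>lborel) * q \<eta> \<partial>lborel)"
  proof (rule nn_integral_cong)
    fix \<eta>
    have "(\<integral>\<^sup>+\<xi>. (a (\<xi> - \<eta>))\<^sup>2 * q \<eta> \<partial>lborel) = (\<integral>\<^sup>+\<xi>. (a (\<xi> - \<eta>))\<^sup>2 \<partial>lborel) * q \<eta>"
      by (rule nn_integral_multc) measurable
    also have "(\<integral>\<^sup>+\<xi>. (a (\<xi> - \<eta>))\<^sup>2 \<partial>lborel) = (\<integral>\<^sup>+\<xi>. (a \<xi>)\<^sup>2 \<partial>lborel)"
      by (rule nn_integral_translate[of "\<lambda>\<xi>. (a \<xi>)\<^sup>2"]) measurable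
    finally show "(\<integral>\<^sup>+\<xi>. (a (\<xi> - \<eta>))\<^sup>2 * q \<eta> \<partial>lborel) = (\<integral>\<^sup>+\<xi>. (a \<xi>)\<^sup>2 \<partial>lborel) * q \<eta>" .
  qed
  also have "\<dots> = (\<integral>\<^sup>+\<xi>. (a \<xi>)\<^sup>2 \<partial>lborel) * ?Q" by (rule nn_integral_cmult) measurable
  finally show ?thesis by (simp add: power2_eq_square mult_ac)
qed

lemma ennreal_sum_sq_le: "(x + y)\<^sup>2 \<le> 2 * (x\<^sup>2 + y\<^sup>2)" for x y :: ennreal
proof -
  have "2 * x * y \<le> x\<^sup>2 + y\<^sup>2" by (rule sum_of_squares_ge_ennreal)
  then have "(x\<^sup>2 + y\<^sup>2) + 2 * x * y \<le> (x\<^sup>2 + y\<^sup>2) + (x\<^sup>2 + y\<^sup>2)" by (rule add_left_mono)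
  then show ?thesis by (simp only: power2_sum mult_2)
qed

definition convolution :: "('a::euclidean_space \<Rightarrow> complex) \<Rightarrow> ('a \<Rightarrow> complex) \<Rightarrow> 'a \<Rightarrow> complex" where
  "convolution g h \<xi> = (LINT \<eta>|lborel. g (\<xi> - \<eta>) * h \<eta>)"

lemma convolution_measurable:
  assumes [measurable]: "g \<in> borel_measurable borel" "h \<in> borel_measurable borel"
  shows "convolution g h \<in> borel_measurable borel"
  unfolding convolution_def[abs_def] by measurable

lemma integrable_convolution_pair:
  fixes g h :: "'a::euclidean_space \<Rightarrow> complex"
  assumes g: "integrable lborel g" and h: "integrable lborel h"
  shows "integrable (lborel \<Otimes>\<^sub>M lborel) (\<lambda>(\<xi>, \<eta>). g (\<xi> - \<eta>) * h \<eta>)"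
proof (rule integrableI_bounded)
  have [measurable]: "g \<in> borel_measurable borel" "h \<in> borel_measurable borel"
    using g[THEN borel_measurable_integrable] h[THEN borel_measurable_integrable] by simp_all
  show "(\<lambda>(\<xi>, \<eta>). g (\<xi> - \<eta>) * h \<eta>) \<in> borel_measurable (lborel \<Otimes>\<^sub>M lborel)" by measurable
  let ?f = "\<lambda>\<xi> \<eta>. ennreal (cmod (g (\<xi> - \<eta>))) * ennreal (cmod (h \<eta>))"
  have "(\<integral>\<^sup>+p. ennreal (norm (case p of (\<xi>, \<eta>) \<Rightarrow> g (\<xi> - \<eta>) * h \<eta>)) \<partial>(lborel \<Otimes>\<^sub>M lborel)) =
     (\<integral>\<^sup>+p. (case p of (\<xi>, \<eta>) \<Rightarrow> ?f \<xi> \<eta>) \<partial>(lborel \<Otimes>\<^sub>M lborel))"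
    by (intro nn_integral_cong) (auto simp: norm_mult ennreal_mult)
  also have "\<dots> = (\<integral>\<^sup>+\<eta>. (\<integral>\<^sup>+\<xi>. ?f \<xi> \<eta> \<partial>lborel) \<partial>lborel)"
    by (subst lborel_pair.nn_integral_snd[symmetric]) auto
  also have "\<dots> = (\<integral>\<^sup>+\<eta>. (\<integral>\<^sup>+\<xi>. ennreal (cmod (g \<xi>)) \<partial>lborel) * ennreal (cmod (h \<eta>)) \<partial>lborel)"
  proof (rule nn_integral_cong)
    fix \<eta>
    have "(\<integral>\<^sup>+\<xi>. ?f \<xi> \<eta> \<partial>lborel) = (\<integral>\<^sup>+\<xi>. ennreal (cmod (g (\<xi> - \<eta>))) \<partial>lborel) * ennreal (cmod (h \<eta>))"
      by (rule nn_integral_multc) measurable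
    also have "(\<integral>\<^sup>+\<xi>. ennreal (cmod (g (\<xi> - \<eta>))) \<partial>lborel) = (\<integral>\<^sup>+\<xi>. ennreal (cmod (g \<xi>)) \<partial>lborel)"
      by (rule nn_integral_translate[of "\<lambda>\<xi>. ennreal (cmod (g \<xi>))"]) measurable
    finally show "(\<integral>\<^sup>+\<xi>. ?f \<xi> \<eta> \<partial>lborel) = (\<integral>\<^sup>+\<xi>. ennreal (cmod (g \<xi>)) \<partial>lborel) * ennreal (cmod (h \<eta>))" .
  qed
  also have "\<dots> = (\<integral>\<^sup>+\<xi>. ennreal (cmod (g \<xi>)) \<partial>lborel) * (\<integral>\<^sup>+\<eta>. ennreal (cmod (h \<eta>)) \<partial>lborel)"
    by (rule nn_integral_cmult) measurable
  also have "\<dots> < \<infinity>"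
    using g h by (simp add: integrable_iff_bounded ennreal_mult_less_top)
  finally show "(\<integral>\<^sup>+p. ennreal (norm (case p of (\<xi>, \<eta>) \<Rightarrow> g (\<xi> - \<eta>) * h \<eta>)) \<partial>(lborel \<Otimes>\<^sub>M lborel)) < \<infinity>" .
qed

lemma fourier1_convolution:
  fixes g h :: "real^'n \<Rightarrow> complex"
  assumes g: "integrable lborel g" and h: "integrable lborel h"
  shows "fourier1 (convolution g h) x = fourier1 g x * fourier1 h x"
proof -
  have [measurable]: "g \<in> borel_measurable borel" "h \<in> borel_measurable borel"
    using g[THEN borel_measurable_integrable] h[THEN borel_measurable_integrable] by simp_all
  have int: "integrable (lborel \<Otimes>\<^sub>M lborel) (\<lambda>(\<xi>, \<eta>). g (\<xi> - \<eta>) * h \<eta> * cis (- (\<xi> \<bullet> x)))"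
  proof (rule Bochner_Integration.integrable_bound[OF integrable_convolution_pair[OF g h]])
    show "AE p in lborel \<Otimes>\<^sub>M lborel. norm (case p of (\<xi>, \<eta>) \<Rightarrow> g (\<xi> - \<eta>) * h \<eta> * cis (- (\<xi> \<bullet> x)))
       \<le> norm (case p of (\<xi>, \<eta>) \<Rightarrow> g (\<xi> - \<eta>) * h \<eta>)"
      by (intro AE_I2) (auto simp: norm_mult)
  qed measurable
  have "fourier1 (convolution g h) x = (LINT \<xi>|lborel. (LINT \<eta>|lborel. g (\<xi> - \<eta>) * h \<eta> * cis (- (\<xi> \<bullet> x))))"
    unfolding fourier1_def convolution_def by simp
  also have "\<dots> = (LINT \<eta>|lborel. (LINT \<xi>|lborel. g (\<xi> - \<eta>) * h \<eta> * cis (- (\<xi> \<bullet> x))))"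
    by (rule lborel_pair.Fubini_integral[OF int, symmetric])
  also have "\<dots> = (LINT \<eta>|lborel. fourier1 g x * (h \<eta> * cis (- (\<eta> \<bullet> x))))"
  proof (rule Bochner_Integration.integral_cong[OF refl])
    fix \<eta> :: "real^'n"
    have "(LINT \<xi>|lborel. g (\<xi> - \<eta>) * h \<eta> * cis (- (\<xi> \<bullet> x))) = (LINT \<xi>|lborel. (g (\<xi> - \<eta>) * cis (- ((\<xi> - \<eta>) \<bullet> x))) * (h \<eta> * cis (- (\<eta> \<bullet> x))))"
    proof (rule Bochner_Integration.integral_cong[OF refl])
      fix \<xi>
      have "cis (- (\<xi> \<bullet> x)) = cis (- ((\<xi> - \<eta>) \<bullet> x)) * cis (- (\<eta> \<bullet> x))"
        by (simp add: cis_mult inner_diff_left)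
      then show "g (\<xi> - \<eta>) * h \<eta> * cis (- (\<xi> \<bullet> x)) = (g (\<xi> - \<eta>) * cis (- ((\<xi> - \<eta>) \<bullet> x))) * (h \<eta> * cis (- (\<eta> \<bullet> x)))"
        by simp
    qed
    also have "\<dots> = (LINT \<xi>|lborel. g (\<xi> - \<eta>) * cis (- ((\<xi> - \<eta>) \<bullet> x))) * (h \<eta> * cis (- (\<eta> \<bullet> x)))"
      by (rule integral_mult_left_zero)
    also have "(LINT \<xi>|lborel. g (\<xi> - \<eta>) * cis (- ((\<xi> - \<eta>) \<bullet> x))) = fourier1 g x"
      unfolding fourier1_def by (rule integral_translate[of "\<lambda>\<xi>. g \<xi> * cis (- (\<xi> \<bullet> x))"]) measurable
    finally show "(LINT \<xi>|lborel. g (\<xi> - \<eta>) * h \<eta> * cis (- (\<xi> \<bullet> x))) = fourier1 g x * (h \<eta> * cis (- (\<eta> \<bullet> x)))" .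
  qed
  also have "\<dots> = fourier1 g x * fourier1 h x" unfolding fourier1_def by (rule integral_mult_right_zero)
  finally show ?thesis .
qed

lemma weighted_convolution_le:
  fixes g h :: "'a::euclidean_space \<Rightarrow> complex"
  assumes "0 \<le> s" and [measurable]: "g \<in> borel_measurable borel" "h \<in> borel_measurable borel"
  shows "ennreal (bessel_weight s \<xi> * cmod (convolution g h \<xi>)) \<le> ennreal (2 powr s) *
    ((\<integral>\<^sup>+\<eta>. ennreal (bessel_weight s (\<xi> - \<eta>) * cmod (g (\<xi> - \<eta>))) * ennreal (cmod (h \<eta>)) \<partial>lborel)
      + (\<integral>\<^sup>+\<eta>. ennreal (bessel_weight s (\<xi> - \<eta>) * cmod (h (\<xi> - \<eta>))) * ennreal (cmod (g \<eta>)) \<partial>lborel))"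
proof -
  let ?G = "\<lambda>\<eta>. ennreal (bessel_weight s \<eta> * cmod (g \<eta>))" and ?H = "\<lambda>\<eta>. ennreal (bessel_weight s \<eta> * cmod (h \<eta>))"
  let ?g = "\<lambda>\<eta>. ennreal (cmod (g \<eta>))" and ?h = "\<lambda>\<eta>. ennreal (cmod (h \<eta>))"
  have split_weight: "ennreal (bessel_weight s \<xi>) * ennreal (cmod (g (\<xi> - \<eta>) * h \<eta>))
      \<le> ennreal (2 powr s) * (?G (\<xi> - \<eta>) * ?h \<eta> + ?g (\<xi> - \<eta>) * ?H \<eta>)" for \<eta>
  proof -
    have "bessel_weight s \<xi> * cmod (g (\<xi> - \<eta>) * h \<eta>)
        \<le> 2 powr s * (bessel_weight s (\<xi> - \<eta>) + bessel_weight s \<eta>) * cmod (g (\<xi> - \<eta>) * h \<eta>)"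
      using assms(1) by (intro mult_right_mono bessel_weight_subadditive) auto
    also have "\<dots> = 2 powr s * ((bessel_weight s (\<xi> - \<eta>) * cmod (g (\<xi> - \<eta>))) * cmod (h \<eta>)
        + cmod (g (\<xi> - \<eta>)) * (bessel_weight s \<eta> * cmod (h \<eta>)))"
      by (simp add: norm_mult algebra_simps)
    finally show ?thesis by (simp add: ennreal_leI flip: ennreal_mult ennreal_plus)
  qed
  have "ennreal (bessel_weight s \<xi> * cmod (convolution g h \<xi>))
      \<le> ennreal (bessel_weight s \<xi>) * (\<integral>\<^sup>+\<eta>. ennreal (cmod (g (\<xi> - \<eta>) * h \<eta>)) \<partial>lborel)"
    unfolding convolution_def
    by (subst ennreal_mult) (auto intro: mult_left_mono ennreal_norm_integral_le)
  also have "\<dots> = (\<integral>\<^sup>+\<eta>. ennreal (bessel_weight s \<xi>) * ennreal (cmod (g (\<xi> - \<eta>) * h \<eta>)) \<partial>lborel)"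
    by (rule nn_integral_cmult[symmetric]) measurable
  also have "\<dots> \<le> (\<integral>\<^sup>+\<eta>. ennreal (2 powr s) * (?G (\<xi> - \<eta>) * ?h \<eta> + ?g (\<xi> - \<eta>) * ?H \<eta>) \<partial>lborel)"
    by (rule nn_integral_mono) (rule split_weight)
  also have "\<dots> = ennreal (2 powr s) * ((\<integral>\<^sup>+\<eta>. ?G (\<xi> - \<eta>) * ?h \<eta> \<partial>lborel) + (\<integral>\<^sup>+\<eta>. ?g (\<xi> - \<eta>) * ?H \<eta> \<partial>lborel))"
    by (subst nn_integral_cmult, measurable, subst nn_integral_add, measurable)
  also have "(\<integral>\<^sup>+\<eta>. ?g (\<xi> - \<eta>) * ?H \<eta> \<partial>lborel) = (\<integral>\<^sup>+\<eta>. ?H (\<xi> - \<eta>) * ?g \<eta> \<partial>lborel)"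
    by (subst nn_integral_reflect[of "\<lambda>\<eta>. ?g (\<xi> - \<eta>) * ?H \<eta>" \<xi>, symmetric]) (simp_all add: mult.commute)
  finally show ?thesis .
qed

lemma nn_integral_weighted_convolution_le:
  fixes g h :: "'a::euclidean_space \<Rightarrow> complex"
  assumes s: "0 \<le> s" and [measurable]: "g \<in> borel_measurable borel" "h \<in> borel_measurable borel"
  shows "(\<integral>\<^sup>+\<xi>. (ennreal (bessel_weight s \<xi> * cmod (convolution g h \<xi>)))\<^sup>2 \<partial>lborel) \<le> (ennreal (2 powr s))\<^sup>2 *
    (2 * ((\<integral>\<^sup>+\<eta>. ennreal (cmod (h \<eta>)) \<partial>lborel)\<^sup>2 * (\<integral>\<^sup>+\<xi>. (ennreal (bessel_weight s \<xi> * cmod (g \<xi>)))\<^sup>2 \<partial>lborel)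
      + (\<integral>\<^sup>+\<eta>. ennreal (cmod (g \<eta>)) \<partial>lborel)\<^sup>2 * (\<integral>\<^sup>+\<xi>. (ennreal (bessel_weight s \<xi> * cmod (h \<xi>)))\<^sup>2 \<partial>lborel)))"
proof -
  let ?I = "\<lambda>g h \<xi>. \<integral>\<^sup>+\<eta>. ennreal (bessel_weight s (\<xi> - \<eta>) * cmod (g (\<xi> - \<eta>))) * ennreal (cmod (h \<eta>)) \<partial>lborel"
  have "(\<integral>\<^sup>+\<xi>. (ennreal (bessel_weight s \<xi> * cmod (convolution g h \<xi>)))\<^sup>2 \<partial>lborel)
      \<le> (\<integral>\<^sup>+\<xi>. (ennreal (2 powr s))\<^sup>2 * (2 * ((?I g h \<xi>)\<^sup>2 + (?I h g \<xi>)\<^sup>2)) \<partial>lborel)"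
  proof (rule nn_integral_mono)
    fix \<xi>
    have "(ennreal (bessel_weight s \<xi> * cmod (convolution g h \<xi>)))\<^sup>2 \<le> (ennreal (2 powr s) * (?I g h \<xi> + ?I h g \<xi>))\<^sup>2"
      by (intro power_mono weighted_convolution_le[OF s]) auto
    also have "\<dots> \<le> (ennreal (2 powr s))\<^sup>2 * (2 * ((?I g h \<xi>)\<^sup>2 + (?I h g \<xi>)\<^sup>2))"
      unfolding power_mult_distrib by (intro mult_left_mono ennreal_sum_sq_le) simp
    finally show "(ennreal (bessel_weight s \<xi> * cmod (convolution g h \<xi>)))\<^sup>2
        \<le> (ennreal (2 powr s))\<^sup>2 * (2 * ((?I g h \<xi>)\<^sup>2 + (?I h g \<xi>)\<^sup>2))" .
  qed
  also have "\<dots> = (ennreal (2 powr s))\<^sup>2 * (2 * ((\<integral>\<^sup>+\<xi>. (?I g h \<xi>)\<^sup>2 \<partial>lborel) + (\<integral>\<^sup>+\<xi>. (?I h g \<xi>)\<^sup>2 \<partial>lborel)))"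
    by (subst nn_integral_cmult, measurable, subst nn_integral_cmult, measurable, subst nn_integral_add, measurable)
  finally show ?thesis
    by (rule order_trans) (intro mult_left_mono add_mono nn_integral_Young; simp)
qed

section \<open>Sobolev spaces of order greater than half the dimension\<close>

text \<open>An element \<open>U\<close> of \<open>L\<^sup>2\<close> encodes the \<open>H\<^sup>s\<close> function \<open>sobolev_fun U\<close> whose Fourier transform \<open>sobolev_FT U\<close>
  is \<open>U\<close> divided by the weight; \<open>weighted_FT\<close> below is the inverse encoding.\<close>

locale sobolev_space =
  fixes s :: real and n_type :: "'n::finite itself"
  assumes s_gt: "s > real CARD('n) / 2"
begin

lemma s_pos: "s > 0"
proof -
  have "0 \<le> real CARD('n) / 2" by simp
  then show ?thesis using s_gt by (rule le_less_trans)
qed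

lemma square_integrable_inverse_weight: "square_integrable (\<lambda>\<xi>::real^'n. complex_of_real (bessel_weight (- s) \<xi>))"
  using s_gt by (intro square_integrable_bessel_weight_neg) simp

definition embedding_const :: real where
  "embedding_const = norm (abs_lsq (\<lambda>\<xi>::real^'n. complex_of_real (bessel_weight (- s) \<xi>)))"

definition sobolev_FT :: "(real^'n) lsq \<Rightarrow> real^'n \<Rightarrow> complex" where
  "sobolev_FT U \<xi> = of_real (bessel_weight (- s) \<xi>) * rep_lsq U \<xi>"

lemma sobolev_FT_measurable [measurable]: "sobolev_FT U \<in> borel_measurable borel"
  unfolding sobolev_FT_def[abs_def] by measurable

lemma cmod_bessel_weight_neg_le: "cmod (complex_of_real (bessel_weight (- s) \<xi>)) \<le> 1"
  using bessel_weight_neg_le_1[of s \<xi>] s_pos by simp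

lemma abs_sobolev_FT: "abs_lsq (sobolev_FT U) = mult_op (\<lambda>\<xi>. of_real (bessel_weight (- s) \<xi>)) U"
  unfolding mult_op_def sobolev_FT_def[abs_def] by simp

lemma square_integrable_sobolev_FT: "square_integrable (sobolev_FT U)"
  unfolding sobolev_FT_def[abs_def]
  by (rule square_integrable_mult_bounded[OF square_integrable_rep _ cmod_bessel_weight_neg_le]) measurable

lemma integrable_sobolev_FT: "integrable lborel (sobolev_FT U)"
  unfolding sobolev_FT_def[abs_def]
  by (rule integrable_mult_square_integrable[OF square_integrable_inverse_weight square_integrable_rep])

lemma rep_eq_sobolev_FT: "rep_lsq U \<xi> = of_real (bessel_weight s \<xi>) * sobolev_FT U \<xi>"
  by (simp add: sobolev_FT_def)

lemma sobolev_FT_inj: "AE \<xi> in lborel. sobolev_FT U \<xi> = sobolev_FT V \<xi> \<Longrightarrow> U = V"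
  by (rule lsq_eqI) (erule eventually_mono, simp add: rep_eq_sobolev_FT)

lemma sobolev_FT_abs_lsq:
  assumes "square_integrable f" shows "AE \<xi> in lborel. sobolev_FT (abs_lsq f) \<xi> = of_real (bessel_weight (- s) \<xi>) * f \<xi>"
  using rep_abs_lsq[OF assms] by eventually_elim (simp add: sobolev_FT_def)

lemma nn_integral_sobolev_FT_sq:
  "(\<integral>\<^sup>+\<xi>. ennreal (cmod (sobolev_FT U \<xi>)) \<partial>lborel)\<^sup>2 \<le> ennreal (embedding_const\<^sup>2) * ennreal ((norm U)\<^sup>2)"
proof -
  let ?w = "\<lambda>\<xi>::real^'n. complex_of_real (bessel_weight (- s) \<xi>)"
  have "(\<integral>\<^sup>+\<xi>. ennreal (cmod (sobolev_FT U \<xi>)) \<partial>lborel) = (\<integral>\<^sup>+\<xi>. ennreal (cmod (?w \<xi>)) * ennreal (cmod (rep_lsq U \<xi>)) \<partial>lborel)"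
    by (intro nn_integral_cong) (simp add: sobolev_FT_def norm_mult ennreal_mult)
  also have "\<dots>\<^sup>2 \<le> (\<integral>\<^sup>+\<xi>. (ennreal (cmod (?w \<xi>)))\<^sup>2 \<partial>lborel) * (\<integral>\<^sup>+\<xi>. (ennreal (cmod (rep_lsq U \<xi>)))\<^sup>2 \<partial>lborel)"
    by (rule Cauchy_Schwarz_nn_integral) measurable
  also have "(\<integral>\<^sup>+\<xi>. (ennreal (cmod (?w \<xi>)))\<^sup>2 \<partial>lborel) = ennreal (embedding_const\<^sup>2)"
    unfolding embedding_const_def nn_integral_abs_lsq[OF square_integrable_inverse_weight, symmetric] by (simp add: ennreal_power)
  also have "(\<integral>\<^sup>+\<xi>. (ennreal (cmod (rep_lsq U \<xi>)))\<^sup>2 \<partial>lborel) = ennreal ((norm U)\<^sup>2)"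
    unfolding nn_integral_rep_lsq[symmetric] by (simp add: ennreal_power)
  finally show ?thesis .
qed

definition algebra_const :: real where "algebra_const = 2 * 2 powr s * embedding_const"

lemma algebra_const_nonneg: "algebra_const \<ge> 0"
  by (simp add: algebra_const_def embedding_const_def)

lemma nn_integral_convolution_sobolev_FT_le:
  "(\<integral>\<^sup>+\<xi>. ennreal ((cmod (of_real (bessel_weight s \<xi>) * convolution (sobolev_FT U) (sobolev_FT V) \<xi>))\<^sup>2) \<partial>lborel)
    \<le> ennreal ((algebra_const * norm U * norm V)\<^sup>2)"
proof -
  have weighted: "(\<integral>\<^sup>+\<xi>. (ennreal (bessel_weight s \<xi> * cmod (sobolev_FT U \<xi>)))\<^sup>2 \<partial>lborel) = ennreal ((norm U)\<^sup>2)"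
    for U :: "(real^'n) lsq"
    unfolding nn_integral_rep_lsq[symmetric] rep_eq_sobolev_FT[of U] by (simp add: norm_mult ennreal_power)
  let ?bound = "\<lambda>U V. ennreal (embedding_const\<^sup>2) * ennreal ((norm U)\<^sup>2) * ennreal ((norm V)\<^sup>2)"
  have "(\<integral>\<^sup>+\<xi>. ennreal ((cmod (of_real (bessel_weight s \<xi>) * convolution (sobolev_FT U) (sobolev_FT V) \<xi>))\<^sup>2) \<partial>lborel)
      = (\<integral>\<^sup>+\<xi>. (ennreal (bessel_weight s \<xi> * cmod (convolution (sobolev_FT U) (sobolev_FT V) \<xi>)))\<^sup>2 \<partial>lborel)"
    by (simp add: norm_mult ennreal_power)
  also have "\<dots> \<le> (ennreal (2 powr s))\<^sup>2 * (2 * (?bound V U + ?bound U V))"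
    using s_pos
    by (intro order_trans[OF nn_integral_weighted_convolution_le])
       (auto simp: weighted intro!: mult_left_mono add_mono mult_right_mono nn_integral_sobolev_FT_sq)
  also have "?bound V U + ?bound U V = 2 * ?bound U V" by (simp only: mult_2 mult_ac)
  also have "(ennreal (2 powr s))\<^sup>2 * (2 * (2 * ?bound U V))
      = ennreal ((2 powr s)\<^sup>2 * (2 * (2 * (embedding_const\<^sup>2 * (norm U)\<^sup>2 * (norm V)\<^sup>2))))"
    by (simp add: ennreal_mult ennreal_power mult_ac)
  also have "(2 powr s)\<^sup>2 * (2 * (2 * (embedding_const\<^sup>2 * (norm U)\<^sup>2 * (norm V)\<^sup>2))) = (algebra_const * norm U * norm V)\<^sup>2"
    unfolding algebra_const_def by (simp add: power_mult_distrib mult_ac)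
  finally show ?thesis .
qed

definition fourier_const :: complex where "fourier_const = of_real (1 / (2 * pi) ^ CARD('n))"

definition sobolev_fun :: "(real^'n) lsq \<Rightarrow> real^'n \<Rightarrow> complex" where
  "sobolev_fun U x = fourier_const * fourier1 (sobolev_FT U) (- x)"

lemma sobolev_fun_measurable [measurable]: "sobolev_fun U \<in> borel_measurable borel"
proof -
  have [measurable]: "fourier1 (sobolev_FT U) \<in> borel_measurable borel" by measurable
  show ?thesis unfolding sobolev_fun_def[abs_def] by measurable
qed

lemma rep_inv_fourier_sobolev_FT: "AE x in lborel. rep_lsq (inv_fourier_lsq (abs_lsq (sobolev_FT U))) x = sobolev_fun U x"
  unfolding sobolev_fun_def fourier_const_def
  by (rule inv_fourier_lsq_eq_fourier1[OF integrable_sobolev_FT square_integrable_sobolev_FT])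

lemma square_integrable_sobolev_fun: "square_integrable (sobolev_fun U)"
  by (rule square_integrable_cong_AE[OF square_integrable_rep _ rep_inv_fourier_sobolev_FT]) simp

lemma abs_sobolev_fun: "abs_lsq (sobolev_fun U) = inv_fourier_lsq (abs_lsq (sobolev_FT U))"
  by (rule lsq_eqI_abs[OF square_integrable_sobolev_fun rep_inv_fourier_sobolev_FT, symmetric])

lemma sobolev_fun_inj:
  assumes "AE x in lborel. sobolev_fun U x = sobolev_fun V x" shows "U = V"
proof -
  have "inv_fourier_lsq (abs_lsq (sobolev_FT U)) = inv_fourier_lsq (abs_lsq (sobolev_FT V))"
    unfolding abs_sobolev_fun[symmetric]
    by (rule abs_lsq_eqI[OF square_integrable_sobolev_fun square_integrable_sobolev_fun assms])
  then have abs_FT_eq: "abs_lsq (sobolev_FT U) = abs_lsq (sobolev_FT V)"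
    using fourier_lsq_inv_fourier_lsq by metis
  have "AE \<xi> in lborel. sobolev_FT U \<xi> = sobolev_FT V \<xi>"
    using rep_abs_lsq[OF square_integrable_sobolev_FT[of U]] rep_abs_lsq[OF square_integrable_sobolev_FT[of V]]
    unfolding abs_FT_eq by eventually_elim simp
  then show ?thesis by (rule sobolev_FT_inj)
qed

lemma sobolev_fun_eqI:
  assumes "g \<in> borel_measurable borel" "AE \<xi> in lborel. sobolev_FT U \<xi> = g \<xi>"
  shows "sobolev_fun U x = fourier_const * fourier1 g (- x)"
  unfolding sobolev_fun_def using fourier1_cong_AE[OF sobolev_FT_measurable assms] by simp

lemma sobolev_fun_add: "sobolev_fun (U + V) x = sobolev_fun U x + sobolev_fun V x"
proof -
  have "sobolev_fun (U + V) x = fourier_const * fourier1 (\<lambda>\<xi>. sobolev_FT U \<xi> + sobolev_FT V \<xi>) (- x)"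
  proof (rule sobolev_fun_eqI)
    show "AE \<xi> in lborel. sobolev_FT (U + V) \<xi> = sobolev_FT U \<xi> + sobolev_FT V \<xi>"
      using rep_add[of U V] by eventually_elim (simp add: sobolev_FT_def algebra_simps)
  qed measurable
  then show ?thesis by (simp add: fourier1_add integrable_sobolev_FT sobolev_fun_def algebra_simps)
qed

lemma sobolev_fun_mult_op_const: "sobolev_fun (mult_op (\<lambda>_. c) U) x = c * sobolev_fun U x"
proof -
  have "sobolev_fun (mult_op (\<lambda>_. c) U) x = fourier_const * fourier1 (\<lambda>\<xi>. c * sobolev_FT U \<xi>) (- x)"
  proof (rule sobolev_fun_eqI)
    show "AE \<xi> in lborel. sobolev_FT (mult_op (\<lambda>_. c) U) \<xi> = c * sobolev_FT U \<xi>"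
      using rep_mult_op[of "\<lambda>_. c" "cmod c" U] by simp (erule eventually_mono, simp add: sobolev_FT_def)
  qed measurable
  then show ?thesis by (simp add: fourier1_cmult sobolev_fun_def)
qed

lemma sobolev_fun_scaleR: "sobolev_fun (c *\<^sub>R U) x = of_real c * sobolev_fun U x"
  using sobolev_fun_mult_op_const[of "of_real c" U x] by (simp add: mult_op_of_real)

lemma sobolev_fun_zero: "sobolev_fun 0 x = 0"
  using sobolev_fun_scaleR[of 0 0 x] by simp

lemma sobolev_fun_diff: "sobolev_fun (U - V) x = sobolev_fun U x - sobolev_fun V x"
  using sobolev_fun_add[of U "(-1) *\<^sub>R V" x] sobolev_fun_scaleR[of "-1" V x] by simp

definition sobolev_mult :: "(real^'n) lsq \<Rightarrow> (real^'n) lsq \<Rightarrow> (real^'n) lsq" where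
  "sobolev_mult U V = mult_op (\<lambda>_. fourier_const)
    (abs_lsq (\<lambda>\<xi>. of_real (bessel_weight s \<xi>) * convolution (sobolev_FT U) (sobolev_FT V) \<xi>))"

lemma convolution_sobolev_FT_measurable [measurable]: "convolution (sobolev_FT U) (sobolev_FT V) \<in> borel_measurable borel"
  by (rule convolution_measurable) measurable

lemma square_integrable_weighted_convolution:
  "square_integrable (\<lambda>\<xi>. of_real (bessel_weight s \<xi>) * convolution (sobolev_FT U) (sobolev_FT V) \<xi>)"
  and norm_weighted_convolution_le:
  "norm (abs_lsq (\<lambda>\<xi>. of_real (bessel_weight s \<xi>) * convolution (sobolev_FT U) (sobolev_FT V) \<xi>)) \<le> algebra_const * norm U * norm V"
  using norm_abs_lsq_le[OF _ _ nn_integral_convolution_sobolev_FT_le] algebra_const_nonneg by simp_all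

lemma norm_sobolev_mult: "norm (sobolev_mult U V) \<le> cmod fourier_const * algebra_const * norm U * norm V"
proof -
  have "norm (sobolev_mult U V)
      \<le> cmod fourier_const * norm (abs_lsq (\<lambda>\<xi>. of_real (bessel_weight s \<xi>) * convolution (sobolev_FT U) (sobolev_FT V) \<xi>))"
    unfolding sobolev_mult_def by (rule norm_mult_op_le) auto
  also have "\<dots> \<le> cmod fourier_const * (algebra_const * norm U * norm V)"
    by (intro mult_left_mono norm_weighted_convolution_le) simp
  finally show ?thesis by (simp add: mult_ac)
qed

lemma sobolev_fun_mult: "sobolev_fun (sobolev_mult U V) x = sobolev_fun U x * sobolev_fun V x"
proof -
  let ?W = "abs_lsq (\<lambda>\<xi>. of_real (bessel_weight s \<xi>) * convolution (sobolev_FT U) (sobolev_FT V) \<xi>)"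
  have "sobolev_fun ?W x = fourier_const * fourier1 (convolution (sobolev_FT U) (sobolev_FT V)) (- x)"
    using sobolev_FT_abs_lsq[OF square_integrable_weighted_convolution[of U V]]
    by (intro sobolev_fun_eqI) simp_all
  then show ?thesis
    unfolding sobolev_mult_def sobolev_fun_mult_op_const
    by (simp add: fourier1_convolution integrable_sobolev_FT sobolev_fun_def)
qed

lemma bounded_bilinear_sobolev_mult: "bounded_bilinear sobolev_mult"
proof
  show "sobolev_mult (U + U') V = sobolev_mult U V + sobolev_mult U' V" for U U' V
    by (rule sobolev_fun_inj) (simp add: sobolev_fun_add sobolev_fun_mult algebra_simps)
  show "sobolev_mult U (V + V') = sobolev_mult U V + sobolev_mult U V'" for U V V'
    by (rule sobolev_fun_inj) (simp add: sobolev_fun_add sobolev_fun_mult algebra_simps)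
  show "sobolev_mult (r *\<^sub>R U) V = r *\<^sub>R sobolev_mult U V" for r U V
    by (rule sobolev_fun_inj) (simp add: sobolev_fun_scaleR sobolev_fun_mult algebra_simps)
  show "sobolev_mult U (r *\<^sub>R V) = r *\<^sub>R sobolev_mult U V" for r U V
    by (rule sobolev_fun_inj) (simp add: sobolev_fun_scaleR sobolev_fun_mult algebra_simps)
  show "\<exists>K. \<forall>U V. norm (sobolev_mult U V) \<le> norm U * norm V * K"
    using norm_sobolev_mult by (intro exI[of _ "cmod fourier_const * algebra_const"]) (simp add: mult_ac)
qed

definition sobolev_cnj :: "(real^'n) lsq \<Rightarrow> (real^'n) lsq" where
  "sobolev_cnj U = abs_lsq (\<lambda>\<xi>. cnj (rep_lsq U (- \<xi>)))"

lemma nn_integral_cnj_rep_reflect: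
  "(\<integral>\<^sup>+\<xi>. ennreal ((cmod (cnj (rep_lsq U (- \<xi>))))\<^sup>2) \<partial>lborel) = ennreal ((norm U)\<^sup>2)" for U :: "(real^'n) lsq"
  using nn_integral_reflect[of "\<lambda>\<xi>. ennreal ((cmod (rep_lsq U \<xi>))\<^sup>2)" 0] by (simp add: nn_integral_rep_lsq)

lemma square_integrable_cnj_rep_reflect: "square_integrable (\<lambda>\<xi>. cnj (rep_lsq U (- \<xi>)))" for U :: "(real^'n) lsq"
  by (rule square_integrable_if_nn_integral_finite) (measurable, simp only: nn_integral_cnj_rep_reflect, simp)

lemma norm_sobolev_cnj: "norm (sobolev_cnj U) = norm U"
  using nn_integral_abs_lsq[OF square_integrable_cnj_rep_reflect[of U]]
  unfolding sobolev_cnj_def nn_integral_cnj_rep_reflect by simp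

lemma sobolev_fun_cnj: "sobolev_fun (sobolev_cnj U) x = cnj (sobolev_fun U x)"
proof -
  have "sobolev_fun (sobolev_cnj U) x = fourier_const * fourier1 (\<lambda>\<xi>. cnj (sobolev_FT U (- \<xi>))) (- x)"
  proof (rule sobolev_fun_eqI)
    show "AE \<xi> in lborel. sobolev_FT (sobolev_cnj U) \<xi> = cnj (sobolev_FT U (- \<xi>))"
      unfolding sobolev_cnj_def using sobolev_FT_abs_lsq[OF square_integrable_cnj_rep_reflect]
      by eventually_elim (simp add: sobolev_FT_def)
  qed measurable
  also have "fourier1 (\<lambda>\<xi>. cnj (sobolev_FT U (- \<xi>))) (- x) = (LINT \<xi>|lborel. cnj (sobolev_FT U (0 - \<xi>)) * cis (- ((0 - \<xi>) \<bullet> x)))"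
    unfolding fourier1_def by simp
  also have "\<dots> = (LINT \<xi>|lborel. cnj (sobolev_FT U \<xi>) * cis (- (\<xi> \<bullet> x)))"
    by (rule integral_reflect[of "\<lambda>\<xi>. cnj (sobolev_FT U \<xi>) * cis (- (\<xi> \<bullet> x))"]) measurable
  also have "\<dots> = cnj (fourier1 (sobolev_FT U) (- x))"
    unfolding fourier1_def Bochner_Integration.integral_cnj[symmetric] by (simp add: cis_cnj)
  finally show ?thesis by (simp add: sobolev_fun_def fourier_const_def)
qed

lemma bounded_linear_sobolev_cnj: "bounded_linear sobolev_cnj"
proof (rule bounded_linear_intro[where K=1])
  show "sobolev_cnj (U + V) = sobolev_cnj U + sobolev_cnj V" for U V
    by (rule sobolev_fun_inj) (simp add: sobolev_fun_add sobolev_fun_cnj)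
  show "sobolev_cnj (r *\<^sub>R U) = r *\<^sub>R sobolev_cnj U" for r U
    by (rule sobolev_fun_inj) (simp add: sobolev_fun_scaleR sobolev_fun_cnj)
qed (simp add: norm_sobolev_cnj)

primrec sobolev_nonlin :: "nat \<Rightarrow> (real^'n) lsq \<Rightarrow> (real^'n) lsq" where
  "sobolev_nonlin 0 = (\<lambda>U. U)"
| "sobolev_nonlin (Suc k) = (\<lambda>U. sobolev_mult (sobolev_nonlin k U) (sobolev_mult U (sobolev_cnj U)))"

lemma sobolev_fun_nonlin: "sobolev_fun (sobolev_nonlin k U) x = nonlin k (sobolev_fun U) x"
proof (induction k)
  case 0
  show ?case by (simp add: nonlin_def)
next
  case (Suc k)
  have "complex_of_real (cmod z ^ (2 * Suc k)) = complex_of_real (cmod z ^ (2 * k)) * (z * cnj z)" for z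
    by (simp add: complex_norm_square[symmetric] power2_eq_square mult_ac)
  with Suc show ?case
    by (simp only: sobolev_nonlin.simps sobolev_fun_mult sobolev_fun_cnj nonlin_def mult.assoc)
qed

end

definition lipschitz_on_balls :: "('a::real_normed_vector \<Rightarrow> 'b::real_normed_vector) \<Rightarrow> bool" where
  "lipschitz_on_balls f \<longleftrightarrow> (\<forall>M. \<exists>L. L-lipschitz_on (cball 0 M) f)"

lemma lipschitz_on_balls_bounded:
  assumes "lipschitz_on_balls f"
  obtains B where "B \<ge> 0" "\<And>x. norm x \<le> M \<Longrightarrow> norm (f x) \<le> B" "B-lipschitz_on (cball 0 M) f"
proof -
  obtain L where L: "L-lipschitz_on (cball 0 M) f" using assms by (auto simp: lipschitz_on_balls_def)
  have "L \<ge> 0" using lipschitz_on_nonneg[OF L] .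
  show ?thesis
  proof (rule that[of "norm (f 0) + L * \<bar>M\<bar> + L"])
    show "norm (f 0) + L * \<bar>M\<bar> + L \<ge> 0" using \<open>L \<ge> 0\<close> by simp
    show "(norm (f 0) + L * \<bar>M\<bar> + L)-lipschitz_on (cball 0 M) f"
      using \<open>L \<ge> 0\<close> by (intro lipschitz_on_mono[OF L]) auto
    fix x :: 'a assume x: "norm x \<le> M"
    then have "norm (f x - f 0) \<le> L * norm x"
      using lipschitz_onD[OF L, of x 0] order_trans[OF norm_ge_zero x] by (simp add: dist_norm)
    also have "\<dots> \<le> L * \<bar>M\<bar>" using x \<open>L \<ge> 0\<close> by (intro mult_left_mono) auto
    finally show "norm (f x) \<le> norm (f 0) + L * \<bar>M\<bar> + L"
      using norm_triangle_sub[of "f x" "f 0"] \<open>L \<ge> 0\<close> by simp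
  qed
qed

lemma lipschitz_on_balls_continuous_on:
  assumes "lipschitz_on_balls f" shows "continuous_on S f"
proof -
  have "isCont f x" for x
  proof -
    obtain L where "L-lipschitz_on (cball 0 (norm x + 1)) f" using assms by (auto simp: lipschitz_on_balls_def)
    then have "continuous_on (cball 0 (norm x + 1)) f" by (rule lipschitz_on_continuous_on)
    then show ?thesis by (rule continuous_on_interior) (auto intro: interiorI[of "ball 0 (norm x + 1)"])
  qed
  then show ?thesis by (simp add: continuous_at_imp_continuous_on)
qed

lemma lipschitz_on_balls_linear: "bounded_linear f \<Longrightarrow> lipschitz_on_balls f"
  unfolding lipschitz_on_balls_def using bounded_linear.lipschitz_boundE by blast

lemma lipschitz_on_balls_bilinear:
  fixes f :: "'c::real_normed_vector \<Rightarrow> 'a::real_normed_vector" and g :: "'c \<Rightarrow> 'b::real_normed_vector"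
  assumes "bounded_bilinear mul" and f: "lipschitz_on_balls f" and g: "lipschitz_on_balls g"
  shows "lipschitz_on_balls (\<lambda>x. mul (f x) (g x))"
  unfolding lipschitz_on_balls_def
proof (rule allI)
  fix M :: real
  interpret bounded_bilinear mul by fact
  obtain K where K: "K > 0" "\<And>a b. norm (mul a b) \<le> norm a * norm b * K" using pos_bounded by blast
  obtain B where B: "B \<ge> 0" "\<And>x. norm x \<le> M \<Longrightarrow> norm (f x) \<le> B" "B-lipschitz_on (cball 0 M) f"
    using lipschitz_on_balls_bounded[OF f, of M] by blast
  obtain C where C: "C \<ge> 0" "\<And>x. norm x \<le> M \<Longrightarrow> norm (g x) \<le> C" "C-lipschitz_on (cball 0 M) g"
    using lipschitz_on_balls_bounded[OF g, of M] by blast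
  have "(2 * B * C * K)-lipschitz_on (cball 0 M) (\<lambda>x. mul (f x) (g x))"
  proof (rule lipschitz_onI)
    fix x y :: 'c assume xy: "x \<in> cball 0 M" "y \<in> cball 0 M"
    have "mul (f x) (g x) - mul (f y) (g y) = mul (f x - f y) (g x) + mul (f y) (g x - g y)"
      by (simp add: diff_left diff_right)
    then have "dist (mul (f x) (g x)) (mul (f y) (g y)) \<le> norm (f x - f y) * norm (g x) * K + norm (f y) * norm (g x - g y) * K"
      unfolding dist_norm by (simp only:) (intro norm_triangle_le add_mono K)
    also have "\<dots> \<le> (B * dist x y) * C * K + B * (C * dist x y) * K"
      using K B C xy lipschitz_onD[OF B(3) xy] lipschitz_onD[OF C(3) xy]
      by (intro add_mono mult_right_mono mult_mono) (auto simp: dist_norm)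
    finally show "dist (mul (f x) (g x)) (mul (f y) (g y)) \<le> 2 * B * C * K * dist x y"
      by (simp add: algebra_simps)
  qed (use K B C in simp)
  then show "\<exists>L. L-lipschitz_on (cball 0 M) (\<lambda>x. mul (f x) (g x))" ..
qed

lemma (in sobolev_space) lipschitz_on_balls_sobolev_nonlin: "lipschitz_on_balls (sobolev_nonlin k)"
proof (induction k)
  case 0
  show ?case by (simp add: lipschitz_on_balls_linear[OF bounded_linear_ident])
next
  case (Suc k)
  then show ?case
    unfolding sobolev_nonlin.simps
    by (intro lipschitz_on_balls_bilinear[OF bounded_bilinear_sobolev_mult]
        lipschitz_on_balls_linear[OF bounded_linear_ident] lipschitz_on_balls_linear[OF bounded_linear_sobolev_cnj])
qed

section \<open>Volterra equations in Banach spaces\<close>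

definition volterra_solution :: "(real \<Rightarrow> 'b \<Rightarrow> 'b) \<Rightarrow> real \<Rightarrow> 'b::banach \<Rightarrow> (real \<Rightarrow> 'b) \<Rightarrow> bool" where
  "volterra_solution F T U0 V \<longleftrightarrow> continuous_on {0..T} V \<and> (\<forall>t\<in>{0..T}. V t = U0 + integral {0..t} (\<lambda>\<tau>. F \<tau> (V \<tau>)))"

locale picard =
  fixes F :: "real \<Rightarrow> 'b::banach \<Rightarrow> 'b" and R T B :: real
  assumes R: "R > 0" and T: "T > 0" and B: "B \<ge> 0"
    and cont: "\<And>V. continuous_on {0..T} V \<Longrightarrow> continuous_on {0..T} (\<lambda>\<tau>. F \<tau> (V \<tau>))"
    and bound: "\<And>\<tau> U. norm U \<le> 2 * R \<Longrightarrow> norm (F \<tau> U) \<le> B"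
    and lipschitz: "\<And>\<tau>. B-lipschitz_on (cball 0 (2 * R)) (F \<tau>)"
    and maps_ball: "B * T \<le> R" and contracts: "B * T \<le> 1/2"
begin

definition admissible :: "(real \<Rightarrow> 'b) \<Rightarrow> bool" where
  "admissible V \<longleftrightarrow> continuous_on {0..T} V \<and> (\<forall>t\<in>{0..T}. norm (V t) \<le> 2 * R)"

lemma continuous_on_integrand:
  assumes "admissible V" "t \<in> {0..T}" shows "continuous_on {0..t} (\<lambda>\<tau>. F \<tau> (V \<tau>))"
  by (rule continuous_on_subset[OF cont]) (use assms in \<open>auto simp: admissible_def\<close>)

lemma integral_diff_le:
  assumes V: "admissible V" and V': "admissible V'" and t: "t \<in> {0..T}"
    and close: "\<And>\<tau>. \<tau> \<in> {0..T} \<Longrightarrow> norm (V \<tau> - V' \<tau>) \<le> d"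
  shows "norm (integral {0..t} (\<lambda>\<tau>. F \<tau> (V \<tau>)) - integral {0..t} (\<lambda>\<tau>. F \<tau> (V' \<tau>))) \<le> d / 2"
proof -
  have d: "0 \<le> d" using close[OF t] norm_ge_zero order_trans by blast
  have "integral {0..t} (\<lambda>\<tau>. F \<tau> (V \<tau>)) - integral {0..t} (\<lambda>\<tau>. F \<tau> (V' \<tau>)) = integral {0..t} (\<lambda>\<tau>. F \<tau> (V \<tau>) - F \<tau> (V' \<tau>))"
    by (rule Henstock_Kurzweil_Integration.integral_diff[symmetric]; rule integrable_continuous_interval)
       (rule continuous_on_integrand[OF V t] continuous_on_integrand[OF V' t])+
  also have "norm \<dots> \<le> (B * d) * (t - 0)"
  proof (rule integral_bound)
    fix \<tau> assume "\<tau> \<in> {0..t}"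
    then have \<tau>: "\<tau> \<in> {0..T}" using t by auto
    have "norm (F \<tau> (V \<tau>) - F \<tau> (V' \<tau>)) \<le> B * norm (V \<tau> - V' \<tau>)"
      using lipschitz_onD[OF lipschitz, of "V \<tau>" "V' \<tau>" \<tau>] V V' \<tau> by (auto simp: admissible_def dist_norm)
    also have "\<dots> \<le> B * d" using close[OF \<tau>] B by (rule mult_left_mono)
    finally show "norm (F \<tau> (V \<tau>) - F \<tau> (V' \<tau>)) \<le> B * d" .
  qed (use t in \<open>auto intro!: continuous_on_diff continuous_on_integrand V V'\<close>)
  also have "\<dots> \<le> (B * d) * T" using t B d by (intro mult_left_mono) auto
  also have "\<dots> = (B * T) * d" by simp
  also have "\<dots> \<le> (1/2) * d" using contracts d by (rule mult_right_mono)
  finally show ?thesis by simp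
qed

definition picard_map :: "'b \<Rightarrow> (real \<Rightarrow> 'b) \<Rightarrow> real \<Rightarrow> 'b" where
  "picard_map U0 V t = U0 + integral {0..t} (\<lambda>\<tau>. F \<tau> (V \<tau>))"

lemma norm_picard_map_diff_le:
  assumes V: "admissible V" and t: "t \<in> {0..T}"
  shows "norm (picard_map U0 V t - U0) \<le> R"
proof -
  have "norm (picard_map U0 V t - U0) = norm (integral {0..t} (\<lambda>\<tau>. F \<tau> (V \<tau>)))" by (simp add: picard_map_def)
  also have "\<dots> \<le> B * (t - 0)"
    by (rule integral_bound[OF _ continuous_on_integrand[OF V t]]) (use V t in \<open>auto intro!: bound simp: admissible_def\<close>)
  also have "\<dots> \<le> B * T" using t B by (intro mult_left_mono) auto
  finally show ?thesis using maps_ball by simp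
qed

lemma admissible_picard_map:
  assumes U0: "norm U0 \<le> R" and V: "admissible V"
  shows "admissible (picard_map U0 V)"
  unfolding admissible_def
proof
  have "T \<in> {0..T}" using T by simp
  then show "continuous_on {0..T} (picard_map U0 V)"
    unfolding picard_map_def[abs_def]
    by (intro continuous_on_add continuous_on_const indefinite_integral_continuous_1 integrable_continuous_interval
        continuous_on_integrand[OF V])
  show "\<forall>t\<in>{0..T}. norm (picard_map U0 V t) \<le> 2 * R"
  proof
    fix t assume "t \<in> {0..T}"
    from norm_picard_map_diff_le[OF V this, of U0] U0 norm_triangle_sub[of "picard_map U0 V t" U0]
    show "norm (picard_map U0 V t) \<le> 2 * R" by linarith
  qed
qed

primrec picard_iterate :: "'b \<Rightarrow> nat \<Rightarrow> real \<Rightarrow> 'b" where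
  "picard_iterate U0 0 = (\<lambda>_. U0)"
| "picard_iterate U0 (Suc n) = picard_map U0 (picard_iterate U0 n)"

lemma admissible_picard_iterate: "norm U0 \<le> R \<Longrightarrow> admissible (picard_iterate U0 n)"
proof (induction n)
  case 0
  then show ?case using R by (simp add: admissible_def)
next
  case (Suc n)
  then show ?case by (simp add: admissible_picard_map)
qed

lemma norm_picard_iterate_step_le:
  assumes U0: "norm U0 \<le> R" and "t \<in> {0..T}"
  shows "norm (picard_iterate U0 (Suc n) t - picard_iterate U0 n t) \<le> R * (1/2) ^ n"
  using assms(2)
proof (induction n arbitrary: t)
  case 0
  then show ?case using norm_picard_map_diff_le[OF admissible_picard_iterate[OF U0, of 0]] by simp
next
  case (Suc n)
  have "picard_iterate U0 (Suc (Suc n)) t - picard_iterate U0 (Suc n) t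
      = integral {0..t} (\<lambda>\<tau>. F \<tau> (picard_iterate U0 (Suc n) \<tau>)) - integral {0..t} (\<lambda>\<tau>. F \<tau> (picard_iterate U0 n \<tau>))"
    by (simp add: picard_map_def[of U0 _ t])
  also have "norm \<dots> \<le> (R * (1/2) ^ n) / 2"
    by (rule integral_diff_le[OF admissible_picard_iterate[OF U0] admissible_picard_iterate[OF U0] Suc.prems Suc.IH])
  finally show ?case by simp
qed

definition picard_limit :: "'b \<Rightarrow> real \<Rightarrow> 'b" where
  "picard_limit U0 t = U0 + (\<Sum>n. picard_iterate U0 (Suc n) t - picard_iterate U0 n t)"

lemma uniform_limit_picard_iterate:
  assumes "norm U0 \<le> R"
  shows "uniform_limit {0..T} (picard_iterate U0) (picard_limit U0) sequentially"
proof -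
  let ?d = "\<lambda>n t. picard_iterate U0 (Suc n) t - picard_iterate U0 n t"
  have "uniform_limit {0..T} (\<lambda>n t. \<Sum>i<n. ?d i t) (\<lambda>t. \<Sum>i. ?d i t) sequentially"
  proof (rule Weierstrass_m_test)
    show "norm (?d n t) \<le> R * (1/2) ^ n" if "t \<in> {0..T}" for n t
      by (rule norm_picard_iterate_step_le[OF assms that])
    show "summable (\<lambda>n. R * (1/2) ^ n)" by (intro summable_mult summable_geometric) simp
  qed
  moreover have "(\<Sum>i<n. ?d i t) = picard_iterate U0 n t - U0" for n t
    using sum_lessThan_telescope[of "\<lambda>n. picard_iterate U0 n t" n] by simp
  ultimately have "uniform_limit {0..T} (\<lambda>n t. picard_iterate U0 n t - U0) (\<lambda>t. \<Sum>i. ?d i t) sequentially"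
    by (simp only:)
  from uniform_limit_add[OF uniform_limit_const this, of "\<lambda>_. U0"] show ?thesis
    by (simp add: picard_limit_def[abs_def])
qed

lemma tendsto_picard_iterate:
  "norm U0 \<le> R \<Longrightarrow> t \<in> {0..T} \<Longrightarrow> (\<lambda>n. picard_iterate U0 n t) \<longlonglongrightarrow> picard_limit U0 t"
  by (rule tendsto_uniform_limitI[OF uniform_limit_picard_iterate])

lemma admissible_picard_limit:
  assumes "norm U0 \<le> R" shows "admissible (picard_limit U0)"
  unfolding admissible_def
proof
  show "continuous_on {0..T} (picard_limit U0)"
    by (rule uniform_limit_theorem[OF _ uniform_limit_picard_iterate[OF assms]])
       (use admissible_picard_iterate[OF assms] in \<open>auto simp: admissible_def\<close>)
  show "\<forall>t\<in>{0..T}. norm (picard_limit U0 t) \<le> 2 * R"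
  proof
    fix t assume t: "t \<in> {0..T}"
    show "norm (picard_limit U0 t) \<le> 2 * R"
      by (rule LIMSEQ_le_const2[OF tendsto_norm[OF tendsto_picard_iterate[OF assms t]]])
         (use admissible_picard_iterate[OF assms] t in \<open>auto simp: admissible_def\<close>)
  qed
qed

lemma picard_map_picard_limit:
  assumes U0: "norm U0 \<le> R" and t: "t \<in> {0..T}"
  shows "picard_limit U0 t = picard_map U0 (picard_limit U0) t"
proof -
  have "(\<lambda>n. picard_map U0 (picard_iterate U0 n) t) \<longlonglongrightarrow> picard_map U0 (picard_limit U0) t"
  proof (rule LIMSEQ_I)
    fix e :: real assume "e > 0"
    then obtain N where N: "\<And>n \<tau>. n \<ge> N \<Longrightarrow> \<tau> \<in> {0..T} \<Longrightarrow> dist (picard_iterate U0 n \<tau>) (picard_limit U0 \<tau>) < e"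
      using uniform_limit_picard_iterate[OF U0] unfolding uniform_limit_sequentially_iff by metis
    show "\<exists>no. \<forall>n\<ge>no. norm (picard_map U0 (picard_iterate U0 n) t - picard_map U0 (picard_limit U0) t) < e"
    proof (intro exI allI impI)
      fix n assume n: "n \<ge> N"
      have "norm (picard_map U0 (picard_iterate U0 n) t - picard_map U0 (picard_limit U0) t) \<le> e / 2"
        unfolding picard_map_def add_diff_cancel_left
        by (rule integral_diff_le[OF admissible_picard_iterate[OF U0] admissible_picard_limit[OF U0] t])
           (use N[OF n] in \<open>auto simp: dist_norm less_imp_le\<close>)
      then show "norm (picard_map U0 (picard_iterate U0 n) t - picard_map U0 (picard_limit U0) t) < e"
        using \<open>e > 0\<close> by linarith
    qed
  qed
  moreover have "(\<lambda>n. picard_map U0 (picard_iterate U0 n) t) \<longlonglongrightarrow> picard_limit U0 t"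
    using LIMSEQ_Suc[OF tendsto_picard_iterate[OF U0 t]] by simp
  ultimately show ?thesis using LIMSEQ_unique by blast
qed

lemma volterra_solution_picard_limit:
  assumes "norm U0 \<le> R" shows "volterra_solution F T U0 (picard_limit U0)"
  using admissible_picard_limit[OF assms] picard_map_picard_limit[OF assms]
  by (simp add: volterra_solution_def admissible_def picard_map_def)

lemma norm_picard_limit_diff_le:
  assumes U0: "norm U0 \<le> R" and V0: "norm V0 \<le> R" and t: "t \<in> {0..T}"
  shows "norm (picard_limit U0 t - picard_limit V0 t) \<le> 2 * norm (U0 - V0)"
proof -
  let ?U = "picard_limit U0" and ?V = "picard_limit V0"
  have "continuous_on {0..T} (\<lambda>t. norm (?U t - ?V t))"
    using admissible_picard_limit[OF U0] admissible_picard_limit[OF V0]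
    by (intro continuous_on_norm continuous_on_diff) (auto simp: admissible_def)
  from continuous_attains_sup[OF compact_Icc _ this] t
  obtain t0 where t0: "t0 \<in> {0..T}" "\<And>\<tau>. \<tau> \<in> {0..T} \<Longrightarrow> norm (?U \<tau> - ?V \<tau>) \<le> norm (?U t0 - ?V t0)" by blast
  let ?m = "norm (?U t0 - ?V t0)"
  have "?U t0 - ?V t0 = (U0 - V0) + (integral {0..t0} (\<lambda>\<tau>. F \<tau> (?U \<tau>)) - integral {0..t0} (\<lambda>\<tau>. F \<tau> (?V \<tau>)))"
    by (subst picard_map_picard_limit[OF U0 t0(1)], subst picard_map_picard_limit[OF V0 t0(1)]) (simp add: picard_map_def)
  also have "norm \<dots> \<le> norm (U0 - V0) + norm (integral {0..t0} (\<lambda>\<tau>. F \<tau> (?U \<tau>)) - integral {0..t0} (\<lambda>\<tau>. F \<tau> (?V \<tau>)))"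
    by (rule norm_triangle_ineq)
  also have "norm (integral {0..t0} (\<lambda>\<tau>. F \<tau> (?U \<tau>)) - integral {0..t0} (\<lambda>\<tau>. F \<tau> (?V \<tau>))) \<le> ?m / 2"
    by (rule integral_diff_le[OF admissible_picard_limit[OF U0] admissible_picard_limit[OF V0] t0])
  finally have "?m \<le> 2 * norm (U0 - V0)" by simp
  with t0(2)[OF t] show ?thesis by linarith
qed

end

lemma volterra_local_wellposedness:
  fixes F :: "real \<Rightarrow> 'b::banach \<Rightarrow> 'b"
  assumes R: "R > 0" and B: "B \<ge> 0"
    and cont: "\<And>T V. continuous_on {0..T} V \<Longrightarrow> continuous_on {0..T} (\<lambda>\<tau>. F \<tau> (V \<tau>))"
    and bound: "\<And>\<tau> U. norm U \<le> 2 * R \<Longrightarrow> norm (F \<tau> U) \<le> B"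
    and lipschitz: "\<And>\<tau>. B-lipschitz_on (cball 0 (2 * R)) (F \<tau>)"
  obtains T S where "T > 0" "\<And>U. norm U \<le> R \<Longrightarrow> volterra_solution F T U (S U)"
    "\<And>U V t. norm U \<le> R \<Longrightarrow> norm V \<le> R \<Longrightarrow> t \<in> {0..T} \<Longrightarrow> norm (S U t - S V t) \<le> 2 * norm (U - V)"
proof -
  define T where "T = min R (1/2) / (B + 1)"
  have T: "T > 0" unfolding T_def using R B by simp
  have "B * T = B / (B + 1) * min R (1/2)" by (simp add: T_def)
  also have "\<dots> \<le> 1 * min R (1/2)" using B R by (intro mult_right_mono) (auto simp: divide_le_eq_1)
  finally have "B * T \<le> min R (1/2)" by simp
  then interpret picard F R T B
    by unfold_locales (use R T B cont bound lipschitz in auto)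
  show ?thesis
    by (rule that[OF T volterra_solution_picard_limit norm_picard_limit_diff_le])
qed

lemma norm_integral_le_exp:
  fixes f :: "real \<Rightarrow> 'b::banach"
  assumes "0 \<le> t" "L > 0" "0 \<le> m" and cont: "continuous_on {0..t} f"
    and f_le: "\<And>\<tau>. \<tau> \<in> {0..t} \<Longrightarrow> norm (f \<tau>) \<le> L * (m * exp (2 * L * \<tau>))"
  shows "norm (integral {0..t} f) \<le> m / 2 * exp (2 * L * t)"
proof -
  have "((\<lambda>\<tau>. L * (m * exp (2 * L * \<tau>))) has_integral (m / 2 * exp (2 * L * t) - m / 2 * exp (2 * L * 0))) {0..t}"
  proof (rule fundamental_theorem_of_calculus[OF \<open>0 \<le> t\<close>])
    show "((\<lambda>\<tau>. m / 2 * exp (2 * L * \<tau>)) has_vector_derivative L * (m * exp (2 * L * \<tau>))) (at \<tau> within {0..t})" for \<tau>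
      unfolding has_real_derivative_iff_has_vector_derivative[symmetric]
      by (auto intro!: derivative_eq_intros)
  qed
  then have "norm (integral {0..t} f) \<le> m / 2 * exp (2 * L * t) - m / 2 * exp (2 * L * 0)"
    using integral_norm_bound_integral[OF integrable_continuous_interval[OF cont] _ f_le]
    by (metis has_integral_integrable integral_unique)
  then show ?thesis using assms(3) by simp
qed

text \<open>Gronwall: at a maximum of \<open>exp (- 2 L t) * norm (V t - V' t)\<close> the integral equation halves the value.\<close>

lemma eq_0_if_norm_le_half_weighted:
  fixes D :: "real \<Rightarrow> 'b::real_normed_vector"
  assumes D: "continuous_on {0..T} D" and t: "t \<in> {0..T}"
    and half: "\<And>t0 K. t0 \<in> {0..T} \<Longrightarrow> (\<And>\<tau>. \<tau> \<in> {0..T} \<Longrightarrow> norm (D \<tau>) \<le> K * exp (c * \<tau>))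
      \<Longrightarrow> norm (D t0) \<le> K / 2 * exp (c * t0)"
  shows "D t = 0"
proof -
  let ?g = "\<lambda>t. exp (- (c * t)) * norm (D t)"
  have "continuous_on {0..T} ?g" by (intro continuous_intros D)
  from continuous_attains_sup[OF compact_Icc _ this] t
  obtain t0 where t0: "t0 \<in> {0..T}" "\<And>\<tau>. \<tau> \<in> {0..T} \<Longrightarrow> ?g \<tau> \<le> ?g t0" by blast
  have D_le: "norm (D \<tau>) \<le> ?g t0 * exp (c * \<tau>)" if "\<tau> \<in> {0..T}" for \<tau>
  proof -
    have "norm (D \<tau>) = ?g \<tau> * exp (c * \<tau>)" by (simp add: exp_minus)
    also have "\<dots> \<le> ?g t0 * exp (c * \<tau>)" by (intro mult_right_mono t0(2)[OF that]) simp
    finally show ?thesis .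
  qed
  have "?g t0 \<le> ?g t0 / 2" using half[OF t0(1) D_le] by (simp add: exp_minus field_simps)
  moreover have "?g t0 \<ge> 0" by simp
  ultimately have "?g t0 = 0" by linarith
  with D_le[OF t] show ?thesis by (simp only: mult_zero_left norm_le_zero_iff)
qed

lemma volterra_solution_unique:
  fixes F :: "real \<Rightarrow> 'b::banach \<Rightarrow> 'b"
  assumes V: "volterra_solution F T U0 V" and V': "volterra_solution F T U0 V'"
    and cont: "\<And>V. continuous_on {0..T} V \<Longrightarrow> continuous_on {0..T} (\<lambda>\<tau>. F \<tau> (V \<tau>))"
    and lipschitz: "\<And>M. \<exists>L. \<forall>\<tau>. L-lipschitz_on (cball 0 M) (F \<tau>)" and t: "t \<in> {0..T}"
  shows "V t = V' t"
proof -
  have cont_V: "continuous_on {0..T} V" "continuous_on {0..T} V'"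
    using V V' by (simp_all add: volterra_solution_def)
  have diff_eq: "V t - V' t = integral {0..t} (\<lambda>\<tau>. F \<tau> (V \<tau>)) - integral {0..t} (\<lambda>\<tau>. F \<tau> (V' \<tau>))" if "t \<in> {0..T}" for t
    using V V' that unfolding volterra_solution_def by (metis add_diff_cancel_left)
  have "bounded (V ` {0..T} \<union> V' ` {0..T})"
    by (intro compact_imp_bounded compact_Un compact_continuous_image cont_V compact_Icc)
  then obtain M where M: "\<And>t. t \<in> {0..T} \<Longrightarrow> norm (V t) \<le> M \<and> norm (V' t) \<le> M"
    unfolding bounded_iff by blast
  obtain K where K: "\<And>\<tau>. K-lipschitz_on (cball 0 M) (F \<tau>)" using lipschitz by blast
  define L where "L = K + 1"
  have L: "L > 0" using lipschitz_on_nonneg[OF K] by (simp add: L_def)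
  have "V t - V' t = 0" using continuous_on_diff[OF cont_V] t
  proof (rule eq_0_if_norm_le_half_weighted)
    fix t0 N :: real
    assume t0: "t0 \<in> {0..T}" and diff_le: "\<And>\<tau>. \<tau> \<in> {0..T} \<Longrightarrow> norm (V \<tau> - V' \<tau>) \<le> N * exp (2 * L * \<tau>)"
    have "0 \<le> N * exp (2 * L * t0)" using diff_le[OF t0] by (rule order_trans[OF norm_ge_zero])
    then have N: "N \<ge> 0" by (simp add: zero_le_mult_iff)
    have cont_F: "continuous_on {0..t0} (\<lambda>\<tau>. F \<tau> (V \<tau>))" "continuous_on {0..t0} (\<lambda>\<tau>. F \<tau> (V' \<tau>))"
      by (rule continuous_on_subset[OF cont[OF cont_V(1)]] continuous_on_subset[OF cont[OF cont_V(2)]], use t0 in simp)+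
    have "norm (V t0 - V' t0) = norm (integral {0..t0} (\<lambda>\<tau>. F \<tau> (V \<tau>) - F \<tau> (V' \<tau>)))"
      unfolding diff_eq[OF t0]
      by (subst Henstock_Kurzweil_Integration.integral_diff) (auto intro!: integrable_continuous_interval cont_F)
    also have "\<dots> \<le> N / 2 * exp (2 * L * t0)"
    proof (rule norm_integral_le_exp[OF _ L])
      fix \<tau> assume "\<tau> \<in> {0..t0}"
      then have \<tau>: "\<tau> \<in> {0..T}" using t0 by auto
      have "norm (F \<tau> (V \<tau>) - F \<tau> (V' \<tau>)) \<le> L * norm (V \<tau> - V' \<tau>)"
        using lipschitz_onD[OF K[of \<tau>], of "V \<tau>" "V' \<tau>"] M[OF \<tau>] by (simp add: dist_norm L_def distrib_right add_increasing2)
      also have "\<dots> \<le> L * (N * exp (2 * L * \<tau>))" using L by (intro mult_left_mono diff_le \<tau>) simp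
      finally show "norm (F \<tau> (V \<tau>) - F \<tau> (V' \<tau>)) \<le> L * (N * exp (2 * L * \<tau>))" .
    qed (use t0 N in \<open>auto intro!: continuous_on_diff cont_F\<close>)
    finally show "norm (V t0 - V' t0) \<le> N / 2 * exp (2 * L * t0)" .
  qed
  then show ?thesis by simp
qed

section \<open>The interaction picture\<close>

definition phase :: "real \<Rightarrow> real \<Rightarrow> real" where "phase \<alpha> t = t powr (\<alpha> + 1) / (\<alpha> + 1)"

lemma phase_0: "phase \<alpha> 0 = 0"
  by (simp add: phase_def)

lemma phase_measurable [measurable]: "phase \<alpha> \<in> borel_measurable borel"
  unfolding phase_def[abs_def] by measurable

lemma continuous_on_phase: "\<alpha> > 0 \<Longrightarrow> continuous_on {0..T} (phase \<alpha>)"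
  unfolding phase_def[abs_def] by (intro continuous_intros continuous_on_powr') auto

definition propagator :: "real \<Rightarrow> 'a::euclidean_space lsq \<Rightarrow> 'a lsq" where
  "propagator \<theta> = mult_op (\<lambda>\<xi>. cis (\<theta> * (norm \<xi>)\<^sup>2))"

lemma propagator_multiplier:
  "(\<lambda>\<xi>. cis (\<theta> * (norm \<xi>)\<^sup>2)) \<in> borel_measurable borel" "cmod (cis (\<theta> * (norm \<xi>)\<^sup>2)) \<le> 1"
proof -
  show "(\<lambda>\<xi>. cis (\<theta> * (norm \<xi>)\<^sup>2)) \<in> borel_measurable borel" by measurable
qed simp

lemma bounded_linear_propagator: "bounded_linear (propagator \<theta>)"
  unfolding propagator_def by (rule bounded_linear_mult_op[OF propagator_multiplier])

lemma rep_propagator: "AE \<xi> in lborel. rep_lsq (propagator \<theta> U) \<xi> = cis (\<theta> * (norm \<xi>)\<^sup>2) * rep_lsq U \<xi>"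
  unfolding propagator_def by (rule rep_mult_op[OF propagator_multiplier])

lemma propagator_propagator: "propagator \<theta> (propagator \<theta>' U) = propagator (\<theta> + \<theta>') U"
  unfolding propagator_def
  by (subst mult_op_mult_op[OF propagator_multiplier propagator_multiplier]) (simp add: cis_mult distrib_right)

lemma propagator_0 [simp]: "propagator 0 U = U"
  by (simp add: propagator_def mult_op_one)

lemma propagator_cancel [simp]:
  "propagator \<theta> (propagator (- \<theta>) U) = U" "propagator (- \<theta>) (propagator \<theta> U) = U"
  by (simp_all add: propagator_propagator)

lemma norm_propagator [simp]: "norm (propagator \<theta> U) = norm U"
proof (rule antisym)
  have contraction: "norm (propagator \<theta> U) \<le> norm U" for \<theta> and U :: "'a lsq"
    using norm_mult_op_le[OF propagator_multiplier, of \<theta> U] by (simp add: propagator_def)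
  show "norm (propagator \<theta> U) \<le> norm U" by (rule contraction)
  show "norm U \<le> norm (propagator \<theta> U)" using contraction[of "- \<theta>" "propagator \<theta> U"] by simp
qed

lemma propagator_diff: "propagator \<theta> (U - V) = propagator \<theta> U - propagator \<theta> V"
  by (rule linear_diff[OF bounded_linear.linear[OF bounded_linear_propagator]])

lemma propagator_add: "propagator \<theta> (U + V) = propagator \<theta> U + propagator \<theta> V"
  by (rule linear_add[OF bounded_linear.linear[OF bounded_linear_propagator]])

lemma propagator_eq_iff: "propagator \<theta> U = V \<longleftrightarrow> U = propagator (- \<theta>) V"
  by auto

lemma tendsto_propagator:
  fixes U :: "nat \<Rightarrow> 'a::euclidean_space lsq"
  assumes \<theta>: "\<theta> \<longlonglongrightarrow> \<theta>0" and U: "U \<longlonglongrightarrow> U0"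
  shows "(\<lambda>n. propagator (\<theta> n) (U n)) \<longlonglongrightarrow> propagator \<theta>0 U0"
proof -
  have "(\<lambda>n. propagator (\<theta> n) U0) \<longlonglongrightarrow> propagator \<theta>0 U0"
    unfolding propagator_def
  proof (rule tendsto_mult_op[where C=1])
    fix \<xi> :: 'a
    show "(\<lambda>n. cis (\<theta> n * (norm \<xi>)\<^sup>2)) \<longlonglongrightarrow> cis (\<theta>0 * (norm \<xi>)\<^sup>2)"
      unfolding cis_conv_exp by (intro tendsto_exp tendsto_mult tendsto_of_real tendsto_const \<theta>)
  qed (rule propagator_multiplier)+
  moreover have "(\<lambda>n. norm (propagator (\<theta> n) (U n - U0))) \<longlonglongrightarrow> 0"
    using U by (simp add: tendsto_norm_zero_iff LIM_zero_iff)
  ultimately have "(\<lambda>n. propagator (\<theta> n) U0 + propagator (\<theta> n) (U n - U0)) \<longlonglongrightarrow> propagator \<theta>0 U0 + 0"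
    by (intro tendsto_add) (simp_all only: tendsto_norm_zero_iff)
  then show ?thesis by (simp flip: propagator_add)
qed

lemma continuous_on_propagator:
  fixes f :: "'b::metric_space \<Rightarrow> real"
  assumes "continuous_on S f" "continuous_on S g"
  shows "continuous_on S (\<lambda>t. propagator (f t) (g t))"
  using assms unfolding continuous_on_sequentially comp_def by (auto intro!: tendsto_propagator)

context sobolev_space
begin

definition weighted_FT :: "(real^'n \<Rightarrow> complex) \<Rightarrow> (real^'n) lsq" where
  "weighted_FT f = abs_lsq (\<lambda>\<xi>. of_real (bessel_weight s \<xi>) * FT f \<xi>)"

lemma cmod_weight_mult_sq: "(cmod (of_real (bessel_weight s \<xi>) * z))\<^sup>2 = (1 + (norm \<xi>)\<^sup>2) powr s * (cmod z)\<^sup>2"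
  by (simp add: norm_mult power_mult_distrib bessel_weight_sq)

lemma FT_measurable: "square_integrable f \<Longrightarrow> FT f \<in> borel_measurable borel"
  by (rule square_integrable_measurable_borel[OF square_integrable_FT_abs(1)])

lemma sobolev_iff:
  "f \<in> sobolev s \<longleftrightarrow> square_integrable f \<and> square_integrable (\<lambda>\<xi>::real^'n. of_real (bessel_weight s \<xi>) * FT f \<xi>)"
proof (cases "square_integrable f")
  case True
  then have [measurable]: "FT f \<in> borel_measurable borel" by (rule FT_measurable)
  have "(\<lambda>\<xi>. of_real (bessel_weight s \<xi>) * FT f \<xi>) \<in> borel_measurable lborel" by measurable
  with True show ?thesis
    unfolding sobolev_def mem_Collect_eq L2_eq_square_integrable
      square_integrable_def[of "\<lambda>\<xi>. of_real (bessel_weight s \<xi>) * FT f \<xi>"] cmod_weight_mult_sq by simp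
qed (simp add: sobolev_def L2_eq_square_integrable)

lemma sobolev_square_integrable: "f \<in> sobolev s \<Longrightarrow> square_integrable f" for f :: "real^'n \<Rightarrow> complex"
  by (simp add: sobolev_iff)

lemma sobolev_measurable: "f \<in> sobolev s \<Longrightarrow> f \<in> borel_measurable borel" for f :: "real^'n \<Rightarrow> complex"
  by (rule square_integrable_measurable_borel[OF sobolev_square_integrable])

lemma hs_norm_eq: "f \<in> sobolev s \<Longrightarrow> hs_norm s f = norm (weighted_FT f)"
proof -
  assume "f \<in> sobolev s"
  then have "square_integrable (\<lambda>\<xi>. of_real (bessel_weight s \<xi>) * FT f \<xi>)" by (simp add: sobolev_iff)
  from norm_abs_lsq_sq[OF this]
  have "(norm (weighted_FT f))\<^sup>2 = (LINT \<xi>|lborel. (1 + (norm \<xi>)\<^sup>2) powr s * (cmod (FT f \<xi>))\<^sup>2)"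
    by (simp only: weighted_FT_def cmod_weight_mult_sq)
  then show ?thesis unfolding hs_norm_def by (metis norm_ge_zero real_sqrt_unique)
qed

lemma weighted_FT_eqI:
  assumes f: "f \<in> borel_measurable borel" and AE: "AE x in lborel. f x = sobolev_fun U x"
  shows sobolev_memI: "f \<in> sobolev s" and weighted_FT_eq: "weighted_FT f = U"
proof -
  have L2: "square_integrable f"
    using f AE by (intro square_integrable_cong_AE[OF square_integrable_sobolev_fun]) auto
  have "abs_lsq f = inv_fourier_lsq (abs_lsq (sobolev_FT U))"
    unfolding abs_sobolev_fun[symmetric] by (rule abs_lsq_eqI[OF L2 square_integrable_sobolev_fun AE])
  then have "fourier_lsq (abs_lsq f) = abs_lsq (sobolev_FT U)" by (simp only: fourier_lsq_inv_fourier_lsq)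
  with FT_AE[OF L2] rep_abs_lsq[OF square_integrable_sobolev_FT[of U]] have "AE \<xi> in lborel. FT f \<xi> = sobolev_FT U \<xi>" by auto
  then have rep: "AE \<xi> in lborel. rep_lsq U \<xi> = of_real (bessel_weight s \<xi>) * FT f \<xi>"
    by eventually_elim (simp add: rep_eq_sobolev_FT)
  have [measurable]: "FT f \<in> borel_measurable borel" by (rule FT_measurable[OF L2])
  have weighted: "square_integrable (\<lambda>\<xi>. of_real (bessel_weight s \<xi>) * FT f \<xi>)"
    by (rule square_integrable_cong_AE[OF square_integrable_rep _ rep]) measurable
  show "f \<in> sobolev s" using L2 weighted by (simp add: sobolev_iff)
  show "weighted_FT f = U" unfolding weighted_FT_def by (rule lsq_eqI_abs[OF weighted rep, symmetric])
qed

lemma sobolev_fun_mem: "sobolev_fun U \<in> sobolev s" and weighted_FT_sobolev_fun [simp]: "weighted_FT (sobolev_fun U) = U"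
  using weighted_FT_eqI[of "sobolev_fun U" U] by simp_all

lemma rep_weighted_FT:
  "f \<in> sobolev s \<Longrightarrow> AE \<xi> in lborel. rep_lsq (weighted_FT f) \<xi> = of_real (bessel_weight s \<xi>) * FT f \<xi>"
  unfolding weighted_FT_def by (rule rep_abs_lsq) (simp add: sobolev_iff)

lemma sobolev_FT_weighted_FT:
  assumes "f \<in> sobolev s" shows "AE \<xi> in lborel. sobolev_FT (weighted_FT f) \<xi> = FT f \<xi>"
  using rep_weighted_FT[OF assms] by eventually_elim (simp add: sobolev_FT_def)

lemma sobolev_fun_weighted_FT:
  assumes "f \<in> sobolev s" shows "AE x in lborel. f x = sobolev_fun (weighted_FT f) x"
proof -
  have L2: "square_integrable f" using assms by (rule sobolev_square_integrable)
  have "abs_lsq f = inv_fourier_lsq (abs_lsq (FT f))"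
    by (simp add: square_integrable_FT_abs(2)[OF L2] inv_fourier_lsq_fourier_lsq)
  also have "abs_lsq (FT f) = abs_lsq (sobolev_FT (weighted_FT f))"
    by (rule abs_lsq_eqI[OF square_integrable_FT_abs(1)[OF L2] square_integrable_sobolev_FT])
       (use sobolev_FT_weighted_FT[OF assms] in auto)
  also have "inv_fourier_lsq \<dots> = abs_lsq (sobolev_fun (weighted_FT f))" by (rule abs_sobolev_fun[symmetric])
  finally have "abs_lsq f = abs_lsq (sobolev_fun (weighted_FT f))" .
  with rep_abs_lsq[OF L2] rep_abs_lsq[OF square_integrable_sobolev_fun[of "weighted_FT f"]] show ?thesis by auto
qed

lemma
  assumes f: "f \<in> sobolev s" and g: "g \<in> sobolev s"
  shows sobolev_add: "(\<lambda>x. f x + g x) \<in> sobolev s"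
    and weighted_FT_add: "weighted_FT (\<lambda>x. f x + g x) = weighted_FT f + weighted_FT g"
    and sobolev_diff: "(\<lambda>x. f x - g x) \<in> sobolev s"
    and weighted_FT_diff: "weighted_FT (\<lambda>x. f x - g x) = weighted_FT f - weighted_FT g"
proof -
  note [measurable] = f[THEN sobolev_measurable] g[THEN sobolev_measurable]
  have "AE x in lborel. f x + g x = sobolev_fun (weighted_FT f + weighted_FT g) x"
    using sobolev_fun_weighted_FT[OF f] sobolev_fun_weighted_FT[OF g] by eventually_elim (simp add: sobolev_fun_add)
  from weighted_FT_eqI[OF _ this]
  show "(\<lambda>x. f x + g x) \<in> sobolev s" "weighted_FT (\<lambda>x. f x + g x) = weighted_FT f + weighted_FT g" by simp_all
  have "AE x in lborel. f x - g x = sobolev_fun (weighted_FT f - weighted_FT g) x"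
    using sobolev_fun_weighted_FT[OF f] sobolev_fun_weighted_FT[OF g] by eventually_elim (simp add: sobolev_fun_diff)
  from weighted_FT_eqI[OF _ this]
  show "(\<lambda>x. f x - g x) \<in> sobolev s" "weighted_FT (\<lambda>x. f x - g x) = weighted_FT f - weighted_FT g" by simp_all
qed

lemma
  assumes f: "f \<in> sobolev s"
  shows sobolev_cmult: "(\<lambda>x. c * f x) \<in> sobolev s"
    and weighted_FT_cmult: "weighted_FT (\<lambda>x. c * f x) = mult_op (\<lambda>_. c) (weighted_FT f)"
    and sobolev_nonlin_mem: "nonlin k f \<in> sobolev s"
    and weighted_FT_nonlin: "weighted_FT (nonlin k f) = sobolev_nonlin k (weighted_FT f)"
proof -
  note [measurable] = sobolev_measurable[OF f]
  have "AE x in lborel. c * f x = sobolev_fun (mult_op (\<lambda>_. c) (weighted_FT f)) x"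
    using sobolev_fun_weighted_FT[OF f] by eventually_elim (simp add: sobolev_fun_mult_op_const)
  from weighted_FT_eqI[OF _ this]
  show "(\<lambda>x. c * f x) \<in> sobolev s" "weighted_FT (\<lambda>x. c * f x) = mult_op (\<lambda>_. c) (weighted_FT f)" by simp_all
  have "AE x in lborel. nonlin k f x = sobolev_fun (sobolev_nonlin k (weighted_FT f)) x"
    using sobolev_fun_weighted_FT[OF f] by eventually_elim (simp add: sobolev_fun_nonlin nonlin_def)
  moreover have "nonlin k f \<in> borel_measurable borel" unfolding nonlin_def by measurable
  ultimately show "nonlin k f \<in> sobolev s" "weighted_FT (nonlin k f) = sobolev_nonlin k (weighted_FT f)"
    using weighted_FT_eqI by blast+
qed

lemma hs_dist_eq: "f \<in> sobolev s \<Longrightarrow> g \<in> sobolev s \<Longrightarrow> hs_dist s f g = norm (weighted_FT f - weighted_FT g)"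
  by (simp add: hs_dist_def hs_norm_eq sobolev_diff weighted_FT_diff)

lemma hs_inner_eq:
  assumes f: "f \<in> sobolev s" and g: "g \<in> sobolev s"
  shows "hs_inner s f g = pairing (\<lambda>\<xi>. cnj (rep_lsq (weighted_FT g) \<xi>)) (weighted_FT f)"
  unfolding hs_inner_def pairing_def
proof (rule integral_cong_AE)
  have [measurable]: "FT f \<in> borel_measurable borel" "FT g \<in> borel_measurable borel"
    using f g by (auto intro: FT_measurable sobolev_square_integrable)
  show "(\<lambda>\<xi>. of_real ((1 + (norm \<xi>)\<^sup>2) powr s) * FT f \<xi> * cnj (FT g \<xi>)) \<in> borel_measurable lborel" by measurable
  show "AE \<xi> in lborel. of_real ((1 + (norm \<xi>)\<^sup>2) powr s) * FT f \<xi> * cnj (FT g \<xi>)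
      = cnj (rep_lsq (weighted_FT g) \<xi>) * rep_lsq (weighted_FT f) \<xi>"
    using rep_weighted_FT[OF f] rep_weighted_FT[OF g]
    by eventually_elim (simp add: power2_eq_square[where a="bessel_weight s \<xi>" for \<xi>] flip: bessel_weight_sq)
qed measurable

lemma W_eq:
  assumes F: "F \<in> sobolev s"
  shows W_measurable: "W \<alpha> t \<tau> F \<in> borel_measurable borel"
    and W_AE: "AE x in lborel. W \<alpha> t \<tau> F x = sobolev_fun (propagator (phase \<alpha> \<tau> - phase \<alpha> t) (weighted_FT F)) x"
proof -
  let ?\<theta> = "phase \<alpha> \<tau> - phase \<alpha> t"
  let ?g = "\<lambda>\<xi>. cis (?\<theta> * (norm \<xi>)\<^sup>2) * FT F \<xi>"
  have W_alt: "W \<alpha> t \<tau> F = (SOME h. is_fourier_L2 h ?g)"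
    by (simp add: W_def phase_def diff_divide_distrib)
  have g: "square_integrable ?g"
    by (rule square_integrable_mult_bounded[OF square_integrable_FT_abs(1)[OF sobolev_square_integrable[OF F]] propagator_multiplier])
  have "abs_lsq ?g = abs_lsq (sobolev_FT (propagator ?\<theta> (weighted_FT F)))"
  proof (rule abs_lsq_eqI[OF g square_integrable_sobolev_FT])
    show "AE \<xi> in lborel. ?g \<xi> = sobolev_FT (propagator ?\<theta> (weighted_FT F)) \<xi>"
      using rep_propagator[of ?\<theta> "weighted_FT F"] sobolev_FT_weighted_FT[OF F]
      by eventually_elim (simp add: sobolev_FT_def mult_ac)
  qed
  then have "abs_lsq (W \<alpha> t \<tau> F) = abs_lsq (sobolev_fun (propagator ?\<theta> (weighted_FT F)))"
    unfolding W_alt SOME_is_fourier_L2(2)[OF g] abs_sobolev_fun by simp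
  moreover have W: "square_integrable (W \<alpha> t \<tau> F)" unfolding W_alt by (rule SOME_is_fourier_L2(1)[OF g])
  ultimately show "AE x in lborel. W \<alpha> t \<tau> F x = sobolev_fun (propagator ?\<theta> (weighted_FT F)) x"
    using rep_abs_lsq[OF W] rep_abs_lsq[OF square_integrable_sobolev_fun[of "propagator ?\<theta> (weighted_FT F)"]] by auto
  show "W \<alpha> t \<tau> F \<in> borel_measurable borel" by (rule square_integrable_measurable_borel[OF W])
qed

definition box_pairing :: "real^'n \<Rightarrow> real^'n \<Rightarrow> (real^'n) lsq \<Rightarrow> complex" where
  "box_pairing a b U = pairing (indicator (cbox a b)) (abs_lsq (sobolev_fun U))"

lemma boxpair_eqI:
  assumes [measurable]: "f \<in> borel_measurable borel" and eq: "AE x in lborel. f x = sobolev_fun U x"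
  shows "boxpair f a b = box_pairing a b U"
proof -
  have "boxpair f a b = (LINT x|lborel. indicator (cbox a b) x * sobolev_fun U x)"
    unfolding boxpair_def
  proof (rule integral_cong_AE)
    show "AE x in lborel. f x * indicator (cbox a b) x = indicator (cbox a b) x * sobolev_fun U x"
      using eq by eventually_elim simp
  qed measurable
  then show ?thesis by (simp add: box_pairing_def pairing_abs_lsq square_integrable_cbox square_integrable_sobolev_fun)
qed

lemma bounded_linear_box_pairing: "bounded_linear (box_pairing a b)"
proof -
  have "bounded_linear (\<lambda>U. pairing (indicator (cbox a b)) (inv_fourier_lsq (mult_op (\<lambda>\<xi>. of_real (bessel_weight (- s) \<xi>)) U)))"
    by (intro bounded_linear_compose[OF bounded_linear_pairing[OF square_integrable_cbox]]
        bounded_linear_compose[OF bounded_linear_inv_fourier_lsq] bounded_linear_mult_op[OF _ cmod_bessel_weight_neg_le]) measurable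
  then show ?thesis unfolding box_pairing_def[abs_def] abs_sobolev_fun abs_sobolev_FT .
qed

lemma box_pairing_inj:
  assumes "\<And>a b. box_pairing a b U = box_pairing a b V" shows "U = V"
proof (rule sobolev_fun_inj)
  have "abs_lsq (sobolev_fun U) = abs_lsq (sobolev_fun V)"
    using assms unfolding box_pairing_def by (rule lsq_eq_boxI)
  with rep_abs_lsq[OF square_integrable_sobolev_fun[of U]] rep_abs_lsq[OF square_integrable_sobolev_fun[of V]]
  show "AE x in lborel. sobolev_fun U x = sobolev_fun V x" by auto
qed

definition to_interaction :: "real \<Rightarrow> (real \<Rightarrow> real^'n \<Rightarrow> complex) \<Rightarrow> real \<Rightarrow> (real^'n) lsq" where
  "to_interaction \<alpha> u t = propagator (phase \<alpha> t) (weighted_FT (u t))"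

definition from_interaction :: "real \<Rightarrow> (real \<Rightarrow> (real^'n) lsq) \<Rightarrow> real \<Rightarrow> real^'n \<Rightarrow> complex" where
  "from_interaction \<alpha> V t = sobolev_fun (propagator (- phase \<alpha> t) (V t))"

definition interaction_nonlin :: "real \<Rightarrow> real \<Rightarrow> nat \<Rightarrow> real \<Rightarrow> (real^'n) lsq \<Rightarrow> (real^'n) lsq" where
  "interaction_nonlin \<alpha> \<sigma> k \<tau> V
    = propagator (phase \<alpha> \<tau>) (mult_op (\<lambda>_. - \<i> * of_real \<sigma>) (sobolev_nonlin k (propagator (- phase \<alpha> \<tau>) V)))"

lemma to_interaction_from_interaction [simp]: "to_interaction \<alpha> (from_interaction \<alpha> V) = V"
  by (simp add: fun_eq_iff to_interaction_def from_interaction_def)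

lemma cont_Hs_iff:
  "cont_Hs s T u \<longleftrightarrow> (\<forall>t\<in>{0..T}. u t \<in> sobolev s) \<and> continuous_on {0..T} (\<lambda>t. weighted_FT (u t))"
  unfolding cont_Hs_def continuous_on_iff
  by (auto simp: dist_norm hs_dist_eq)

lemma continuous_on_to_interaction:
  assumes "\<alpha> > 0" "cont_Hs s T u" shows "continuous_on {0..T} (to_interaction \<alpha> u)"
  unfolding to_interaction_def[abs_def] using assms
  by (intro continuous_on_propagator continuous_on_phase) (auto simp: cont_Hs_iff)

lemma cont_Hs_from_interaction:
  assumes "\<alpha> > 0" "continuous_on {0..T} V" shows "cont_Hs s T (from_interaction \<alpha> V)"
  unfolding cont_Hs_iff from_interaction_def
  by (auto simp: sobolev_fun_mem intro!: continuous_on_propagator continuous_on_minus continuous_on_phase assms)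

lemma continuous_on_interaction_nonlin:
  assumes "\<alpha> > 0" "continuous_on {0..T} V"
  shows "continuous_on {0..T} (\<lambda>\<tau>. interaction_nonlin \<alpha> \<sigma> k \<tau> (V \<tau>))"
  unfolding interaction_nonlin_def
  by (intro continuous_on_propagator bounded_linear.continuous_on[OF bounded_linear_mult_op_const]
      continuous_on_compose2[OF lipschitz_on_balls_continuous_on[OF lipschitz_on_balls_sobolev_nonlin] _ subset_UNIV]
      continuous_on_minus continuous_on_phase assms)

lemma interaction_nonlin_lipschitz:
  obtains B where "B \<ge> 0" "\<And>\<tau> U. norm U \<le> M \<Longrightarrow> norm (interaction_nonlin \<alpha> \<sigma> k \<tau> U) \<le> B"
    "\<And>\<tau>. B-lipschitz_on (cball 0 M) (interaction_nonlin \<alpha> \<sigma> k \<tau>)"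
proof -
  have "lipschitz_on_balls (\<lambda>U. mult_op (\<lambda>_. - \<i> * of_real \<sigma>) (sobolev_nonlin k U))"
    unfolding lipschitz_on_balls_def
  proof
    fix M
    obtain L where L: "L-lipschitz_on (cball 0 M) (sobolev_nonlin k)"
      using lipschitz_on_balls_sobolev_nonlin by (auto simp: lipschitz_on_balls_def)
    obtain K where "K-lipschitz_on (sobolev_nonlin k ` cball 0 M) (mult_op (\<lambda>_. - \<i> * of_real \<sigma>))"
      using bounded_linear.lipschitz_boundE[OF bounded_linear_mult_op_const] .
    from lipschitz_on_compose2[OF L this]
    show "\<exists>L. L-lipschitz_on (cball 0 M) (\<lambda>U. mult_op (\<lambda>_. - \<i> * of_real \<sigma>) (sobolev_nonlin k U))" by blast
  qed
  then obtain B where B: "B \<ge> 0" "\<And>U. norm U \<le> M \<Longrightarrow> norm (mult_op (\<lambda>_. - \<i> * of_real \<sigma>) (sobolev_nonlin k U)) \<le> B"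
    "B-lipschitz_on (cball 0 M) (\<lambda>U. mult_op (\<lambda>_. - \<i> * of_real \<sigma>) (sobolev_nonlin k U))"
    using lipschitz_on_balls_bounded[of _ M] by blast
  show ?thesis
  proof (rule that[of B])
    show "B-lipschitz_on (cball 0 M) (interaction_nonlin \<alpha> \<sigma> k \<tau>)" for \<tau>
      using lipschitz_onD[OF B(3), of "propagator (- phase \<alpha> \<tau>) U" "propagator (- phase \<alpha> \<tau>) V" for U V] B(1)
      by (intro lipschitz_onI) (auto simp: interaction_nonlin_def dist_norm simp flip: propagator_diff)
  qed (use B in \<open>auto simp: interaction_nonlin_def\<close>)
qed

lemma boxpair_W:
  assumes "F \<in> sobolev s"
  shows "boxpair (W \<alpha> t \<tau> F) a b = box_pairing a b (propagator (phase \<alpha> \<tau> - phase \<alpha> t) (weighted_FT F))"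
  by (rule boxpair_eqI[OF W_measurable[OF assms] W_AE[OF assms]])

lemma boxpair_W_nonlin:
  assumes "u \<tau> \<in> sobolev s"
  shows "boxpair (W \<alpha> t \<tau> (\<lambda>x. - \<i> * of_real \<sigma> * nonlin k (u \<tau>) x)) a b
    = box_pairing a b (propagator (- phase \<alpha> t) (interaction_nonlin \<alpha> \<sigma> k \<tau> (to_interaction \<alpha> u \<tau>)))"
  unfolding boxpair_W[OF sobolev_cmult[OF sobolev_nonlin_mem[OF assms]]]
    weighted_FT_cmult[OF sobolev_nonlin_mem[OF assms]] weighted_FT_nonlin[OF assms]
  by (simp add: interaction_nonlin_def to_interaction_def propagator_propagator)

lemma LINT_boxpair_W_nonlin:
  assumes \<alpha>: "\<alpha> > 0" and u: "cont_Hs s T u" and t: "t \<in> {0..T}"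
  shows "(LINT \<tau>:{0..t}|lborel. boxpair (W \<alpha> t \<tau> (\<lambda>x. - \<i> * of_real \<sigma> * nonlin k (u \<tau>) x)) a b)
    = box_pairing a b (propagator (- phase \<alpha> t) (integral {0..t} (\<lambda>\<tau>. interaction_nonlin \<alpha> \<sigma> k \<tau> (to_interaction \<alpha> u \<tau>))))"
proof -
  let ?N = "\<lambda>\<tau>. interaction_nonlin \<alpha> \<sigma> k \<tau> (to_interaction \<alpha> u \<tau>)" and ?\<Lambda> = "\<lambda>U. box_pairing a b (propagator (- phase \<alpha> t) U)"
  have linear: "bounded_linear ?\<Lambda>"
    by (rule bounded_linear_compose[OF bounded_linear_box_pairing bounded_linear_propagator])
  have cont: "continuous_on {0..t} ?N"
    by (rule continuous_on_interaction_nonlin[OF \<alpha>], rule continuous_on_subset[OF continuous_on_to_interaction[OF \<alpha> u]])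
       (use t in auto)
  have "u \<tau> \<in> sobolev s" if "\<tau> \<in> {0..t}" for \<tau> using u t that by (simp add: cont_Hs_iff)
  then have "(LINT \<tau>:{0..t}|lborel. boxpair (W \<alpha> t \<tau> (\<lambda>x. - \<i> * of_real \<sigma> * nonlin k (u \<tau>) x)) a b) = (LINT \<tau>:{0..t}|lborel. ?\<Lambda> (?N \<tau>))"
    by (intro set_lebesgue_integral_cong) (auto simp only: boxpair_W_nonlin sets_lborel borel_closed closed_atLeastAtMost)
  also have "\<dots> = integral {0..t} (\<lambda>\<tau>. ?\<Lambda> (?N \<tau>))"
    by (rule set_borel_integral_eq_integral(2)[OF borel_integrable_atLeastAtMost'[OF bounded_linear.continuous_on[OF linear cont]]])
  also have "\<dots> = ?\<Lambda> (integral {0..t} ?N)"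
    using integral_linear[OF integrable_continuous_interval[OF cont] linear] by (simp add: comp_def)
  finally show ?thesis .
qed

lemma solves_iff:
  assumes \<alpha>: "\<alpha> > 0" and u0: "u0 \<in> sobolev s" and u: "cont_Hs s T u"
  shows "solves \<alpha> \<sigma> k T u0 u \<longleftrightarrow> volterra_solution (interaction_nonlin \<alpha> \<sigma> k) T (weighted_FT u0) (to_interaction \<alpha> u)"
proof -
  let ?I = "\<lambda>t. integral {0..t} (\<lambda>\<tau>. interaction_nonlin \<alpha> \<sigma> k \<tau> (to_interaction \<alpha> u \<tau>))"
  interpret box: bounded_linear "box_pairing a b" for a b by (rule bounded_linear_box_pairing)
  have "(\<forall>a b. boxpair (u t) a b = boxpair (W \<alpha> t 0 u0) a b
       + (LINT \<tau>:{0..t}|lborel. boxpair (W \<alpha> t \<tau> (\<lambda>x. - \<i> * of_real \<sigma> * nonlin k (u \<tau>) x)) a b))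
     \<longleftrightarrow> to_interaction \<alpha> u t = weighted_FT u0 + ?I t" if t: "t \<in> {0..T}" for t
  proof -
    have sobolev_ut: "u t \<in> sobolev s" using u t by (simp add: cont_Hs_iff)
    have "boxpair (u t) a b = box_pairing a b (weighted_FT (u t))" for a b
      by (rule boxpair_eqI[OF sobolev_measurable[OF sobolev_ut] sobolev_fun_weighted_FT[OF sobolev_ut]])
    moreover have "boxpair (W \<alpha> t 0 u0) a b + box_pairing a b (propagator (- phase \<alpha> t) (?I t))
        = box_pairing a b (propagator (- phase \<alpha> t) (weighted_FT u0 + ?I t))" for a b
      by (simp add: boxpair_W u0 phase_0 propagator_add box.add)
    moreover have "(\<forall>a b. box_pairing a b (weighted_FT (u t)) = box_pairing a b (propagator (- phase \<alpha> t) (weighted_FT u0 + ?I t)))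
        \<longleftrightarrow> to_interaction \<alpha> u t = weighted_FT u0 + ?I t"
      unfolding to_interaction_def propagator_eq_iff by (auto intro: box_pairing_inj)
    ultimately show ?thesis by (simp only: LINT_boxpair_W_nonlin[OF \<alpha> u t])
  qed
  then show ?thesis
    unfolding solves_def volterra_solution_def by (simp add: continuous_on_to_interaction[OF \<alpha> u])
qed

end

section \<open>Local well-posedness\<close>

context sobolev_space
begin

definition Hs_curves :: "real \<Rightarrow> (real \<Rightarrow> real^'n \<Rightarrow> complex) set" where
  "Hs_curves T = {u. cont_Hs s T u}"

definition Hs_curve_norm :: "real \<Rightarrow> (real \<Rightarrow> real^'n \<Rightarrow> complex) \<Rightarrow> real" where
  "Hs_curve_norm T u = (SUP t\<in>{0..T}. norm (weighted_FT (u t)))"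

lemma Hs_curves_iff:
  "u \<in> Hs_curves T \<longleftrightarrow> (\<forall>t\<in>{0..T}. u t \<in> sobolev s) \<and> continuous_on {0..T} (\<lambda>t. weighted_FT (u t))"
  by (simp add: Hs_curves_def cont_Hs_iff)

lemma Hs_curve_norm_ge:
  assumes "u \<in> Hs_curves T" "t \<in> {0..T}" shows "norm (weighted_FT (u t)) \<le> Hs_curve_norm T u"
  unfolding Hs_curve_norm_def
proof (rule cSUP_upper[OF assms(2)])
  have "compact ((\<lambda>t. norm (weighted_FT (u t))) ` {0..T})"
    using assms(1) by (intro compact_continuous_image continuous_on_norm) (auto simp: Hs_curves_iff)
  then show "bdd_above ((\<lambda>t. norm (weighted_FT (u t))) ` {0..T})" by (intro bounded_imp_bdd_above compact_imp_bounded)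
qed

lemma Hs_curve_norm_le:
  assumes "T \<ge> 0" "\<And>t. t \<in> {0..T} \<Longrightarrow> norm (weighted_FT (u t)) \<le> C" shows "Hs_curve_norm T u \<le> C"
  unfolding Hs_curve_norm_def using assms by (intro cSUP_least) auto

lemma Hs_curve_norm_nonneg:
  assumes "T \<ge> 0" "u \<in> Hs_curves T" shows "Hs_curve_norm T u \<ge> 0"
  using Hs_curve_norm_ge[OF assms(2), of 0] order_trans[OF norm_ge_zero] assms(1) by auto

lemma Hs_curves_eqI:
  assumes "\<And>t. t \<in> {0..T} \<Longrightarrow> u t \<in> sobolev s" "\<And>t. t \<in> {0..T} \<Longrightarrow> weighted_FT (u t) = V t" "continuous_on {0..T} V"
  shows "u \<in> Hs_curves T"
  unfolding Hs_curves_iff using assms continuous_on_eq[OF assms(3)] by simp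

lemma Hs_curves_add: "u \<in> Hs_curves T \<Longrightarrow> v \<in> Hs_curves T \<Longrightarrow> (\<lambda>t x. u t x + v t x) \<in> Hs_curves T"
  by (rule Hs_curves_eqI[where V="\<lambda>t. weighted_FT (u t) + weighted_FT (v t)"])
     (auto simp: Hs_curves_iff sobolev_add weighted_FT_add intro: continuous_on_add)

lemma Hs_curves_diff: "u \<in> Hs_curves T \<Longrightarrow> v \<in> Hs_curves T \<Longrightarrow> (\<lambda>t x. u t x - v t x) \<in> Hs_curves T"
  by (rule Hs_curves_eqI[where V="\<lambda>t. weighted_FT (u t) - weighted_FT (v t)"])
     (auto simp: Hs_curves_iff sobolev_diff weighted_FT_diff intro: continuous_on_diff)

lemma Hs_curves_cmult: "u \<in> Hs_curves T \<Longrightarrow> (\<lambda>t x. c * u t x) \<in> Hs_curves T"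
  by (rule Hs_curves_eqI[where V="\<lambda>t. mult_op (\<lambda>_. c) (weighted_FT (u t))"])
     (auto simp: Hs_curves_iff sobolev_cmult weighted_FT_cmult intro: bounded_linear.continuous_on[OF bounded_linear_mult_op_const])

lemma Hs_curve_norm_add_le:
  assumes T: "T \<ge> 0" and u: "u \<in> Hs_curves T" and v: "v \<in> Hs_curves T"
  shows "Hs_curve_norm T (\<lambda>t x. u t x + v t x) \<le> Hs_curve_norm T u + Hs_curve_norm T v"
proof (rule Hs_curve_norm_le[OF T])
  fix t assume t: "t \<in> {0..T}"
  have "norm (weighted_FT (\<lambda>x. u t x + v t x)) \<le> norm (weighted_FT (u t)) + norm (weighted_FT (v t))"
    using u v t by (simp add: Hs_curves_iff weighted_FT_add norm_triangle_ineq)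
  also have "\<dots> \<le> Hs_curve_norm T u + Hs_curve_norm T v" by (intro add_mono Hs_curve_norm_ge u v t)
  finally show "norm (weighted_FT (\<lambda>x. u t x + v t x)) \<le> Hs_curve_norm T u + Hs_curve_norm T v" .
qed

lemma Hs_curve_norm_cmult_le:
  assumes T: "T \<ge> 0" and u: "u \<in> Hs_curves T"
  shows "Hs_curve_norm T (\<lambda>t x. c * u t x) \<le> cmod c * Hs_curve_norm T u"
proof (rule Hs_curve_norm_le[OF T])
  fix t assume t: "t \<in> {0..T}"
  have "norm (weighted_FT (\<lambda>x. c * u t x)) = norm (mult_op (\<lambda>_. c) (weighted_FT (u t)))"
    using u t by (simp add: Hs_curves_iff weighted_FT_cmult)
  also have "\<dots> \<le> cmod c * norm (weighted_FT (u t))" by (rule norm_mult_op_le) auto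
  also have "\<dots> \<le> cmod c * Hs_curve_norm T u" by (intro mult_left_mono Hs_curve_norm_ge u t) simp
  finally show "norm (weighted_FT (\<lambda>x. c * u t x)) \<le> cmod c * Hs_curve_norm T u" .
qed

lemma Hs_curve_norm_cmult:
  assumes T: "T \<ge> 0" and u: "u \<in> Hs_curves T"
  shows "Hs_curve_norm T (\<lambda>t x. c * u t x) = cmod c * Hs_curve_norm T u"
proof (rule antisym[OF Hs_curve_norm_cmult_le[OF T u]], cases "c = 0")
  case True
  then show "cmod c * Hs_curve_norm T u \<le> Hs_curve_norm T (\<lambda>t x. c * u t x)"
    using Hs_curve_norm_nonneg[OF T Hs_curves_cmult[OF u, of c]] by simp
next
  case False
  then have "(\<lambda>t x. inverse c * (c * u t x)) = u" by (simp add: field_simps)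
  then have "Hs_curve_norm T u \<le> inverse (cmod c) * Hs_curve_norm T (\<lambda>t x. c * u t x)"
    using Hs_curve_norm_cmult_le[OF T Hs_curves_cmult[OF u], of "inverse c" c] by (simp add: norm_inverse)
  then show "cmod c * Hs_curve_norm T u \<le> Hs_curve_norm T (\<lambda>t x. c * u t x)"
    using False by (simp add: field_simps)
qed

lemma Hs_curve_norm_tendsto_0:
  assumes T: "T \<ge> 0" and f: "\<And>n. f n \<in> Hs_curves T" and v: "v \<in> Hs_curves T"
    and lim: "uniform_limit {0..T} (\<lambda>n t. weighted_FT (f n t)) (\<lambda>t. weighted_FT (v t)) sequentially"
  shows "(\<lambda>n. Hs_curve_norm T (\<lambda>t x. f n t x - v t x)) \<longlonglongrightarrow> 0"
proof (rule LIMSEQ_I)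
  fix e :: real assume "e > 0"
  then have "e / 2 > 0" by simp
  with lim obtain M where M: "\<And>n t. n \<ge> M \<Longrightarrow> t \<in> {0..T} \<Longrightarrow> dist (weighted_FT (f n t)) (weighted_FT (v t)) < e / 2"
    unfolding uniform_limit_sequentially_iff by meson
  show "\<exists>no. \<forall>n\<ge>no. norm (Hs_curve_norm T (\<lambda>t x. f n t x - v t x) - 0) < e"
  proof (intro exI allI impI)
    fix n assume "n \<ge> M"
    from M[OF this] have "Hs_curve_norm T (\<lambda>t x. f n t x - v t x) \<le> e / 2"
      using f v by (intro Hs_curve_norm_le[OF T]) (auto simp: Hs_curves_iff weighted_FT_diff dist_norm less_imp_le)
    then show "norm (Hs_curve_norm T (\<lambda>t x. f n t x - v t x) - 0) < e"
      using Hs_curve_norm_nonneg[OF T Hs_curves_diff[OF f v], of n] \<open>e > 0\<close> by simp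
  qed
qed

lemma Hs_curves_complete:
  assumes T: "T \<ge> 0" and f: "\<And>n. f n \<in> Hs_curves T"
    and Cauchy: "\<And>\<epsilon>. \<epsilon> > 0 \<Longrightarrow> \<exists>M. \<forall>m\<ge>M. \<forall>n\<ge>M. Hs_curve_norm T (\<lambda>t x. f m t x - f n t x) < \<epsilon>"
  shows "\<exists>v\<in>Hs_curves T. (\<lambda>n. Hs_curve_norm T (\<lambda>t x. f n t x - v t x)) \<longlonglongrightarrow> 0"
proof -
  have dist_le: "dist (weighted_FT (f m t)) (weighted_FT (f n t)) \<le> Hs_curve_norm T (\<lambda>t x. f m t x - f n t x)"
    if "t \<in> {0..T}" for m n t
    using Hs_curve_norm_ge[OF Hs_curves_diff[OF f f] that, of m n] f that
    by (simp add: dist_norm Hs_curves_iff weighted_FT_diff)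
  have "uniformly_Cauchy_on {0..T} (\<lambda>n t. weighted_FT (f n t))"
    unfolding uniformly_Cauchy_on_def using Cauchy dist_le by (meson le_less_trans)
  then obtain V where V: "uniform_limit {0..T} (\<lambda>n t. weighted_FT (f n t)) V sequentially"
    using Cauchy_uniformly_convergent unfolding uniformly_convergent_on_def by blast
  have "continuous_on {0..T} V"
    by (rule uniform_limit_theorem[OF _ V]) (use f in \<open>auto simp: Hs_curves_iff\<close>)
  then have v: "(\<lambda>t. sobolev_fun (V t)) \<in> Hs_curves T" by (simp add: Hs_curves_iff sobolev_fun_mem)
  show ?thesis
    by (intro bexI[of _ "\<lambda>t. sobolev_fun (V t)"] Hs_curve_norm_tendsto_0 T f v) (simp add: V)
qed

lemma hs_inner_measurable:
  assumes u: "u \<in> Hs_curves T" and v: "v \<in> sobolev s"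
  shows "(\<lambda>t. hs_inner s (u t) v) \<in> borel_measurable (restrict_space lborel {0..T})"
proof -
  let ?g = "\<lambda>t. pairing (\<lambda>\<xi>. cnj (rep_lsq (weighted_FT v) \<xi>)) (weighted_FT (u t))"
  have "continuous_on {0..T} ?g"
    using u by (intro bounded_linear.continuous_on[OF bounded_linear_pairing] square_integrable_cnj square_integrable_rep)
      (simp add: Hs_curves_iff)
  then have "?g \<in> borel_measurable (restrict_space borel {0..T})"
    by (rule borel_measurable_continuous_on_restrict)
  moreover have "sets (restrict_space lborel {0..T}) = sets (restrict_space borel {0..T})"
    by (rule sets_restrict_space_cong) simp
  ultimately have g: "?g \<in> borel_measurable (restrict_space lborel {0..T})"
    using measurable_cong_sets by blast
  have "hs_inner s (u t) v = ?g t" if "t \<in> space (restrict_space lborel {0..T})" for t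
    using that u v by (intro hs_inner_eq) (auto simp: Hs_curves_iff space_restrict_space)
  then show ?thesis using g measurable_cong[of "restrict_space lborel {0..T}" "\<lambda>t. hs_inner s (u t) v" ?g] by blast
qed

lemma banach_Linf_Hs_curves:
  assumes "T \<ge> 0"
  shows "banach_Linf s T (Hs_curves T) (Hs_curve_norm T)"
  unfolding banach_Linf_def
proof (intro conjI ballI allI impI)
  have "(\<lambda>_::real^'n. 0) \<in> sobolev s \<and> weighted_FT (\<lambda>_. 0) = 0"
    using weighted_FT_eqI[of "\<lambda>_. 0" 0] by (simp add: sobolev_fun_zero)
  then show "(\<lambda>_ _. 0) \<in> Hs_curves T" by (simp add: Hs_curves_iff)
  show "AE t in lborel. t \<in> {0..T} \<longrightarrow> hs_norm s (u t) = 0" if u: "u \<in> Hs_curves T" "Hs_curve_norm T u = 0" for u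
  proof (intro AE_I2 impI)
    fix t assume "t \<in> {0..T}"
    then show "hs_norm s (u t) = 0" using Hs_curve_norm_ge[OF u(1)] u by (simp add: Hs_curves_iff hs_norm_eq)
  qed
  show "\<exists>C. AE t in lborel. t \<in> {0..T} \<longrightarrow> hs_norm s (u t) \<le> C" if u: "u \<in> Hs_curves T" for u
    using Hs_curve_norm_ge[OF u] u by (intro exI[of _ "Hs_curve_norm T u"] AE_I2) (simp add: Hs_curves_iff hs_norm_eq)
  show "\<exists>v\<in>Hs_curves T. (\<lambda>n. Hs_curve_norm T (\<lambda>t x. f n t x - v t x)) \<longlonglongrightarrow> 0"
    if "\<forall>n. f n \<in> Hs_curves T" "\<forall>\<epsilon>>0. \<exists>M. \<forall>m\<ge>M. \<forall>n\<ge>M. Hs_curve_norm T (\<lambda>t x. f m t x - f n t x) < \<epsilon>" for f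
    using Hs_curves_complete[OF assms, of f] that by blast
qed (auto simp: assms Hs_curves_add Hs_curves_cmult Hs_curve_norm_nonneg Hs_curve_norm_add_le Hs_curve_norm_cmult
    hs_inner_measurable Hs_curves_iff[THEN iffD1])

lemma mem_Hball_iff: "u0 \<in> Hball s R \<longleftrightarrow> u0 \<in> sobolev s \<and> norm (weighted_FT u0) \<le> R"
  by (auto simp: Hball_def hs_norm_eq)

lemma hs_local_existence:
  assumes \<alpha>: "\<alpha> > 0" and R: "R > 0"
  obtains T sol where "T > 0" "\<And>u0. u0 \<in> Hball s R \<Longrightarrow> cont_Hs s T (sol u0)"
    "\<And>u0. u0 \<in> Hball s R \<Longrightarrow> solves \<alpha> \<sigma> k T u0 (sol u0 :: real \<Rightarrow> real^'n \<Rightarrow> complex)"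
    "\<And>u0 v0 t. u0 \<in> Hball s R \<Longrightarrow> v0 \<in> Hball s R \<Longrightarrow> t \<in> {0..T} \<Longrightarrow> hs_dist s (sol v0 t) (sol u0 t) \<le> 2 * hs_dist s v0 u0"
proof -
  obtain B where "B \<ge> 0" "\<And>\<tau> U. norm U \<le> 2 * R \<Longrightarrow> norm (interaction_nonlin \<alpha> \<sigma> k \<tau> U) \<le> B"
    "\<And>\<tau>. B-lipschitz_on (cball 0 (2 * R)) (interaction_nonlin \<alpha> \<sigma> k \<tau>)"
    using interaction_nonlin_lipschitz[of "2 * R" \<alpha> \<sigma> k] by blast
  from volterra_local_wellposedness[OF R this(1) continuous_on_interaction_nonlin[OF \<alpha>] this(2,3)]
  obtain T S where T: "T > 0" and S: "\<And>U. norm U \<le> R \<Longrightarrow> volterra_solution (interaction_nonlin \<alpha> \<sigma> k) T U (S U)"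
    and S_diff: "\<And>U V t. norm U \<le> R \<Longrightarrow> norm V \<le> R \<Longrightarrow> t \<in> {0..T} \<Longrightarrow> norm (S U t - S V t) \<le> 2 * norm (U - V)"
    by blast
  define sol where "sol u0 = from_interaction \<alpha> (S (weighted_FT u0))" for u0
  have cont: "cont_Hs s T (sol u0)" if "u0 \<in> Hball s R" for u0
    unfolding sol_def using S that by (intro cont_Hs_from_interaction[OF \<alpha>]) (auto simp: mem_Hball_iff volterra_solution_def)
  have "solves \<alpha> \<sigma> k T u0 (sol u0)" if "u0 \<in> Hball s R" for u0
    using S that cont[OF that] by (subst solves_iff[OF \<alpha>]) (auto simp: mem_Hball_iff sol_def)
  moreover have "hs_dist s (sol v0 t) (sol u0 t) \<le> 2 * hs_dist s v0 u0"
    if "u0 \<in> Hball s R" "v0 \<in> Hball s R" "t \<in> {0..T}" for u0 v0 t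
    using S_diff that
    by (simp add: sol_def from_interaction_def hs_dist_eq sobolev_fun_mem mem_Hball_iff flip: propagator_diff)
  ultimately show ?thesis using that[of T sol] T cont by blast
qed

lemma hs_solution_unique:
  fixes u v :: "real \<Rightarrow> real^'n \<Rightarrow> complex"
  assumes \<alpha>: "\<alpha> > 0" and u0: "u0 \<in> sobolev s" and u: "cont_Hs s T u" "solves \<alpha> \<sigma> k T u0 u"
    and v: "cont_Hs s T v" "solves \<alpha> \<sigma> k T u0 v" and t: "t \<in> {0..T}"
  shows "hs_dist s (v t) (u t) = 0"
proof -
  have "to_interaction \<alpha> v t = to_interaction \<alpha> u t"
  proof (rule volterra_solution_unique)
    show "volterra_solution (interaction_nonlin \<alpha> \<sigma> k) T (weighted_FT u0) (to_interaction \<alpha> v)"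
      using v solves_iff[OF \<alpha> u0 v(1)] by blast
    show "volterra_solution (interaction_nonlin \<alpha> \<sigma> k) T (weighted_FT u0) (to_interaction \<alpha> u)"
      using u solves_iff[OF \<alpha> u0 u(1)] by blast
    show "\<exists>L. \<forall>\<tau>. L-lipschitz_on (cball 0 M) (interaction_nonlin \<alpha> \<sigma> k \<tau>)" for M
      by (rule interaction_nonlin_lipschitz[of M \<alpha> \<sigma> k]) blast
  qed (rule continuous_on_interaction_nonlin[OF \<alpha>], assumption, rule t)
  then have "weighted_FT (v t) = weighted_FT (u t)"
    unfolding to_interaction_def by (subst (asm) propagator_eq_iff) (simp add: propagator_propagator)
  moreover have "v t \<in> sobolev s" "u t \<in> sobolev s" using u v t by (simp_all add: cont_Hs_iff)
  ultimately show ?thesis by (simp add: hs_dist_eq)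
qed

end

section \<open>Resonance kernels\<close>

definition cauchy_kernel :: "real \<Rightarrow> real" where "cauchy_kernel x = 2 * inverse (1 + x\<^sup>2)"

lemma cauchy_kernel_nonneg [simp]: "cauchy_kernel x \<ge> 0"
  by (simp add: cauchy_kernel_def add_nonneg_nonneg)

lemma cauchy_kernel_minus [simp]: "cauchy_kernel (- x) = cauchy_kernel x"
  by (simp add: cauchy_kernel_def)

lemma cauchy_kernel_measurable [measurable]: "cauchy_kernel \<in> borel_measurable borel"
  unfolding cauchy_kernel_def[abs_def] by measurable

lemma cauchy_kernel_antimono: "x\<^sup>2 \<le> y\<^sup>2 \<Longrightarrow> cauchy_kernel y \<le> cauchy_kernel x"
  unfolding cauchy_kernel_def by (intro mult_left_mono le_imp_inverse_le) (auto intro: add_pos_nonneg)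

lemma cauchy_kernel_le_2: "cauchy_kernel x \<le> 2"
  using cauchy_kernel_antimono[of 0 x] by (simp add: cauchy_kernel_def)

lemma nn_integral_cauchy_kernel: "(\<integral>\<^sup>+t. ennreal (cauchy_kernel t) \<partial>lborel) = ennreal (2 * pi)"
proof -
  have "(LINT t|lborel. inverse (1 + t\<^sup>2)) = pi"
    using LBINT_inverse_1_plus_square
    by (simp add: interval_lebesgue_integral_def set_lebesgue_integral_def einterval_def)
  then have "(LINT t|lborel. cauchy_kernel t) = 2 * pi" by (simp add: cauchy_kernel_def)
  moreover have "integrable lborel cauchy_kernel"
    unfolding cauchy_kernel_def[abs_def] by (intro integrable_mult_right integrable_inverse_1_plus_square_real)
  ultimately show ?thesis using nn_integral_eq_integral[of lborel cauchy_kernel] by simp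
qed

lemma mult_cauchy_kernel_le:
  assumes "0 \<le> d" "d \<le> w" shows "d * cauchy_kernel (d * w) \<le> cauchy_kernel d"
proof -
  have pos: "0 < 1 + x\<^sup>2" for x :: real by (simp add: add_pos_nonneg)
  have "0 \<le> (1 - d)\<^sup>2" "0 \<le> (d - d * d)\<^sup>2" "0 \<le> (1 - d * d)\<^sup>2" by simp_all
  then have "d * (1 + d\<^sup>2) \<le> 1 + (d * d)\<^sup>2" by (simp add: power2_eq_square algebra_simps)
  also have "\<dots> \<le> 1 + (d * w)\<^sup>2" using assms by (intro add_left_mono power_mono mult_left_mono) auto
  finally have "d / (1 + (d * w)\<^sup>2) \<le> 1 / (1 + d\<^sup>2)" using pos[of d] pos[of "d * w"] by (simp add: field_simps)
  then show ?thesis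
    by (simp only: cauchy_kernel_def divide_inverse mult_1 mult.left_commute[of d 2] mult_le_cancel_left_pos zero_less_numeral)
qed

lemma cauchy_kernel_schur_bound:
  "sqrt (\<bar>a\<bar> * \<bar>t\<bar>) * cauchy_kernel (a\<^sup>2 - t\<^sup>2) \<le> \<bar>a\<bar> * cauchy_kernel (a * (\<bar>t\<bar> - \<bar>a\<bar>)) + cauchy_kernel (\<bar>t\<bar> - \<bar>a\<bar>)"
proof -
  define d where "d = \<bar>\<bar>t\<bar> - \<bar>a\<bar>\<bar>"
  define w where "w = \<bar>t\<bar> + \<bar>a\<bar>"
  have d: "0 \<le> d" "d \<le> w" "\<bar>t\<bar> \<le> \<bar>a\<bar> + d" "\<bar>a\<bar> \<le> w" by (auto simp: d_def w_def)
  have "d * w = \<bar>(\<bar>t\<bar> - \<bar>a\<bar>) * (\<bar>t\<bar> + \<bar>a\<bar>)\<bar>" by (simp add: d_def w_def abs_mult)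
  also have "(\<bar>t\<bar> - \<bar>a\<bar>) * (\<bar>t\<bar> + \<bar>a\<bar>) = t\<^sup>2 - a\<^sup>2" by (simp add: algebra_simps power2_eq_square)
  finally have kernel: "cauchy_kernel (a\<^sup>2 - t\<^sup>2) = cauchy_kernel (d * w)"
    by (simp add: cauchy_kernel_def power2_commute[of "t\<^sup>2"])
  have "\<bar>a\<bar> * \<bar>t\<bar> \<le> (\<bar>a\<bar> + d)\<^sup>2" using d unfolding power2_eq_square by (intro mult_mono) auto
  then have "sqrt (\<bar>a\<bar> * \<bar>t\<bar>) \<le> \<bar>a\<bar> + d" using d by (intro real_le_lsqrt) auto
  then have "sqrt (\<bar>a\<bar> * \<bar>t\<bar>) * cauchy_kernel (d * w) \<le> (\<bar>a\<bar> + d) * cauchy_kernel (d * w)" by (rule mult_right_mono) simp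
  also have "\<dots> = \<bar>a\<bar> * cauchy_kernel (d * w) + d * cauchy_kernel (d * w)" by (rule distrib_right)
  also have "\<dots> \<le> \<bar>a\<bar> * cauchy_kernel (a * (\<bar>t\<bar> - \<bar>a\<bar>)) + cauchy_kernel d"
  proof (intro add_mono mult_left_mono cauchy_kernel_antimono mult_cauchy_kernel_le d)
    have "(a * (\<bar>t\<bar> - \<bar>a\<bar>))\<^sup>2 = (d * \<bar>a\<bar>)\<^sup>2" by (simp add: d_def power_mult_distrib)
    also have "\<dots> \<le> (d * w)\<^sup>2" using d by (intro power_mono mult_left_mono) auto
    finally show "(a * (\<bar>t\<bar> - \<bar>a\<bar>))\<^sup>2 \<le> (d * w)\<^sup>2" .
  qed simp
  also have "cauchy_kernel d = cauchy_kernel (\<bar>t\<bar> - \<bar>a\<bar>)" by (simp add: cauchy_kernel_def d_def)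
  finally show ?thesis unfolding kernel .
qed

lemma nn_integral_abs_shift:
  fixes g :: "real \<Rightarrow> ennreal"
  assumes [measurable]: "g \<in> borel_measurable borel"
  shows "(\<integral>\<^sup>+t. g (\<bar>t\<bar> - b) \<partial>lborel) \<le> 2 * (\<integral>\<^sup>+t. g t \<partial>lborel)"
proof -
  have "g (\<bar>t\<bar> - b) \<le> g (t - b) + g (- b - t)" for t
    by (cases "t \<ge> 0") (simp_all add: add_increasing add_increasing2 minus_diff_commute)
  then have "(\<integral>\<^sup>+t. g (\<bar>t\<bar> - b) \<partial>lborel) \<le> (\<integral>\<^sup>+t. g (t - b) + g (- b - t) \<partial>lborel)"
    by (rule nn_integral_mono)
  also have "\<dots> = (\<integral>\<^sup>+t. g (t - b) \<partial>lborel) + (\<integral>\<^sup>+t. g (- b - t) \<partial>lborel)"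
    by (rule nn_integral_add) measurable
  also have "\<dots> = 2 * (\<integral>\<^sup>+t. g t \<partial>lborel)"
    unfolding nn_integral_translate[OF assms] nn_integral_reflect[OF assms] by (simp add: mult_2)
  finally show ?thesis .
qed

lemma nn_integral_cauchy_kernel_scale_le: "(\<integral>\<^sup>+u. ennreal (\<bar>a\<bar> * cauchy_kernel (a * u)) \<partial>lborel) \<le> ennreal (2 * pi)"
proof (cases "a = 0")
  case False
  have "ennreal (2 * pi) = \<bar>a\<bar> * (\<integral>\<^sup>+u. ennreal (cauchy_kernel (0 + a * u)) \<partial>lborel)"
    unfolding nn_integral_cauchy_kernel[symmetric] by (rule nn_integral_real_affine[OF _ False]) measurable
  also have "\<dots> = (\<integral>\<^sup>+u. ennreal (\<bar>a\<bar> * cauchy_kernel (a * u)) \<partial>lborel)"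
    by (subst nn_integral_cmult[symmetric]) (auto simp: ennreal_mult)
  finally show ?thesis by simp
qed simp

lemma nn_integral_cauchy_kernel_schur_le:
  "(\<integral>\<^sup>+t. ennreal (sqrt (\<bar>a\<bar> * \<bar>t\<bar>) * cauchy_kernel (a\<^sup>2 - t\<^sup>2)) \<partial>lborel) \<le> ennreal (8 * pi)"
proof -
  let ?g = "\<lambda>u. ennreal (\<bar>a\<bar> * cauchy_kernel (a * u)) + ennreal (cauchy_kernel u)"
  have "(\<integral>\<^sup>+t. ennreal (sqrt (\<bar>a\<bar> * \<bar>t\<bar>) * cauchy_kernel (a\<^sup>2 - t\<^sup>2)) \<partial>lborel) \<le> (\<integral>\<^sup>+t. ?g (\<bar>t\<bar> - \<bar>a\<bar>) \<partial>lborel)"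
    by (intro nn_integral_mono order_trans[OF ennreal_leI[OF cauchy_kernel_schur_bound]]) simp
  also have "\<dots> \<le> 2 * (\<integral>\<^sup>+u. ?g u \<partial>lborel)" by (rule nn_integral_abs_shift) measurable
  also have "(\<integral>\<^sup>+u. ?g u \<partial>lborel) = (\<integral>\<^sup>+u. ennreal (\<bar>a\<bar> * cauchy_kernel (a * u)) \<partial>lborel) + (\<integral>\<^sup>+u. ennreal (cauchy_kernel u) \<partial>lborel)"
    by (rule nn_integral_add) measurable
  also have "2 * \<dots> \<le> 2 * (ennreal (2 * pi) + ennreal (2 * pi))"
    by (intro mult_left_mono add_mono nn_integral_cauchy_kernel_scale_le eq_refl[OF nn_integral_cauchy_kernel]) simp
  also have "\<dots> = ennreal 2 * ennreal (4 * pi)" by (simp flip: ennreal_plus)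
  also have "\<dots> = ennreal (8 * pi)" by (subst ennreal_mult[symmetric]) auto
  finally show ?thesis .
qed

lemma nn_integral_cauchy_kernel_quadratic_le:
  fixes b c c' :: real
  assumes "\<bar>b\<bar> \<ge> 1 + \<bar>c\<bar> / 2"
  shows "(\<integral>\<^sup>+y. ennreal (\<bar>c\<bar> * cauchy_kernel (y\<^sup>2 + 2 * b * y + c')) * indicator {0..1} y \<partial>lborel) \<le> ennreal (2 * pi)"
proof -
  let ?q = "\<lambda>y. y\<^sup>2 + 2 * b * y + c'"
  let ?f = "\<lambda>y. sgn b * (2 * (y + b)) * cauchy_kernel (?q y)" and ?F = "\<lambda>y. sgn b * (2 * arctan (?q y))"
  have slope: "\<bar>c\<bar> \<le> sgn b * (2 * (y + b))" if "y \<in> {0..1}" for y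
    using assms that by (cases "b > 0") (auto simp: sgn_if)
  have "(\<integral>\<^sup>+y. ennreal (\<bar>c\<bar> * cauchy_kernel (?q y)) * indicator {0..1} y \<partial>lborel) \<le> (\<integral>\<^sup>+y. ennreal (?f y) * indicator {0..1} y \<partial>lborel)"
  proof (rule nn_integral_mono)
    show "ennreal (\<bar>c\<bar> * cauchy_kernel (?q y)) * indicator {0..1} y \<le> ennreal (?f y) * indicator {0..1} y" for y
      using slope[of y] by (cases "y \<in> {0..1}") (auto intro!: ennreal_leI mult_right_mono)
  qed
  also have "\<dots> = ennreal (?F 1 - ?F 0)"
  proof (rule nn_integral_FTC_Icc)
    show "?f \<in> borel_measurable borel" by measurable
    show "0 \<le> ?f y" if "y \<in> {0..1}" for y
      using order_trans[OF abs_ge_zero slope[OF that]] by (rule mult_nonneg_nonneg) simp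
    show "DERIV ?F y :> ?f y" if "y \<in> {0..1}" for y
      by (auto intro!: derivative_eq_intros simp: cauchy_kernel_def algebra_simps)
  qed simp
  also have "\<dots> \<le> ennreal (2 * pi)"
  proof (rule ennreal_leI)
    have "- (pi / 2) < arctan (?q 1)" "arctan (?q 1) < pi / 2" "- (pi / 2) < arctan (?q 0)" "arctan (?q 0) < pi / 2"
      using arctan_bounded by auto
    then show "?F 1 - ?F 0 \<le> 2 * pi" by (auto simp: sgn_if)
  qed
  finally show ?thesis .
qed

definition gaussian :: "'a::real_normed_vector \<Rightarrow> real" where "gaussian x = exp (- ((norm x)\<^sup>2 / 2))"

lemma gaussian_pos [simp]: "gaussian x > 0" and gaussian_nonneg [simp]: "gaussian x \<ge> 0"
  by (simp_all add: gaussian_def)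

lemma gaussian_minus [simp]: "gaussian (- x) = gaussian x"
  by (simp add: gaussian_def)

lemma gaussian_measurable [measurable]: "gaussian \<in> borel_measurable (borel :: 'a::euclidean_space measure)"
  unfolding gaussian_def[abs_def] by measurable

lemma gaussian_le_cauchy_kernel: "gaussian x \<le> cauchy_kernel x" for x :: real
proof -
  have "(1 + x\<^sup>2) / 2 \<le> exp (x\<^sup>2 / 2)" using exp_ge_add_one_self[of "x\<^sup>2 / 2"] by (simp add: field_simps)
  then have "inverse (exp (x\<^sup>2 / 2)) \<le> inverse ((1 + x\<^sup>2) / 2)" by (rule le_imp_inverse_le) (simp add: add_pos_nonneg)
  then show ?thesis by (simp add: gaussian_def cauchy_kernel_def exp_minus inverse_eq_divide)
qed

lemma gaussian_eq_prod: "gaussian x = (\<Prod>b\<in>Basis. gaussian (x \<bullet> b))" for x :: "'a::euclidean_space"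
proof -
  have "- ((norm x)\<^sup>2 / 2) = (\<Sum>b\<in>Basis. - ((x \<bullet> b)\<^sup>2 / 2))"
    unfolding power2_norm_eq_inner euclidean_inner[of x x] by (simp add: power2_eq_square sum_negf sum_divide_distrib)
  then show ?thesis by (simp add: gaussian_def exp_sum)
qed

lemma sqrt_gaussian: "sqrt (gaussian x) = exp (- ((norm x)\<^sup>2 / 4))"
  by (rule real_sqrt_unique) (simp_all add: gaussian_def power2_eq_square flip: exp_add)

lemma gaussian_add_le: 
  assumes "norm v \<le> 1" shows "gaussian (\<zeta> + v) \<le> exp (1/2) * sqrt (gaussian \<zeta>)"
proof -
  have "(norm v)\<^sup>2 \<le> 1" using assms by (simp add: power_le_one)
  with norm_add_sq_le[of "\<zeta> + v" "- v"] have "(norm \<zeta>)\<^sup>2 \<le> 2 * (norm (\<zeta> + v))\<^sup>2 + 2" by simp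
  then have "exp (- ((norm (\<zeta> + v))\<^sup>2 / 2)) \<le> exp (1/2 + - ((norm \<zeta>)\<^sup>2 / 4))" by simp
  then show ?thesis unfolding gaussian_def[of "\<zeta> + v"] sqrt_gaussian exp_add .
qed

lemma gaussian_moment_le:
  fixes \<zeta> :: "'a::euclidean_space" and d :: nat
  shows "(1 + norm \<zeta>) * sqrt (gaussian \<zeta>) \<le> 2 * (4 * real (Suc d)) ^ Suc d * (bessel_weight (- real d) \<zeta>)\<^sup>2"
proof -
  let ?x = "norm \<zeta>" and ?K = "(4 * real (Suc d)) ^ Suc d"
  have pos: "1 + ?x\<^sup>2 > 0" by (simp add: add_pos_nonneg)
  have "1 + ?x\<^sup>2 \<le> 4 * real (Suc d) * (1 + (?x\<^sup>2 / 4) / real (Suc d))" by (simp add: field_simps)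
  then have "(1 + ?x\<^sup>2) ^ Suc d \<le> (4 * real (Suc d) * (1 + (?x\<^sup>2 / 4) / real (Suc d))) ^ Suc d" by (rule power_mono) simp
  also have "\<dots> \<le> ?K * exp (?x\<^sup>2 / 4)"
    unfolding power_mult_distrib[of "4 * real (Suc d)"]
    by (intro mult_left_mono exp_ge_one_plus_x_over_n_power_n) (simp_all add: order_trans[of _ 0])
  finally have power_le: "(1 + ?x\<^sup>2) ^ Suc d \<le> ?K * exp (?x\<^sup>2 / 4)" .
  have "2 * ?x \<le> ?x\<^sup>2 + 1" using sum_squares_bound[of ?x 1] by simp
  then have "1 + ?x \<le> 2 * (1 + ?x\<^sup>2)" by (smt (verit) zero_le_power2)
  then have "(1 + ?x) * (1 + ?x\<^sup>2) ^ d \<le> 2 * (1 + ?x\<^sup>2) * (1 + ?x\<^sup>2) ^ d" by (rule mult_right_mono) simp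
  also have "\<dots> = 2 * (1 + ?x\<^sup>2) ^ Suc d" by simp
  also have "\<dots> \<le> 2 * (?K * exp (?x\<^sup>2 / 4))" by (intro mult_left_mono power_le) simp
  finally have "(1 + ?x) * (1 + ?x\<^sup>2) ^ d \<le> 2 * ?K * exp (?x\<^sup>2 / 4)" by (simp only: mult.assoc)
  then have "(1 + ?x) / exp (?x\<^sup>2 / 4) \<le> 2 * ?K / (1 + ?x\<^sup>2) ^ d"
    using zero_less_power[OF pos] by (simp only: pos_divide_le_eq exp_gt_zero pos_le_divide_eq times_divide_eq_left)
  moreover have "sqrt (gaussian \<zeta>) = 1 / exp (?x\<^sup>2 / 4)" by (simp add: sqrt_gaussian exp_minus inverse_eq_divide)
  moreover have "(bessel_weight (- real d) \<zeta>)\<^sup>2 = 1 / (1 + ?x\<^sup>2) ^ d"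
    using pos by (simp add: bessel_weight_sq powr_minus powr_realpow inverse_eq_divide)
  ultimately show ?thesis by (simp only: times_divide_eq_right mult_1_right)
qed

lemma nn_integral_gaussian_moment_finite:
  "(\<integral>\<^sup>+(\<zeta>::'a::euclidean_space). ennreal ((1 + norm \<zeta>) * sqrt (gaussian \<zeta>)) \<partial>lborel) < \<infinity>"
proof -
  let ?d = "DIM('a)"
  let ?K = "2 * (4 * real (Suc ?d)) ^ Suc ?d" and ?w = "\<lambda>\<zeta>::'a. complex_of_real (bessel_weight (- real ?d) \<zeta>)"
  have w: "square_integrable ?w" by (rule square_integrable_bessel_weight_neg) (simp add: DIM_positive)
  have "(\<integral>\<^sup>+(\<zeta>::'a). ennreal ((1 + norm \<zeta>) * sqrt (gaussian \<zeta>)) \<partial>lborel) \<le> (\<integral>\<^sup>+\<zeta>. ennreal ?K * ennreal ((cmod (?w \<zeta>))\<^sup>2) \<partial>lborel)"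
    by (intro nn_integral_mono order_trans[OF ennreal_leI[OF gaussian_moment_le[of _ ?d]]]) (simp add: ennreal_mult)
  also have "\<dots> = ennreal ?K * (\<integral>\<^sup>+\<zeta>. ennreal ((cmod (?w \<zeta>))\<^sup>2) \<partial>lborel)"
    by (rule nn_integral_cmult) measurable
  also have "\<dots> < \<infinity>" unfolding nn_integral_abs_lsq[OF w] by (simp add: ennreal_mult_less_top)
  finally show ?thesis .
qed

definition schur_kernel :: "('a::real_normed_vector \<Rightarrow> real) \<Rightarrow> 'a \<Rightarrow> 'a \<Rightarrow> real" where
  "schur_kernel \<kappa> \<xi> \<eta> = sqrt (norm \<xi> * norm \<eta>) * (\<kappa> (\<xi> - \<eta>) * cauchy_kernel ((norm \<xi>)\<^sup>2 - (norm \<eta>)\<^sup>2))"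

lemma schur_kernel_nonneg: "(\<And>\<zeta>. \<kappa> \<zeta> \<ge> 0) \<Longrightarrow> schur_kernel \<kappa> \<xi> \<eta> \<ge> 0"
  by (simp add: schur_kernel_def)

lemma schur_kernel_commute:
  assumes "\<And>\<zeta>. \<kappa> (- \<zeta>) = \<kappa> \<zeta>" shows "schur_kernel \<kappa> \<xi> \<eta> = schur_kernel \<kappa> \<eta> \<xi>"
  using assms[of "\<xi> - \<eta>"] cauchy_kernel_minus[of "(norm \<xi>)\<^sup>2 - (norm \<eta>)\<^sup>2"] by (simp add: schur_kernel_def mult.commute)

lemma schur_kernel_measurable:
  fixes \<kappa> :: "'a::euclidean_space \<Rightarrow> real"
  assumes [measurable]: "\<kappa> \<in> borel_measurable borel"
  shows "case_prod (schur_kernel \<kappa>) \<in> borel_measurable (borel \<Otimes>\<^sub>M borel)" "schur_kernel \<kappa> \<xi> \<in> borel_measurable borel"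
  unfolding schur_kernel_def[abs_def] by measurable

lemma nn_integral_schur_kernel_cmult:
  fixes \<kappa> :: "'a::euclidean_space \<Rightarrow> real"
  assumes [measurable]: "\<kappa> \<in> borel_measurable borel" and "\<And>\<zeta>. \<kappa> \<zeta> \<ge> 0" "c \<ge> 0"
  shows "(\<integral>\<^sup>+\<eta>. ennreal (schur_kernel (\<lambda>\<zeta>. c * \<kappa> \<zeta>) \<xi> \<eta>) \<partial>lborel) = ennreal c * (\<integral>\<^sup>+\<eta>. ennreal (schur_kernel \<kappa> \<xi> \<eta>) \<partial>lborel)"
proof -
  have "schur_kernel (\<lambda>\<zeta>. c * \<kappa> \<zeta>) \<xi> \<eta> = c * schur_kernel \<kappa> \<xi> \<eta>" for \<eta>
    by (simp add: schur_kernel_def)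
  then have "(\<integral>\<^sup>+\<eta>. ennreal (schur_kernel (\<lambda>\<zeta>. c * \<kappa> \<zeta>) \<xi> \<eta>) \<partial>lborel) = (\<integral>\<^sup>+\<eta>. ennreal c * ennreal (schur_kernel \<kappa> \<xi> \<eta>) \<partial>lborel)"
    using assms(2,3) by (simp add: ennreal_mult schur_kernel_nonneg)
  also have "\<dots> = ennreal c * (\<integral>\<^sup>+\<eta>. ennreal (schur_kernel \<kappa> \<xi> \<eta>) \<partial>lborel)"
    by (rule nn_integral_cmult) (use schur_kernel_measurable(2)[OF assms(1)] in measurable)
  finally show ?thesis .
qed

lemma exists_large_coordinate: "\<exists>i\<in>Basis. norm \<xi> \<le> real DIM('a) * \<bar>\<xi> \<bullet> i\<bar>" for \<xi> :: "'a::euclidean_space"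
proof -
  let ?K = "Max ((\<lambda>b. \<bar>\<xi> \<bullet> b\<bar>) ` Basis)"
  have "?K \<in> (\<lambda>b. \<bar>\<xi> \<bullet> b\<bar>) ` Basis" by (intro Max_in) auto
  then obtain i where i: "i \<in> Basis" "?K = \<bar>\<xi> \<bullet> i\<bar>" by (rule imageE) (rule that)
  have "norm \<xi> \<le> (\<Sum>b\<in>Basis. \<bar>\<xi> \<bullet> b\<bar>)" by (rule norm_le_l1)
  also have "\<dots> \<le> real DIM('a) * ?K" by (rule sum_bounded_above) auto
  finally have "norm \<xi> \<le> real DIM('a) * \<bar>\<xi> \<bullet> i\<bar>" unfolding i(2) .
  then show ?thesis using i(1) by (rule bexI)
qed

lemma nn_integral_average:
  fixes F :: "'a::euclidean_space \<Rightarrow> ennreal"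
  assumes [measurable]: "F \<in> borel_measurable borel"
  shows "(\<integral>\<^sup>+\<zeta>. F \<zeta> \<partial>lborel) = (\<integral>\<^sup>+\<zeta>. (\<integral>\<^sup>+y. F (\<zeta> + y *\<^sub>R i) * indicator {0..1::real} y \<partial>lborel) \<partial>lborel)"
proof -
  have translate: "(\<integral>\<^sup>+\<zeta>. F (\<zeta> + y *\<^sub>R i) * indicator {0..1} y \<partial>lborel) = (\<integral>\<^sup>+\<zeta>. F \<zeta> \<partial>lborel) * indicator {0..1} y" for y :: real
  proof -
    have "(\<integral>\<^sup>+\<zeta>. F (\<zeta> + y *\<^sub>R i) * indicator {0..1} y \<partial>lborel) = (\<integral>\<^sup>+\<zeta>. F (\<zeta> + y *\<^sub>R i) \<partial>lborel) * indicator {0..1} y"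
      by (rule nn_integral_multc) measurable
    then show ?thesis using nn_integral_translate[of F "- (y *\<^sub>R i)"] by simp
  qed
  have "(\<integral>\<^sup>+\<zeta>. (\<integral>\<^sup>+y. F (\<zeta> + y *\<^sub>R i) * indicator {0..1::real} y \<partial>lborel) \<partial>lborel) = (\<integral>\<^sup>+y. (\<integral>\<^sup>+\<zeta>. F (\<zeta> + y *\<^sub>R i) * indicator {0..1::real} y \<partial>lborel) \<partial>lborel)"
    by (rule lborel_pair.Fubini') measurable
  also have "\<dots> = (\<integral>\<^sup>+y. (\<integral>\<^sup>+\<zeta>. F \<zeta> \<partial>lborel) * indicator {0..1::real} y \<partial>lborel)" by (simp only: translate)
  also have "\<dots> = (\<integral>\<^sup>+\<zeta>. F \<zeta> \<partial>lborel)" by (simp add: nn_integral_cmult)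
  finally show ?thesis by simp
qed

lemma resonance_average_le:
  fixes \<xi> \<zeta> :: "'a::euclidean_space"
  assumes i: "i \<in> Basis"
  shows "(\<integral>\<^sup>+y. ennreal (\<bar>\<xi> \<bullet> i\<bar> * cauchy_kernel ((norm \<xi>)\<^sup>2 - (norm (\<xi> + (\<zeta> + y *\<^sub>R i)))\<^sup>2)) * indicator {0..1::real} y \<partial>lborel)
    \<le> ennreal (8 * (1 + norm \<zeta>))"
proof -
  define b where "b = (\<xi> + \<zeta>) \<bullet> i"
  define c where "c = (norm (\<xi> + \<zeta>))\<^sup>2 - (norm \<xi>)\<^sup>2"
  let ?h = "\<lambda>y. \<bar>\<xi> \<bullet> i\<bar> * cauchy_kernel (y\<^sup>2 + 2 * b * y + c)"
  have "(norm (\<xi> + (\<zeta> + y *\<^sub>R i)))\<^sup>2 = (norm (\<xi> + \<zeta>))\<^sup>2 + 2 * b * y + y\<^sup>2" for y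
    unfolding add.assoc[symmetric] power2_norm_eq_inner b_def using i
    by (simp add: inner_add_left inner_add_right inner_commute[of i \<xi>] inner_commute[of i \<zeta>] inner_Basis power2_eq_square algebra_simps)
  then have "(norm \<xi>)\<^sup>2 - (norm (\<xi> + (\<zeta> + y *\<^sub>R i)))\<^sup>2 = - (y\<^sup>2 + 2 * b * y + c)" for y
    by (simp add: c_def)
  then have "(\<integral>\<^sup>+y. ennreal (\<bar>\<xi> \<bullet> i\<bar> * cauchy_kernel ((norm \<xi>)\<^sup>2 - (norm (\<xi> + (\<zeta> + y *\<^sub>R i)))\<^sup>2)) * indicator {0..1::real} y \<partial>lborel)
      = (\<integral>\<^sup>+y. ennreal (?h y) * indicator {0..1} y \<partial>lborel)"
    by (simp only: cauchy_kernel_minus)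
  also have "\<dots> \<le> ennreal (8 * (1 + norm \<zeta>))"
  proof (cases "\<bar>b\<bar> \<ge> 1 + \<bar>\<xi> \<bullet> i\<bar> / 2")
    case True
    have "2 * pi \<le> 8 * (1 + norm \<zeta>)" using pi_less_4 by (simp add: distrib_left add_increasing2)
    then show ?thesis using nn_integral_cauchy_kernel_quadratic_le[OF True, of c] by (meson ennreal_leI order_trans)
  next
    case False
    have "b = \<xi> \<bullet> i + \<zeta> \<bullet> i" by (simp add: b_def inner_add_left)
    with False Basis_le_norm[OF i, of \<zeta>] have small: "\<bar>\<xi> \<bullet> i\<bar> \<le> 2 + 2 * norm \<zeta>" by linarith
    have "?h y \<le> 8 * (1 + norm \<zeta>)" for y
    proof -
      have "?h y \<le> (2 + 2 * norm \<zeta>) * 2" by (intro mult_mono small cauchy_kernel_le_2) auto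
      also have "\<dots> \<le> 8 * (1 + norm \<zeta>)" by simp
      finally show ?thesis .
    qed
    then have "(\<integral>\<^sup>+y. ennreal (?h y) * indicator {0..1} y \<partial>lborel) \<le> (\<integral>\<^sup>+y. ennreal (8 * (1 + norm \<zeta>)) * indicator {0..1::real} y \<partial>lborel)"
      by (intro nn_integral_mono mult_right_mono ennreal_leI) auto
    also have "\<dots> = ennreal (8 * (1 + norm \<zeta>))" by (simp add: nn_integral_cmult)
    finally show ?thesis .
  qed
  finally show ?thesis .
qed

lemma gaussian_resonance_average_le:
  fixes \<xi> \<zeta> :: "'a::euclidean_space"
  assumes i: "i \<in> Basis" and large: "norm \<xi> \<le> real DIM('a) * \<bar>\<xi> \<bullet> i\<bar>"
  shows "(\<integral>\<^sup>+y. ennreal (norm \<xi> * (gaussian (\<zeta> + y *\<^sub>R i) * cauchy_kernel ((norm \<xi>)\<^sup>2 - (norm (\<xi> + (\<zeta> + y *\<^sub>R i)))\<^sup>2))) * indicator {0..1::real} y \<partial>lborel)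
    \<le> ennreal (8 * (real DIM('a) * exp (1/2))) * ennreal ((1 + norm \<zeta>) * sqrt (gaussian \<zeta>))"
proof -
  let ?N = "real DIM('a) * exp (1/2) * sqrt (gaussian \<zeta>)" and ?k = "\<lambda>y. cauchy_kernel ((norm \<xi>)\<^sup>2 - (norm (\<xi> + (\<zeta> + y *\<^sub>R i)))\<^sup>2)"
  have resonance_le: "norm \<xi> * (gaussian (\<zeta> + y *\<^sub>R i) * ?k y) \<le> ?N * (\<bar>\<xi> \<bullet> i\<bar> * ?k y)" if "y \<in> {0..1}" for y
  proof -
    have "norm \<xi> * (gaussian (\<zeta> + y *\<^sub>R i) * ?k y) \<le> (real DIM('a) * \<bar>\<xi> \<bullet> i\<bar>) * ((exp (1/2) * sqrt (gaussian \<zeta>)) * ?k y)"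
      using i that by (intro mult_mono large gaussian_add_le order_refl) auto
    also have "\<dots> = ?N * (\<bar>\<xi> \<bullet> i\<bar> * ?k y)" by (simp only: mult_ac)
    finally show ?thesis .
  qed
  have "(\<integral>\<^sup>+y. ennreal (norm \<xi> * (gaussian (\<zeta> + y *\<^sub>R i) * ?k y)) * indicator {0..1::real} y \<partial>lborel)
     \<le> (\<integral>\<^sup>+y. ennreal ?N * (ennreal (\<bar>\<xi> \<bullet> i\<bar> * ?k y) * indicator {0..1} y) \<partial>lborel)"
  proof (rule nn_integral_mono)
    fix y :: real
    have product: "ennreal (?N * (\<bar>\<xi> \<bullet> i\<bar> * ?k y)) = ennreal ?N * ennreal (\<bar>\<xi> \<bullet> i\<bar> * ?k y)" by (rule ennreal_mult) auto
    show "ennreal (norm \<xi> * (gaussian (\<zeta> + y *\<^sub>R i) * ?k y)) * indicator {0..1} y \<le> ennreal ?N * (ennreal (\<bar>\<xi> \<bullet> i\<bar> * ?k y) * indicator {0..1} y)"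
    proof (cases "y \<in> {0..1}")
      case True
      show ?thesis using ennreal_leI[OF resonance_le[OF True]] by (simp only: indicator_simps(1)[OF True] mult_1_right product)
    qed simp
  qed
  also have "\<dots> = ennreal ?N * (\<integral>\<^sup>+y. ennreal (\<bar>\<xi> \<bullet> i\<bar> * ?k y) * indicator {0..1} y \<partial>lborel)"
    by (rule nn_integral_cmult) measurable
  also have "\<dots> \<le> ennreal ?N * ennreal (8 * (1 + norm \<zeta>))" by (intro mult_left_mono resonance_average_le i) simp
  also have "\<dots> = ennreal (?N * (8 * (1 + norm \<zeta>)))" by (rule ennreal_mult[symmetric]) auto
  also have "?N * (8 * (1 + norm \<zeta>)) = 8 * (real DIM('a) * exp (1/2)) * ((1 + norm \<zeta>) * sqrt (gaussian \<zeta>))"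
    by (simp only: mult_ac)
  also have "ennreal \<dots> = ennreal (8 * (real DIM('a) * exp (1/2))) * ennreal ((1 + norm \<zeta>) * sqrt (gaussian \<zeta>))"
    by (rule ennreal_mult) auto
  finally show ?thesis .
qed

lemma schur_kernel_gaussian_le:
  "schur_kernel gaussian \<xi> (\<xi> + \<zeta>) \<le> norm \<xi> * (gaussian \<zeta> * cauchy_kernel ((norm \<xi>)\<^sup>2 - (norm (\<xi> + \<zeta>))\<^sup>2))
    + 2 * ((1 + norm \<zeta>) * sqrt (gaussian \<zeta>))"
proof -
  let ?k = "cauchy_kernel ((norm \<xi>)\<^sup>2 - (norm (\<xi> + \<zeta>))\<^sup>2)"
  have "norm \<xi> * norm (\<xi> + \<zeta>) \<le> (norm \<xi> + norm \<zeta>)\<^sup>2"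
    unfolding power2_eq_square by (intro mult_mono norm_triangle_ineq) auto
  then have "sqrt (norm \<xi> * norm (\<xi> + \<zeta>)) \<le> norm \<xi> + norm \<zeta>" by (intro real_le_lsqrt) auto
  then have "sqrt (norm \<xi> * norm (\<xi> + \<zeta>)) * (gaussian \<zeta> * ?k) \<le> (norm \<xi> + norm \<zeta>) * (gaussian \<zeta> * ?k)"
    by (rule mult_right_mono) simp
  also have "\<dots> = norm \<xi> * (gaussian \<zeta> * ?k) + norm \<zeta> * gaussian \<zeta> * ?k" by (simp add: algebra_simps)
  also have "norm \<zeta> * gaussian \<zeta> * ?k \<le> (1 + norm \<zeta>) * sqrt (gaussian \<zeta>) * 2"
    unfolding sqrt_gaussian by (intro mult_mono cauchy_kernel_le_2) (auto simp: gaussian_def)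
  finally show ?thesis by (simp add: schur_kernel_def mult_ac)
qed

text \<open>For \<open>|\<xi>|\<close> large the resonance factor decays only transversally to the sphere \<open>|\<eta>| = |\<xi>|\<close>; averaging over unit
  translations in the direction of a large coordinate of \<open>\<xi>\<close> turns this into a one-dimensional integral.\<close>

lemma schur_kernel_gaussian_bound:
  obtains C where "C \<ge> 0" "\<And>\<xi>::'a::euclidean_space. (\<integral>\<^sup>+\<eta>. ennreal (schur_kernel gaussian \<xi> \<eta>) \<partial>lborel) \<le> ennreal C"
proof -
  let ?H = "\<lambda>\<zeta>::'a. ennreal ((1 + norm \<zeta>) * sqrt (gaussian \<zeta>))" and ?K = "ennreal (8 * (real DIM('a) * exp (1/2)))"
  define D where "D = (?K + 2) * (\<integral>\<^sup>+\<zeta>. ?H \<zeta> \<partial>lborel)"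
  have "D < \<infinity>" unfolding D_def using nn_integral_gaussian_moment_finite[where 'a='a] by (simp add: ennreal_mult_less_top)
  have schur_le: "(\<integral>\<^sup>+\<eta>. ennreal (schur_kernel gaussian \<xi> \<eta>) \<partial>lborel) \<le> D" for \<xi> :: 'a
  proof -
    let ?F = "\<lambda>\<zeta>. ennreal (norm \<xi> * (gaussian \<zeta> * cauchy_kernel ((norm \<xi>)\<^sup>2 - (norm (\<xi> + \<zeta>))\<^sup>2)))"
    obtain i where i: "i \<in> Basis" "norm \<xi> \<le> real DIM('a) * \<bar>\<xi> \<bullet> i\<bar>" using exists_large_coordinate by blast
    have "(\<integral>\<^sup>+\<eta>. ennreal (schur_kernel gaussian \<xi> \<eta>) \<partial>lborel) = (\<integral>\<^sup>+\<zeta>. ennreal (schur_kernel gaussian \<xi> (\<zeta> - - \<xi>)) \<partial>lborel)"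
      by (rule nn_integral_translate[symmetric]) (use schur_kernel_measurable(2)[OF gaussian_measurable] in measurable)
    also have "\<dots> \<le> (\<integral>\<^sup>+\<zeta>. ?F \<zeta> + 2 * ?H \<zeta> \<partial>lborel)"
      by (intro nn_integral_mono)
        (simp add: add.commute[of _ \<xi>] order_trans[OF ennreal_leI[OF schur_kernel_gaussian_le]] ennreal_mult)
    also have "\<dots> = (\<integral>\<^sup>+\<zeta>. ?F \<zeta> \<partial>lborel) + 2 * (\<integral>\<^sup>+\<zeta>. ?H \<zeta> \<partial>lborel)"
      by (subst nn_integral_add, measurable) (subst nn_integral_cmult, auto)
    also have "(\<integral>\<^sup>+\<zeta>. ?F \<zeta> \<partial>lborel) = (\<integral>\<^sup>+\<zeta>. (\<integral>\<^sup>+y. ?F (\<zeta> + y *\<^sub>R i) * indicator {0..1::real} y \<partial>lborel) \<partial>lborel)"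
      by (rule nn_integral_average) measurable
    also have "\<dots> \<le> (\<integral>\<^sup>+\<zeta>. ?K * ?H \<zeta> \<partial>lborel)"
      by (rule nn_integral_mono) (rule gaussian_resonance_average_le[OF i])
    also have "\<dots> = ?K * (\<integral>\<^sup>+\<zeta>. ?H \<zeta> \<partial>lborel)" by (rule nn_integral_cmult) measurable
    finally show ?thesis unfolding D_def by (simp add: distrib_right add_right_mono)
  qed
  have "D = ennreal (enn2real D)" using \<open>D < \<infinity>\<close> by simp
  with schur_le show ?thesis by (intro that[of "enn2real D"]) (auto simp del: ennreal_enn2real)
qed

lemma nn_integral_norm_1d:
  fixes F :: "real \<Rightarrow> ennreal"
  assumes "DIM('a::euclidean_space) = 1" and [measurable]: "F \<in> borel_measurable borel"
  shows "(\<integral>\<^sup>+(\<eta>::'a). F (norm \<eta>) \<partial>lborel) = (\<integral>\<^sup>+t. F \<bar>t\<bar> \<partial>lborel)"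
proof -
  obtain b where b: "(Basis :: 'a set) = {b}" using assms(1) by (rule card_1_singletonE)
  have norm_eq: "norm \<eta> = \<bar>\<eta> \<bullet> b\<bar>" for \<eta> :: 'a
    using euclidean_inner[of \<eta> \<eta>] by (simp add: b norm_eq_sqrt_inner flip: power2_eq_square)
  have "(\<integral>\<^sup>+(\<eta>::'a). (\<Prod>i\<in>Basis. F \<bar>\<eta> \<bullet> i\<bar>) \<partial>lborel) = (\<Prod>i\<in>(Basis::'a set). \<integral>\<^sup>+t. F \<bar>t\<bar> \<partial>lborel)"
    by (rule nn_integral_lborel_prod[where f="\<lambda>_ t. F \<bar>t\<bar>"]) auto
  then show ?thesis unfolding b by (simp add: norm_eq)
qed

lemma schur_kernel_const_bound:
  fixes \<xi> :: "'a::euclidean_space"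
  assumes "DIM('a) = 1"
  shows "(\<integral>\<^sup>+\<eta>. ennreal (schur_kernel (\<lambda>_. 1) \<xi> \<eta>) \<partial>lborel) \<le> ennreal (8 * pi)"
proof -
  have "(\<integral>\<^sup>+\<eta>. ennreal (schur_kernel (\<lambda>_. 1) \<xi> \<eta>) \<partial>lborel)
      = (\<integral>\<^sup>+t. ennreal (sqrt (\<bar>norm \<xi>\<bar> * \<bar>t\<bar>) * cauchy_kernel ((norm \<xi>)\<^sup>2 - t\<^sup>2)) \<partial>lborel)"
    using nn_integral_norm_1d[OF assms, of "\<lambda>u. ennreal (sqrt (norm \<xi> * u) * cauchy_kernel ((norm \<xi>)\<^sup>2 - u\<^sup>2))"]
    by (simp add: schur_kernel_def)
  also have "\<dots> \<le> ennreal (8 * pi)" by (rule nn_integral_cauchy_kernel_schur_le)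
  finally show ?thesis .
qed

section \<open>Kato smoothing for the free evolution\<close>

lemma
  shows integrable_gaussian_real: "integrable lborel (gaussian :: real \<Rightarrow> real)"
    and gaussian_FT_real: "(LINT r|lborel. complex_of_real (gaussian r) * cis (l * r)) = of_real (sqrt (2 * pi) * gaussian l)"
proof -
  have density: "gaussian r = sqrt (2 * pi) * std_normal_density r" for r :: real
    by (simp add: gaussian_def std_normal_density_def)
  show "integrable lborel (gaussian :: real \<Rightarrow> real)"
    unfolding density[abs_def] using integrable_normal_density[of 1 0] by simp
  have "(LINT r|lborel. std_normal_density r *\<^sub>R iexp (l * r)) = char std_normal_distribution l"
    unfolding char_def by (subst integral_density) auto
  also have "\<dots> = of_real (gaussian l)" by (simp add: char_std_normal_distribution gaussian_def)
  finally have "of_real (sqrt (2 * pi)) * (LINT r|lborel. std_normal_density r *\<^sub>R iexp (l * r)) = of_real (sqrt (2 * pi) * gaussian l)"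
    by simp
  then show "(LINT r|lborel. complex_of_real (gaussian r) * cis (l * r)) = of_real (sqrt (2 * pi) * gaussian l)"
    by (simp add: density cis_conv_exp scaleR_conv_of_real mult.assoc)
qed

lemma
  fixes f :: "'a::euclidean_space \<Rightarrow> complex" and g :: "'b::euclidean_space \<Rightarrow> complex"
  assumes "integrable lborel f" "integrable lborel g"
  shows integrable_lborel_pair: "integrable lborel (\<lambda>p. f (fst p) * g (snd p))"
    and integral_lborel_pair: "(LINT p|lborel. f (fst p) * g (snd p)) = (LINT x|lborel. f x) * (LINT y|lborel. g y)"
proof -
  have int: "integrable (lborel \<Otimes>\<^sub>M lborel) (\<lambda>p. f (fst p) * g (snd p))"
    using integrable_mult_pair[OF assms, of "\<lambda>_. 1" 1] by simp
  then show "integrable lborel (\<lambda>p. f (fst p) * g (snd p))" unfolding lborel_prod .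
  have "(LINT p|(lborel \<Otimes>\<^sub>M lborel). f (fst p) * g (snd p)) = (LINT x|lborel. LINT y|lborel. f x * g y)"
    using lborel_pair.integral_fst'[OF int] by simp
  then show "(LINT p|lborel. f (fst p) * g (snd p)) = (LINT x|lborel. f x) * (LINT y|lborel. g y)"
    unfolding lborel_prod by simp
qed

definition free_evolution :: "('a::euclidean_space \<Rightarrow> complex) \<Rightarrow> real \<Rightarrow> 'a \<Rightarrow> complex" where
  "free_evolution a r x = (LINT \<xi>|lborel. a \<xi> * cis (x \<bullet> \<xi> - r * (norm \<xi>)\<^sup>2))"

lemma free_evolution_measurable:
  assumes [measurable]: "a \<in> borel_measurable borel"
  shows "(\<lambda>q. free_evolution a (fst q) (snd q)) \<in> borel_measurable lborel"
  unfolding free_evolution_def by (simp only: lborel_prod[symmetric]) measurable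

lemma free_evolution_norm_sq:
  assumes a: "integrable lborel a"
  shows "of_real ((cmod (free_evolution a r x))\<^sup>2)
    = (LINT p|lborel. a (fst p) * cnj (a (snd p)) * cis (x \<bullet> (fst p - snd p) - r * ((norm (fst p))\<^sup>2 - (norm (snd p))\<^sup>2)))"
proof -
  let ?u = "\<lambda>\<xi>. a \<xi> * cis (x \<bullet> \<xi> - r * (norm \<xi>)\<^sup>2)"
  have int: "integrable lborel ?u" by (rule integrable_mult_cis[OF a]) measurable
  have product: "?u \<xi> * cnj (?u \<eta>) = a \<xi> * cnj (a \<eta>) * cis (x \<bullet> (\<xi> - \<eta>) - r * ((norm \<xi>)\<^sup>2 - (norm \<eta>)\<^sup>2))" for \<xi> \<eta>
  proof -
    have "?u \<xi> * cnj (?u \<eta>) = a \<xi> * cnj (a \<eta>) * (cis (x \<bullet> \<xi> - r * (norm \<xi>)\<^sup>2) * cnj (cis (x \<bullet> \<eta> - r * (norm \<eta>)\<^sup>2)))"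
      by (simp only: complex_cnj_mult mult_ac)
    also have "cis (x \<bullet> \<xi> - r * (norm \<xi>)\<^sup>2) * cnj (cis (x \<bullet> \<eta> - r * (norm \<eta>)\<^sup>2)) = cis (x \<bullet> (\<xi> - \<eta>) - r * ((norm \<xi>)\<^sup>2 - (norm \<eta>)\<^sup>2))"
      unfolding cis_cnj cis_mult by (simp add: algebra_simps)
    finally show ?thesis .
  qed
  have "of_real ((cmod (free_evolution a r x))\<^sup>2) = (LINT \<xi>|lborel. ?u \<xi>) * (LINT \<eta>|lborel. cnj (?u \<eta>))"
    unfolding complex_norm_square free_evolution_def by (simp only: Bochner_Integration.integral_cnj)
  also have "\<dots> = (LINT p|lborel. ?u (fst p) * cnj (?u (snd p)))"
    by (rule integral_lborel_pair[OF int, symmetric]) (rule integrable_bounded_linear[OF bounded_linear_cnj int])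
  finally show ?thesis by (simp only: product)
qed

lemma integral_gaussian_weight_cis:
  fixes \<rho> :: "'a::euclidean_space \<Rightarrow> real"
  assumes \<rho>: "integrable lborel \<rho>"
  shows "(LINT q|lborel. of_real (gaussian (fst q)) * of_real (\<rho> (snd q)) * cis (snd q \<bullet> \<zeta> - fst q * l))
    = of_real (sqrt (2 * pi) * gaussian l) * (LINT x|lborel. of_real (\<rho> x) * cis (x \<bullet> \<zeta>))"
proof -
  let ?u = "\<lambda>r. complex_of_real (gaussian r) * cis (- l * r)" and ?v = "\<lambda>x. complex_of_real (\<rho> x) * cis (x \<bullet> \<zeta>)"
  have "integrable lborel ?u" "integrable lborel ?v"
    by (rule integrable_mult_cis, rule integrable_of_real, rule integrable_gaussian_real, measurable)
       (rule integrable_mult_cis, rule integrable_of_real, rule \<rho>, measurable)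
  note integral_lborel_pair[OF this]
  moreover have "complex_of_real (gaussian (fst q)) * of_real (\<rho> (snd q)) * cis (snd q \<bullet> \<zeta> - fst q * l) = ?u (fst q) * ?v (snd q)" for q
  proof -
    have "cis (snd q \<bullet> \<zeta> - fst q * l) = cis (- l * fst q) * cis (snd q \<bullet> \<zeta>)" by (simp add: cis_mult mult.commute)
    then show ?thesis by (simp only: mult_ac)
  qed
  ultimately show ?thesis by (simp only: gaussian_FT_real[of "- l"] gaussian_minus)
qed

text \<open>The \<open>T T\<^sup>*\<close> step: squaring the evolution and integrating out space and time leaves the Fourier transform of the weight,
  evaluated at frequency differences.\<close>

lemma
  fixes a :: "'a::euclidean_space \<Rightarrow> complex" and \<rho> :: "'a \<Rightarrow> real"
  assumes a: "integrable lborel a" and \<rho>: "integrable lborel \<rho>"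
  shows integrable_free_evolution_sq:
      "integrable lborel (\<lambda>q. gaussian (fst q) * \<rho> (snd q) * (cmod (free_evolution a (fst q) (snd q)))\<^sup>2)"
    and integral_free_evolution_sq:
      "complex_of_real (LINT q|lborel. gaussian (fst q) * \<rho> (snd q) * (cmod (free_evolution a (fst q) (snd q)))\<^sup>2)
        = (LINT p|lborel. a (fst p) * cnj (a (snd p)) * (of_real (sqrt (2 * pi) * gaussian ((norm (fst p))\<^sup>2 - (norm (snd p))\<^sup>2))
            * (LINT x|lborel. of_real (\<rho> x) * cis (x \<bullet> (fst p - snd p)))))"
proof -
  let ?f = "\<lambda>q::real \<times> 'a. complex_of_real (gaussian (fst q)) * complex_of_real (\<rho> (snd q))" and ?g = "\<lambda>p. a (fst p) * cnj (a (snd p))"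
  let ?h = "\<lambda>(q::real \<times> 'a) (p::'a \<times> 'a). cis (snd q \<bullet> (fst p - snd p) - fst q * ((norm (fst p))\<^sup>2 - (norm (snd p))\<^sup>2))"
  have f: "integrable lborel ?f"
    by (intro integrable_lborel_pair integrable_of_real integrable_gaussian_real \<rho>)
  have g: "integrable lborel ?g"
    by (intro integrable_lborel_pair a integrable_bounded_linear[OF bounded_linear_cnj])
  have "(\<lambda>z. ?h (fst z) (snd z)) \<in> borel_measurable borel"
    by (intro borel_measurable_continuous_onI) (auto simp: cis_conv_exp intro!: continuous_intros)
  then have h: "(\<lambda>z. ?h (fst z) (snd z)) \<in> borel_measurable (lborel \<Otimes>\<^sub>M lborel)" by (simp add: lborel_prod)
  have int: "integrable (lborel \<Otimes>\<^sub>M lborel) (\<lambda>(q, p). ?f q * ?g p * ?h q p)"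
    using integrable_mult_pair[OF f g h, of 1] by (simp add: split_def)
  have inner: "(LINT p|lborel. ?f q * ?g p * ?h q p) = of_real (gaussian (fst q) * \<rho> (snd q) * (cmod (free_evolution a (fst q) (snd q)))\<^sup>2)" for q
    unfolding of_real_mult[of "gaussian (fst q) * _"] free_evolution_norm_sq[OF a]
    by (simp only: mult.assoc integral_mult_right_zero of_real_mult)
  have "integrable lborel (\<lambda>q. complex_of_real (gaussian (fst q) * \<rho> (snd q) * (cmod (free_evolution a (fst q) (snd q)))\<^sup>2))"
    using lborel_pair.integrable_fst[OF int] unfolding inner .
  from integrable_Re[OF this]
  show "integrable lborel (\<lambda>q. gaussian (fst q) * \<rho> (snd q) * (cmod (free_evolution a (fst q) (snd q)))\<^sup>2)"
    by (simp only: Re_complex_of_real)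
  have "complex_of_real (LINT q|lborel. gaussian (fst q) * \<rho> (snd q) * (cmod (free_evolution a (fst q) (snd q)))\<^sup>2)
      = (LINT q|lborel. (LINT p|lborel. ?f q * ?g p * ?h q p))"
    unfolding inner by (rule integral_complex_of_real[symmetric])
  also have "\<dots> = (LINT p|lborel. (LINT q|lborel. ?f q * ?g p * ?h q p))"
    by (rule lborel_pair.Fubini_integral[OF int, symmetric])
  also have "\<dots> = (LINT p|lborel. (LINT q|lborel. ?g p * (?f q * ?h q p)))" by (simp only: mult_ac)
  also have "\<dots> = (LINT p|lborel. ?g p * (LINT q|lborel. ?f q * ?h q p))" by (simp only: integral_mult_right_zero)
  finally show "complex_of_real (LINT q|lborel. gaussian (fst q) * \<rho> (snd q) * (cmod (free_evolution a (fst q) (snd q)))\<^sup>2)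
      = (LINT p|lborel. ?g p * (of_real (sqrt (2 * pi) * gaussian ((norm (fst p))\<^sup>2 - (norm (snd p))\<^sup>2))
          * (LINT x|lborel. of_real (\<rho> x) * cis (x \<bullet> (fst p - snd p)))))"
    unfolding integral_gaussian_weight_cis[OF \<rho>] .
qed

lemma nn_integral_free_evolution_sq_le:
  fixes a :: "'a::euclidean_space \<Rightarrow> complex"
  assumes a: "integrable lborel a" and \<rho>: "integrable lborel \<rho>" "\<And>x. \<rho> x \<ge> 0"
    and [measurable]: "\<kappa> \<in> borel_measurable borel"
    and \<kappa>: "\<And>\<zeta>. cmod (LINT x|lborel. of_real (\<rho> x) * cis (x \<bullet> \<zeta>)) \<le> \<kappa> \<zeta>"
  shows "(\<integral>\<^sup>+q. ennreal (gaussian (fst q) * \<rho> (snd q) * (cmod (free_evolution a (fst q) (snd q)))\<^sup>2) \<partial>lborel)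
    \<le> (\<integral>\<^sup>+\<xi>. (\<integral>\<^sup>+\<eta>. ennreal (cmod (a \<xi>) * cmod (a \<eta>) * (sqrt (2 * pi) * gaussian ((norm \<xi>)\<^sup>2 - (norm \<eta>)\<^sup>2) * \<kappa> (\<xi> - \<eta>))) \<partial>lborel) \<partial>lborel)"
proof -
  have [measurable]: "a \<in> borel_measurable borel" using borel_measurable_integrable[OF a] by simp
  let ?F = "\<lambda>q. gaussian (fst q) * \<rho> (snd q) * (cmod (free_evolution a (fst q) (snd q)))\<^sup>2"
  let ?G = "\<lambda>p. a (fst p) * cnj (a (snd p)) * (of_real (sqrt (2 * pi) * gaussian ((norm (fst p))\<^sup>2 - (norm (snd p))\<^sup>2))
    * (LINT x|lborel. of_real (\<rho> x) * cis (x \<bullet> (fst p - snd p))))"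
  let ?B = "\<lambda>\<xi> \<eta>. cmod (a \<xi>) * cmod (a \<eta>) * (sqrt (2 * pi) * gaussian ((norm \<xi>)\<^sup>2 - (norm \<eta>)\<^sup>2) * \<kappa> (\<xi> - \<eta>))"
  have "?F q \<ge> 0" for q using \<rho>(2) by simp
  then have "(\<integral>\<^sup>+q. ennreal (?F q) \<partial>lborel) = ennreal (cmod (complex_of_real (LINT q|lborel. ?F q)))"
    using nn_integral_eq_integral[OF integrable_free_evolution_sq[OF a \<rho>(1)]] by simp
  also have "\<dots> \<le> (\<integral>\<^sup>+p. ennreal (cmod (?G p)) \<partial>lborel)"
    unfolding integral_free_evolution_sq[OF a \<rho>(1)] by (rule ennreal_norm_integral_le)
  also have "\<dots> \<le> (\<integral>\<^sup>+p. (case p of (\<xi>, \<eta>) \<Rightarrow> ennreal (?B \<xi> \<eta>)) \<partial>lborel)"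
  proof (rule nn_integral_mono)
    fix p :: "'a \<times> 'a"
    obtain \<xi> \<eta> where p: "p = (\<xi>, \<eta>)" by (cases p)
    have "cmod (?G p) = cmod (a \<xi>) * cmod (a \<eta>)
        * (sqrt (2 * pi) * gaussian ((norm \<xi>)\<^sup>2 - (norm \<eta>)\<^sup>2) * cmod (LINT x|lborel. of_real (\<rho> x) * cis (x \<bullet> (\<xi> - \<eta>))))"
      by (simp add: p norm_mult)
    also have "\<dots> \<le> ?B \<xi> \<eta>" by (intro mult_left_mono \<kappa>) auto
    finally show "ennreal (cmod (?G p)) \<le> (case p of (\<xi>, \<eta>) \<Rightarrow> ennreal (?B \<xi> \<eta>))" unfolding p by (simp only: prod.case ennreal_leI)
  qed
  also have "\<dots> = (\<integral>\<^sup>+\<xi>. (\<integral>\<^sup>+\<eta>. ennreal (?B \<xi> \<eta>) \<partial>lborel) \<partial>lborel)"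
    unfolding lborel_prod[symmetric] by (subst lborel.nn_integral_fst[symmetric]) auto
  finally show ?thesis .
qed

lemma schur_test:
  fixes A :: "'a::euclidean_space \<Rightarrow> real" and k :: "'a \<Rightarrow> 'a \<Rightarrow> real"
  assumes [measurable]: "A \<in> borel_measurable borel" "case_prod k \<in> borel_measurable (borel \<Otimes>\<^sub>M borel)"
    and nonneg: "\<And>\<xi>. A \<xi> \<ge> 0" "\<And>\<xi> \<eta>. k \<xi> \<eta> \<ge> 0" and commute: "\<And>\<xi> \<eta>. k \<xi> \<eta> = k \<eta> \<xi>"
    and C: "\<And>\<xi>. (\<integral>\<^sup>+\<eta>. ennreal (k \<xi> \<eta>) \<partial>lborel) \<le> ennreal C"
  shows "(\<integral>\<^sup>+\<xi>. (\<integral>\<^sup>+\<eta>. ennreal (A \<xi> * A \<eta> * k \<xi> \<eta>) \<partial>lborel) \<partial>lborel) \<le> 2 * (ennreal C * (\<integral>\<^sup>+\<xi>. ennreal ((A \<xi>)\<^sup>2) \<partial>lborel))"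
proof -
  let ?f = "\<lambda>\<xi> \<eta>. ennreal ((A \<xi>)\<^sup>2) * ennreal (k \<xi> \<eta>)"
  have f [measurable]: "case_prod ?f \<in> borel_measurable (lborel \<Otimes>\<^sub>M lborel)" by measurable
  have AM_GM: "ennreal (A \<xi> * A \<eta> * k \<xi> \<eta>) \<le> ?f \<xi> \<eta> + ?f \<eta> \<xi>" for \<xi> \<eta>
  proof -
    have "A \<xi> * A \<eta> \<le> (A \<xi>)\<^sup>2 + (A \<eta>)\<^sup>2"
      using sum_squares_bound[of "A \<xi>" "A \<eta>"] mult_nonneg_nonneg[OF nonneg(1)[of \<xi>] nonneg(1)[of \<eta>]] by linarith
    from mult_right_mono[OF this nonneg(2)]
    have "A \<xi> * A \<eta> * k \<xi> \<eta> \<le> (A \<xi>)\<^sup>2 * k \<xi> \<eta> + (A \<eta>)\<^sup>2 * k \<eta> \<xi>" by (simp add: distrib_right commute[of \<eta> \<xi>])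
    from ennreal_leI[OF this] show ?thesis using nonneg by (simp add: ennreal_mult)
  qed
  have "(\<integral>\<^sup>+\<xi>. (\<integral>\<^sup>+\<eta>. ennreal (A \<xi> * A \<eta> * k \<xi> \<eta>) \<partial>lborel) \<partial>lborel) \<le> (\<integral>\<^sup>+\<xi>. (\<integral>\<^sup>+\<eta>. ?f \<xi> \<eta> + ?f \<eta> \<xi> \<partial>lborel) \<partial>lborel)"
    by (intro nn_integral_mono AM_GM)
  also have "\<dots> = (\<integral>\<^sup>+\<xi>. (\<integral>\<^sup>+\<eta>. ?f \<xi> \<eta> \<partial>lborel) + (\<integral>\<^sup>+\<eta>. ?f \<eta> \<xi> \<partial>lborel) \<partial>lborel)"
    by (intro nn_integral_cong nn_integral_add) measurable
  also have "\<dots> = (\<integral>\<^sup>+\<xi>. (\<integral>\<^sup>+\<eta>. ?f \<xi> \<eta> \<partial>lborel) \<partial>lborel) + (\<integral>\<^sup>+\<xi>. (\<integral>\<^sup>+\<eta>. ?f \<eta> \<xi> \<partial>lborel) \<partial>lborel)"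
    by (rule nn_integral_add) measurable
  also have "(\<integral>\<^sup>+\<xi>. (\<integral>\<^sup>+\<eta>. ?f \<eta> \<xi> \<partial>lborel) \<partial>lborel) = (\<integral>\<^sup>+\<xi>. (\<integral>\<^sup>+\<eta>. ?f \<xi> \<eta> \<partial>lborel) \<partial>lborel)"
    by (rule lborel_pair.Fubini'[OF f])
  also have "(\<integral>\<^sup>+\<xi>. (\<integral>\<^sup>+\<eta>. ?f \<xi> \<eta> \<partial>lborel) \<partial>lborel) \<le> (\<integral>\<^sup>+\<xi>. ennreal C * ennreal ((A \<xi>)\<^sup>2) \<partial>lborel)"
  proof (rule nn_integral_mono)
    fix \<xi>
    have "(\<integral>\<^sup>+\<eta>. ?f \<xi> \<eta> \<partial>lborel) = ennreal ((A \<xi>)\<^sup>2) * (\<integral>\<^sup>+\<eta>. ennreal (k \<xi> \<eta>) \<partial>lborel)" by (rule nn_integral_cmult) measurable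
    also have "\<dots> \<le> ennreal ((A \<xi>)\<^sup>2) * ennreal C" by (intro mult_left_mono C) simp
    finally show "(\<integral>\<^sup>+\<eta>. ?f \<xi> \<eta> \<partial>lborel) \<le> ennreal C * ennreal ((A \<xi>)\<^sup>2)" by (simp add: mult.commute)
  qed
  also have "\<dots> = ennreal C * (\<integral>\<^sup>+\<xi>. ennreal ((A \<xi>)\<^sup>2) \<partial>lborel)" by (rule nn_integral_cmult) measurable
  finally show ?thesis by (simp add: mult_2 add_mono)
qed

text \<open>A weight enters only through a majorant \<open>\<kappa>\<close> of its Fourier transform.\<close>

definition smoothing_weight :: "('a::euclidean_space \<Rightarrow> real) \<Rightarrow> real \<Rightarrow> bool" where
  "smoothing_weight \<rho> C \<longleftrightarrow> integrable lborel \<rho> \<and> (\<forall>x. \<rho> x \<ge> 0) \<and> C \<ge> 0 \<and>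
     (\<exists>\<kappa>. \<kappa> \<in> borel_measurable borel \<and> (\<forall>\<zeta>. \<kappa> (- \<zeta>) = \<kappa> \<zeta>) \<and>
        (\<forall>\<zeta>. cmod (LINT x|lborel. of_real (\<rho> x) * cis (x \<bullet> \<zeta>)) \<le> \<kappa> \<zeta>) \<and>
        (\<forall>\<xi>. (\<integral>\<^sup>+\<eta>. ennreal (schur_kernel \<kappa> \<xi> \<eta>) \<partial>lborel) \<le> ennreal C))"

lemma smoothing_weightD:
  assumes "smoothing_weight \<rho> C"
  shows smoothing_weight_integrable: "integrable lborel \<rho>" and smoothing_weight_nonneg: "\<rho> x \<ge> 0"
    and smoothing_weight_const_nonneg: "C \<ge> 0" and smoothing_weight_measurable: "\<rho> \<in> borel_measurable borel"
  using assms borel_measurable_integrable[of lborel \<rho>] by (auto simp: smoothing_weight_def)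

lemma nn_integral_free_evolution_smoothing:
  fixes a :: "'a::euclidean_space \<Rightarrow> complex"
  assumes w: "smoothing_weight \<rho> C" and a: "integrable lborel a"
    and A [measurable]: "A \<in> borel_measurable borel" and A_nonneg: "\<And>\<xi>. A \<xi> \<ge> 0" and a_le: "\<And>\<xi>. cmod (a \<xi>) \<le> sqrt (norm \<xi>) * A \<xi>"
  shows "(\<integral>\<^sup>+q. ennreal (gaussian (fst q) * \<rho> (snd q) * (cmod (free_evolution a (fst q) (snd q)))\<^sup>2) \<partial>lborel)
    \<le> ennreal (2 * sqrt (2 * pi) * C) * (\<integral>\<^sup>+\<xi>. ennreal ((A \<xi>)\<^sup>2) \<partial>lborel)"
proof -
  obtain \<kappa> where \<kappa> [measurable]: "\<kappa> \<in> borel_measurable borel" and even: "\<And>\<zeta>. \<kappa> (- \<zeta>) = \<kappa> \<zeta>"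
    and FT_le: "\<And>\<zeta>. cmod (LINT x|lborel. of_real (\<rho> x) * cis (x \<bullet> \<zeta>)) \<le> \<kappa> \<zeta>"
    and schur: "\<And>\<xi>. (\<integral>\<^sup>+\<eta>. ennreal (schur_kernel \<kappa> \<xi> \<eta>) \<partial>lborel) \<le> ennreal C"
    using w unfolding smoothing_weight_def by blast
  note [measurable] = schur_kernel_measurable[OF \<kappa>]
  have \<kappa>_nonneg: "\<kappa> \<zeta> \<ge> 0" for \<zeta> using order_trans[OF norm_ge_zero FT_le] .
  have kernel_nonneg: "schur_kernel \<kappa> \<xi> \<eta> \<ge> 0" for \<xi> \<eta> by (rule schur_kernel_nonneg[OF \<kappa>_nonneg])
  have kernel_commute: "schur_kernel \<kappa> \<xi> \<eta> = schur_kernel \<kappa> \<eta> \<xi>" for \<xi> \<eta> using even by (rule schur_kernel_commute)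
  have integrand_le: "ennreal (cmod (a \<xi>) * cmod (a \<eta>) * (sqrt (2 * pi) * gaussian ((norm \<xi>)\<^sup>2 - (norm \<eta>)\<^sup>2) * \<kappa> (\<xi> - \<eta>)))
      \<le> ennreal (sqrt (2 * pi)) * ennreal (A \<xi> * A \<eta> * schur_kernel \<kappa> \<xi> \<eta>)" for \<xi> \<eta>
  proof -
    have "cmod (a \<xi>) * cmod (a \<eta>) * (sqrt (2 * pi) * gaussian ((norm \<xi>)\<^sup>2 - (norm \<eta>)\<^sup>2) * \<kappa> (\<xi> - \<eta>))
       \<le> (sqrt (norm \<xi>) * A \<xi>) * (sqrt (norm \<eta>) * A \<eta>) * (sqrt (2 * pi) * cauchy_kernel ((norm \<xi>)\<^sup>2 - (norm \<eta>)\<^sup>2) * \<kappa> (\<xi> - \<eta>))"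
      by (intro mult_mono a_le gaussian_le_cauchy_kernel order_refl mult_nonneg_nonneg \<kappa>_nonneg A_nonneg) auto
    also have "\<dots> = sqrt (2 * pi) * (A \<xi> * A \<eta> * schur_kernel \<kappa> \<xi> \<eta>)"
      unfolding schur_kernel_def real_sqrt_mult by (simp only: mult_ac)
    finally show ?thesis using A_nonneg kernel_nonneg by (subst ennreal_mult[symmetric]) (auto intro: ennreal_leI)
  qed
  have "(\<integral>\<^sup>+q. ennreal (gaussian (fst q) * \<rho> (snd q) * (cmod (free_evolution a (fst q) (snd q)))\<^sup>2) \<partial>lborel)
     \<le> (\<integral>\<^sup>+\<xi>. (\<integral>\<^sup>+\<eta>. ennreal (sqrt (2 * pi)) * ennreal (A \<xi> * A \<eta> * schur_kernel \<kappa> \<xi> \<eta>) \<partial>lborel) \<partial>lborel)"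
    by (rule order_trans[OF nn_integral_free_evolution_sq_le[OF a smoothing_weight_integrable[OF w] smoothing_weight_nonneg[OF w] \<kappa> FT_le]])
       (intro nn_integral_mono integrand_le)
  also have "\<dots> = ennreal (sqrt (2 * pi)) * (\<integral>\<^sup>+\<xi>. (\<integral>\<^sup>+\<eta>. ennreal (A \<xi> * A \<eta> * schur_kernel \<kappa> \<xi> \<eta>) \<partial>lborel) \<partial>lborel)"
    by (subst nn_integral_cmult[symmetric], measurable) (intro nn_integral_cong nn_integral_cmult, measurable)
  also have "\<dots> \<le> ennreal (sqrt (2 * pi)) * (2 * (ennreal C * (\<integral>\<^sup>+\<xi>. ennreal ((A \<xi>)\<^sup>2) \<partial>lborel)))"
    by (intro mult_left_mono schur_test[OF A schur_kernel_measurable(1)[OF \<kappa>] A_nonneg kernel_nonneg kernel_commute schur]) simp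
  also have "\<dots> = ennreal (2 * sqrt (2 * pi) * C) * (\<integral>\<^sup>+\<xi>. ennreal ((A \<xi>)\<^sup>2) \<partial>lborel)"
    using smoothing_weight_const_nonneg[OF w] by (simp add: ennreal_mult mult_ac)
  finally show ?thesis .
qed

lemma gaussian_cis_eq_prod:
  "complex_of_real (gaussian x) * cis (x \<bullet> \<zeta>) = (\<Prod>i\<in>Basis. complex_of_real (gaussian (x \<bullet> i)) * cis ((\<zeta> \<bullet> i) * (x \<bullet> i)))"
  for x \<zeta> :: "'a::euclidean_space"
proof -
  have "x \<bullet> \<zeta> = (\<Sum>i\<in>Basis. (\<zeta> \<bullet> i) * (x \<bullet> i))" by (subst euclidean_inner) (simp add: mult.commute)
  then have "cis (x \<bullet> \<zeta>) = (\<Prod>i\<in>Basis. cis ((\<zeta> \<bullet> i) * (x \<bullet> i)))" by (simp only: cis_sum[OF finite_Basis])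
  then show ?thesis by (simp only: gaussian_eq_prod[of x] of_real_prod prod.distrib)
qed

lemma
  fixes \<zeta> :: "'a::euclidean_space"
  shows integrable_gaussian_cis: "integrable lborel (\<lambda>x. complex_of_real (gaussian x) * cis (x \<bullet> \<zeta>))"
    and gaussian_FT: "(LINT x|lborel. complex_of_real (gaussian x) * cis (x \<bullet> \<zeta>)) = of_real (sqrt (2 * pi) ^ DIM('a) * gaussian \<zeta>)"
proof -
  let ?f = "\<lambda>(i::'a) t. complex_of_real (gaussian t) * cis ((\<zeta> \<bullet> i) * t)"
  have int: "integrable lborel (?f i)" for i
    by (rule integrable_mult_cis[OF integrable_of_real[OF integrable_gaussian_real]]) measurable
  then show "integrable lborel (\<lambda>x. complex_of_real (gaussian x) * cis (x \<bullet> \<zeta>))"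
    unfolding gaussian_cis_eq_prod using integrable_lborel_prod[of ?f] by blast
  have "(LINT x|lborel. complex_of_real (gaussian x) * cis (x \<bullet> \<zeta>)) = (\<Prod>i\<in>(Basis::'a set). LINT t|lborel. ?f i t)"
    unfolding gaussian_cis_eq_prod using integral_lborel_prod[of ?f] int by blast
  then show "(LINT x|lborel. complex_of_real (gaussian x) * cis (x \<bullet> \<zeta>)) = of_real (sqrt (2 * pi) ^ DIM('a) * gaussian \<zeta>)"
    by (simp only: gaussian_FT_real of_real_prod[symmetric] prod.distrib prod_constant gaussian_eq_prod[of \<zeta>])
qed

lemma integrable_gaussian: "integrable lborel (\<lambda>x::'a::euclidean_space. gaussian (x - b))"
proof -
  have "integrable lborel (gaussian :: 'a \<Rightarrow> real)"
    using integrable_Re[OF integrable_gaussian_cis[of 0]] by simp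
  then have "integrable (distr lborel borel (\<lambda>x::'a. x - b)) gaussian"
    by (simp only: distr_lborel_translate)
  then show ?thesis by (subst (asm) integrable_distr_eq) auto
qed

lemma cmod_gaussian_FT:
  fixes b \<zeta> :: "'a::euclidean_space"
  shows "cmod (LINT x|lborel. complex_of_real (gaussian (x - b)) * cis (x \<bullet> \<zeta>)) = sqrt (2 * pi) ^ DIM('a) * gaussian \<zeta>"
proof -
  have "complex_of_real (gaussian (x - b)) * cis (x \<bullet> \<zeta>) = cis (b \<bullet> \<zeta>) * (complex_of_real (gaussian (x - b)) * cis ((x - b) \<bullet> \<zeta>))" for x
  proof -
    have "cis (x \<bullet> \<zeta>) = cis (b \<bullet> \<zeta>) * cis ((x - b) \<bullet> \<zeta>)" by (simp add: cis_mult inner_diff_left)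
    then show ?thesis by (simp only: mult_ac)
  qed
  then have "(LINT x|lborel. complex_of_real (gaussian (x - b)) * cis (x \<bullet> \<zeta>))
      = cis (b \<bullet> \<zeta>) * (LINT x|lborel. complex_of_real (gaussian (x - b)) * cis ((x - b) \<bullet> \<zeta>))"
    by (simp only: integral_mult_right_zero)
  also have "(LINT x|lborel. complex_of_real (gaussian (x - b)) * cis ((x - b) \<bullet> \<zeta>)) = (LINT x|lborel. complex_of_real (gaussian x) * cis (x \<bullet> \<zeta>))"
    by (rule integral_translate[of "\<lambda>x. complex_of_real (gaussian x) * cis (x \<bullet> \<zeta>)"]) measurable
  finally show ?thesis unfolding gaussian_FT by (simp add: norm_mult norm_power abs_mult power_abs)
qed

lemma smoothing_weight_gaussian: "\<exists>C. \<forall>b::'a::euclidean_space. smoothing_weight (\<lambda>x. gaussian (x - b)) C"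
proof -
  obtain C where C: "C \<ge> 0" "\<And>\<xi>::'a. (\<integral>\<^sup>+\<eta>. ennreal (schur_kernel gaussian \<xi> \<eta>) \<partial>lborel) \<le> ennreal C"
    using schur_kernel_gaussian_bound[where 'a='a] by blast
  let ?D = "sqrt (2 * pi) ^ DIM('a)"
  have "smoothing_weight (\<lambda>x. gaussian (x - b)) (?D * C)" for b :: 'a
    unfolding smoothing_weight_def
  proof (intro conjI exI[of _ "\<lambda>\<zeta>. ?D * gaussian \<zeta>"] allI)
    show "integrable lborel (\<lambda>x. gaussian (x - b))" by (rule integrable_gaussian)
    show "cmod (LINT x|lborel. complex_of_real (gaussian (x - b)) * cis (x \<bullet> \<zeta>)) \<le> ?D * gaussian \<zeta>" for \<zeta>
      by (rule eq_refl[OF cmod_gaussian_FT])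
    show "(\<integral>\<^sup>+\<eta>. ennreal (schur_kernel (\<lambda>\<zeta>. ?D * gaussian \<zeta>) \<xi> \<eta>) \<partial>lborel) \<le> ennreal (?D * C)" for \<xi> :: 'a
      using C by (simp add: nn_integral_schur_kernel_cmult ennreal_mult mult_left_mono)
  qed (use C in auto)
  then show ?thesis by blast
qed

lemma smoothing_weight_indicator:
  fixes A :: "'a::euclidean_space set"
  assumes dim: "DIM('a) = 1" and A: "A \<in> sets borel" "emeasure lborel A < \<infinity>"
  shows "smoothing_weight (indicator A) (measure lborel A * (8 * pi))"
  unfolding smoothing_weight_def
proof (intro conjI exI[of _ "\<lambda>_. measure lborel A * 1"] allI)
  show "integrable lborel (indicator A :: 'a \<Rightarrow> real)" using A by (simp add: integrable_indicator_iff)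
  show "cmod (LINT x|lborel. complex_of_real (indicator A x) * cis (x \<bullet> \<zeta>)) \<le> measure lborel A * 1" for \<zeta>
  proof -
    have "cmod (LINT x|lborel. complex_of_real (indicator A x) * cis (x \<bullet> \<zeta>)) \<le> (LINT x|lborel. cmod (complex_of_real (indicator A x) * cis (x \<bullet> \<zeta>)))"
      by (rule integral_norm_bound)
    also have "\<dots> = (LINT x|lborel. indicator A x)" by (simp add: norm_mult)
    finally show ?thesis using A by simp
  qed
  show "(\<integral>\<^sup>+\<eta>. ennreal (schur_kernel (\<lambda>_. measure lborel A * 1) \<xi> \<eta>) \<partial>lborel) \<le> ennreal (measure lborel A * (8 * pi))" for \<xi> :: 'a
    using schur_kernel_const_bound[OF dim, of \<xi>] by (subst nn_integral_schur_kernel_cmult) (auto simp: ennreal_mult intro: mult_left_mono)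
qed auto

section \<open>Kato smoothing with a forcing term\<close>

lemma has_real_derivative_abs_powr:
  fixes \<alpha> t :: real
  assumes "\<alpha> > 0" "t \<ge> 0"
  shows "((\<lambda>t. \<bar>t\<bar> powr (\<alpha> + 1) / (\<alpha> + 1)) has_real_derivative t powr \<alpha>) (at t)"
proof (cases "t = 0")
  case True
  have "((\<lambda>h::real. \<bar>h\<bar> powr \<alpha> / (\<alpha> + 1)) \<longlongrightarrow> 0) (at 0)"
    using assms(1) by (intro tendsto_divide_zero tendsto_zero_powrI[where b=\<alpha>] tendsto_rabs_zero tendsto_ident_at tendsto_const) auto
  then have "((\<lambda>h. (\<bar>0 + h\<bar> powr (\<alpha> + 1) / (\<alpha> + 1) - \<bar>0\<bar> powr (\<alpha> + 1) / (\<alpha> + 1)) / h) \<longlongrightarrow> 0) (at 0)"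
  proof (rule Lim_null_comparison[rotated], intro always_eventually allI)
    fix h :: real
    show "norm ((\<bar>0 + h\<bar> powr (\<alpha> + 1) / (\<alpha> + 1) - \<bar>0\<bar> powr (\<alpha> + 1) / (\<alpha> + 1)) / h) \<le> \<bar>h\<bar> powr \<alpha> / (\<alpha> + 1)"
      using assms(1) by (simp add: abs_mult powr_add)
  qed
  then show ?thesis using True assms(1) by (simp add: DERIV_def)
next
  case False
  then have "t > 0" using assms(2) by simp
  have "((\<lambda>t. t powr (\<alpha> + 1) / (\<alpha> + 1)) has_real_derivative t powr \<alpha>) (at t)"
    using \<open>t > 0\<close> assms(1) by (auto intro!: derivative_eq_intros)
  then show ?thesis
    by (rule has_field_derivative_transform_within_open[where S="{0<..}"]) (use \<open>t > 0\<close> in auto)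
qed

lemma nn_integral_phase:
  fixes h :: "real \<Rightarrow> ennreal"
  assumes \<alpha>: "\<alpha> > 0" and T: "T > 0" and [measurable]: "h \<in> borel_measurable borel"
  shows "(\<integral>\<^sup>+t. h (phase \<alpha> t) * ennreal (t powr \<alpha>) * indicator {0..T} t \<partial>lborel) = (\<integral>\<^sup>+r. h r * indicator {0..phase \<alpha> T} r \<partial>lborel)"
proof -
  let ?g = "\<lambda>t. \<bar>t\<bar> powr (\<alpha> + 1) / (\<alpha> + 1)"
  have "(\<integral>\<^sup>+r. h r * indicator {?g 0..?g T} r \<partial>lborel) = (\<integral>\<^sup>+t. h (?g t) * ennreal (t powr \<alpha>) * indicator {0..T} t \<partial>lborel)"
  proof (rule nn_integral_substitution_aux)
    show "continuous_on {0..T} (\<lambda>t. t powr \<alpha>)" using \<alpha> by (intro continuous_on_powr' continuous_intros) auto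
  qed (use \<alpha> T in \<open>auto intro: has_real_derivative_abs_powr\<close>)
  moreover have "(\<integral>\<^sup>+t. h (?g t) * ennreal (t powr \<alpha>) * indicator {0..T} t \<partial>lborel)
      = (\<integral>\<^sup>+t. h (phase \<alpha> t) * ennreal (t powr \<alpha>) * indicator {0..T} t \<partial>lborel)"
    by (intro nn_integral_cong) (auto simp: indicator_def phase_def)
  ultimately show ?thesis using T by (simp add: phase_def)
qed

lemma integral_sq_le:
  fixes g :: "real \<Rightarrow> complex"
  assumes g: "continuous_on UNIV g" and t: "0 \<le> t" "t \<le> T"
  shows "ennreal ((cmod (integral {0..t} g))\<^sup>2) \<le> ennreal T * (\<integral>\<^sup>+\<tau>. ennreal ((cmod (g \<tau>))\<^sup>2) * indicator {0..T} \<tau> \<partial>lborel)"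
proof -
  have [measurable]: "g \<in> borel_measurable borel" by (rule borel_measurable_continuous_onI[OF g])
  have "integral {0..t} g = (LINT \<tau>:{0..t}|lborel. g \<tau>)"
    by (rule set_borel_integral_eq_integral(2)[symmetric]) (rule borel_integrable_atLeastAtMost', rule continuous_on_subset[OF g], simp)
  then have "ennreal (cmod (integral {0..t} g)) \<le> (\<integral>\<^sup>+\<tau>. ennreal (cmod (indicator {0..t} \<tau> *\<^sub>R g \<tau>)) \<partial>lborel)"
    unfolding set_lebesgue_integral_def by (simp only: ennreal_norm_integral_le)
  also have "\<dots> = (\<integral>\<^sup>+\<tau>. (ennreal (cmod (g \<tau>)) * indicator {0..t} \<tau>) * indicator {0..t} \<tau> \<partial>lborel)"
    by (intro nn_integral_cong) (auto simp: indicator_def)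
  finally have "(ennreal (cmod (integral {0..t} g)))\<^sup>2 \<le> (\<integral>\<^sup>+\<tau>. (ennreal (cmod (g \<tau>)) * indicator {0..t} \<tau>) * indicator {0..t} \<tau> \<partial>lborel)\<^sup>2"
    by (rule power_mono) simp
  also have "\<dots> \<le> (\<integral>\<^sup>+\<tau>. (ennreal (cmod (g \<tau>)) * indicator {0..t} \<tau>)\<^sup>2 \<partial>lborel) * (\<integral>\<^sup>+\<tau>. (indicator {0..t} \<tau>)\<^sup>2 \<partial>lborel)"
    by (rule Cauchy_Schwarz_nn_integral) measurable
  also have "(\<integral>\<^sup>+\<tau>. (indicator {0..t} \<tau> :: ennreal)\<^sup>2 \<partial>lborel) = (\<integral>\<^sup>+\<tau>. indicator {0..t} \<tau> \<partial>lborel)"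
    by (intro nn_integral_cong) (auto simp: indicator_def)
  also have "\<dots> = ennreal t" using t by simp
  also have "(\<integral>\<^sup>+\<tau>. (ennreal (cmod (g \<tau>)) * indicator {0..t} \<tau>)\<^sup>2 \<partial>lborel) \<le> (\<integral>\<^sup>+\<tau>. ennreal ((cmod (g \<tau>))\<^sup>2) * indicator {0..T} \<tau> \<partial>lborel)"
    by (intro nn_integral_mono) (use t in \<open>auto simp: indicator_def ennreal_power\<close>)
  also have "ennreal t \<le> ennreal T" using t by (intro ennreal_leI)
  finally show ?thesis by (simp add: ennreal_power mult.commute mult_mono)
qed

lemma functional_duhamel_sq_le:
  fixes k :: "'b::banach \<Rightarrow> complex"
  assumes k: "bounded_linear k" and G: "continuous_on UNIV G" and t: "t \<in> {0..T}"
  shows "ennreal ((cmod (k (U0 + integral {0..t} G)))\<^sup>2)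
    \<le> 2 * (ennreal ((cmod (k U0))\<^sup>2) + ennreal T * (\<integral>\<^sup>+\<tau>. ennreal ((cmod (k (G \<tau>)))\<^sup>2) * indicator {0..T} \<tau> \<partial>lborel))"
proof -
  interpret bounded_linear k by (rule k)
  have "continuous_on {0..t} G" by (rule continuous_on_subset[OF G]) simp
  from integral_linear[OF integrable_continuous_interval[OF this] k]
  have "k (U0 + integral {0..t} G) = k U0 + integral {0..t} (\<lambda>\<tau>. k (G \<tau>))" by (simp add: add comp_def)
  then have "ennreal (cmod (k (U0 + integral {0..t} G))) \<le> ennreal (cmod (k U0)) + ennreal (cmod (integral {0..t} (\<lambda>\<tau>. k (G \<tau>))))"
    by (simp add: norm_triangle_ineq ennreal_leI flip: ennreal_plus)
  then have "(ennreal (cmod (k (U0 + integral {0..t} G))))\<^sup>2 \<le> (ennreal (cmod (k U0)) + ennreal (cmod (integral {0..t} (\<lambda>\<tau>. k (G \<tau>)))))\<^sup>2"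
    by (rule power_mono) simp
  also have "\<dots> \<le> 2 * ((ennreal (cmod (k U0)))\<^sup>2 + (ennreal (cmod (integral {0..t} (\<lambda>\<tau>. k (G \<tau>)))))\<^sup>2)" by (rule ennreal_sum_sq_le)
  also have "\<dots> \<le> 2 * ((ennreal (cmod (k U0)))\<^sup>2 + ennreal T * (\<integral>\<^sup>+\<tau>. ennreal ((cmod (k (G \<tau>)))\<^sup>2) * indicator {0..T} \<tau> \<partial>lborel))"
    unfolding ennreal_power[OF norm_ge_zero]
    by (intro mult_left_mono add_left_mono integral_sq_le continuous_on G) (use t in auto)
  finally show ?thesis by (simp add: ennreal_power)
qed

definition duhamel_bound :: "real \<Rightarrow> 'b::real_normed_vector \<Rightarrow> (real \<Rightarrow> 'b) \<Rightarrow> ennreal" where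
  "duhamel_bound T U0 G = 2 * (ennreal ((norm U0)\<^sup>2) + ennreal T * (\<integral>\<^sup>+\<tau>. ennreal ((norm (G \<tau>))\<^sup>2) * indicator {0..T} \<tau> \<partial>lborel))"

lemma (in sigma_finite_measure) nn_integral_swap_le:
  fixes K :: "'a \<Rightarrow> real \<Rightarrow> ennreal" and h :: "real \<Rightarrow> ennreal"
  assumes K: "(\<lambda>(q, \<tau>). K q \<tau>) \<in> borel_measurable (M \<Otimes>\<^sub>M lborel)"
    and h [measurable]: "h \<in> borel_measurable borel" and A [measurable]: "A \<in> sets borel"
    and K_le: "\<And>\<tau>. (\<integral>\<^sup>+q. K q \<tau> \<partial>M) \<le> C * h \<tau>"
  shows "(\<integral>\<^sup>+q. (\<integral>\<^sup>+\<tau>. K q \<tau> * indicator A \<tau> \<partial>lborel) \<partial>M) \<le> C * (\<integral>\<^sup>+\<tau>. h \<tau> * indicator A \<tau> \<partial>lborel)"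
proof -
  interpret pair_sigma_finite M lborel ..
  have K_slice [measurable]: "(\<lambda>q. K q \<tau>) \<in> borel_measurable M" for \<tau>
    using measurable_compose[OF measurable_Pair2' K, of \<tau>] by simp
  have "(\<integral>\<^sup>+q. (\<integral>\<^sup>+\<tau>. K q \<tau> * indicator A \<tau> \<partial>lborel) \<partial>M) = (\<integral>\<^sup>+\<tau>. (\<integral>\<^sup>+q. K q \<tau> * indicator A \<tau> \<partial>M) \<partial>lborel)"
    using K by (intro Fubini'[symmetric]) (auto simp: split_def)
  also have "\<dots> \<le> (\<integral>\<^sup>+\<tau>. C * (h \<tau> * indicator A \<tau>) \<partial>lborel)"
    by (intro nn_integral_mono) (simp add: nn_integral_multc mult_right_mono K_le flip: mult.assoc)
  also have "\<dots> = C * (\<integral>\<^sup>+\<tau>. h \<tau> * indicator A \<tau> \<partial>lborel)" by (rule nn_integral_cmult) measurable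
  finally show ?thesis .
qed

lemma (in sigma_finite_measure) nn_integral_duhamel_le:
  fixes k :: "'a \<Rightarrow> 'b::banach \<Rightarrow> complex"
  assumes k: "\<And>q. bounded_linear (k q)" and G: "continuous_on UNIV G"
    and meas: "\<And>U. (\<lambda>q. k q U) \<in> borel_measurable M" "(\<lambda>(q, \<tau>). k q (G \<tau>)) \<in> borel_measurable (M \<Otimes>\<^sub>M lborel)"
    and k_le: "\<And>U. (\<integral>\<^sup>+q. ennreal ((cmod (k q U))\<^sup>2) \<partial>M) \<le> ennreal C * ennreal ((norm U)\<^sup>2)"
    and time: "AE q in M. time q \<in> {0..T}"
    and V: "\<And>t. t \<in> {0..T} \<Longrightarrow> V t = U0 + integral {0..t} G"
  shows "(\<integral>\<^sup>+q. ennreal ((cmod (k q (V (time q))))\<^sup>2) \<partial>M) \<le> ennreal C * duhamel_bound T U0 G"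
proof -
  let ?K = "\<lambda>U q. ennreal ((cmod (k q U))\<^sup>2)" and ?N = "\<integral>\<^sup>+\<tau>. ennreal ((norm (G \<tau>))\<^sup>2) * indicator {0..T} \<tau> \<partial>lborel"
  let ?J = "\<lambda>q. \<integral>\<^sup>+\<tau>. ?K (G \<tau>) q * indicator {0..T} \<tau> \<partial>lborel"
  have meas_K [measurable]: "?K U \<in> borel_measurable M" for U using meas(1) by measurable
  have meas_KG: "(\<lambda>(q, \<tau>). ?K (G \<tau>) q) \<in> borel_measurable (M \<Otimes>\<^sub>M lborel)"
    using meas(2) unfolding split_def by measurable
  have meas_J [measurable]: "?J \<in> borel_measurable M"
    using meas_KG by (intro lborel.borel_measurable_nn_integral) (auto simp: split_def)
  have norm_G: "(\<lambda>\<tau>. ennreal ((norm (G \<tau>))\<^sup>2)) \<in> borel_measurable borel"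
    by (intro measurable_compose[OF _ measurable_ennreal] borel_measurable_power
        borel_measurable_continuous_onI continuous_on_norm G)
  have "(\<integral>\<^sup>+q. ?K (V (time q)) q \<partial>M) \<le> (\<integral>\<^sup>+q. 2 * (?K U0 q + ennreal T * ?J q) \<partial>M)"
  proof (rule nn_integral_mono_AE)
    show "AE q in M. ?K (V (time q)) q \<le> 2 * (?K U0 q + ennreal T * ?J q)"
      using time by eventually_elim (simp only: V functional_duhamel_sq_le[OF k G])
  qed
  also have "\<dots> = 2 * ((\<integral>\<^sup>+q. ?K U0 q \<partial>M) + ennreal T * (\<integral>\<^sup>+q. ?J q \<partial>M))"
    by (subst nn_integral_cmult, measurable) (subst nn_integral_add, measurable, subst nn_integral_cmult, auto)
  also have "\<dots> \<le> 2 * (ennreal C * ennreal ((norm U0)\<^sup>2) + ennreal T * (ennreal C * ?N))"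
    by (intro mult_left_mono add_mono k_le nn_integral_swap_le[OF meas_KG norm_G]) auto
  also have "\<dots> = ennreal C * duhamel_bound T U0 G"
    unfolding duhamel_bound_def by (simp only: distrib_left mult_ac)
  finally show ?thesis .
qed

lemma borel_measurable_fst_snd [measurable]:
  "fst \<in> borel_measurable (borel :: ('a::second_countable_topology \<times> 'b::second_countable_topology) measure)"
  "snd \<in> borel_measurable (borel :: ('a::second_countable_topology \<times> 'b::second_countable_topology) measure)"
  by (simp_all flip: borel_prod)

definition smoothing_measure :: "real \<Rightarrow> real \<Rightarrow> ('a::euclidean_space \<Rightarrow> real) \<Rightarrow> (real \<times> 'a) measure" where
  "smoothing_measure \<alpha> T \<rho> = density lborel (\<lambda>q. ennreal (fst q powr \<alpha> * \<rho> (snd q)) * indicator {0..T} (fst q))"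

lemma sets_smoothing_measure [simp, measurable_cong]: "sets (smoothing_measure \<alpha> T \<rho>) = sets borel"
  by (simp add: smoothing_measure_def)

lemma nn_integral_smoothing_measure:
  assumes [measurable]: "\<rho> \<in> borel_measurable borel" "g \<in> borel_measurable borel"
    and "\<And>x. \<rho> x \<ge> 0" "\<And>q. g q \<ge> 0"
  shows "(\<integral>\<^sup>+q. ennreal (g q) \<partial>smoothing_measure \<alpha> T \<rho>)
    = (\<integral>\<^sup>+q. ennreal (fst q powr \<alpha> * \<rho> (snd q) * g q) * indicator {0..T} (fst q) \<partial>lborel)"
proof -
  have "(\<integral>\<^sup>+q. ennreal (g q) \<partial>smoothing_measure \<alpha> T \<rho>)
      = (\<integral>\<^sup>+q. (ennreal (fst q powr \<alpha> * \<rho> (snd q)) * indicator {0..T} (fst q)) * ennreal (g q) \<partial>lborel)"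
    unfolding smoothing_measure_def by (rule nn_integral_density) measurable
  also have "\<dots> = (\<integral>\<^sup>+q. ennreal (fst q powr \<alpha> * \<rho> (snd q) * g q) * indicator {0..T} (fst q) \<partial>lborel)"
    using assms(3,4) by (intro nn_integral_cong) (simp add: ennreal_mult mult_ac)
  finally show ?thesis .
qed

lemma sigma_finite_smoothing_measure:
  assumes [measurable]: "\<rho> \<in> borel_measurable borel" shows "sigma_finite_measure (smoothing_measure \<alpha> T \<rho>)"
  unfolding smoothing_measure_def
  by (subst sigma_finite_measure.sigma_finite_iff_density_finite[OF lborel.sigma_finite_measure_axioms]) (auto simp: ennreal_mult_eq_top_iff indicator_def)

text \<open>The endpoint \<open>t = 0\<close> drops out because the density vanishes there.\<close>

lemma AE_smoothing_measureI:
  assumes [measurable]: "\<rho> \<in> borel_measurable borel" and "AE q in lborel. fst q \<in> {0<..T} \<longrightarrow> P q"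
  shows "AE q in smoothing_measure \<alpha> T \<rho>. P q"
  unfolding smoothing_measure_def
proof (subst AE_density)
  show "AE q in lborel. 0 < ennreal (fst q powr \<alpha> * \<rho> (snd q)) * indicator {0..T} (fst q) \<longrightarrow> P q"
    using assms(2) by eventually_elim (auto simp: indicator_def less_le)
qed measurable

lemma nn_integral_reparametrize_time:
  fixes F :: "real \<times> 'a::euclidean_space \<Rightarrow> ennreal"
  assumes [measurable]: "c \<in> borel_measurable borel" "g \<in> borel_measurable borel" "F \<in> borel_measurable borel"
  shows "(\<integral>\<^sup>+q. c (fst q) * F (g (fst q), snd q) \<partial>lborel) = (\<integral>\<^sup>+t. c t * (\<integral>\<^sup>+x. F (g t, x) \<partial>lborel) \<partial>lborel)"
proof -
  have [measurable]: "F \<in> borel_measurable (borel \<Otimes>\<^sub>M borel)" by (simp add: borel_prod)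
  have "(\<integral>\<^sup>+q. c (fst q) * F (g (fst q), snd q) \<partial>lborel) = (\<integral>\<^sup>+t. (\<integral>\<^sup>+x. c t * F (g t, x) \<partial>lborel) \<partial>lborel)"
    unfolding lborel_prod[symmetric] by (subst lborel.nn_integral_fst[symmetric]) (simp_all add: split_def)
  also have "\<dots> = (\<integral>\<^sup>+t. c t * (\<integral>\<^sup>+x. F (g t, x) \<partial>lborel) \<partial>lborel)"
    by (intro nn_integral_cong nn_integral_cmult) measurable
  finally show ?thesis .
qed

context sobolev_space
begin

definition deriv_symbol :: "real^'n \<Rightarrow> real" where "deriv_symbol \<xi> = norm \<xi> powr (s + 1/2) * bessel_weight (- s) \<xi>"

lemma deriv_symbol_nonneg: "deriv_symbol \<xi> \<ge> 0" by (simp add: deriv_symbol_def)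

lemma deriv_symbol_measurable [measurable]: "deriv_symbol \<in> borel_measurable borel"
  unfolding deriv_symbol_def[abs_def] by measurable

lemma norm_powr_le_bessel_weight: "norm \<xi> powr s \<le> bessel_weight s \<xi>" for \<xi> :: "real^'n"
proof -
  have "norm \<xi> powr s = ((norm \<xi>)\<^sup>2) powr (s / 2)"
    by (cases "\<xi> = 0") (simp_all add: powr_powr flip: powr_numeral)
  also have "\<dots> \<le> bessel_weight s \<xi>" unfolding bessel_weight_def using s_pos by (intro powr_mono2) auto
  finally show ?thesis .
qed

lemma deriv_symbol_le: "deriv_symbol \<xi> \<le> sqrt (norm \<xi>)"
proof -
  have "norm \<xi> powr s * bessel_weight (- s) \<xi> \<le> bessel_weight s \<xi> * bessel_weight (- s) \<xi>"
    by (rule mult_right_mono[OF norm_powr_le_bessel_weight]) simp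
  then have "norm \<xi> powr (1/2) * (norm \<xi> powr s * bessel_weight (- s) \<xi>) \<le> norm \<xi> powr (1/2) * 1"
    by (intro mult_left_mono) auto
  then show ?thesis by (simp add: deriv_symbol_def powr_add powr_half_sqrt mult_ac)
qed

definition trunc_symbol :: "real \<Rightarrow> real^'n \<Rightarrow> real" where "trunc_symbol M \<xi> = indicator (cball 0 M) \<xi> * deriv_symbol \<xi>"

lemma trunc_symbol_nonneg: "trunc_symbol M \<xi> \<ge> 0" by (simp add: trunc_symbol_def deriv_symbol_nonneg)

lemma trunc_symbol_measurable [measurable]: "trunc_symbol M \<in> borel_measurable borel"
  unfolding trunc_symbol_def[abs_def]
  by (intro borel_measurable_times borel_measurable_indicator borel_closed closed_cball deriv_symbol_measurable)

lemma trunc_symbol_le: "trunc_symbol M \<xi> \<le> sqrt (norm \<xi>)"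
  unfolding trunc_symbol_def using deriv_symbol_le[of \<xi>] by (simp add: indicator_def)

lemma trunc_symbol_bounded: "trunc_symbol M \<xi> \<le> sqrt \<bar>M\<bar>"
proof (cases "norm \<xi> \<le> M")
  case True
  then show ?thesis using trunc_symbol_le[of M \<xi>] real_sqrt_le_mono[of "norm \<xi>" "\<bar>M\<bar>"] by linarith
qed (simp add: trunc_symbol_def)

definition trunc_deriv_kernel :: "real \<Rightarrow> real \<Rightarrow> real^'n \<Rightarrow> real^'n \<Rightarrow> complex" where
  "trunc_deriv_kernel M r x \<xi> = fourier_const * (of_real (trunc_symbol M \<xi>) * cis (x \<bullet> \<xi> - r * (norm \<xi>)\<^sup>2))"

lemma trunc_deriv_kernel_measurable [measurable]: "trunc_deriv_kernel M r x \<in> borel_measurable borel"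
  unfolding trunc_deriv_kernel_def[abs_def] by measurable

lemma cmod_trunc_deriv_kernel: "cmod (trunc_deriv_kernel M r x \<xi>) = cmod fourier_const * trunc_symbol M \<xi>"
  by (simp add: trunc_deriv_kernel_def norm_mult trunc_symbol_nonneg)

lemma square_integrable_trunc_deriv_kernel: "square_integrable (trunc_deriv_kernel M r x)"
proof -
  have "emeasure lborel (cball (0::real^'n) M) < \<infinity>" by (rule emeasure_bounded_finite[OF bounded_cball])
  note square_integrable_indicator[OF _ this]
  moreover have "cmod (trunc_deriv_kernel M r x \<xi>) \<le> cmod fourier_const * sqrt \<bar>M\<bar>" for \<xi>
    unfolding cmod_trunc_deriv_kernel by (intro mult_left_mono trunc_symbol_bounded) simp
  ultimately have "square_integrable (\<lambda>\<xi>. trunc_deriv_kernel M r x \<xi> * indicator (cball 0 M) \<xi>)"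
    by (intro square_integrable_mult_bounded) auto
  moreover have "trunc_deriv_kernel M r x \<xi> * indicator (cball 0 M) \<xi> = trunc_deriv_kernel M r x \<xi>" for \<xi>
    by (simp add: trunc_deriv_kernel_def trunc_symbol_def indicator_def)
  ultimately show ?thesis by simp
qed

text \<open>\<open>trunc_deriv M r x U\<close> is the value at \<open>x\<close> of \<open>D\<^sub>x\<close> to the power \<open>s + 1/2\<close> applied to the free evolution at phase \<open>r\<close> of
  the \<open>H\<^sup>s\<close> function encoded by \<open>U\<close>, restricted to frequencies \<open>|\<xi>| \<le> M\<close>.\<close>

definition trunc_deriv :: "real \<Rightarrow> real \<Rightarrow> real^'n \<Rightarrow> (real^'n) lsq \<Rightarrow> complex" where
  "trunc_deriv M r x U = pairing (trunc_deriv_kernel M r x) U"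

lemma bounded_linear_trunc_deriv: "bounded_linear (trunc_deriv M r x)"
  unfolding trunc_deriv_def[abs_def] by (rule bounded_linear_pairing[OF square_integrable_trunc_deriv_kernel])

lemma norm_trunc_deriv_kernel: "norm (abs_lsq (trunc_deriv_kernel M r x)) = norm (abs_lsq (trunc_deriv_kernel M 0 0))"
  by (rule power2_eq_imp_eq, unfold norm_abs_lsq_sq[OF square_integrable_trunc_deriv_kernel] cmod_trunc_deriv_kernel) (rule refl norm_ge_zero)+

lemma norm_trunc_deriv_le: "cmod (trunc_deriv M r x U) \<le> norm (abs_lsq (trunc_deriv_kernel M 0 0)) * norm U"
  using norm_pairing_le[OF square_integrable_trunc_deriv_kernel, of M r x U] unfolding trunc_deriv_def norm_trunc_deriv_kernel[of M r x] .

lemma tendsto_trunc_deriv: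
  assumes r: "r \<longlonglongrightarrow> r'" and x: "x \<longlonglongrightarrow> x'" and U: "U \<longlonglongrightarrow> U'"
  shows "(\<lambda>n. trunc_deriv M (r n) (x n) (U n)) \<longlonglongrightarrow> trunc_deriv M r' x' U'"
proof -
  have "(\<lambda>n. trunc_deriv M (r n) (x n) U') \<longlonglongrightarrow> trunc_deriv M r' x' U'"
    unfolding trunc_deriv_def pairing_def
  proof (rule integral_dominated_convergence[where w="\<lambda>\<xi>. cmod (trunc_deriv_kernel M 0 0 \<xi> * rep_lsq U' \<xi>)"])
    show "integrable lborel (\<lambda>\<xi>. cmod (trunc_deriv_kernel M 0 0 \<xi> * rep_lsq U' \<xi>))"
      by (intro integrable_norm integrable_mult_square_integrable square_integrable_trunc_deriv_kernel square_integrable_rep)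
    show "AE \<xi> in lborel. (\<lambda>n. trunc_deriv_kernel M (r n) (x n) \<xi> * rep_lsq U' \<xi>) \<longlonglongrightarrow> trunc_deriv_kernel M r' x' \<xi> * rep_lsq U' \<xi>"
      unfolding trunc_deriv_kernel_def cis_conv_exp
      by (intro AE_I2 tendsto_mult tendsto_const tendsto_exp tendsto_of_real tendsto_diff tendsto_inner r x)
    show "AE \<xi> in lborel. norm (trunc_deriv_kernel M (r n) (x n) \<xi> * rep_lsq U' \<xi>) \<le> cmod (trunc_deriv_kernel M 0 0 \<xi> * rep_lsq U' \<xi>)" for n
      by (simp add: norm_mult cmod_trunc_deriv_kernel)
  qed measurable
  moreover have "(\<lambda>n. trunc_deriv M (r n) (x n) (U n - U')) \<longlonglongrightarrow> 0"
  proof (rule Lim_null_comparison)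
    show "\<forall>\<^sub>F n in sequentially. norm (trunc_deriv M (r n) (x n) (U n - U')) \<le> norm (abs_lsq (trunc_deriv_kernel M 0 0)) * norm (U n - U')"
      by (intro always_eventually allI norm_trunc_deriv_le)
    have "(\<lambda>n. norm (U n - U')) \<longlonglongrightarrow> 0" using U by (simp add: tendsto_norm_zero_iff LIM_zero_iff)
    then show "(\<lambda>n. norm (abs_lsq (trunc_deriv_kernel M 0 0)) * norm (U n - U')) \<longlonglongrightarrow> 0" by (rule tendsto_mult_right_zero)
  qed
  ultimately have "(\<lambda>n. trunc_deriv M (r n) (x n) U' + trunc_deriv M (r n) (x n) (U n - U')) \<longlonglongrightarrow> trunc_deriv M r' x' U' + 0"
    by (rule tendsto_add)
  then show ?thesis by (simp add: linear_diff[OF bounded_linear.linear[OF bounded_linear_trunc_deriv]])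
qed

lemma continuous_on_trunc_deriv:
  fixes f :: "'c::metric_space \<Rightarrow> real"
  assumes "continuous_on S f" "continuous_on S g" "continuous_on S h"
  shows "continuous_on S (\<lambda>p. trunc_deriv M (f p) (g p) (h p))"
  using assms unfolding continuous_on_sequentially comp_def by (auto intro!: tendsto_trunc_deriv)

lemma trunc_deriv_measurable:
  assumes f: "f \<in> borel_measurable N" and g: "g \<in> borel_measurable N" and k: "k \<in> borel_measurable N"
    and U: "continuous_on UNIV (U :: real \<Rightarrow> (real^'n) lsq)"
  shows "(\<lambda>p. trunc_deriv M (f p) (g p) (U (k p))) \<in> borel_measurable N"
proof -
  let ?F = "\<lambda>z::real \<times> (real^'n) \<times> real. trunc_deriv M (fst z) (fst (snd z)) (U (snd (snd z)))"
  have "continuous_on UNIV ?F"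
    by (intro continuous_on_trunc_deriv continuous_on_compose2[OF U] continuous_intros) auto
  then have F: "?F \<in> borel_measurable borel" by (rule borel_measurable_continuous_onI)
  have "(\<lambda>p. (f p, g p, k p)) \<in> borel_measurable N" by (intro borel_measurable_Pair f g k)
  from measurable_compose[OF this F] show ?thesis by simp
qed

lemma trunc_deriv_measurable_const:
  assumes "f \<in> borel_measurable N" "g \<in> borel_measurable N"
  shows "(\<lambda>p. trunc_deriv M (f p) (g p) U) \<in> borel_measurable N"
  using trunc_deriv_measurable[OF assms, of "\<lambda>_. 0" "\<lambda>_. U"] by simp

lemma trunc_deriv_eq_free_evolution:
  "trunc_deriv M r x U = fourier_const * free_evolution (\<lambda>\<xi>. of_real (trunc_symbol M \<xi>) * rep_lsq U \<xi>) r x"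
  unfolding trunc_deriv_def pairing_def trunc_deriv_kernel_def free_evolution_def integral_mult_right_zero[symmetric]
  by (simp only: mult_ac)

definition smoothing_const :: real where "smoothing_const = (cmod fourier_const)\<^sup>2 * (2 * sqrt (2 * pi))"

lemma smoothing_const_nonneg: "smoothing_const \<ge> 0" by (simp add: smoothing_const_def)

lemma trunc_deriv_smoothing:
  assumes w: "smoothing_weight \<rho> C"
  shows "(\<integral>\<^sup>+q. ennreal (gaussian (fst q) * \<rho> (snd q) * (cmod (trunc_deriv M (fst q) (snd q) U))\<^sup>2) \<partial>lborel)
    \<le> ennreal (smoothing_const * C) * ennreal ((norm U)\<^sup>2)"
proof -
  note [measurable] = smoothing_weight_measurable[OF w]
  let ?a = "\<lambda>\<xi>. of_real (trunc_symbol M \<xi>) * rep_lsq U \<xi>" and ?c = "ennreal ((cmod fourier_const)\<^sup>2)"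
  let ?E = "\<lambda>q. ennreal (gaussian (fst q) * \<rho> (snd q) * (cmod (free_evolution ?a (fst q) (snd q)))\<^sup>2)"
  have "fourier_const \<noteq> 0" by (simp add: fourier_const_def)
  then have "?a = (\<lambda>\<xi>. (trunc_deriv_kernel M 0 0 \<xi> * rep_lsq U \<xi>) / fourier_const)"
    by (simp add: trunc_deriv_kernel_def mult.assoc)
  moreover have "integrable lborel (\<lambda>\<xi>. trunc_deriv_kernel M 0 0 \<xi> * rep_lsq U \<xi>)"
    by (intro integrable_mult_square_integrable square_integrable_trunc_deriv_kernel square_integrable_rep)
  ultimately have a: "integrable lborel ?a" by (simp only: integrable_divide)
  have "(\<integral>\<^sup>+q. ennreal (gaussian (fst q) * \<rho> (snd q) * (cmod (trunc_deriv M (fst q) (snd q) U))\<^sup>2) \<partial>lborel) = (\<integral>\<^sup>+q. ?c * ?E q \<partial>lborel)"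
    using smoothing_weight_nonneg[OF w]
    by (intro nn_integral_cong) (simp add: trunc_deriv_eq_free_evolution norm_mult power_mult_distrib mult_ac flip: ennreal_mult)
  also have "\<dots> = ?c * (\<integral>\<^sup>+q. ?E q \<partial>lborel)"
    by (rule nn_integral_cmult) (use free_evolution_measurable[of ?a] in measurable)
  also have "\<dots> \<le> ?c * (ennreal (2 * sqrt (2 * pi) * C) * (\<integral>\<^sup>+\<xi>. ennreal ((cmod (rep_lsq U \<xi>))\<^sup>2) \<partial>lborel))"
  proof (intro mult_left_mono nn_integral_free_evolution_smoothing[OF w a])
    show "cmod (?a \<xi>) \<le> sqrt (norm \<xi>) * cmod (rep_lsq U \<xi>)" for \<xi>
      using trunc_symbol_le[of M \<xi>] trunc_symbol_nonneg[of M \<xi>] by (simp add: norm_mult mult_right_mono)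
  qed auto
  also have "\<dots> = ?c * ennreal (2 * sqrt (2 * pi) * C) * ennreal ((norm U)\<^sup>2)" by (simp only: nn_integral_rep_lsq mult.assoc)
  also have "?c * ennreal (2 * sqrt (2 * pi) * C) = ennreal (smoothing_const * C)"
    using smoothing_weight_const_nonneg[OF w] by (subst ennreal_mult[symmetric]) (auto simp: smoothing_const_def mult_ac)
  finally show ?thesis .
qed

definition weighted_smoothing_const :: "real \<Rightarrow> real \<Rightarrow> real" where
  "weighted_smoothing_const \<alpha> T = inverse (gaussian (phase \<alpha> T)) * smoothing_const"

lemma weighted_smoothing_const_nonneg: "weighted_smoothing_const \<alpha> T \<ge> 0"
  using smoothing_const_nonneg by (simp add: weighted_smoothing_const_def)

text \<open>The substitution \<open>r = phase \<alpha> t\<close> absorbs the weight \<open>t\<^sup>\<alpha>\<close>.\<close>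

lemma linear_smoothing:
  assumes \<alpha>: "\<alpha> > 0" and T: "T > 0" and w: "smoothing_weight \<rho> C"
  shows "(\<integral>\<^sup>+q. ennreal ((cmod (trunc_deriv M (phase \<alpha> (fst q)) (snd q) U))\<^sup>2) \<partial>smoothing_measure \<alpha> T \<rho>)
    \<le> ennreal (weighted_smoothing_const \<alpha> T * C) * ennreal ((norm U)\<^sup>2)"
proof -
  note [measurable] = smoothing_weight_measurable[OF w] trunc_deriv_measurable_const
  have \<rho>: "\<rho> x \<ge> 0" for x by (rule smoothing_weight_nonneg[OF w])
  let ?F = "\<lambda>q. ennreal (\<rho> (snd q) * (cmod (trunc_deriv M (fst q) (snd q) U))\<^sup>2)" and ?g = "gaussian (phase \<alpha> T)"
  let ?h = "\<lambda>r. \<integral>\<^sup>+x. ?F (r, x) \<partial>lborel"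
  have F [measurable]: "?F \<in> borel_measurable borel" by measurable
  then have "?F \<in> borel_measurable (borel \<Otimes>\<^sub>M lborel)" by (simp add: borel_prod cong: measurable_cong_sets sets_pair_measure_cong)
  then have h [measurable]: "?h \<in> borel_measurable borel" by (intro lborel.borel_measurable_nn_integral) (simp add: split_def)
  have "(\<integral>\<^sup>+q. ennreal ((cmod (trunc_deriv M (phase \<alpha> (fst q)) (snd q) U))\<^sup>2) \<partial>smoothing_measure \<alpha> T \<rho>)
      = (\<integral>\<^sup>+q. (ennreal (fst q powr \<alpha>) * indicator {0..T} (fst q)) * ?F (phase \<alpha> (fst q), snd q) \<partial>lborel)"
    using \<rho> by (subst nn_integral_smoothing_measure) (auto intro!: nn_integral_cong simp: ennreal_mult mult_ac)
  also have "\<dots> = (\<integral>\<^sup>+t. (ennreal (t powr \<alpha>) * indicator {0..T} t) * ?h (phase \<alpha> t) \<partial>lborel)"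
    by (rule nn_integral_reparametrize_time) measurable
  also have "\<dots> = (\<integral>\<^sup>+r. ?h r * indicator {0..phase \<alpha> T} r \<partial>lborel)"
    using nn_integral_phase[OF \<alpha> T h] by (simp only: mult_ac)
  also have "\<dots> \<le> (\<integral>\<^sup>+r. ennreal (inverse ?g) * (ennreal (gaussian r) * ?h r) \<partial>lborel)"
  proof (rule nn_integral_mono)
    fix r :: real
    have "?h r \<le> ennreal (inverse ?g) * (ennreal (gaussian r) * ?h r)" if "r \<in> {0..phase \<alpha> T}"
    proof -
      have "r\<^sup>2 \<le> (phase \<alpha> T)\<^sup>2" using that by (intro power_mono) auto
      then have "1 \<le> inverse ?g * gaussian r" by (simp add: gaussian_def field_simps)
      from mult_right_mono[OF ennreal_leI[OF this], of "?h r"] show ?thesis by (simp add: ennreal_mult mult.assoc)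
    qed
    then show "?h r * indicator {0..phase \<alpha> T} r \<le> ennreal (inverse ?g) * (ennreal (gaussian r) * ?h r)"
      by (cases "r \<in> {0..phase \<alpha> T}") auto
  qed
  also have "\<dots> = ennreal (inverse ?g) * (\<integral>\<^sup>+r. ennreal (gaussian r) * ?h r \<partial>lborel)" by (rule nn_integral_cmult) measurable
  also have "(\<integral>\<^sup>+r. ennreal (gaussian r) * ?h r \<partial>lborel) = (\<integral>\<^sup>+q. ennreal (gaussian (fst q)) * ?F (fst q, snd q) \<partial>lborel)"
    by (rule nn_integral_reparametrize_time[symmetric]) measurable
  also have "\<dots> = (\<integral>\<^sup>+q. ennreal (gaussian (fst q) * \<rho> (snd q) * (cmod (trunc_deriv M (fst q) (snd q) U))\<^sup>2) \<partial>lborel)"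
    using \<rho> by (intro nn_integral_cong) (simp add: mult.assoc flip: ennreal_mult)
  also have "\<dots> \<le> ennreal (smoothing_const * C) * ennreal ((norm U)\<^sup>2)" by (rule trunc_deriv_smoothing[OF w])
  also have "ennreal (inverse ?g) * (ennreal (smoothing_const * C) * ennreal ((norm U)\<^sup>2)) = ennreal (weighted_smoothing_const \<alpha> T * C) * ennreal ((norm U)\<^sup>2)"
    using smoothing_weight_const_nonneg[OF w] smoothing_const_nonneg
    by (simp add: weighted_smoothing_const_def mult.assoc ennreal_mult)
  finally show ?thesis by (simp add: mult_left_mono)
qed

lemma duhamel_smoothing:
  assumes \<alpha>: "\<alpha> > 0" and T: "T > 0" and w: "smoothing_weight \<rho> C" and G: "continuous_on UNIV G"
    and V: "\<And>t. t \<in> {0..T} \<Longrightarrow> V t = U0 + integral {0..t} G"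
  shows "(\<integral>\<^sup>+q. ennreal ((cmod (trunc_deriv M (phase \<alpha> (fst q)) (snd q) (V (fst q))))\<^sup>2) \<partial>smoothing_measure \<alpha> T \<rho>)
    \<le> ennreal (weighted_smoothing_const \<alpha> T * C) * duhamel_bound T U0 G"
proof -
  note \<rho> [measurable] = smoothing_weight_measurable[OF w]
  interpret sigma_finite_measure "smoothing_measure \<alpha> T \<rho>" by (rule sigma_finite_smoothing_measure[OF \<rho>])
  show ?thesis
  proof (rule nn_integral_duhamel_le[OF bounded_linear_trunc_deriv G _ _ linear_smoothing[OF \<alpha> T w] _ V])
    show "(\<lambda>q. trunc_deriv M (phase \<alpha> (fst q)) (snd q) U) \<in> borel_measurable (smoothing_measure \<alpha> T \<rho>)" for U
      by (rule trunc_deriv_measurable_const) measurable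
    show "(\<lambda>(q, \<tau>). trunc_deriv M (phase \<alpha> (fst q)) (snd q) (G \<tau>)) \<in> borel_measurable (smoothing_measure \<alpha> T \<rho> \<Otimes>\<^sub>M lborel)"
      unfolding split_def by (rule trunc_deriv_measurable[OF _ _ _ G]) measurable
    show "AE q in smoothing_measure \<alpha> T \<rho>. fst q \<in> {0..T}"
      by (rule AE_smoothing_measureI[OF \<rho>]) auto
  qed
qed

end

section \<open>Smoothing of the solution\<close>

lemma LINT_norm_diff_sq_tendsto_0:
  assumes F: "\<And>n. square_integrable (F n)" and lim: "(\<lambda>n. abs_lsq (F n)) \<longlonglongrightarrow> U"
  shows "(\<lambda>n. LINT q|lborel. (cmod (F n q - rep_lsq U q))\<^sup>2) \<longlonglongrightarrow> 0"
proof -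
  have "(norm (abs_lsq (F n) - U))\<^sup>2 = (LINT q|lborel. (cmod (F n q - rep_lsq U q))\<^sup>2)" for n
    using norm_abs_lsq_sq[OF square_integrable_diff[OF F square_integrable_rep], of n U]
    by (simp add: abs_lsq_diff[OF F square_integrable_rep] abs_rep_lsq)
  moreover have "(\<lambda>n. (norm (abs_lsq (F n) - U))\<^sup>2) \<longlonglongrightarrow> (norm (U - U))\<^sup>2"
    by (intro tendsto_power tendsto_norm tendsto_diff lim tendsto_const)
  ultimately show ?thesis by simp
qed

lemma tendsto_if_norm_diff_sq_tendsto_0:
  fixes f :: "nat \<Rightarrow> 'b::real_normed_vector"
  assumes "(\<lambda>n. (norm (f n - l))\<^sup>2) \<longlonglongrightarrow> 0" shows "f \<longlonglongrightarrow> l"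
  using tendsto_real_sqrt[OF assms] by (simp add: tendsto_norm_zero_iff LIM_zero_iff)

lemma L2_limit_AE_subsequence:
  assumes F: "\<And>n. square_integrable (F n)" and lim: "(\<lambda>n. abs_lsq (F n)) \<longlonglongrightarrow> U"
  obtains r :: "nat \<Rightarrow> nat" where "AE q in lborel. (\<lambda>n. F (r n) q) \<longlonglongrightarrow> rep_lsq U q"
proof -
  let ?E = "\<lambda>n q. (cmod (F n q - rep_lsq U q))\<^sup>2"
  have int: "integrable lborel (?E n)" for n by (intro integrable_norm_sq square_integrable_diff F square_integrable_rep)
  have "(\<lambda>n. LINT q|lborel. norm (?E n q)) \<longlonglongrightarrow> 0" using LINT_norm_diff_sq_tendsto_0[OF F lim] by simp
  from tendsto_L1_AE_subseq[OF int this]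
  obtain r :: "nat \<Rightarrow> nat" where "AE q in lborel. (\<lambda>n. ?E (r n) q) \<longlonglongrightarrow> 0" by blast
  then have "AE q in lborel. (\<lambda>n. F (r n) q) \<longlonglongrightarrow> rep_lsq U q"
    by eventually_elim (rule tendsto_if_norm_diff_sq_tendsto_0)
  then show ?thesis by (rule that)
qed

lemma section_measurable:
  fixes f :: "'a::euclidean_space \<times> 'b::euclidean_space \<Rightarrow> complex"
  assumes "f \<in> borel_measurable borel" shows "(\<lambda>x. f (t, x)) \<in> borel_measurable lborel"
proof -
  have "(\<lambda>x::'b. (t, x)) \<in> borel_measurable borel" by (intro borel_measurable_continuous_onI continuous_intros)
  from measurable_compose[OF this assms] show ?thesis by simp
qed

lemma AE_square_integrable_section:
  fixes f :: "'a::euclidean_space \<times> 'b::euclidean_space \<Rightarrow> complex"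
  assumes f: "square_integrable f" shows "AE t in lborel. square_integrable (\<lambda>x. f (t, x))"
proof -
  have "integrable (lborel \<Otimes>\<^sub>M lborel) (\<lambda>q. (cmod (f q))\<^sup>2)" unfolding lborel_prod by (rule integrable_norm_sq[OF f])
  then have "AE t in lborel. integrable lborel (\<lambda>x. (cmod (f (t, x)))\<^sup>2)" by (rule lborel_pair.AE_integrable_fst')
  then show ?thesis
    by eventually_elim (simp add: square_integrable_def section_measurable[OF square_integrable_measurable_borel[OF f], simplified])
qed

lemma L2_limit_sections:
  fixes F :: "nat \<Rightarrow> 'a::euclidean_space \<times> 'b::euclidean_space \<Rightarrow> complex"
  assumes F: "\<And>n. square_integrable (F n)" and lim: "(\<lambda>n. abs_lsq (F n)) \<longlonglongrightarrow> U"
  obtains r :: "nat \<Rightarrow> nat" where "strict_mono r"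
    "AE t in lborel. square_integrable (\<lambda>x. rep_lsq U (t, x)) \<and> (\<forall>n. square_integrable (\<lambda>x. F (r n) (t, x))) \<and>
       (\<lambda>n. abs_lsq (\<lambda>x. F (r n) (t, x))) \<longlonglongrightarrow> abs_lsq (\<lambda>x. rep_lsq U (t, x))"
proof -
  let ?E = "\<lambda>n q. (cmod (F n q - rep_lsq U q))\<^sup>2" and ?D = "\<lambda>n t. LINT x|lborel. (cmod (F n (t, x) - rep_lsq U (t, x)))\<^sup>2"
  have int: "integrable (lborel \<Otimes>\<^sub>M lborel) (?E n)" for n
    unfolding lborel_prod by (intro integrable_norm_sq square_integrable_diff F square_integrable_rep)
  have D: "integrable lborel (?D n)" for n using lborel_pair.integrable_fst'[OF int] by simp
  have "(LINT t|lborel. norm (?D n t)) = (LINT q|lborel. ?E n q)" for n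
    using lborel_pair.integral_fst'[OF int, of n] unfolding lborel_prod by simp
  then have "(\<lambda>n. LINT t|lborel. norm (?D n t)) \<longlonglongrightarrow> 0" using LINT_norm_diff_sq_tendsto_0[OF F lim] by simp
  from tendsto_L1_AE_subseq[OF D this]
  obtain r :: "nat \<Rightarrow> nat" where r: "strict_mono r" and D_lim: "AE t in lborel. (\<lambda>n. ?D (r n) t) \<longlonglongrightarrow> 0" by blast
  have "AE t in lborel. \<forall>n. square_integrable (\<lambda>x. F (r n) (t, x))"
    unfolding AE_all_countable by (intro allI AE_square_integrable_section F)
  with D_lim AE_square_integrable_section[OF square_integrable_rep[of U]]
  have "AE t in lborel. square_integrable (\<lambda>x. rep_lsq U (t, x)) \<and> (\<forall>n. square_integrable (\<lambda>x. F (r n) (t, x))) \<and>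
       (\<lambda>n. abs_lsq (\<lambda>x. F (r n) (t, x))) \<longlonglongrightarrow> abs_lsq (\<lambda>x. rep_lsq U (t, x))"
  proof eventually_elim
    case (elim t)
    have "?D (r n) t = (norm (abs_lsq (\<lambda>x. F (r n) (t, x)) - abs_lsq (\<lambda>x. rep_lsq U (t, x))))\<^sup>2" for n
      using elim by (simp add: norm_abs_lsq_sq square_integrable_diff flip: abs_lsq_diff)
    with elim show ?case by (auto intro: tendsto_if_norm_diff_sq_tendsto_0)
  qed
  then show ?thesis by (rule that[OF r])
qed

lemma Cauchy_if_norm_diff_sq_le:
  fixes X :: "nat \<Rightarrow> 'b::real_normed_vector" and b :: "nat \<Rightarrow> ennreal"
  assumes diff_le: "\<And>m n. n \<le> m \<Longrightarrow> ennreal ((norm (X m - X n))\<^sup>2) \<le> b n" and b: "b \<longlonglongrightarrow> 0"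
  shows "Cauchy X"
proof (rule CauchyI')
  fix e :: real assume "e > 0"
  then have "0 < ennreal (e\<^sup>2)" by simp
  with b have "\<forall>\<^sub>F n in sequentially. b n < ennreal (e\<^sup>2)" by (rule order_tendstoD)
  then obtain N where N: "\<And>n. n \<ge> N \<Longrightarrow> b n < ennreal (e\<^sup>2)" unfolding eventually_sequentially by blast
  have "norm (X m - X n) < e" if "N \<le> m" "m < n" for m n
  proof -
    have "ennreal ((norm (X n - X m))\<^sup>2) < ennreal (e\<^sup>2)" using le_less_trans[OF diff_le N] that by simp
    then have "(norm (X n - X m))\<^sup>2 < e\<^sup>2" by (simp add: ennreal_less_iff)
    then have "norm (X n - X m) < e" by (rule power2_less_imp_less) (use \<open>e > 0\<close> in simp)
    then show ?thesis by (simp only: norm_minus_commute)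
  qed
  then show "\<exists>M. \<forall>m\<ge>M. \<forall>n>m. dist (X m) (X n) < e" unfolding dist_norm by blast
qed

definition high_freq :: "nat \<Rightarrow> 'a::euclidean_space lsq \<Rightarrow> 'a lsq" where
  "high_freq n = mult_op (indicator (- cball 0 (real n)))"

lemma high_freq_multiplier:
  "(indicator (- cball 0 (real n)) :: 'a::euclidean_space \<Rightarrow> complex) \<in> borel_measurable borel"
  "cmod (indicator (- cball (0::'a) (real n)) x) \<le> 1"
proof -
  have "- cball (0::'a) (real n) \<in> sets borel" by (intro borel_open open_Compl closed_cball)
  then show "(indicator (- cball 0 (real n)) :: 'a \<Rightarrow> complex) \<in> borel_measurable borel" by simp
qed (simp add: indicator_def)

lemma bounded_linear_high_freq: "bounded_linear (high_freq n)"
  unfolding high_freq_def by (rule bounded_linear_mult_op[OF high_freq_multiplier])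

lemma norm_high_freq_le: "norm (high_freq n U) \<le> norm U"
  unfolding high_freq_def using norm_mult_op_le[OF high_freq_multiplier, of n U] by simp

lemma high_freq_tendsto_0: "(\<lambda>n. high_freq n U) \<longlonglongrightarrow> 0"
proof -
  have "(\<lambda>n. high_freq n U) \<longlonglongrightarrow> mult_op (\<lambda>_. 0) U"
    unfolding high_freq_def
  proof (rule tendsto_mult_op[where C=1])
    show "(\<lambda>n. indicator (- cball 0 (real n)) x) \<longlonglongrightarrow> (0::complex)" for x :: 'a
    proof (rule tendsto_eventually)
      obtain k :: nat where "norm x \<le> real k" using real_arch_simple by blast
      then show "\<forall>\<^sub>F n in sequentially. indicator (- cball 0 (real n)) x = (0::complex)"
        by (intro eventually_sequentiallyI[of k]) (simp add: indicator_def)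
    qed
  qed (auto intro: high_freq_multiplier)
  then show ?thesis by (simp add: mult_op_zero)
qed

lemma high_freq_duhamel:
  fixes G :: "real \<Rightarrow> 'a::euclidean_space lsq"
  assumes G: "continuous_on UNIV G"
  shows "high_freq n (U0 + integral {0..t} G) = high_freq n U0 + integral {0..t} (\<lambda>\<tau>. high_freq n (G \<tau>))"
proof -
  interpret bounded_linear "high_freq n" by (rule bounded_linear_high_freq)
  have "continuous_on {0..t} G" by (rule continuous_on_subset[OF G]) simp
  from integral_linear[OF integrable_continuous_interval[OF this] bounded_linear_high_freq, of n]
  show ?thesis by (simp add: comp_def add)
qed

lemma nn_integral_norm_sq_finite:
  fixes G :: "real \<Rightarrow> 'b::real_normed_vector"
  assumes G: "continuous_on UNIV G" and T: "T \<ge> 0"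
  shows "(\<integral>\<^sup>+\<tau>. ennreal ((norm (G \<tau>))\<^sup>2) * indicator {0..T} \<tau> \<partial>lborel) < \<infinity>"
proof -
  have "compact (G ` {0..T})" by (rule compact_continuous_image[OF continuous_on_subset[OF G]]) auto
  then obtain B where "\<forall>v\<in>G ` {0..T}. norm v \<le> B" using compact_imp_bounded bounded_iff by blast
  then have "(\<integral>\<^sup>+\<tau>. ennreal ((norm (G \<tau>))\<^sup>2) * indicator {0..T} \<tau> \<partial>lborel) \<le> (\<integral>\<^sup>+\<tau>. ennreal (B\<^sup>2) * indicator {0..T} \<tau> \<partial>lborel)"
    by (intro nn_integral_mono) (auto simp: indicator_def intro!: ennreal_leI power_mono)
  also have "\<dots> = ennreal (B\<^sup>2) * ennreal T" using T by (subst nn_integral_cmult) auto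
  also have "\<dots> < \<infinity>" by (simp add: ennreal_mult_less_top)
  finally show ?thesis .
qed

lemma duhamel_bound_finite: "continuous_on UNIV G \<Longrightarrow> T \<ge> 0 \<Longrightarrow> duhamel_bound T U0 G < \<infinity>"
  unfolding duhamel_bound_def using nn_integral_norm_sq_finite[of G T] by (simp add: ennreal_mult_less_top)

lemma duhamel_bound_high_freq_tendsto_0:
  fixes G :: "real \<Rightarrow> 'a::euclidean_space lsq"
  assumes G: "continuous_on UNIV G" and T: "T \<ge> 0"
  shows "(\<lambda>n. duhamel_bound T (high_freq n U0) (\<lambda>\<tau>. high_freq n (G \<tau>))) \<longlonglongrightarrow> 0"
proof -
  have norm_lim: "(\<lambda>n. ennreal ((norm (high_freq n U))\<^sup>2)) \<longlonglongrightarrow> 0" for U :: "'a lsq"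
  proof -
    have "(\<lambda>n. (norm (high_freq n U))\<^sup>2) \<longlonglongrightarrow> (norm (0::'a lsq))\<^sup>2"
      by (intro tendsto_power tendsto_norm high_freq_tendsto_0)
    from tendsto_ennrealI[OF this] show ?thesis by simp
  qed
  have [measurable]: "(\<lambda>\<tau>. norm (high_freq n (G \<tau>))) \<in> borel_measurable borel" "(\<lambda>\<tau>. norm (G \<tau>)) \<in> borel_measurable borel" for n
    by (intro borel_measurable_continuous_onI continuous_on_norm bounded_linear.continuous_on[OF bounded_linear_high_freq] G)+
  have "(\<lambda>n. \<integral>\<^sup>+\<tau>. ennreal ((norm (high_freq n (G \<tau>)))\<^sup>2) * indicator {0..T} \<tau> \<partial>lborel) \<longlonglongrightarrow> (\<integral>\<^sup>+(\<tau>::real). 0 \<partial>lborel)"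
  proof (rule nn_integral_dominated_convergence[where w="\<lambda>\<tau>. ennreal ((norm (G \<tau>))\<^sup>2) * indicator {0..T} \<tau>"])
    show "AE \<tau> in lborel. ennreal ((norm (high_freq n (G \<tau>)))\<^sup>2) * indicator {0..T} \<tau> \<le> ennreal ((norm (G \<tau>))\<^sup>2) * indicator {0..T} \<tau>" for n
      by (intro AE_I2 mult_right_mono ennreal_leI power_mono norm_high_freq_le) auto
    show "AE \<tau> in lborel. (\<lambda>n. ennreal ((norm (high_freq n (G \<tau>)))\<^sup>2) * indicator {0..T} \<tau>) \<longlonglongrightarrow> 0"
      using norm_lim by (intro AE_I2) (auto simp: indicator_def)
  qed (use nn_integral_norm_sq_finite[OF G T] in auto)
  then have "(\<lambda>n. 2 * (ennreal ((norm (high_freq n U0))\<^sup>2) + ennreal T * (\<integral>\<^sup>+\<tau>. ennreal ((norm (high_freq n (G \<tau>)))\<^sup>2) * indicator {0..T} \<tau> \<partial>lborel)))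
      \<longlonglongrightarrow> 2 * (0 + ennreal T * (\<integral>\<^sup>+(\<tau>::real). 0 \<partial>lborel))"
    by (intro ennreal_tendsto_cmult tendsto_add norm_lim) auto
  then show ?thesis by (simp add: duhamel_bound_def)
qed

context sobolev_space
begin

lemma trunc_deriv_high_freq:
  assumes "n \<le> m" shows "trunc_deriv (real m) r x (high_freq n U) = trunc_deriv (real m) r x U - trunc_deriv (real n) r x U"
proof -
  have "trunc_deriv (real m) r x (high_freq n U) = (LINT \<xi>|lborel. trunc_deriv_kernel (real m) r x \<xi> * (indicator (- cball 0 (real n)) \<xi> * rep_lsq U \<xi>))"
    unfolding trunc_deriv_def high_freq_def mult_op_def
    by (rule pairing_abs_lsq[OF square_integrable_trunc_deriv_kernel square_integrable_mult_rep[OF high_freq_multiplier]])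
  also have "\<dots> = (LINT \<xi>|lborel. trunc_deriv_kernel (real m) r x \<xi> * rep_lsq U \<xi> - trunc_deriv_kernel (real n) r x \<xi> * rep_lsq U \<xi>)"
    using assms by (intro Bochner_Integration.integral_cong) (auto simp: trunc_deriv_kernel_def trunc_symbol_def indicator_def)
  also have "\<dots> = trunc_deriv (real m) r x U - trunc_deriv (real n) r x U"
    unfolding trunc_deriv_def pairing_def
    by (intro Bochner_Integration.integral_diff integrable_mult_square_integrable square_integrable_trunc_deriv_kernel square_integrable_rep)
  finally show ?thesis .
qed

definition gaussian_schur_const :: real where
  "gaussian_schur_const = (SOME C. \<forall>b::real^'n. smoothing_weight (\<lambda>x. gaussian (x - b)) C)"

lemma smoothing_weight_gaussian_translate: "smoothing_weight (\<lambda>x::real^'n. gaussian (x - b)) gaussian_schur_const"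
  using someI_ex[OF smoothing_weight_gaussian[where 'a="real^'n"]] unfolding gaussian_schur_const_def by blast

lemma smoothing_weight_gaussian_0: "smoothing_weight (gaussian :: real^'n \<Rightarrow> real) gaussian_schur_const"
  using smoothing_weight_gaussian_translate[of 0] by simp

end

text \<open>The interaction profile \<open>V\<close> of the curve \<open>u\<close> is a Duhamel integral of \<open>G\<close>; \<open>G\<close> and \<open>V\<close> are continued beyond \<open>[0, T]\<close>.\<close>

locale duhamel_curve = sobolev_space s n_type for s and n_type :: "'n::finite itself" +
  fixes \<alpha> T :: real and U0 :: "(real^'n) lsq" and G V :: "real \<Rightarrow> (real^'n) lsq" and u :: "real \<Rightarrow> real^'n \<Rightarrow> complex"
  assumes \<alpha>: "\<alpha> > 0" and T: "T > 0" and G: "continuous_on UNIV G" and V: "continuous_on UNIV V"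
    and V_eq: "\<And>t. t \<in> {0..T} \<Longrightarrow> V t = U0 + integral {0..t} G"
    and u_mem: "\<And>t. t \<in> {0..T} \<Longrightarrow> u t \<in> sobolev s"
    and to_interaction_u: "\<And>t. t \<in> {0..T} \<Longrightarrow> to_interaction \<alpha> u t = V t"
begin

definition weight :: "real \<times> (real^'n) \<Rightarrow> real" where
  "weight q = sqrt (fst q powr \<alpha> * gaussian (snd q)) * indicator {0..T} (fst q)"

lemma weight_measurable [measurable]: "weight \<in> borel_measurable borel" unfolding weight_def[abs_def] by measurable

lemma weight_pos: "fst q \<in> {0<..T} \<Longrightarrow> weight q > 0"
  by (simp add: weight_def)

lemma nn_integral_weight:
  assumes [measurable]: "f \<in> borel_measurable borel"
  shows "(\<integral>\<^sup>+q. ennreal ((cmod (of_real (weight q) * f q))\<^sup>2) \<partial>lborel) = (\<integral>\<^sup>+q. ennreal ((cmod (f q))\<^sup>2) \<partial>smoothing_measure \<alpha> T gaussian)"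
proof -
  have "(weight q)\<^sup>2 = fst q powr \<alpha> * gaussian (snd q) * indicator {0..T} (fst q)" for q
    by (simp add: weight_def power_mult_distrib indicator_def)
  then have "ennreal ((cmod (of_real (weight q) * f q))\<^sup>2)
      = ennreal (fst q powr \<alpha> * gaussian (snd q) * (cmod (f q))\<^sup>2) * indicator {0..T} (fst q)" for q
    by (simp add: norm_mult power_mult_distrib indicator_def)
  then show ?thesis by (subst nn_integral_smoothing_measure) auto
qed

definition trunc_solution_deriv :: "nat \<Rightarrow> real \<times> (real^'n) \<Rightarrow> complex" where
  "trunc_solution_deriv n q = trunc_deriv (real n) (phase \<alpha> (fst q)) (snd q) (V (fst q))"

lemma trunc_solution_deriv_measurable [measurable]: "trunc_solution_deriv n \<in> borel_measurable borel"
  unfolding trunc_solution_deriv_def[abs_def] by (rule trunc_deriv_measurable[OF _ _ _ V]) measurable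

definition weighted_trunc_deriv :: "nat \<Rightarrow> real \<times> (real^'n) \<Rightarrow> complex" where
  "weighted_trunc_deriv n q = of_real (weight q) * trunc_solution_deriv n q"

lemma weighted_trunc_deriv_measurable [measurable]: "weighted_trunc_deriv n \<in> borel_measurable borel"
  unfolding weighted_trunc_deriv_def[abs_def] by measurable

lemma trunc_solution_deriv_bound:
  "smoothing_weight \<rho> C \<Longrightarrow> (\<integral>\<^sup>+q. ennreal ((cmod (trunc_solution_deriv n q))\<^sup>2) \<partial>smoothing_measure \<alpha> T \<rho>)
    \<le> ennreal (weighted_smoothing_const \<alpha> T * C) * duhamel_bound T U0 G"
  unfolding trunc_solution_deriv_def by (rule duhamel_smoothing[OF \<alpha> T _ G V_eq])

lemma square_integrable_weighted_trunc_deriv: "square_integrable (weighted_trunc_deriv n)"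
proof (rule square_integrable_if_nn_integral_finite)
  have "(\<integral>\<^sup>+q. ennreal ((cmod (weighted_trunc_deriv n q))\<^sup>2) \<partial>lborel)
      \<le> ennreal (weighted_smoothing_const \<alpha> T * gaussian_schur_const) * duhamel_bound T U0 G"
    unfolding weighted_trunc_deriv_def by (simp add: nn_integral_weight trunc_solution_deriv_bound[OF smoothing_weight_gaussian_0])
  also have "\<dots> < \<infinity>" using duhamel_bound_finite[OF G] T by (simp add: ennreal_mult_less_top)
  finally show "(\<integral>\<^sup>+q. ennreal ((cmod (weighted_trunc_deriv n q))\<^sup>2) \<partial>lborel) < \<infinity>" .
qed measurable

lemma weighted_trunc_deriv_diff_le:
  assumes "n \<le> m"
  shows "ennreal ((norm (abs_lsq (weighted_trunc_deriv m) - abs_lsq (weighted_trunc_deriv n)))\<^sup>2)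
    \<le> ennreal (weighted_smoothing_const \<alpha> T * gaussian_schur_const) * duhamel_bound T (high_freq n U0) (\<lambda>\<tau>. high_freq n (G \<tau>))"
proof -
  let ?d = "\<lambda>q. trunc_deriv (real m) (phase \<alpha> (fst q)) (snd q) (high_freq n (V (fst q)))"
  have cont: "continuous_on UNIV (\<lambda>\<tau>. high_freq n (F \<tau>))" if "continuous_on UNIV F" for F :: "real \<Rightarrow> (real^'n) lsq"
    using that by (rule bounded_linear.continuous_on[OF bounded_linear_high_freq])
  have d [measurable]: "?d \<in> borel_measurable borel" by (rule trunc_deriv_measurable[OF _ _ _ cont[OF V]]) measurable
  have "ennreal ((norm (abs_lsq (weighted_trunc_deriv m) - abs_lsq (weighted_trunc_deriv n)))\<^sup>2)
      = (\<integral>\<^sup>+q. ennreal ((cmod (weighted_trunc_deriv m q - weighted_trunc_deriv n q))\<^sup>2) \<partial>lborel)"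
    by (simp add: nn_integral_abs_lsq square_integrable_diff square_integrable_weighted_trunc_deriv abs_lsq_diff)
  also have "\<dots> = (\<integral>\<^sup>+q. ennreal ((cmod (?d q))\<^sup>2) \<partial>smoothing_measure \<alpha> T gaussian)"
    unfolding weighted_trunc_deriv_def trunc_solution_deriv_def right_diff_distrib[symmetric] trunc_deriv_high_freq[OF assms, symmetric]
    by (rule nn_integral_weight[OF d])
  also have "\<dots> \<le> ennreal (weighted_smoothing_const \<alpha> T * gaussian_schur_const) * duhamel_bound T (high_freq n U0) (\<lambda>\<tau>. high_freq n (G \<tau>))"
    by (rule duhamel_smoothing[OF \<alpha> T smoothing_weight_gaussian_0 cont[OF G]]) (simp add: V_eq high_freq_duhamel[OF G])
  finally show ?thesis .
qed

definition weighted_deriv_limit :: "(real \<times> (real^'n)) lsq" where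
  "weighted_deriv_limit = lim (\<lambda>n. abs_lsq (weighted_trunc_deriv n))"

lemma weighted_trunc_deriv_tendsto: "(\<lambda>n. abs_lsq (weighted_trunc_deriv n)) \<longlonglongrightarrow> weighted_deriv_limit"
proof -
  have "(\<lambda>n. ennreal (weighted_smoothing_const \<alpha> T * gaussian_schur_const) * duhamel_bound T (high_freq n U0) (\<lambda>\<tau>. high_freq n (G \<tau>))) \<longlonglongrightarrow>
      ennreal (weighted_smoothing_const \<alpha> T * gaussian_schur_const) * 0"
    using T by (intro ennreal_tendsto_cmult duhamel_bound_high_freq_tendsto_0[OF G]) auto
  then have "Cauchy (\<lambda>n. abs_lsq (weighted_trunc_deriv n))"
    by (intro Cauchy_if_norm_diff_sq_le[OF weighted_trunc_deriv_diff_le]) simp_all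
  then show ?thesis
    unfolding weighted_deriv_limit_def using Cauchy_convergent by (simp add: convergent_LIMSEQ_iff)
qed

text \<open>Division by the weight recovers the derivative itself; for \<open>t\<close> outside \<open>(0, T]\<close> the quotient is junk.\<close>

definition solution_deriv :: "real \<times> (real^'n) \<Rightarrow> complex" where
  "solution_deriv q = rep_lsq weighted_deriv_limit q / of_real (weight q)"

lemma solution_deriv_measurable [measurable]: "solution_deriv \<in> borel_measurable borel"
  unfolding solution_deriv_def[abs_def] by measurable

lemma solution_deriv_pointwise_limit:
  obtains r :: "nat \<Rightarrow> nat" where "AE q in lborel. fst q \<in> {0<..T} \<longrightarrow> (\<lambda>n. trunc_solution_deriv (r n) q) \<longlonglongrightarrow> solution_deriv q"
proof -
  obtain r :: "nat \<Rightarrow> nat" where "AE q in lborel. (\<lambda>n. weighted_trunc_deriv (r n) q) \<longlonglongrightarrow> rep_lsq weighted_deriv_limit q"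
    by (rule L2_limit_AE_subsequence[OF square_integrable_weighted_trunc_deriv weighted_trunc_deriv_tendsto])
  then have "AE q in lborel. fst q \<in> {0<..T} \<longrightarrow> (\<lambda>n. trunc_solution_deriv (r n) q) \<longlonglongrightarrow> solution_deriv q"
  proof (eventually_elim, intro impI)
    fix q :: "real \<times> (real^'n)"
    assume lim: "(\<lambda>n. weighted_trunc_deriv (r n) q) \<longlonglongrightarrow> rep_lsq weighted_deriv_limit q" and "fst q \<in> {0<..T}"
    then have "complex_of_real (weight q) \<noteq> 0" using weight_pos[of q] by simp
    with tendsto_divide[OF lim tendsto_const this]
    show "(\<lambda>n. trunc_solution_deriv (r n) q) \<longlonglongrightarrow> solution_deriv q" by (simp add: solution_deriv_def weighted_trunc_deriv_def)
  qed
  then show ?thesis by (rule that)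
qed

lemma solution_deriv_bound:
  assumes w: "smoothing_weight \<rho> C"
  shows "(\<integral>\<^sup>+q. ennreal ((cmod (solution_deriv q))\<^sup>2) \<partial>smoothing_measure \<alpha> T \<rho>) \<le> ennreal (weighted_smoothing_const \<alpha> T * C) * duhamel_bound T U0 G"
proof -
  obtain r :: "nat \<Rightarrow> nat" where "AE q in lborel. fst q \<in> {0<..T} \<longrightarrow> (\<lambda>n. trunc_solution_deriv (r n) q) \<longlonglongrightarrow> solution_deriv q"
    by (rule solution_deriv_pointwise_limit)
  then have "AE q in smoothing_measure \<alpha> T \<rho>. (\<lambda>n. trunc_solution_deriv (r n) q) \<longlonglongrightarrow> solution_deriv q"
    by (rule AE_smoothing_measureI[OF smoothing_weight_measurable[OF w]])
  then show ?thesis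
    by (rule nn_integral_norm_sq_limit_le[rotated]) (auto intro!: always_eventually trunc_solution_deriv_bound[OF w])
qed

end

lemma
  fixes \<phi> :: "'a::euclidean_space \<Rightarrow> complex"
  assumes \<phi>: "\<phi> \<in> borel_measurable borel" and bound: "\<And>x. cmod (\<phi> x) \<le> B" and support: "\<And>x. norm x > R \<Longrightarrow> \<phi> x = 0"
  shows square_integrable_bounded_support: "square_integrable \<phi>" and integrable_bounded_support: "integrable lborel \<phi>"
proof -
  have ball_finite: "emeasure lborel (cball (0::'a) R) < \<infinity>" by (rule emeasure_bounded_finite[OF bounded_cball])
  have ball: "square_integrable (indicator (cball (0::'a) R) :: 'a \<Rightarrow> complex)" by (rule square_integrable_indicator[OF _ ball_finite]) simp
  have restrict: "\<phi> x * indicator (cball 0 R) x = \<phi> x" for x using support[of x] by (cases "norm x \<le> R") (auto simp: indicator_def)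
  have "square_integrable (\<lambda>x. \<phi> x * indicator (cball 0 R) x)" by (rule square_integrable_mult_bounded[OF ball \<phi> bound])
  then show square: "square_integrable \<phi>" unfolding restrict .
  from integrable_mult_square_integrable[OF square ball] show "integrable lborel \<phi>" unfolding restrict .
qed

lemma test_fnE:
  assumes "test_fn \<phi>"
  obtains B R where "\<phi> \<in> borel_measurable borel" "\<And>x. cmod (\<phi> x) \<le> B" "\<And>x. norm x > R \<Longrightarrow> \<phi> x = 0"
  using assms unfolding test_fn_def bounded_iff by auto

lemma fourier1_reflect:
  fixes \<phi> :: "real^'n \<Rightarrow> complex"
  assumes [measurable]: "\<phi> \<in> borel_measurable borel"
  shows "fourier1 (\<lambda>x. \<phi> (- x)) \<xi> = fourier1 \<phi> (- \<xi>)"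
proof -
  have "(LINT x|lborel. \<phi> (0 - x) * cis (- ((0 - x) \<bullet> - \<xi>))) = (LINT x|lborel. \<phi> x * cis (- (x \<bullet> - \<xi>)))"
    by (rule integral_reflect[of "\<lambda>x. \<phi> x * cis (- (x \<bullet> - \<xi>))" 0]) measurable
  then show ?thesis by (simp add: fourier1_def)
qed

lemma bessel_weight_le_power: "bessel_weight (real d) \<xi> \<le> (1 + norm \<xi>) ^ d"
proof -
  have "bessel_weight (real d) \<xi> \<le> ((1 + norm \<xi>)\<^sup>2) powr (real d / 2)"
    unfolding bessel_weight_def by (intro powr_mono2) (auto simp: power2_eq_square algebra_simps)
  also have "(1 + norm \<xi>)\<^sup>2 = (1 + norm \<xi>) powr 2" by simp
  also have "((1 + norm \<xi>) powr 2) powr (real d / 2) = (1 + norm \<xi>) powr (real d)" by (simp only: powr_powr) simp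
  also have "\<dots> = (1 + norm \<xi>) ^ d" by (rule powr_realpow) (simp add: add_pos_nonneg)
  finally show ?thesis .
qed

lemma test_fn_decay:
  fixes \<phi> :: "real^'n \<Rightarrow> complex"
  assumes "test_fn \<phi>"
  obtains C where "\<And>\<xi>. sqrt (norm \<xi>) * cmod (fourier1 \<phi> (- \<xi>)) \<le> C * bessel_weight (- real CARD('n)) \<xi>"
proof -
  let ?d = "CARD('n)"
  obtain C where C: "\<And>\<xi>. (1 + norm \<xi>) ^ Suc ?d * cmod (fourier1 \<phi> \<xi>) \<le> C" using assms unfolding test_fn_def by blast
  have "sqrt (norm \<xi>) * cmod (fourier1 \<phi> (- \<xi>)) \<le> C * bessel_weight (- real ?d) \<xi>" for \<xi>
  proof -
    have "sqrt (norm \<xi>) \<le> 1 + norm \<xi>" by (rule real_le_lsqrt) (auto simp: power2_eq_square algebra_simps)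
    then have "sqrt (norm \<xi>) * bessel_weight (real ?d) \<xi> \<le> (1 + norm \<xi>) * (1 + norm \<xi>) ^ ?d"
      by (rule mult_mono[OF _ bessel_weight_le_power]) auto
    then have "sqrt (norm \<xi>) * bessel_weight (real ?d) \<xi> * cmod (fourier1 \<phi> (- \<xi>)) \<le> (1 + norm (- \<xi>)) ^ Suc ?d * cmod (fourier1 \<phi> (- \<xi>))"
      by (intro mult_right_mono) auto
    also have "\<dots> \<le> C" by (rule C)
    finally have "sqrt (norm \<xi>) * bessel_weight (real ?d) \<xi> * cmod (fourier1 \<phi> (- \<xi>)) * bessel_weight (- real ?d) \<xi> \<le> C * bessel_weight (- real ?d) \<xi>"
      by (rule mult_right_mono) simp
    also have "sqrt (norm \<xi>) * bessel_weight (real ?d) \<xi> * cmod (fourier1 \<phi> (- \<xi>)) * bessel_weight (- real ?d) \<xi>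
        = sqrt (norm \<xi>) * cmod (fourier1 \<phi> (- \<xi>)) * (bessel_weight (real ?d) \<xi> * bessel_weight (- real ?d) \<xi>)"
      by (simp only: mult_ac)
    finally show ?thesis by simp
  qed
  then show ?thesis by (rule that)
qed

context sobolev_space
begin

lemma trunc_deriv_pairing:
  fixes \<phi> :: "real^'n \<Rightarrow> complex"
  assumes "test_fn \<phi>"
  shows "(LINT x|lborel. trunc_deriv M r x U * \<phi> x) = (LINT \<xi>|lborel. trunc_deriv_kernel M r 0 \<xi> * rep_lsq U \<xi> * fourier1 \<phi> (- \<xi>))"
proof -
  obtain B R where \<phi> [measurable]: "\<phi> \<in> borel_measurable borel" and bound: "\<And>x. cmod (\<phi> x) \<le> B" and support: "\<And>x. norm x > R \<Longrightarrow> \<phi> x = 0"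
    using test_fnE[OF assms] by blast
  have \<phi>_int: "integrable lborel (\<lambda>x. \<phi> (- x))"
    by (rule integrable_bounded_support[where B=B and R=R]) (use bound support in auto)
  let ?a = "\<lambda>\<xi>. trunc_deriv_kernel M r 0 \<xi> * rep_lsq U \<xi>"
  have a: "integrable lborel ?a" by (rule integrable_mult_square_integrable[OF square_integrable_trunc_deriv_kernel square_integrable_rep])
  have [measurable]: "fourier1 ?a \<in> borel_measurable borel" by (rule fourier1_measurable) measurable
  have "trunc_deriv M r x U = fourier1 ?a (0 - x)" for x
    unfolding trunc_deriv_def pairing_def fourier1_def
  proof (rule Bochner_Integration.integral_cong[OF refl])
    fix \<xi> :: "real^'n"
    have "cis (x \<bullet> \<xi> - r * (norm \<xi>)\<^sup>2) = cis (0 \<bullet> \<xi> - r * (norm \<xi>)\<^sup>2) * cis (- (\<xi> \<bullet> (0 - x)))"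
      unfolding cis_mult by (simp add: inner_commute[of x \<xi>])
    then show "trunc_deriv_kernel M r x \<xi> * rep_lsq U \<xi> = trunc_deriv_kernel M r 0 \<xi> * rep_lsq U \<xi> * cis (- (\<xi> \<bullet> (0 - x)))"
      unfolding trunc_deriv_kernel_def by (simp only: mult_ac)
  qed
  then have "(LINT x|lborel. trunc_deriv M r x U * \<phi> x) = (LINT x|lborel. fourier1 ?a (0 - x) * \<phi> (- (0 - x)))" by simp
  also have "\<dots> = (LINT y|lborel. fourier1 ?a y * \<phi> (- y))"
    by (rule integral_reflect[of "\<lambda>y. fourier1 ?a y * \<phi> (- y)" 0]) measurable
  also have "\<dots> = (LINT \<xi>|lborel. ?a \<xi> * fourier1 (\<lambda>y. \<phi> (- y)) \<xi>)" by (rule fourier1_duality[OF a \<phi>_int])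
  finally show ?thesis unfolding fourier1_reflect[OF \<phi>] .
qed

lemma trunc_deriv_kernel_tendsto:
  assumes "strict_mono (q :: nat \<Rightarrow> nat)"
  shows "(\<lambda>n. trunc_deriv_kernel (real (q n)) r x \<xi>) \<longlonglongrightarrow> fourier_const * (of_real (deriv_symbol \<xi>) * cis (x \<bullet> \<xi> - r * (norm \<xi>)\<^sup>2))"
proof (rule tendsto_eventually)
  obtain k :: nat where k: "norm \<xi> \<le> real k" using real_arch_simple by blast
  show "\<forall>\<^sub>F n in sequentially. trunc_deriv_kernel (real (q n)) r x \<xi> = fourier_const * (of_real (deriv_symbol \<xi>) * cis (x \<bullet> \<xi> - r * (norm \<xi>)\<^sup>2))"
  proof (rule eventually_sequentiallyI[of k])
    fix n assume "n \<ge> k"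
    then have "norm \<xi> \<le> real (q n)" using k seq_suble[OF assms, of n] by linarith
    then show "trunc_deriv_kernel (real (q n)) r x \<xi> = fourier_const * (of_real (deriv_symbol \<xi>) * cis (x \<bullet> \<xi> - r * (norm \<xi>)\<^sup>2))"
      by (simp add: trunc_deriv_kernel_def trunc_symbol_def)
  qed
qed

lemma trunc_deriv_pairing_limit:
  fixes \<phi> :: "real^'n \<Rightarrow> complex" and q :: "nat \<Rightarrow> nat"
  assumes \<phi>: "test_fn \<phi>" and q: "strict_mono q"
  shows "(\<lambda>n. LINT x|lborel. trunc_deriv (real (q n)) r x U * \<phi> x) \<longlonglongrightarrow>
    (LINT \<xi>|lborel. fourier_const * (of_real (deriv_symbol \<xi>) * cis (- r * (norm \<xi>)\<^sup>2)) * rep_lsq U \<xi> * fourier1 \<phi> (- \<xi>))"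
proof -
  have [measurable]: "fourier1 \<phi> \<in> borel_measurable borel" using \<phi> by (intro fourier1_measurable) (simp add: test_fn_def)
  have [measurable]: "rep_lsq U \<in> borel_measurable borel" by (rule rep_measurable)
  obtain C where C: "\<And>\<xi>. sqrt (norm \<xi>) * cmod (fourier1 \<phi> (- \<xi>)) \<le> C * bessel_weight (- real CARD('n)) \<xi>" using test_fn_decay[OF \<phi>] by blast
  let ?w = "\<lambda>\<xi>::real^'n. complex_of_real (bessel_weight (- real CARD('n)) \<xi>)"
  have w: "square_integrable ?w" by (rule square_integrable_bessel_weight_neg) simp
  show ?thesis unfolding trunc_deriv_pairing[OF \<phi>]
  proof (rule integral_dominated_convergence[where w="\<lambda>\<xi>. cmod fourier_const * C * cmod (?w \<xi> * rep_lsq U \<xi>)"])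
    show "integrable lborel (\<lambda>\<xi>. cmod fourier_const * C * cmod (?w \<xi> * rep_lsq U \<xi>))"
      by (intro integrable_mult_right integrable_norm integrable_mult_square_integrable[OF w square_integrable_rep])
    show "AE \<xi> in lborel. (\<lambda>n. trunc_deriv_kernel (real (q n)) r 0 \<xi> * rep_lsq U \<xi> * fourier1 \<phi> (- \<xi>)) \<longlonglongrightarrow>
      fourier_const * (of_real (deriv_symbol \<xi>) * cis (- r * (norm \<xi>)\<^sup>2)) * rep_lsq U \<xi> * fourier1 \<phi> (- \<xi>)"
      using trunc_deriv_kernel_tendsto[OF q, of r 0] by (intro AE_I2 tendsto_mult tendsto_const) simp
    show "AE \<xi> in lborel. norm (trunc_deriv_kernel (real (q n)) r 0 \<xi> * rep_lsq U \<xi> * fourier1 \<phi> (- \<xi>))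
        \<le> cmod fourier_const * C * cmod (?w \<xi> * rep_lsq U \<xi>)" for n
    proof (rule AE_I2)
      fix \<xi> :: "real^'n"
      have "trunc_symbol (real (q n)) \<xi> * cmod (fourier1 \<phi> (- \<xi>)) \<le> C * bessel_weight (- real CARD('n)) \<xi>"
        by (rule order_trans[OF mult_right_mono[OF trunc_symbol_le] C]) simp
      then have "cmod fourier_const * cmod (rep_lsq U \<xi>) * (trunc_symbol (real (q n)) \<xi> * cmod (fourier1 \<phi> (- \<xi>)))
          \<le> cmod fourier_const * cmod (rep_lsq U \<xi>) * (C * bessel_weight (- real CARD('n)) \<xi>)"
        by (rule mult_left_mono) simp
      then show "norm (trunc_deriv_kernel (real (q n)) r 0 \<xi> * rep_lsq U \<xi> * fourier1 \<phi> (- \<xi>)) \<le> cmod fourier_const * C * cmod (?w \<xi> * rep_lsq U \<xi>)"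
        unfolding norm_mult cmod_trunc_deriv_kernel norm_of_real abs_of_nonneg[OF bessel_weight_nonneg] by (simp only: mult_ac)
    qed
  qed measurable
qed

end

context duhamel_curve
begin

lemma AE_FT_solution:
  assumes t: "t \<in> {0..T}"
  shows "AE \<xi> in lborel. FT (u t) \<xi> = of_real (bessel_weight (- s) \<xi>) * (cis (- phase \<alpha> t * (norm \<xi>)\<^sup>2) * rep_lsq (V t) \<xi>)"
proof -
  have "weighted_FT (u t) = propagator (- phase \<alpha> t) (V t)"
    using to_interaction_u[OF t] unfolding to_interaction_def by (subst (asm) propagator_eq_iff)
  with sobolev_FT_weighted_FT[OF u_mem[OF t]] have "AE \<xi> in lborel. sobolev_FT (propagator (- phase \<alpha> t) (V t)) \<xi> = FT (u t) \<xi>"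
    by simp
  with rep_propagator[of "- phase \<alpha> t" "V t"] show ?thesis
    by eventually_elim (simp add: sobolev_FT_def)
qed

lemma square_integrable_test_fn_div_weight:
  assumes \<phi>: "test_fn \<phi>" and t: "t \<in> {0<..T}"
  shows "square_integrable (\<lambda>x. \<phi> x / of_real (weight (t, x)))"
proof -
  obtain B R where [measurable]: "\<phi> \<in> borel_measurable borel" and bound: "\<And>x. cmod (\<phi> x) \<le> B" and support: "\<And>x. norm x > R \<Longrightarrow> \<phi> x = 0"
    using test_fnE[OF \<phi>] by blast
  let ?m = "sqrt (t powr \<alpha> * gaussian R)"
  have weight_ge: "?m \<le> weight (t, x)" if "norm x \<le> R" for x
  proof -
    have "(norm x)\<^sup>2 \<le> R\<^sup>2" using that by (intro power_mono) auto
    then show ?thesis using t by (simp add: weight_def gaussian_def)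
  qed
  show ?thesis
  proof (rule square_integrable_bounded_support)
    show "(\<lambda>x. \<phi> x / of_real (weight (t, x))) \<in> borel_measurable borel"
      unfolding weight_def fst_conv snd_conv by measurable
    show "\<phi> x / of_real (weight (t, x)) = 0" if "norm x > R" for x using support[OF that] by simp
    show "cmod (\<phi> x / of_real (weight (t, x))) \<le> B / ?m" for x
    proof (cases "norm x \<le> R")
      case True
      have "0 < ?m" using t by simp
      have "cmod (\<phi> x) / weight (t, x) \<le> B / ?m"
        using order_trans[OF norm_ge_zero bound[of x]] by (intro frac_le bound weight_ge[OF True] \<open>0 < ?m\<close>) auto
      then show ?thesis using weight_pos[of "(t, x)"] t by (simp add: norm_divide)
    next
      case False
      then show ?thesis using support[of x] order_trans[OF norm_ge_zero bound[of x]] t by simp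
    qed
  qed
qed

lemma solution_deriv_pairing_limit:
  fixes F :: "nat \<Rightarrow> nat"
  assumes \<phi>: "test_fn \<phi>" and t: "t \<in> {0<..T}" and limit: "square_integrable (\<lambda>x. rep_lsq weighted_deriv_limit (t, x))"
    and trunc: "\<And>n. square_integrable (\<lambda>x. weighted_trunc_deriv (F n) (t, x))"
    and tendsto: "(\<lambda>n. abs_lsq (\<lambda>x. weighted_trunc_deriv (F n) (t, x))) \<longlonglongrightarrow> abs_lsq (\<lambda>x. rep_lsq weighted_deriv_limit (t, x))"
  shows "integrable lborel (\<lambda>x. solution_deriv (t, x) * \<phi> x)"
    and "(\<lambda>n. LINT x|lborel. trunc_solution_deriv (F n) (t, x) * \<phi> x) \<longlonglongrightarrow> (LINT x|lborel. solution_deriv (t, x) * \<phi> x)"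
proof -
  let ?\<psi> = "\<lambda>x. \<phi> x / of_real (weight (t, x))"
  have \<psi>: "square_integrable ?\<psi>" by (rule square_integrable_test_fn_div_weight[OF \<phi> t])
  have deriv_eq: "solution_deriv (t, x) * \<phi> x = ?\<psi> x * rep_lsq weighted_deriv_limit (t, x)" for x
    by (simp add: solution_deriv_def)
  have "weight (t, x) \<noteq> 0" for x using weight_pos[of "(t, x)"] t by simp
  then have trunc_eq: "trunc_solution_deriv (F n) (t, x) * \<phi> x = ?\<psi> x * weighted_trunc_deriv (F n) (t, x)" for n x
    by (simp add: weighted_trunc_deriv_def)
  show "integrable lborel (\<lambda>x. solution_deriv (t, x) * \<phi> x)"
    unfolding deriv_eq by (rule integrable_mult_square_integrable[OF \<psi> limit])
  show "(\<lambda>n. LINT x|lborel. trunc_solution_deriv (F n) (t, x) * \<phi> x) \<longlonglongrightarrow> (LINT x|lborel. solution_deriv (t, x) * \<phi> x)"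
    unfolding deriv_eq trunc_eq pairing_abs_lsq[OF \<psi> limit, symmetric] pairing_abs_lsq[OF \<psi> trunc, symmetric]
    by (rule bounded_linear.tendsto[OF bounded_linear_pairing[OF \<psi>] tendsto])
qed

lemma pairing_deriv_symbol_eq:
  assumes \<phi>: "test_fn \<phi>" and t: "t \<in> {0..T}"
  shows "(LINT \<xi>|lborel. fourier_const * (of_real (deriv_symbol \<xi>) * cis (- phase \<alpha> t * (norm \<xi>)\<^sup>2)) * rep_lsq (V t) \<xi> * fourier1 \<phi> (- \<xi>))
    = fourier_const * (LINT \<xi>|lborel. of_real (norm \<xi> powr (s + 1/2)) * FT (u t) \<xi> * fourier1 \<phi> (- \<xi>))"
proof -
  have [measurable]: "fourier1 \<phi> \<in> borel_measurable borel" using \<phi> by (intro fourier1_measurable) (simp add: test_fn_def)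
  have [measurable]: "rep_lsq (V t) \<in> borel_measurable borel" by (rule rep_measurable)
  have [measurable]: "FT (u t) \<in> borel_measurable borel" by (rule FT_measurable[OF sobolev_square_integrable[OF u_mem[OF t]]])
  have "(LINT \<xi>|lborel. fourier_const * (of_real (deriv_symbol \<xi>) * cis (- phase \<alpha> t * (norm \<xi>)\<^sup>2)) * rep_lsq (V t) \<xi> * fourier1 \<phi> (- \<xi>))
      = (LINT \<xi>|lborel. fourier_const * (of_real (norm \<xi> powr (s + 1/2)) * FT (u t) \<xi> * fourier1 \<phi> (- \<xi>)))"
  proof (rule integral_cong_AE)
    show "AE \<xi> in lborel. fourier_const * (of_real (deriv_symbol \<xi>) * cis (- phase \<alpha> t * (norm \<xi>)\<^sup>2)) * rep_lsq (V t) \<xi> * fourier1 \<phi> (- \<xi>)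
        = fourier_const * (of_real (norm \<xi> powr (s + 1/2)) * FT (u t) \<xi> * fourier1 \<phi> (- \<xi>))"
      using AE_FT_solution[OF t] by eventually_elim (simp only: deriv_symbol_def of_real_mult mult_ac)
  qed measurable
  then show ?thesis by (simp only: integral_mult_right_zero)
qed

lemma solution_deriv_is_Dx: "is_Dx (s + 1/2) T u solution_deriv"
  unfolding is_Dx_def
proof
  show "solution_deriv \<in> borel_measurable (lborel \<Otimes>\<^sub>M lborel)" by (simp add: lborel_prod)
  obtain r :: "nat \<Rightarrow> nat" where r: "strict_mono r"
    and sections: "AE t in lborel. square_integrable (\<lambda>x. rep_lsq weighted_deriv_limit (t, x)) \<and>
      (\<forall>n. square_integrable (\<lambda>x. weighted_trunc_deriv (r n) (t, x))) \<and>
      (\<lambda>n. abs_lsq (\<lambda>x. weighted_trunc_deriv (r n) (t, x))) \<longlonglongrightarrow> abs_lsq (\<lambda>x. rep_lsq weighted_deriv_limit (t, x))"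
    using L2_limit_sections[OF square_integrable_weighted_trunc_deriv weighted_trunc_deriv_tendsto] by blast
  show "AE t in lborel. t \<in> {0..T} \<longrightarrow> (\<forall>\<phi>. test_fn \<phi> \<longrightarrow>
        integrable lborel (\<lambda>x. solution_deriv (t, x) * \<phi> x) \<and>
        (LINT x|lborel. solution_deriv (t, x) * \<phi> x) =
          of_real (1 / (2 * pi) ^ CARD('n)) *
          (LINT \<xi>|lborel. of_real (norm \<xi> powr (s + 1/2)) * FT (u t) \<xi> * fourier1 \<phi> (- \<xi>)))"
    using sections AE_lborel_singleton[of 0]
  proof (eventually_elim, intro impI allI)
    case (elim t)
    fix \<phi> :: "real^'n \<Rightarrow> complex"
    assume t: "t \<in> {0..T}" and \<phi>: "test_fn \<phi>"
    then have "t \<in> {0<..T}" using elim(2) by simp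
    note limit = solution_deriv_pairing_limit[OF \<phi> this, of r]
    have "(\<lambda>n. LINT x|lborel. trunc_solution_deriv (r n) (t, x) * \<phi> x) \<longlonglongrightarrow>
        (LINT \<xi>|lborel. fourier_const * (of_real (deriv_symbol \<xi>) * cis (- phase \<alpha> t * (norm \<xi>)\<^sup>2)) * rep_lsq (V t) \<xi> * fourier1 \<phi> (- \<xi>))"
      unfolding trunc_solution_deriv_def fst_conv snd_conv by (rule trunc_deriv_pairing_limit[OF \<phi> r])
    with limit(2) elim(1) have "(LINT x|lborel. solution_deriv (t, x) * \<phi> x)
        = fourier_const * (LINT \<xi>|lborel. of_real (norm \<xi> powr (s + 1/2)) * FT (u t) \<xi> * fourier1 \<phi> (- \<xi>))"
      unfolding pairing_deriv_symbol_eq[OF \<phi> t] by (blast intro: LIMSEQ_unique)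
    with limit(1) elim(1) show "integrable lborel (\<lambda>x. solution_deriv (t, x) * \<phi> x) \<and> (LINT x|lborel. solution_deriv (t, x) * \<phi> x) =
          of_real (1 / (2 * pi) ^ CARD('n)) *
          (LINT \<xi>|lborel. of_real (norm \<xi> powr (s + 1/2)) * FT (u t) \<xi> * fourier1 \<phi> (- \<xi>))"
      unfolding fourier_const_def by blast
  qed
qed

end

lemma AE_le_on_finite_set:
  fixes F :: "'a \<Rightarrow> ennreal"
  assumes [measurable]: "F \<in> borel_measurable M" "A \<in> sets M" and K: "K < \<infinity>" and A: "emeasure M A < \<infinity>"
    and set_integral_le: "\<And>B. B \<in> sets M \<Longrightarrow> B \<subseteq> A \<Longrightarrow> (\<integral>\<^sup>+x. F x * indicator B x \<partial>M) \<le> K * emeasure M B"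
  shows "AE x in M. x \<in> A \<longrightarrow> F x \<le> K"
proof -
  define B where "B = {x \<in> space M. x \<in> A \<and> K < F x}"
  have [measurable]: "B \<in> sets M" unfolding B_def by measurable
  have "B \<subseteq> A" by (auto simp: B_def)
  then have "emeasure M B < \<infinity>" using emeasure_mono[of B A M] A by (auto intro: le_less_trans)
  then have fin: "K * emeasure M B < \<infinity>" using K by (simp add: ennreal_mult_less_top)
  have "(\<integral>\<^sup>+x. F x * indicator B x - K * indicator B x \<partial>M) = (\<integral>\<^sup>+x. F x * indicator B x \<partial>M) - (\<integral>\<^sup>+x. K * indicator B x \<partial>M)"
  proof (rule nn_integral_diff)
    show "(\<integral>\<^sup>+x. K * indicator B x \<partial>M) \<noteq> \<infinity>" using fin by (simp add: nn_integral_cmult_indicator)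
    show "AE x in M. K * indicator B x \<le> F x * indicator B x" by (rule AE_I2) (auto simp: B_def indicator_def)
  qed measurable
  also have "\<dots> = 0" using set_integral_le[OF _ \<open>B \<subseteq> A\<close>] fin by (simp add: nn_integral_cmult_indicator diff_eq_0_iff_ennreal)
  finally have "AE x in M. F x * indicator B x - K * indicator B x = 0"
    by (subst (asm) nn_integral_0_iff_AE) auto
  with AE_space show ?thesis
  proof eventually_elim
    case (elim x)
    then have "F x - K = 0" if "x \<in> B" using that by simp
    then have "x \<notin> B" using K by (auto simp: B_def diff_eq_0_iff_ennreal)
    then show ?case using elim(1) by (auto simp: B_def not_less)
  qed
qed

lemma AE_le_if_set_nn_integral_le:
  fixes F :: "'a::euclidean_space \<Rightarrow> ennreal"
  assumes [measurable]: "F \<in> borel_measurable borel" and K: "K < \<infinity>"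
    and set_integral_le: "\<And>A. A \<in> sets borel \<Longrightarrow> emeasure lborel A < \<infinity> \<Longrightarrow> (\<integral>\<^sup>+x. F x * indicator A x \<partial>lborel) \<le> K * emeasure lborel A"
  shows "AE x in lborel. F x \<le> K"
proof -
  have "AE x in lborel. x \<in> cball 0 (real j) \<longrightarrow> F x \<le> K" for j :: nat
  proof (rule AE_le_on_finite_set)
    show fin: "emeasure lborel (cball (0::'a) (real j)) < \<infinity>" by (rule emeasure_bounded_finite[OF bounded_cball])
    show "(\<integral>\<^sup>+x. F x * indicator B x \<partial>lborel) \<le> K * emeasure lborel B" if "B \<in> sets lborel" "B \<subseteq> cball 0 (real j)" for B
      using that le_less_trans[OF emeasure_mono[OF that(2), of lborel] fin] by (intro set_integral_le) auto
  qed (use K in auto)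
  then have "AE x in lborel. \<forall>j::nat. x \<in> cball 0 (real j) \<longrightarrow> F x \<le> K" unfolding AE_all_countable ..
  then show ?thesis
  proof eventually_elim
    case (elim x)
    obtain j :: nat where "norm x \<le> real j" using real_arch_simple by blast
    then show ?case using elim by auto
  qed
qed

lemma gaussian_cube_bound:
  fixes \<beta> :: "'n::finite \<Rightarrow> int"
  assumes "x \<in> cube \<beta>"
  shows "1 \<le> exp (real CARD('n) / 2) * gaussian (x - (\<chi> i. of_int (\<beta> i)))"
proof -
  let ?b = "(\<chi> i. of_int (\<beta> i)) :: real^'n"
  have "(norm (x - ?b))\<^sup>2 = (\<Sum>i\<in>UNIV. (x $ i - of_int (\<beta> i))\<^sup>2)"
    unfolding power2_norm_eq_inner inner_vec_def by (simp add: power2_eq_square)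
  also have "\<dots> \<le> (\<Sum>i\<in>(UNIV::'n set). 1)"
  proof (rule sum_mono)
    fix i
    have "0 \<le> x $ i - of_int (\<beta> i)" "x $ i - of_int (\<beta> i) \<le> 1"
      using assms unfolding cube_def by (auto simp: less_imp_le algebra_simps dest!: spec[of _ i])
    then show "(x $ i - of_int (\<beta> i))\<^sup>2 \<le> 1" by (simp add: power_le_one)
  qed
  finally have "(norm (x - ?b))\<^sup>2 \<le> real CARD('n)" by simp
  then have "1 \<le> exp (real CARD('n) / 2 + - ((norm (x - ?b))\<^sup>2 / 2))" by simp
  then show ?thesis unfolding exp_add gaussian_def .
qed

context duhamel_curve
begin

lemma duhamel_bound_solution_finite: "duhamel_bound T U0 G < \<infinity>"
  by (rule duhamel_bound_finite[OF G less_imp_le[OF T]])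

lemma solution_deriv_cube_bound:
  "\<exists>C::real. \<forall>\<beta>. (\<integral>\<^sup>+p. ennreal (fst p powr \<alpha> * (cmod (solution_deriv p))\<^sup>2) * indicator ({0..T} \<times> cube \<beta>) p \<partial>(lborel \<Otimes>\<^sub>M lborel)) \<le> ennreal C"
proof -
  let ?e = "exp (real CARD('n) / 2)"
  let ?K = "ennreal ?e * (ennreal (weighted_smoothing_const \<alpha> T * gaussian_schur_const) * duhamel_bound T U0 G)"
  have "?K < \<infinity>" using duhamel_bound_solution_finite by (simp add: ennreal_mult_less_top)
  have "(\<integral>\<^sup>+p. ennreal (fst p powr \<alpha> * (cmod (solution_deriv p))\<^sup>2) * indicator ({0..T} \<times> cube \<beta>) p \<partial>(lborel \<Otimes>\<^sub>M lborel)) \<le> ?K" for \<beta>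
  proof -
    let ?g = "\<lambda>x. gaussian (x - (\<chi> i. of_int (\<beta> i)) :: real^'n)" and ?w = "\<lambda>p. (cmod (solution_deriv p))\<^sup>2"
    have cube_indicator_le: "ennreal (fst p powr \<alpha> * ?w p) * indicator ({0..T} \<times> cube \<beta>) p \<le> ennreal ?e * (ennreal (fst p powr \<alpha> * ?g (snd p) * ?w p) * indicator {0..T} (fst p))"
      for p :: "real \<times> (real^'n)"
    proof (cases "p \<in> {0..T} \<times> cube \<beta>")
      case True
      then have "1 * (fst p powr \<alpha> * ?w p) \<le> ?e * ?g (snd p) * (fst p powr \<alpha> * ?w p)"
        by (intro mult_right_mono gaussian_cube_bound) auto
      then have "fst p powr \<alpha> * ?w p \<le> ?e * (fst p powr \<alpha> * ?g (snd p) * ?w p)" by (simp only: mult_1 mult_ac)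
      from ennreal_leI[OF this] show ?thesis using True by (cases p) (simp add: ennreal_mult)
    qed simp
    have "(\<integral>\<^sup>+p. ennreal (fst p powr \<alpha> * ?w p) * indicator ({0..T} \<times> cube \<beta>) p \<partial>lborel)
        \<le> (\<integral>\<^sup>+p. ennreal ?e * (ennreal (fst p powr \<alpha> * ?g (snd p) * ?w p) * indicator {0..T} (fst p)) \<partial>lborel)"
      by (rule nn_integral_mono[OF cube_indicator_le])
    also have "\<dots> = ennreal ?e * (\<integral>\<^sup>+p. ennreal (?w p) \<partial>smoothing_measure \<alpha> T ?g)"
      by (subst nn_integral_cmult, measurable) (subst nn_integral_smoothing_measure, auto)
    also have "\<dots> \<le> ?K" by (intro mult_left_mono solution_deriv_bound smoothing_weight_gaussian_translate) simp
    finally show ?thesis unfolding lborel_prod .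
  qed
  moreover have "?K = ennreal (enn2real ?K)" using \<open>?K < \<infinity>\<close> by simp
  ultimately show ?thesis by (intro exI[of _ "enn2real ?K"] allI) (simp only:)
qed

lemma nn_integral_slice_solution_deriv:
  assumes [measurable]: "A \<in> sets borel"
  defines "F \<equiv> \<lambda>x. \<integral>\<^sup>+t. ennreal (t powr \<alpha> * (cmod (solution_deriv (t, x)))\<^sup>2) * indicator {0..T} t \<partial>lborel"
  shows "F \<in> borel_measurable borel"
    and "(\<integral>\<^sup>+x. F x * indicator A x \<partial>lborel) = (\<integral>\<^sup>+q. ennreal ((cmod (solution_deriv q))\<^sup>2) \<partial>smoothing_measure \<alpha> T (indicator A))"
proof -
  have [measurable]: "solution_deriv \<in> borel_measurable (borel \<Otimes>\<^sub>M borel)" unfolding borel_prod by measurable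
  have "(\<lambda>(x, t). ennreal (t powr \<alpha> * (cmod (solution_deriv (t, x)))\<^sup>2) * indicator {0..T} t) \<in> borel_measurable (borel \<Otimes>\<^sub>M lborel)"
    by measurable
  from lborel.borel_measurable_nn_integral[OF this] show "F \<in> borel_measurable borel" unfolding F_def .
  let ?h = "\<lambda>p. ennreal (fst p powr \<alpha> * indicator A (snd p) * (cmod (solution_deriv p))\<^sup>2) * indicator {0..T} (fst p)"
  have "?h \<in> borel_measurable (lborel \<Otimes>\<^sub>M lborel)" unfolding lborel_prod by measurable
  from lborel_pair.nn_integral_snd[OF this]
  have "(\<integral>\<^sup>+x. (\<integral>\<^sup>+t. ?h (t, x) \<partial>lborel) \<partial>lborel) = (\<integral>\<^sup>+q. ?h q \<partial>lborel)" unfolding lborel_prod .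
  moreover have "(\<integral>\<^sup>+x. F x * indicator A x \<partial>lborel) = (\<integral>\<^sup>+x. (\<integral>\<^sup>+t. ?h (t, x) \<partial>lborel) \<partial>lborel)"
    unfolding F_def by (intro nn_integral_cong) (auto simp: indicator_def intro!: nn_integral_cong)
  ultimately show "(\<integral>\<^sup>+x. F x * indicator A x \<partial>lborel) = (\<integral>\<^sup>+q. ennreal ((cmod (solution_deriv q))\<^sup>2) \<partial>smoothing_measure \<alpha> T (indicator A))"
    by (subst nn_integral_smoothing_measure) auto
qed

lemma solution_deriv_line_bound:
  assumes dim: "CARD('n) = 1"
  shows "\<exists>C::real. AE x in lborel. (\<integral>\<^sup>+t. ennreal (t powr \<alpha> * (cmod (solution_deriv (t, x)))\<^sup>2) * indicator {0..T} t \<partial>lborel) \<le> ennreal C"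
proof -
  let ?K = "ennreal (weighted_smoothing_const \<alpha> T * (8 * pi)) * duhamel_bound T U0 G"
  let ?F = "\<lambda>x. \<integral>\<^sup>+t. ennreal (t powr \<alpha> * (cmod (solution_deriv (t, x)))\<^sup>2) * indicator {0..T} t \<partial>lborel"
  have bound_finite: "?K < \<infinity>" using duhamel_bound_solution_finite by (simp add: ennreal_mult_less_top)
  have "AE x in lborel. ?F x \<le> ?K"
  proof (rule AE_le_if_set_nn_integral_le[OF nn_integral_slice_solution_deriv(1)[of UNIV] bound_finite])
    fix A :: "(real^'n) set" assume A: "A \<in> sets borel" "emeasure lborel A < \<infinity>"
    have "(\<integral>\<^sup>+x. ?F x * indicator A x \<partial>lborel) = (\<integral>\<^sup>+q. ennreal ((cmod (solution_deriv q))\<^sup>2) \<partial>smoothing_measure \<alpha> T (indicator A))"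
      by (rule nn_integral_slice_solution_deriv(2)[OF A(1)])
    also have "\<dots> \<le> ennreal (weighted_smoothing_const \<alpha> T * (measure lborel A * (8 * pi))) * duhamel_bound T U0 G"
      using dim by (intro solution_deriv_bound smoothing_weight_indicator A) simp
    also have "weighted_smoothing_const \<alpha> T * (measure lborel A * (8 * pi)) = weighted_smoothing_const \<alpha> T * (8 * pi) * measure lborel A"
      by (simp only: mult_ac)
    also have "ennreal \<dots> = ennreal (weighted_smoothing_const \<alpha> T * (8 * pi)) * emeasure lborel A"
      using A(2) weighted_smoothing_const_nonneg by (simp add: ennreal_mult emeasure_eq_ennreal_measure)
    finally show "(\<integral>\<^sup>+x. ?F x * indicator A x \<partial>lborel) \<le> ?K * emeasure lborel A" by (simp only: mult_ac)
  qed simp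
  moreover have "?K = ennreal (enn2real ?K)" using bound_finite by simp
  ultimately have "AE x in lborel. ?F x \<le> ennreal (enn2real ?K)" by (simp only:)
  then show ?thesis ..
qed

end

lemma (in sobolev_space) hs_solution_smoothing:
  fixes u :: "real \<Rightarrow> real^'n \<Rightarrow> complex"
  assumes \<alpha>: "\<alpha> > 0" and T: "T > 0" and u0: "u0 \<in> sobolev s" and u: "cont_Hs s T u" "solves \<alpha> \<sigma> k T u0 u"
  shows "\<exists>w. is_Dx (s + 1/2) T u w \<and>
    (CARD('n) = 1 \<longrightarrow> (\<exists>C::real. AE x in lborel.
       (\<integral>\<^sup>+t. ennreal (t powr \<alpha> * (cmod (w (t, x)))\<^sup>2) * indicator {0..T} t \<partial>lborel) \<le> ennreal C)) \<and>
    (CARD('n) \<ge> 2 \<longrightarrow> (\<exists>C::real. \<forall>\<beta>.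
       (\<integral>\<^sup>+p. ennreal (fst p powr \<alpha> * (cmod (w p))\<^sup>2) * indicator ({0..T} \<times> cube \<beta>) p \<partial>(lborel \<Otimes>\<^sub>M lborel)) \<le> ennreal C))"
proof -
  let ?V = "to_interaction \<alpha> u" and ?N = "\<lambda>\<tau>. interaction_nonlin \<alpha> \<sigma> k \<tau> (to_interaction \<alpha> u \<tau>)"
  have V: "continuous_on {0..T} ?V" "\<And>t. t \<in> {0..T} \<Longrightarrow> ?V t = weighted_FT u0 + integral {0..t} ?N"
    using u(2) unfolding solves_iff[OF \<alpha> u0 u(1)] volterra_solution_def by auto
  have N: "continuous_on {0..T} ?N" by (rule continuous_on_interaction_nonlin[OF \<alpha> V(1)])
  have ext_cont_eq: "ext_cont f 0 T t = f t" if "t \<in> {0..T}" for f :: "real \<Rightarrow> (real^'n) lsq" and t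
    using that by (intro ext_cont_cancel_cbox) (simp add: cbox_interval)
  interpret duhamel_curve s n_type \<alpha> T "weighted_FT u0" "ext_cont ?N 0 T" "ext_cont ?V 0 T" u
  proof
    show "continuous_on UNIV (ext_cont ?N 0 T)" "continuous_on UNIV (ext_cont ?V 0 T)"
      using V(1) N by (intro continuous_on_ext_cont, simp add: cbox_interval)+
    fix t assume t: "t \<in> {0..T}"
    have "integral {0..t} (ext_cont ?N 0 T) = integral {0..t} ?N"
      using t by (intro Henstock_Kurzweil_Integration.integral_cong ext_cont_eq) auto
    then show "ext_cont ?V 0 T t = weighted_FT u0 + integral {0..t} (ext_cont ?N 0 T)" using V(2)[OF t] by (simp add: ext_cont_eq[OF t])
    show "u t \<in> sobolev s" using u(1) t by (simp add: cont_Hs_iff)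
    show "?V t = ext_cont ?V 0 T t" by (simp add: ext_cont_eq[OF t])
  qed (rule \<alpha> T)+
  show ?thesis using solution_deriv_is_Dx solution_deriv_line_bound solution_deriv_cube_bound by blast
qed

theorem theorem1p3:
  fixes \<alpha> s \<sigma> :: real and k :: nat
  assumes "\<alpha> > 0" and "k \<ge> 1" and "s > real CARD('n) / 2" and "\<sigma> = 1 \<or> \<sigma> = -1"
  shows "\<forall>R>0. \<exists>T>0. \<exists>X N. banach_Linf s T X N \<and>
    (\<exists>sol. (\<forall>u0 \<in> (Hball s R :: (real^'n \<Rightarrow> complex) set).
        sol u0 \<in> X \<and> cont_Hs s T (sol u0) \<and> solves \<alpha> \<sigma> k T u0 (sol u0)
      \<and> (\<forall>v\<in>X. cont_Hs s T v \<and> solves \<alpha> \<sigma> k T u0 v \<longrightarrow>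
            (\<forall>t\<in>{0..T}. hs_dist s (v t) (sol u0 t) = 0))
      \<and> (\<forall>\<epsilon>>0. \<exists>\<delta>>0. \<forall>v0 \<in> Hball s R. hs_dist s v0 u0 < \<delta> \<longrightarrow>
            (\<forall>t\<in>{0..T}. hs_dist s (sol v0 t) (sol u0 t) < \<epsilon>))
      \<and> (\<exists>w. is_Dx (s + 1/2) T (sol u0) w \<and>
            (CARD('n) = 1 \<longrightarrow> (\<exists>C::real. AE x in lborel.
               (\<integral>\<^sup>+ t. ennreal (t powr \<alpha> * (cmod (w (t, x)))^2) * indicator {0..T} t \<partial>lborel) \<le> ennreal C))
          \<and> (CARD('n) \<ge> 2 \<longrightarrow> (\<exists>C::real. \<forall>\<beta>.
               (\<integral>\<^sup>+ p. ennreal (fst p powr \<alpha> * (cmod (w p))^2) * indicator ({0..T} \<times> cube \<beta>) p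
                  \<partial>(lborel \<Otimes>\<^sub>M lborel)) \<le> ennreal C)))))"
proof (intro allI impI, goal_cases)
  case R: (1 R)
  interpret sobolev_space s "TYPE('n)" by unfold_locales (rule assms(3))
  obtain T and sol :: "(real^'n \<Rightarrow> complex) \<Rightarrow> real \<Rightarrow> real^'n \<Rightarrow> complex" where T: "T > 0"
    and sol: "\<And>u0. u0 \<in> Hball s R \<Longrightarrow> cont_Hs s T (sol u0)" "\<And>u0. u0 \<in> Hball s R \<Longrightarrow> solves \<alpha> \<sigma> k T u0 (sol u0)"
    and lipschitz: "\<And>u0 v0 t. u0 \<in> Hball s R \<Longrightarrow> v0 \<in> Hball s R \<Longrightarrow> t \<in> {0..T} \<Longrightarrow> hs_dist s (sol v0 t) (sol u0 t) \<le> 2 * hs_dist s v0 u0"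
    using hs_local_existence[OF assms(1) R, of \<sigma> k] by blast
  show ?case
  proof (intro exI[of _ T] exI[of _ "Hs_curves T"] exI[of _ "Hs_curve_norm T"] exI[of _ sol] conjI[OF T] conjI ballI impI)
    show "banach_Linf s T (Hs_curves T) (Hs_curve_norm T)" using T by (simp add: banach_Linf_Hs_curves)
    fix u0 :: "real^'n \<Rightarrow> complex" assume u0: "u0 \<in> Hball s R"
    then have u0_mem: "u0 \<in> sobolev s" by (simp add: mem_Hball_iff)
    show "cont_Hs s T (sol u0)" "solves \<alpha> \<sigma> k T u0 (sol u0)" by (fact sol[OF u0])+
    then show "sol u0 \<in> Hs_curves T" by (simp add: Hs_curves_def)
    show "hs_dist s (v t) (sol u0 t) = 0" if "cont_Hs s T v \<and> solves \<alpha> \<sigma> k T u0 v" "t \<in> {0..T}" for v t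
      using that by (blast intro: hs_solution_unique[OF assms(1) u0_mem sol[OF u0]])
    show "\<forall>\<epsilon>>0. \<exists>\<delta>>0. \<forall>v0 \<in> Hball s R. hs_dist s v0 u0 < \<delta> \<longrightarrow> (\<forall>t\<in>{0..T}. hs_dist s (sol v0 t) (sol u0 t) < \<epsilon>)"
    proof (intro allI impI)
      fix \<epsilon> :: real assume "\<epsilon> > 0"
      then show "\<exists>\<delta>>0. \<forall>v0 \<in> Hball s R. hs_dist s v0 u0 < \<delta> \<longrightarrow> (\<forall>t\<in>{0..T}. hs_dist s (sol v0 t) (sol u0 t) < \<epsilon>)"
        using lipschitz[OF u0] by (intro exI[of _ "\<epsilon> / 2"]) force
    qed
  qed (use hs_solution_smoothing[OF assms(1) T _ sol] in \<open>simp add: mem_Hball_iff\<close>)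
qed

end
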